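(* Let $D_n<B_n$ be the Weyl groups of types $D_n$ and $B_n$ acting on $\mathbb{C}^{2n}=T^*\mathbb{C}^n$ through their reflection representation $\mathbb{C}^n$. Then $\bigoplus_{n\ge 0}HP_0(\mathcal{O}_{\mathbb{C}^{2n}}^{D_n})^*$ is naturally (via restriction of functionals from $\mathcal{O}_{\mathbb{C}^{2n}}^{D_n}$ to $\mathcal{O}_{\mathbb{C}^{2n}}^{B_n}$) a bigraded subalgebra of $\bigoplus_{n\ge 0}HP_0(\mathcal{O}_{\mathbb{C}^{2n}}^{B_n})^*$. Under the identification $\bigoplus_{n\ge 0}HP_0(\mathcal{O}_{\mathbb{C}^{2n}}^{B_n})^*\cong\mathbb{C}[s_1,s_2,\ldots]$ recalled in the context, it is the subalgebra of those polynomials $f\in\mathbb{C}[s_1,s_2,\dots]$ such that, for all $k\ge 1$, $$\xi_k(f)\big|_{s_1=\cdots=s_{2k-1}=0,\ s_{2k}\ne 0}=0,$$ where $$\xi_k:=\mathcal{V}\biggl(\frac{d}{dx}\Bigl(x^{2k-1}\cdot Q\bigl(\tfrac{1}{s_{2k}}\sum_{i\ge 2k+1}s_i x^{2(i-2k)}\bigr)\Bigr)\biggr),$$ $Q(z)=1+\frac z2-\frac{z^2}{8}+\frac{z^3}{16}-\cdots$ is the Taylor series of $\sqrt{1+z}$ at $z=0$, and $\mathcal{V}\bigl(\sum_{i\ge 0}f_i x^{2i}\bigr):=\sum_{i\ge 0}f_i\,\partial_{s_{i+1}}$ for coefficients $f_i$ in $\mathbb{C}[s_1,s_2,\ldots]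[s_{2k}^{-1}]$.
   Context: For a Poisson algebra $A$, $HP_0(A):=A/\{A,A\}$ and $HP_0(A)^*$ is its dual. $B_n=S_n\ltimes(\mathbb{Z}/2)^n$ acts on $\mathbb{C}^n$ by signed permutation matrices, $D_n=S_n\ltimes(\mathbb{Z}/2)^{n-1}$ is the index-two subgroup with an even number of signs $-1$; both act symplectically on $\mathbb{C}^{2n}=\mathbb{C}^n\oplus(\mathbb{C}^n)^*$ with coordinates $x_1,\dots,x_n,y_1,\dots,y_n$, $\{x_i,y_j\}=\delta_{ij}$, $\{x_i,x_j\}=\{y_i,y_j\}=0$. For $n=0$ the groups are trivial and the space is $\mathbb{C}$. Algebra structure: $\mathcal{O}_{\mathbb{C}^{2n}}^{B_n}=\mathrm{Sym}^n(\mathcal{O}_{\mathbb{C}^2}^{\mathbb{Z}/2})$; for $\phi\in(\mathrm{Sym}^m\mathcal{O}_{\mathbb{C}^2}^{\mathbb{Z}/2})^*$, $\psi\in(\mathrm{Sym}^n\mathcal{O}_{\mathbb{C}^2}^{\mathbb{Z}/2})^*$, the product $\phi\cdot\psi$ is the restriction of $\phi\boxtimes\psi$ to symmetric tensors $\mathrm{Sym}^{m+n}\subseteq T^{m+n}\mathcal{O}_{\mathbb{C}^2}^{\mathbb{Z}/2}$. The bigrading is by $n$ (symmetric power degree) and by weight (polynomial degree, taken nonpositive on dual spaces). Known identification: $\bigoplus_{n\ge 0}HP_0(\mathcal{O}_{\mathbb{C}^{2n}}^{B_n})^*\cong\mathbb{C}[s_1,s_2,\dots]$ as bigraded algebras,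 where $s_i$ has symmetric power degree $i$ and weight $4(1-i)$. The functionals $s_i$ are the following. A functional on $\mathrm{Sym}^i(\mathcal{O}_{\mathbb{C}^2}^{\mathbb{Z}/2})$ is viewed as a homogeneous degree-$i$ polynomial function $f\mapsto s_i(f^{\otimes i})$ on $\mathcal{O}_{\mathbb{C}^2}^{\mathbb{Z}/2}=\mathbb{C}[x^2,xy,y^2]$, extended continuously to $\mathbb{C}[[x^2,xy,y^2]]$. Every $f\in\mathbb{C}[[x^2,xy,y^2]]$ with nonvanishing second derivative at $0$ is equivalent, under even formal symplectomorphisms of the formal disc, to a unique element of the form $y^2+s_1+s_2x^2+s_3x^4+\cdots$; then $s_i(f)$ is the coefficient so defined, and $s_i$ extends uniquely to a polynomial function on all of $\mathbb{C}[[x^2,xy,y^2]]$. Accordingly the $s_i$ are viewed as coordinate functions on $\mathbb{C}[[x^2]]$, $f=s_1(f)+s_2(f)x^2+s_3(f)x^4+\cdots$, and $\xi_k$ as a vector field with coefficients in $\mathbb{C}[s_1,s_2,\ldots][s_{2k}^{-1}]$. *)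

theory Defs
  imports
    Complex_Main
    "HOL-Library.Poly_Mapping"
    "HOL-Combinatorics.Permutations"
    "HOL-Computational_Algebra.Computational_Algebra"
begin

section \<open>Multivariate polynomials over the complex numbers\<close>

text \<open>A polynomial is a finitely supported map from monomials (exponent vectors) to coefficients,
  with the convolution ring structure of \<^theory>\<open>HOL-Library.Poly_Mapping\<close>.\<close>

type_synonym 'v cpoly = "('v \<Rightarrow>\<^sub>0 nat) \<Rightarrow>\<^sub>0 complex"

definition Const :: "complex \<Rightarrow> 'v cpoly" where
  "Const c = Poly_Mapping.single 0 c"

definition Var :: "'v \<Rightarrow> 'v cpoly" where
  "Var v = Poly_Mapping.single (Poly_Mapping.single v 1) 1"

definition indets :: "'v cpoly \<Rightarrow> 'v set" where
  "indets p = (\<Union>m\<in>Poly_Mapping.keys p. Poly_Mapping.keys m)"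

definition eval_with :: "(complex \<Rightarrow> 'b) \<Rightarrow> ('v \<Rightarrow> 'b) \<Rightarrow> 'v cpoly \<Rightarrow> 'b::comm_semiring_1" where
  "eval_with c h p = (\<Sum>m\<in>Poly_Mapping.keys p. c (Poly_Mapping.lookup p m) *
      (\<Prod>v\<in>Poly_Mapping.keys m. h v ^ Poly_Mapping.lookup m v))"

definition psubst :: "('v \<Rightarrow> 'w cpoly) \<Rightarrow> 'v cpoly \<Rightarrow> 'w cpoly" where
  "psubst h p = eval_with Const h p"

definition peval :: "('v \<Rightarrow> complex) \<Rightarrow> 'v cpoly \<Rightarrow> complex" where
  "peval a p = eval_with (\<lambda>c. c) a p"

definition pdiff :: "'v \<Rightarrow> 'v cpoly \<Rightarrow> 'v cpoly" where
  "pdiff v p = (\<Sum>m\<in>Poly_Mapping.keys p.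
      Poly_Mapping.single (m - Poly_Mapping.single v 1)
        (of_nat (Poly_Mapping.lookup m v) * Poly_Mapping.lookup p m))"

definition homogeneous :: "nat \<Rightarrow> 'v cpoly \<Rightarrow> bool" where
  "homogeneous d p \<longleftrightarrow>
     (\<forall>m\<in>Poly_Mapping.keys p. (\<Sum>v\<in>Poly_Mapping.keys m. Poly_Mapping.lookup m v) = d)"


section \<open>The Poisson algebra of functions on \<open>T\<^sup>*\<complex>\<^sup>n\<close> and its invariants\<close>

text \<open>The coordinates are numbered from \<open>0\<close>: functions on \<open>\<complex>\<^sup>2\<^sup>n\<close> are the polynomials in
  \<open>X i\<close>, \<open>Y i\<close> with \<open>i < n\<close>. A single polynomial type thus serves all \<open>n\<close>.\<close>

datatype coord = X nat | Y nat

type_synonym opoly = "coord cpoly"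

definition polys :: "nat \<Rightarrow> opoly set" where
  "polys n = {p. indets p \<subseteq> X ` {..<n} \<union> Y ` {..<n}}"

definition poisson :: "nat \<Rightarrow> opoly \<Rightarrow> opoly \<Rightarrow> opoly" where
  "poisson n f g = (\<Sum>i<n. pdiff (X i) f * pdiff (Y i) g - pdiff (Y i) f * pdiff (X i) g)"

text \<open>A signed permutation is a permutation together with the set of positions carrying the
  sign \<open>-1\<close>. Signed permutation matrices are orthogonal, so the coordinates \<open>x\<close> on \<open>\<complex>\<^sup>n\<close> and \<open>y\<close> on
  its dual are transformed by the same matrix.\<close>

type_synonym signed_perm = "(nat \<Rightarrow> nat) \<times> nat set"

definition type_B :: "nat \<Rightarrow> signed_perm set" where
  "type_B n = {(\<sigma>, E). \<sigma> permutes {..<n} \<and> E \<subseteq> {..<n}}"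

definition type_D :: "nat \<Rightarrow> signed_perm set" where
  "type_D n = {(\<sigma>, E) \<in> type_B n. even (card E)}"

definition act :: "signed_perm \<Rightarrow> opoly \<Rightarrow> opoly" where
  "act g = psubst (\<lambda>v. case v of
       X i \<Rightarrow> (if i \<in> snd g then - Var (X (fst g i)) else Var (X (fst g i)))
     | Y i \<Rightarrow> (if i \<in> snd g then - Var (Y (fst g i)) else Var (Y (fst g i))))"

definition invariants :: "nat \<Rightarrow> signed_perm set \<Rightarrow> opoly set" where
  "invariants n G = {p \<in> polys n. \<forall>g\<in>G. act g p = p}"

abbreviation O_B :: "nat \<Rightarrow> opoly set" where "O_B n \<equiv> invariants n (type_B n)"
abbreviation O_D :: "nat \<Rightarrow> opoly set" where "O_D n \<equiv> invariants n (type_D n)"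


section \<open>Dual spaces and zeroth Poisson homology\<close>

text \<open>Functionals on a subspace \<open>A\<close> are represented by functions that are \<open>0\<close> outside \<open>A\<close>, so that
  equality of functions is equality of functionals.\<close>

type_synonym functional = "opoly \<Rightarrow> complex"

definition dual :: "opoly set \<Rightarrow> functional set" where
  "dual A = {\<phi>. (\<forall>p\<in>A. \<forall>q\<in>A. \<phi> (p + q) = \<phi> p + \<phi> q) \<and>
                (\<forall>c. \<forall>p\<in>A. \<phi> (Const c * p) = c * \<phi> p) \<and>
                (\<forall>p. p \<notin> A \<longrightarrow> \<phi> p = 0)}"

definition restrict_functional :: "opoly set \<Rightarrow> functional \<Rightarrow> functional" where
  "restrict_functional A \<phi> = (\<lambda>p. if p \<in> A then \<phi> p else 0)"

text \<open>The subspace \<open>{A, A}\<close> spanned by all brackets (\<open>A\<close> is always a linear subspace here, so finite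
  sums suffice).\<close>

definition bracket_space :: "nat \<Rightarrow> opoly set \<Rightarrow> opoly set" where
  "bracket_space n A =
     {(\<Sum>j<N. poisson n (f j) (g j)) | (N::nat) f g. \<forall>j<N. f j \<in> A \<and> g j \<in> A}"

text \<open>The dual of \<open>HP\<^sub>0(A) = A / {A, A}\<close>: functionals on the quotient are functionals on \<open>A\<close> that
  vanish on \<open>{A, A}\<close>.\<close>

definition HP0_dual :: "nat \<Rightarrow> opoly set \<Rightarrow> functional set" where
  "HP0_dual n A = {\<phi> \<in> dual A. \<forall>p\<in>bracket_space n A. \<phi> p = 0}"

text \<open>Weight is polynomial degree, counted nonpositively on dual spaces.\<close>

definition has_weight :: "opoly set \<Rightarrow> int \<Rightarrow> functional \<Rightarrow> bool" where
  "has_weight A w \<phi> \<longleftrightarrow> (\<forall>d. \<forall>p\<in>A. homogeneous d p \<and> int d \<noteq> - w \<longrightarrow> \<phi> p = 0)"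


section \<open>The bigraded algebra of functionals\<close>

text \<open>An element of \<open>\<Oplus>\<^sub>n\<close> of spaces of functionals is the finitely supported family of its
  components.\<close>

type_synonym gfunctional = "nat \<Rightarrow> functional"

definition direct_sum :: "(nat \<Rightarrow> functional set) \<Rightarrow> gfunctional set" where
  "direct_sum V = {\<Phi>. (\<forall>n. \<Phi> n \<in> V n) \<and> finite {n. \<exists>p. \<Phi> n p \<noteq> 0}}"

definition HP_B :: "gfunctional set" where "HP_B = direct_sum (\<lambda>n. HP0_dual n (O_B n))"
definition HP_D :: "gfunctional set" where "HP_D = direct_sum (\<lambda>n. HP0_dual n (O_D n))"

definition res_DB :: "gfunctional \<Rightarrow> gfunctional" where
  "res_DB \<Phi> = (\<lambda>n. restrict_functional (O_B n) (\<Phi> n))"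

definition gadd :: "gfunctional \<Rightarrow> gfunctional \<Rightarrow> gfunctional" where
  "gadd \<Phi> \<Psi> = (\<lambda>n p. \<Phi> n p + \<Psi> n p)"

definition gscale :: "complex \<Rightarrow> gfunctional \<Rightarrow> gfunctional" where
  "gscale c \<Phi> = (\<lambda>n p. c * \<Phi> n p)"

definition shift :: "nat \<Rightarrow> opoly \<Rightarrow> opoly" where
  "shift m = psubst (\<lambda>v. case v of X i \<Rightarrow> Var (X (i + m)) | Y i \<Rightarrow> Var (Y (i + m)))"

text \<open>The value of \<open>\<phi> \<boxtimes> \<psi>\<close> on an element of \<open>O_B m \<otimes> O_B n\<close>, embedded into the polynomials in
  \<open>m + n\<close> pairs of variables; it is determined by any way of writing that element as a sum of
  products \<open>G \<otimes> H\<close>, since the two factors involve disjoint sets of variables.\<close>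

definition boxtimes :: "nat \<Rightarrow> nat \<Rightarrow> functional \<Rightarrow> functional \<Rightarrow> functional" where
  "boxtimes m n \<phi> \<psi> F = (THE c. \<exists>(N::nat) G H.
      (\<forall>j<N. G j \<in> O_B m \<and> H j \<in> O_B n) \<and>
      F = (\<Sum>j<N. G j * shift m (H j)) \<and>
      c = (\<Sum>j<N. \<phi> (G j) * \<psi> (H j)))"

text \<open>Here \<open>O_B n\<close> is the \<open>n\<close>-th symmetric power of the even polynomials on \<open>\<complex>\<^sup>2\<close>, so
  \<open>O_B (m + n) \<subseteq> O_B m \<otimes> O_B n\<close>.\<close>

definition fun_mult :: "nat \<Rightarrow> nat \<Rightarrow> functional \<Rightarrow> functional \<Rightarrow> functional" where
  "fun_mult m n \<phi> \<psi> = restrict_functional (O_B (m + n)) (boxtimes m n \<phi> \<psi>)"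

definition gmult :: "gfunctional \<Rightarrow> gfunctional \<Rightarrow> gfunctional" where
  "gmult \<Phi> \<Psi> = (\<lambda>N p. \<Sum>m\<le>N. fun_mult m (N - m) (\<Phi> m) (\<Psi> (N - m)) p)"

definition gin :: "nat \<Rightarrow> functional \<Rightarrow> gfunctional" where
  "gin n \<phi> = (\<lambda>m p. if m = n then \<phi> p else 0)"

text \<open>The unit is the identity functional on \<open>O_B 0 = \<complex>\<close>.\<close>

definition gone :: gfunctional where
  "gone = gin 0 (restrict_functional (O_B 0) (\<lambda>p. Poly_Mapping.lookup p 0))"

definition bihomogeneous :: "nat \<Rightarrow> int \<Rightarrow> gfunctional \<Rightarrow> bool" where
  "bihomogeneous n w \<Phi> \<longleftrightarrow> (\<forall>m p. m \<noteq> n \<longrightarrow> \<Phi> m p = 0) \<and> has_weight (O_B n) w (\<Phi> n)"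

definition bigraded_subalgebra :: "gfunctional set \<Rightarrow> gfunctional set \<Rightarrow> bool" where
  "bigraded_subalgebra S R \<longleftrightarrow>
     S \<subseteq> R \<and> gone \<in> S \<and>
     (\<forall>\<Phi>\<in>S. \<forall>\<Psi>\<in>S. gadd \<Phi> \<Psi> \<in> S) \<and>
     (\<forall>c. \<forall>\<Phi>\<in>S. gscale c \<Phi> \<in> S) \<and>
     (\<forall>\<Phi>\<in>S. \<forall>\<Psi>\<in>S. gmult \<Phi> \<Psi> \<in> S) \<and>
     (\<forall>\<Phi>\<in>S. \<exists>J \<Psi>. finite J \<and>
        (\<forall>(n, w)\<in>J. \<Psi> (n, w) \<in> S \<and> bihomogeneous n w (\<Psi> (n, w))) \<and>
        \<Phi> = (\<lambda>n p. \<Sum>j\<in>J. \<Psi> j n p))"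


section \<open>Formal functions on the disc and the functionals \<open>s\<^sub>i\<close>\<close>

text \<open>A series in \<open>\<complex>[[x, y]]\<close> is a power series in \<open>y\<close> with coefficients in \<open>\<complex>[[x]]\<close>: the coefficient
  of \<open>x\<^sup>a y\<^sup>b\<close> in \<open>f\<close> is \<open>f $ b $ a\<close>.\<close>

type_synonym formal = "complex fps fps"

definition formal_even :: "formal \<Rightarrow> bool" where
  "formal_even f \<longleftrightarrow> (\<forall>a b. odd (a + b) \<longrightarrow> fps_nth (fps_nth f b) a = 0)"

definition formal_odd :: "formal \<Rightarrow> bool" where
  "formal_odd f \<longleftrightarrow> (\<forall>a b. even (a + b) \<longrightarrow> fps_nth (fps_nth f b) a = 0)"

definition diff_x :: "formal \<Rightarrow> formal" where
  "diff_x f = Abs_fps (\<lambda>b. fps_deriv (fps_nth f b))"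

definition diff_y :: "formal \<Rightarrow> formal" where
  "diff_y f = fps_deriv f"

text \<open>A formal symplectomorphism \<open>(x, y) \<mapsto> (P, Q)\<close> is even if it commutes with \<open>-1\<close>, i.e.\ if \<open>P\<close> and \<open>Q\<close>
  are odd; in particular it fixes the origin.\<close>

definition even_symplectomorphism :: "formal \<Rightarrow> formal \<Rightarrow> bool" where
  "even_symplectomorphism P Q \<longleftrightarrow> formal_odd P \<and> formal_odd Q \<and>
     diff_x P * diff_y Q - diff_y P * diff_x Q = 1"

text \<open>\<open>f(P, Q)\<close> for \<open>P\<close>, \<open>Q\<close> without constant term: only the terms \<open>x\<^sup>i y\<^sup>j\<close> of \<open>f\<close> with
  \<open>i + j \<le> a + b\<close> contribute to the coefficient of \<open>x\<^sup>a y\<^sup>b\<close>.\<close>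

definition formal_subst :: "formal \<Rightarrow> formal \<Rightarrow> formal \<Rightarrow> formal" where
  "formal_subst f P Q = Abs_fps (\<lambda>b. Abs_fps (\<lambda>a.
     \<Sum>i\<le>a + b. \<Sum>j\<le>a + b. fps_nth (fps_nth f j) i * fps_nth (fps_nth (P ^ i * Q ^ j) b) a))"

definition equivalent :: "formal \<Rightarrow> formal \<Rightarrow> bool" where
  "equivalent f g \<longleftrightarrow> (\<exists>P Q. even_symplectomorphism P Q \<and> g = formal_subst f P Q)"

definition nonvanishing_second_derivative :: "formal \<Rightarrow> bool" where
  "nonvanishing_second_derivative f \<longleftrightarrow> (\<exists>a b. a + b = 2 \<and> fps_nth (fps_nth f b) a \<noteq> 0)"

text \<open>The series \<open>y\<^sup>2 + c\<^sub>1 + c\<^sub>2 x\<^sup>2 + c\<^sub>3 x\<^sup>4 + \<dots>\<close>.\<close>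

definition normal_form :: "(nat \<Rightarrow> complex) \<Rightarrow> formal" where
  "normal_form c = fps_X ^ 2 +
     fps_const (Abs_fps (\<lambda>m. if even m then c (m div 2 + 1) else 0))"

text \<open>The tensor power \<open>f\<^sup>\<otimes>\<^sup>n = \<Prod>\<^sub>i f(x\<^sub>i, y\<^sub>i)\<close> of the Taylor polynomial of \<open>f\<close> of order \<open>N\<close>.\<close>

definition tensor_power :: "nat \<Rightarrow> nat \<Rightarrow> formal \<Rightarrow> opoly" where
  "tensor_power n N f = (\<Prod>i<n. \<Sum>b\<le>N. \<Sum>a\<le>N - b.
     Const (fps_nth (fps_nth f b) a) * Var (X i) ^ a * Var (Y i) ^ b)"

text \<open>The continuous extension of \<open>f \<mapsto> \<phi>(f\<^sup>\<otimes>\<^sup>i)\<close> to power series: a functional of fixed weight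
  only sees finitely many coefficients of \<open>f\<close>, so its values on the Taylor polynomials of \<open>f\<close> are
  eventually constant.\<close>

definition is_s_functional :: "nat \<Rightarrow> functional \<Rightarrow> bool" where
  "is_s_functional i \<phi> \<longleftrightarrow>
     \<phi> \<in> dual (O_B i) \<and> has_weight (O_B i) (4 * (1 - int i)) \<phi> \<and>
     (\<forall>f c. formal_even f \<and> nonvanishing_second_derivative f \<and> equivalent f (normal_form c) \<longrightarrow>
        eventually (\<lambda>N. \<phi> (tensor_power i N f) = c i) sequentially)"


section \<open>The polynomial ring \<open>\<complex>[s\<^sub>1, s\<^sub>2, \<dots>]\<close> and the vector fields \<open>\<xi>\<^sub>k\<close>\<close>

text \<open>The variable with index \<open>i\<close> is \<open>s\<^sub>i\<close>; index \<open>0\<close> is not used.\<close>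

type_synonym spoly = "nat cpoly"

definition s_ring :: "spoly set" where
  "s_ring = {f. indets f \<subseteq> {1..}}"

text \<open>The algebra homomorphism \<open>\<complex>[s\<^sub>1, s\<^sub>2, \<dots>] \<rightarrow> \<Oplus>\<^sub>n (O_B n)\<^sup>*\<close> that sends the variable \<open>s\<^sub>i\<close> to the
  functional \<open>s i\<close>. The algebra is commutative, so the order of the factors is immaterial.\<close>

definition gmonomial :: "(nat \<Rightarrow> functional) \<Rightarrow> (nat \<Rightarrow>\<^sub>0 nat) \<Rightarrow> gfunctional" where
  "gmonomial s m = foldr (\<lambda>i. gmult (gin i (s i)) ^^ Poly_Mapping.lookup m i)
     (sorted_list_of_set (Poly_Mapping.keys m)) gone"

definition identification :: "(nat \<Rightarrow> functional) \<Rightarrow> spoly \<Rightarrow> gfunctional" where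
  "identification s f = (\<lambda>n p. \<Sum>m\<in>Poly_Mapping.keys f.
     Poly_Mapping.lookup f m * gmonomial s m n p)"

text \<open>The coefficients of \<open>\<xi>\<^sub>k\<close> lie in the localization \<open>\<complex>[s\<^sub>1, s\<^sub>2, \<dots>][s\<^sub>2\<^sub>k\<^sup>-\<^sup>1]\<close>, which is regarded as a
  subring of the field of fractions.\<close>

type_synonym srat = "spoly fract"

definition s_var :: "nat \<Rightarrow> srat" where "s_var i = to_fract (Var i)"

definition Q_series :: "srat fps" where
  "Q_series = Abs_fps (\<lambda>n. to_fract (Const (fps_nth (fps_binomial (1/2)) n)))"

definition Q_arg :: "nat \<Rightarrow> srat fps" where
  "Q_arg k = fps_const (1 / s_var (2 * k)) *
     Abs_fps (\<lambda>m. if even m \<and> m > 0 then s_var (2 * k + m div 2) else 0)"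

definition xi_series :: "nat \<Rightarrow> srat fps" where
  "xi_series k = fps_deriv (fps_X ^ (2 * k - 1) * fps_compose Q_series (Q_arg k))"

text \<open>\<open>\<V>(F)\<close> as a derivation; the sum ranges over the \<open>i\<close> for which \<open>s\<^bsub>i+1\<^esub>\<close> occurs in \<open>f\<close>.\<close>

definition V_field :: "srat fps \<Rightarrow> spoly \<Rightarrow> srat" where
  "V_field F f = (\<Sum>i | Suc i \<in> indets f. fps_nth F (2 * i) * to_fract (pdiff (Suc i) f))"

definition xi :: "nat \<Rightarrow> spoly \<Rightarrow> srat" where
  "xi k f = V_field (xi_series k) f"

text \<open>\<open>r\<close> vanishes on the locus \<open>s\<^sub>1 = \<dots> = s\<^bsub>2k-1\<^esub> = 0\<close>, \<open>s\<^sub>2\<^sub>k \<noteq> 0\<close>, for \<open>r = p / s\<^sub>2\<^sub>k\<^sup>N\<close> in the localization.\<close>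

definition vanishes_on_locus :: "nat \<Rightarrow> srat \<Rightarrow> bool" where
  "vanishes_on_locus k r \<longleftrightarrow> (\<exists>p N. r = to_fract p / s_var (2 * k) ^ N \<and>
     (\<forall>a. (\<forall>i. 1 \<le> i \<and> i < 2 * k \<longrightarrow> a i = 0) \<and> a (2 * k) \<noteq> 0 \<longrightarrow> peval a p = 0))"

end

theory Submission imports Defs begin

text \<open>Invariants of type \<open>B\<^sub>n\<close> are the \<open>n\<close>-th symmetric power of the even functions on the plane; those of
  type \<open>D\<^sub>n\<close> are the sum of the symmetric powers of the even and of the odd functions. A functional on the
  latter that kills brackets vanishes on the odd summand, so it is determined by its restriction \<open>\<phi>\<close> to
  \<open>O_B n\<close>, and \<open>\<phi>\<close> extends (by zero) iff it kills all brackets of \<open>f\<^sup>\<otimes>\<^sup>n\<close> and \<open>g\<^sup>\<otimes>\<^sup>n\<close> with \<open>f\<close>, \<open>g\<close> odd. That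
  bracket is the derivative of the \<open>n\<close>-th tensor power at \<open>f g\<close> in the direction \<open>{f, g}\<close>, and by
  infinitesimal symplectic invariance it is enough to consider \<open>f g = y\<^sup>2 + \<theta>\<^sup>2\<close> with an odd polynomial \<open>\<theta>\<close> in
  \<open>x\<close>, where the direction is proportional to \<open>\<theta>'\<close>. In the coordinates \<open>s\<^sub>i\<close> this says that the derivative of a polynomial at \<open>\<theta>\<^sup>2\<close>
  in the direction \<open>\<theta>'\<close> vanishes. If \<open>s\<^sub>2\<^sub>k\<close> is the first nonzero coordinate of \<open>\<theta>\<^sup>2\<close>, extracting the square
  root makes \<open>\<theta>'\<close> a multiple of the vector \<open>\<xi>\<^sub>k\<close>.\<close>

section \<open>Evaluation homomorphisms and partial derivatives\<close>

text \<open>The equivalence behind the \<open>s_i\<close> is formal, while functionals live on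
  polynomials, where formal symplectomorphisms do not act. The Lie algebra replaces the group: if a
  family of symmetric multilinear forms is closed under the derivations of a Lie algebra and
  vanishes on an affine slice e + N, and if N and the directions X e together fill the space, then
  every Taylor coefficient at e vanishes and so do the forms. The choice of e, N and the operators
  is adapted to each reduction: y^2 plus even polynomials in x for even functions, the single point
  y for odd ones, y plus odd polynomials in x when one factor of a product is held at y. On the odd
  summand the orbit directions at y fill everything, and the Hamiltonian x y multiplies the n-th
  tensor power of y by n; this is why an invariant functional vanishes there for n > 0. The even
  index 2k in \<open>xi k\<close> has this origin: a square root \<theta> = r x^(2k-1) + ... is odd,
  its square starts with r^2 x^(2(2k-1)), and \<open>s_i\<close> is the coefficient of
  x^(2(i-1)).\<close>

definition mon_val :: "('v \<Rightarrow> 'b) \<Rightarrow> ('v \<Rightarrow>\<^sub>0 nat) \<Rightarrow> 'b::comm_semiring_1" where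
  "mon_val h m = (\<Prod>v\<in>Poly_Mapping.keys m. h v ^ Poly_Mapping.lookup m v)"

lemma mon_val_superset:
  assumes "finite S" "Poly_Mapping.keys m \<subseteq> S"
  shows "mon_val h m = (\<Prod>v\<in>S. h v ^ Poly_Mapping.lookup m v)"
  unfolding mon_val_def
  by (rule prod.mono_neutral_left) (use assms in \<open>auto simp: in_keys_iff\<close>)

lemma mon_val_add: "mon_val h (m + m') = mon_val h m * mon_val h m'"
proof -
  let ?S = "Poly_Mapping.keys m \<union> Poly_Mapping.keys m'"
  have "mon_val h (m + m') = (\<Prod>v\<in>?S. h v ^ Poly_Mapping.lookup (m + m') v)"
    by (rule mon_val_superset) (use Poly_Mapping.keys_add[of m m'] in auto)
  also have "\<dots> = (\<Prod>v\<in>?S. h v ^ Poly_Mapping.lookup m v) * (\<Prod>v\<in>?S. h v ^ Poly_Mapping.lookup m' v)"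
    by (simp add: lookup_add power_add prod.distrib)
  also have "\<dots> = mon_val h m * mon_val h m'"
    by (simp add: mon_val_superset[of ?S m] mon_val_superset[of ?S m'])
  finally show ?thesis .
qed

lemma mon_val_zero [simp]: "mon_val h 0 = 1"
  by (simp add: mon_val_def)

lemma mon_val_single [simp]: "mon_val h (Poly_Mapping.single v k) = h v ^ k"
  by (simp add: mon_val_def)

text \<open>One proof of the homomorphism laws for \<open>eval_with\<close> then serves
  \<open>psubst\<close>, \<open>peval\<close>, the embedding \<open>emb\<close> into power series
  and the curves \<open>flow_curve\<close> with coefficients in polynomials.\<close>

definition coeff_hom :: "(complex \<Rightarrow> 'b::comm_semiring_1) \<Rightarrow> bool" where
  "coeff_hom c \<longleftrightarrow> c 0 = 0 \<and> c 1 = 1 \<and> (\<forall>a b. c (a + b) = c a + c b) \<and> (\<forall>a b. c (a * b) = c a * c b)"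

lemma eval_with_superset:
  assumes "c 0 = 0" "finite S" "Poly_Mapping.keys p \<subseteq> S"
  shows "eval_with c h p = (\<Sum>m\<in>S. c (Poly_Mapping.lookup p m) * mon_val h m)"
  unfolding eval_with_def mon_val_def[symmetric]
  by (rule sum.mono_neutral_left) (use assms in \<open>auto simp: in_keys_iff\<close>)

lemma poly_mapping_sum_single:
  "p = (\<Sum>m\<in>Poly_Mapping.keys p. Poly_Mapping.single m (Poly_Mapping.lookup p m))"
proof (rule poly_mapping_eqI)
  fix k
  have "Poly_Mapping.lookup (\<Sum>m\<in>Poly_Mapping.keys p. Poly_Mapping.single m (Poly_Mapping.lookup p m)) k
      = (\<Sum>m\<in>Poly_Mapping.keys p. if m = k then Poly_Mapping.lookup p m else 0)"
    by (simp add: lookup_sum lookup_single when_def)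
  also have "\<dots> = Poly_Mapping.lookup p k"
    by (simp add: sum.delta' in_keys_iff)
  finally show "Poly_Mapping.lookup p k = Poly_Mapping.lookup
      (\<Sum>m\<in>Poly_Mapping.keys p. Poly_Mapping.single m (Poly_Mapping.lookup p m)) k" by simp
qed

lemma eval_with_add:
  assumes "coeff_hom c"
  shows "eval_with c h (p + q) = eval_with c h p + eval_with c h q"
proof -
  let ?S = "Poly_Mapping.keys p \<union> Poly_Mapping.keys q"
  have c: "c 0 = 0" "\<And>a b. c (a + b) = c a + c b" using assms by (auto simp: coeff_hom_def)
  have "eval_with c h (p + q) = (\<Sum>m\<in>?S. c (Poly_Mapping.lookup (p + q) m) * mon_val h m)"
    by (rule eval_with_superset) (use Poly_Mapping.keys_add[of p q] c in auto)
  also have "\<dots> = (\<Sum>m\<in>?S. c (Poly_Mapping.lookup p m) * mon_val h m)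
      + (\<Sum>m\<in>?S. c (Poly_Mapping.lookup q m) * mon_val h m)"
    by (simp add: lookup_add c distrib_right sum.distrib)
  also have "\<dots> = eval_with c h p + eval_with c h q"
    using eval_with_superset[of c ?S p h] eval_with_superset[of c ?S q h] c by simp
  finally show ?thesis .
qed

lemma eval_with_zero [simp]: "eval_with c h 0 = 0"
  by (simp add: eval_with_def)

lemma eval_with_sum:
  assumes "coeff_hom c"
  shows "eval_with c h (\<Sum>i\<in>I. f i) = (\<Sum>i\<in>I. eval_with c h (f i))"
  by (induction I rule: infinite_finite_induct) (auto simp: eval_with_add assms)

lemma eval_with_single:
  assumes "c 0 = 0"
  shows "eval_with c h (Poly_Mapping.single m a) = c a * mon_val h m"
  using assms by (cases "a = 0") (auto simp: eval_with_def mon_val_def)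

lemma eval_with_mult:
  assumes "coeff_hom c"
  shows "eval_with c h (p * q) = eval_with c h p * eval_with c h q"
proof -
  have c: "c 0 = 0" "\<And>a b. c (a * b) = c a * c b" using assms by (auto simp: coeff_hom_def)
  let ?s = "\<lambda>p m. Poly_Mapping.single m (Poly_Mapping.lookup p m)"
  have "p * q = (\<Sum>m\<in>Poly_Mapping.keys p. \<Sum>m'\<in>Poly_Mapping.keys q. ?s p m * ?s q m')"
    by (subst poly_mapping_sum_single[of p], subst poly_mapping_sum_single[of q], rule sum_product)
  then have "eval_with c h (p * q) = (\<Sum>m\<in>Poly_Mapping.keys p. \<Sum>m'\<in>Poly_Mapping.keys q.
      eval_with c h (?s p m) * eval_with c h (?s q m'))"
    by (simp add: eval_with_sum[OF assms] mult_single eval_with_single c mon_val_add mult_ac)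
  also have "\<dots> = (\<Sum>m\<in>Poly_Mapping.keys p. eval_with c h (?s p m)) *
      (\<Sum>m'\<in>Poly_Mapping.keys q. eval_with c h (?s q m'))"
    by (rule sum_product[symmetric])
  also have "\<dots> = eval_with c h p * eval_with c h q"
    by (simp add: eval_with_sum[OF assms, symmetric] poly_mapping_sum_single[symmetric])
  finally show ?thesis .
qed

lemma eval_with_Const: "coeff_hom c \<Longrightarrow> eval_with c h (Const a) = c a"
  by (simp add: Const_def eval_with_single coeff_hom_def)

lemma eval_with_Var: "coeff_hom c \<Longrightarrow> eval_with c h (Var v) = h v"
  by (simp add: Var_def eval_with_single coeff_hom_def)

lemma Const_0 [simp]: "Const 0 = 0" by (simp add: Const_def)
lemma Const_1 [simp]: "Const 1 = 1" by (simp add: Const_def)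
lemma Const_add: "Const (a + b) = Const a + Const b" by (simp add: Const_def single_add)
lemma Const_mult: "Const (a * b) = Const a * Const b" by (simp add: Const_def mult_single)
lemma Const_uminus: "Const (- a) = - Const a" by (simp add: Const_def single_uminus)
lemma Const_power: "Const (a ^ n) = Const a ^ n" by (induction n) (auto simp: Const_mult)
lemma Const_of_nat: "Const (of_nat n) = of_nat n" by (induction n) (auto simp: Const_add)
lemma Const_numeral [simp]: "Const (numeral k) = numeral k"
  using Const_of_nat[of "numeral k"] by simp
lemma Const_sum: "Const (\<Sum>i\<in>I. f i) = (\<Sum>i\<in>I. Const (f i))"
  by (induction I rule: infinite_finite_induct) (auto simp: Const_add)

lemma Const_mult_cancel: "a \<noteq> 0 \<Longrightarrow> Const (1 / a) * (Const a * p) = p"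
  by (simp add: mult.assoc[symmetric] Const_mult[symmetric])

lemma coeff_hom_Const [simp]: "coeff_hom Const"
  by (simp add: coeff_hom_def Const_add Const_mult)

lemma coeff_hom_id [simp]: "coeff_hom (\<lambda>c. c)"
  by (simp add: coeff_hom_def)

lemma eval_with_one: "coeff_hom c \<Longrightarrow> eval_with c h 1 = 1"
  using eval_with_Const[of c h 1] by (simp add: coeff_hom_def)

lemma eval_with_power: "coeff_hom c \<Longrightarrow> eval_with c h (p ^ k) = eval_with c h p ^ k"
  by (induction k) (auto simp: eval_with_one eval_with_mult)

lemma eval_with_prod:
  assumes "coeff_hom c"
  shows "eval_with c h (\<Prod>i\<in>I. f i) = (\<Prod>i\<in>I. eval_with c h (f i))"
  by (induction I rule: infinite_finite_induct) (auto simp: eval_with_mult eval_with_one assms)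

lemma eval_with_uminus:
  fixes c :: "complex \<Rightarrow> 'b::comm_ring_1"
  assumes "coeff_hom c" shows "eval_with c h (- p) = - eval_with c h p"
  using eval_with_add[OF assms, of h p "- p"] by (simp add: add_eq_0_iff)

lemma eval_with_diff:
  fixes c :: "complex \<Rightarrow> 'b::comm_ring_1"
  assumes "coeff_hom c" shows "eval_with c h (p - q) = eval_with c h p - eval_with c h q"
  using eval_with_add[OF assms, of h p "- q"] by (simp add: eval_with_uminus[OF assms])

lemmas eval_with_hom = eval_with_add eval_with_mult eval_with_sum eval_with_prod eval_with_power
  eval_with_one eval_with_uminus eval_with_diff eval_with_Const eval_with_Var

lemma psubst_hom [simp]:
  "psubst h (Const a) = Const a" "psubst h (Var v) = h v"
  "psubst h (p + q) = psubst h p + psubst h q" "psubst h (p * q) = psubst h p * psubst h q"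
  "psubst h (p - q) = psubst h p - psubst h q" "psubst h (- p) = - psubst h p"
  "psubst h 0 = 0" "psubst h 1 = 1" "psubst h (p ^ k) = psubst h p ^ k"
  "psubst h (\<Sum>i\<in>I. f i) = (\<Sum>i\<in>I. psubst h (f i))"
  "psubst h (\<Prod>i\<in>I. f i) = (\<Prod>i\<in>I. psubst h (f i))"
  by (auto simp: psubst_def eval_with_hom)

lemma peval_hom [simp]:
  "peval h (Const a) = a" "peval h (Var v) = h v"
  "peval h (p + q) = peval h p + peval h q" "peval h (p * q) = peval h p * peval h q"
  "peval h (p - q) = peval h p - peval h q" "peval h (- p) = - peval h p"
  "peval h 0 = 0" "peval h 1 = 1" "peval h (p ^ k) = peval h p ^ k"
  "peval h (\<Sum>i\<in>I. f i) = (\<Sum>i\<in>I. peval h (f i))"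
  "peval h (\<Prod>i\<in>I. f i) = (\<Prod>i\<in>I. peval h (f i))"
  by (auto simp: peval_def eval_with_hom)

lemma Var_mon_val: "mon_val Var m = Poly_Mapping.single m 1"
proof -
  have "(\<Prod>v\<in>S. Var v ^ k v) = Poly_Mapping.single (\<Sum>v\<in>S. Poly_Mapping.single v (k v)) 1"
    if "finite S" for S and k :: "'a \<Rightarrow> nat"
    using that
  proof (induction S)
    case (insert x F)
    have "Var x ^ n = Poly_Mapping.single (Poly_Mapping.single x n) 1" for n
      by (induction n) (auto simp: Var_def mult_single single_add[symmetric])
    with insert show ?case by (simp add: mult_single)
  qed auto
  then show ?thesis
    by (simp add: mon_val_def poly_mapping_sum_single[symmetric])
qed

lemma single_conv_mon_val: "Poly_Mapping.single m a = Const a * mon_val Var m"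
  by (simp add: Var_mon_val Const_def mult_single)

lemma cpoly_expand: "p = (\<Sum>m\<in>Poly_Mapping.keys p. Const (Poly_Mapping.lookup p m) * mon_val Var m)"
  using poly_mapping_sum_single[of p] by (simp add: single_conv_mon_val)

lemma indets_Const [simp]: "indets (Const a) = {}"
  by (simp add: indets_def Const_def)
lemma indets_0 [simp]: "indets 0 = {}"
  by (simp add: indets_def)
lemma indets_1 [simp]: "indets 1 = {}"
  using indets_Const[of 1] by simp
lemma indets_Var [simp]: "indets (Var v) = {v}"
  by (simp add: indets_def Var_def)
lemma finite_indets [simp]: "finite (indets p)"
  by (simp add: indets_def)
lemma indets_add: "indets (p + q) \<subseteq> indets p \<union> indets q"
  using Poly_Mapping.keys_add[of p q] by (auto simp: indets_def)
lemma keys_nat_add: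
  "Poly_Mapping.keys (m + m' :: 'v \<Rightarrow>\<^sub>0 nat) = Poly_Mapping.keys m \<union> Poly_Mapping.keys m'"
  by (auto simp: in_keys_iff lookup_add)
lemma indets_mult: "indets (p * q) \<subseteq> indets p \<union> indets q"
proof
  fix v assume "v \<in> indets (p * q)"
  then obtain m where m: "m \<in> Poly_Mapping.keys (p * q)" "v \<in> Poly_Mapping.keys m"
    by (auto simp: indets_def)
  then obtain a b where "a \<in> Poly_Mapping.keys p" "b \<in> Poly_Mapping.keys q" "m = a + b"
    using keys_mult[of p q] by auto
  with m show "v \<in> indets p \<union> indets q"
    by (auto simp: indets_def keys_nat_add)
qed
lemma indets_power: "indets (p ^ k) \<subseteq> indets p"
  by (induction k) (use indets_mult in fastforce)+
lemma indets_sum: "indets (\<Sum>i\<in>I. f i) \<subseteq> (\<Union>i\<in>I. indets (f i))"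
proof (induction I rule: infinite_finite_induct)
  case (insert x F)
  then show ?case using indets_add[of "f x" "sum f F"] by auto
qed auto
lemma indets_prod: "indets (\<Prod>i\<in>I. f i) \<subseteq> (\<Union>i\<in>I. indets (f i))"
proof (induction I rule: infinite_finite_induct)
  case (insert x F)
  then show ?case using indets_mult[of "f x" "prod f F"] by auto
qed auto

text \<open>Constants and variables generate the polynomial ring. The set I confines the induction
  to polynomials in given variables, mostly the two coordinates of the plane.\<close>

lemma cpoly_induct [consumes 1, case_names Const Var add mult]:
  assumes "indets p \<subseteq> I"
    and "\<And>c. P (Const c)" "\<And>v. v \<in> I \<Longrightarrow> P (Var v)"
    and "\<And>p q. P p \<Longrightarrow> P q \<Longrightarrow> P (p + q)" "\<And>p q. P p \<Longrightarrow> P q \<Longrightarrow> P (p * q)"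
  shows "P p"
proof -
  have pw: "P (p ^ k)" if "P p" for p k
    using that assms(2)[of 1] assms(5) by (induction k) auto
  have mon: "P (\<Prod>v\<in>S. Var v ^ k v)" if "finite S" "S \<subseteq> I" for S k
    using that assms(2)[of 1] by (induction S) (auto intro!: assms pw)
  have sum: "P (\<Sum>x\<in>S. g x)" if "finite S" "\<And>x. x \<in> S \<Longrightarrow> P (g x)" for S and g :: "_ \<Rightarrow> 'a cpoly"
    using that assms(2)[of 0] by (induction S) (auto intro!: assms)
  show ?thesis
    apply (subst cpoly_expand, unfold mon_val_def)
    apply (intro sum assms(5) assms(2) mon)
    using assms(1) by (auto simp: indets_def)
qed

lemmas cpoly_induct_UNIV [case_names Const Var add mult] = cpoly_induct[OF subset_UNIV]

lemma eval_with_cong: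
  assumes "\<And>v. v \<in> indets p \<Longrightarrow> h v = h' v"
  shows "eval_with c h p = eval_with c h' p"
  unfolding eval_with_def
proof (intro sum.cong refl arg_cong2[of _ _ _ _ "(*)"] prod.cong, goal_cases)
  case (1 m v)
  then have "v \<in> indets p" unfolding indets_def by blast
  with assms show ?case by simp
qed

lemma eval_with_psubst:
  assumes "coeff_hom c"
  shows "eval_with c h (psubst k p) = eval_with c (\<lambda>v. eval_with c h (k v)) p"
  by (induction p rule: cpoly_induct_UNIV) (simp_all add: eval_with_hom assms)

lemma psubst_psubst: "psubst h (psubst k p) = psubst (\<lambda>v. psubst h (k v)) p"
  by (simp add: psubst_def[of h] psubst_def[of "\<lambda>v. eval_with Const h (k v)"] eval_with_psubst)

lemma psubst_cong: "(\<And>v. v \<in> indets p \<Longrightarrow> h v = h' v) \<Longrightarrow> psubst h p = psubst h' p"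
  unfolding psubst_def by (rule eval_with_cong)

lemma peval_cong: "(\<And>v. v \<in> indets p \<Longrightarrow> h v = h' v) \<Longrightarrow> peval h p = peval h' p"
  unfolding peval_def by (rule eval_with_cong)

lemma psubst_Var [simp]: "psubst Var p = p"
  by (induction p rule: cpoly_induct_UNIV) auto

lemma psubst_ident: "(\<And>v. v \<in> indets p \<Longrightarrow> h v = Var v) \<Longrightarrow> psubst h p = p"
  using psubst_cong[of p h Var] by simp

lemma indets_psubst: "indets (psubst h p) \<subseteq> (\<Union>v\<in>indets p. indets (h v))"
proof -
  have "indets (\<Prod>v\<in>Poly_Mapping.keys m. h v ^ Poly_Mapping.lookup m v)
      \<subseteq> (\<Union>v\<in>indets p. indets (h v))" if "m \<in> Poly_Mapping.keys p" for m
    using that indets_prod indets_power unfolding indets_def[of p] by fastforce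
  then show ?thesis
    unfolding psubst_def eval_with_def
    by (intro order_trans[OF indets_sum] UN_least order_trans[OF indets_mult]) auto
qed

lemma pdiff_superset:
  assumes "finite S" "Poly_Mapping.keys p \<subseteq> S"
  shows "pdiff v p = (\<Sum>m\<in>S. Poly_Mapping.single (m - Poly_Mapping.single v 1)
        (of_nat (Poly_Mapping.lookup m v) * Poly_Mapping.lookup p m))"
  unfolding pdiff_def
  by (rule sum.mono_neutral_left) (use assms in \<open>auto simp: in_keys_iff\<close>)

lemma pdiff_0 [simp]: "pdiff v 0 = 0"
  by (simp add: pdiff_def)

lemma pdiff_add [simp]: "pdiff v (p + q) = pdiff v p + pdiff v q"
proof -
  let ?S = "Poly_Mapping.keys p \<union> Poly_Mapping.keys q"
  have "Poly_Mapping.keys (p + q) \<subseteq> ?S" by (rule Poly_Mapping.keys_add)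
  then show ?thesis
    using pdiff_superset[of ?S "p + q" v] pdiff_superset[of ?S p v] pdiff_superset[of ?S q v]
    by (simp add: lookup_add ring_distribs single_add sum.distrib)
qed

lemma pdiff_sum [simp]: "pdiff v (\<Sum>i\<in>I. f i) = (\<Sum>i\<in>I. pdiff v (f i))"
  by (induction I rule: infinite_finite_induct) auto

lemma pdiff_uminus [simp]: "pdiff v (- p) = - pdiff v p"
  using pdiff_add[of v p "- p"] by (simp add: add_eq_0_iff del: pdiff_add)

lemma pdiff_diff [simp]: "pdiff v (p - q) = pdiff v p - pdiff v q"
  using pdiff_add[of v p "- q"] by (simp del: pdiff_add)

lemma pdiff_single:
  "pdiff v (Poly_Mapping.single m a) =
     Poly_Mapping.single (m - Poly_Mapping.single v 1) (of_nat (Poly_Mapping.lookup m v) * a)"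
  by (cases "a = 0") (auto simp: pdiff_def)

lemma pdiff_Const [simp]: "pdiff v (Const a) = 0"
  by (simp add: Const_def pdiff_single)

lemma pdiff_1 [simp]: "pdiff v 1 = 0"
  using pdiff_Const[of v 1] by (simp del: pdiff_Const)

lemma pdiff_Var [simp]: "pdiff v (Var w) = (if v = w then 1 else 0)"
  by (auto simp: Var_def pdiff_single lookup_single)

lemma pdiff_mult [simp]: "pdiff v (p * q) = pdiff v p * q + p * pdiff v q"
proof -
  let ?e = "Poly_Mapping.single v (1::nat)"
  \<comment> \<open>Subtraction of exponents is truncated, so the exponents agree only if v occurs
    in m; otherwise the coefficient is 0 and both sides vanish.\<close>
  have aux: "Poly_Mapping.single (m + m' - ?e) (of_nat (Poly_Mapping.lookup m v) * c)
      = Poly_Mapping.single (m - ?e + m') (of_nat (Poly_Mapping.lookup m v) * (c::complex))" for m m' c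
  proof (cases "Poly_Mapping.lookup m v = 0")
    case False
    then have "m + m' - ?e = m - ?e + m'"
      by (intro poly_mapping_eqI) (auto simp: lookup_add lookup_minus lookup_single when_def)
    then show ?thesis by simp
  qed simp
  have sing: "pdiff v (Poly_Mapping.single m a * Poly_Mapping.single m' b)
      = pdiff v (Poly_Mapping.single m a) * Poly_Mapping.single m' b
      + Poly_Mapping.single m a * pdiff v (Poly_Mapping.single m' b)" for m m' a b
    using aux[of m m' "a * b"] aux[of m' m "a * b"]
    by (simp add: mult_single pdiff_single lookup_add ring_distribs single_add add.commute mult_ac)
  let ?s = "\<lambda>p m. Poly_Mapping.single m (Poly_Mapping.lookup p m)"
  have pq: "f p * g q = (\<Sum>m\<in>Poly_Mapping.keys p. \<Sum>m'\<in>Poly_Mapping.keys q. f (?s p m) * g (?s q m'))"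
    if "\<And>(I :: ('a \<Rightarrow>\<^sub>0 nat) set) h. f (\<Sum>i\<in>I. h i) = (\<Sum>i\<in>I. f (h i))" "\<And>(I :: ('a \<Rightarrow>\<^sub>0 nat) set) h. g (\<Sum>i\<in>I. h i) = (\<Sum>i\<in>I. g (h i))"
    for f g :: "'a cpoly \<Rightarrow> 'a cpoly"
  proof -
    have "f p = (\<Sum>m\<in>Poly_Mapping.keys p. f (?s p m))" "g q = (\<Sum>m\<in>Poly_Mapping.keys q. g (?s q m))"
      using that(1)[of "?s p" "Poly_Mapping.keys p"] that(2)[of "?s q" "Poly_Mapping.keys q"]
      by (simp_all only: poly_mapping_sum_single[symmetric])
    then show ?thesis by (simp only: sum_product)
  qed
  show ?thesis
    using pq[of "\<lambda>x. x" "\<lambda>x. x"] pq[of "pdiff v" "\<lambda>x. x"] pq[of "\<lambda>x. x" "pdiff v"]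
    by (simp add: sing sum.distrib)
qed

lemma pdiff_power: "pdiff v (p ^ k) = of_nat k * p ^ (k - 1) * pdiff v p"
proof (induction k)
  case (Suc k)
  then show ?case by (cases k) (auto simp: algebra_simps)
qed simp

lemma pdiff_prod:
  assumes "finite I"
  shows "pdiff v (\<Prod>i\<in>I. f i) = (\<Sum>i\<in>I. pdiff v (f i) * (\<Prod>j\<in>I - {i}. f j))"
  using assms
proof (induction I)
  case (insert x F)
  have "(\<Prod>j\<in>insert x F - {i}. f j) = f x * (\<Prod>j\<in>F - {i}. f j)" if "i \<in> F" for i
  proof -
    have "insert x F - {i} = insert x (F - {i})" using insert that by auto
    then show ?thesis using insert by simp
  qed
  moreover have "insert x F - {x} = F" using insert by auto
  ultimately show ?case
    using insert by (simp add: sum_distrib_left mult_ac)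
qed simp

lemma pdiff_commute: "pdiff v (pdiff w p) = pdiff w (pdiff v p)"
  by (induction p rule: cpoly_induct_UNIV) (auto simp: algebra_simps)

lemma pdiff_notin_indets: "v \<notin> indets p \<Longrightarrow> pdiff v p = 0"
  unfolding pdiff_def indets_def by (intro sum.neutral) (auto simp: in_keys_iff)

lemma indets_pdiff: "indets (pdiff v p) \<subseteq> indets p"
proof
  fix w assume "w \<in> indets (pdiff v p)"
  then obtain m where m: "m \<in> Poly_Mapping.keys p"
    "w \<in> indets (Poly_Mapping.single (m - Poly_Mapping.single v 1)
        (of_nat (Poly_Mapping.lookup m v) * Poly_Mapping.lookup p m))"
    unfolding pdiff_def using indets_sum by fastforce
  then have "w \<in> Poly_Mapping.keys (m - Poly_Mapping.single v 1)"
    by (auto simp: indets_def split: if_splits)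
  then have "w \<in> Poly_Mapping.keys m"
    by (auto simp: in_keys_iff lookup_minus)
  with m show "w \<in> indets p" unfolding indets_def by blast
qed

lemma pdiff_psubst:
  assumes "finite V" "indets p \<subseteq> V"
  shows "pdiff v (psubst h p) = (\<Sum>w\<in>V. psubst h (pdiff w p) * pdiff v (h w))"
  using assms(2)
proof (induction p rule: cpoly_induct)
  case (Var w)
  have "(\<Sum>u\<in>V. psubst h (pdiff u (Var w)) * pdiff v (h u)) = (\<Sum>u\<in>V. if u = w then pdiff v (h u) else 0)"
    by (intro sum.cong) auto
  then show ?case using Var assms by (simp add: sum.delta')
next
  case (mult p q)
  then show ?case by (simp add: sum.distrib ring_distribs sum_distrib_left sum_distrib_right mult_ac)
qed (auto simp: sum.distrib ring_distribs)

section \<open>Scalars and spans\<close>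

abbreviation scal :: "complex \<Rightarrow> 'v cpoly \<Rightarrow> 'v cpoly" where "scal c p \<equiv> Const c * p"

interpretation cp: vector_space scal
  by unfold_locales (simp_all add: Const_add Const_mult ring_distribs mult_ac)

interpretation cpc: vector_space_pair scal "(*) :: complex \<Rightarrow> complex \<Rightarrow> complex"
  by unfold_locales (simp_all add: ring_distribs)

text \<open>Elements of \<open>dual A\<close> are continued by 0 outside A and are therefore linear
  only relative to A.\<close>

definition lin_on :: "'v cpoly set \<Rightarrow> ('v cpoly \<Rightarrow> complex) \<Rightarrow> bool" where
  "lin_on A f \<longleftrightarrow> (\<forall>p\<in>A. \<forall>q\<in>A. f (p + q) = f p + f q) \<and> (\<forall>c. \<forall>p\<in>A. f (Const c * p) = c * f p)"

lemma lin_on_subset: "lin_on A f \<Longrightarrow> B \<subseteq> A \<Longrightarrow> lin_on B f"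
  unfolding lin_on_def by blast

lemma lin_onD:
  assumes "lin_on A f"
  shows "p \<in> A \<Longrightarrow> q \<in> A \<Longrightarrow> f (p + q) = f p + f q" "p \<in> A \<Longrightarrow> f (Const c * p) = c * f p"
  using assms by (auto simp: lin_on_def)

lemma lin_on_zero: "lin_on A f \<Longrightarrow> cp.subspace A \<Longrightarrow> f 0 = 0"
  using lin_onD(2)[of A f 0 0] cp.subspace_0 by auto

lemma lin_on_sum:
  assumes "lin_on A f" "cp.subspace A" "\<And>i. i \<in> I \<Longrightarrow> g i \<in> A"
  shows "f (\<Sum>i\<in>I. g i) = (\<Sum>i\<in>I. f (g i))"
  using assms(3)
proof (induction I rule: infinite_finite_induct)
  case (insert x F)
  then show ?case using lin_onD(1)[OF assms(1), of "g x" "sum g F"] cp.subspace_sum[OF assms(2), of F g] by auto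
qed (auto simp: lin_on_zero[OF assms(1,2)])

lemma lin_on_sum_scale:
  assumes "lin_on A f" "cp.subspace A" "\<And>i. i \<in> I \<Longrightarrow> g i \<in> A"
  shows "f (\<Sum>i\<in>I. Const (c i) * g i) = (\<Sum>i\<in>I. c i * f (g i))"
  using lin_on_sum[OF assms(1,2), of I "\<lambda>i. Const (c i) * g i"] assms
  by (simp add: cp.subspace_scale lin_onD(2))

lemma cpoly_span_induct [consumes 1, case_names zero step]:
  assumes "p \<in> cp.span B" "P 0"
    and "\<And>c x y. x \<in> B \<Longrightarrow> y \<in> cp.span B \<Longrightarrow> P y \<Longrightarrow> P (Const c * x + y)"
  shows "P p"
proof -
  have "p \<in> cp.span B \<and> P p"
    using assms(1)
    by (induction rule: cp.span_induct_alt)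
      (auto intro!: assms(2,3) cp.span_add cp.span_scale cp.span_zero intro: cp.span_base)
  then show ?thesis by simp
qed

lemma lin_on_eq_span:
  assumes "lin_on (cp.span B) f" "lin_on (cp.span B) g" "\<And>b. b \<in> B \<Longrightarrow> f b = g b" "p \<in> cp.span B"
  shows "f p = g p"
  using assms(4)
proof (induction rule: cpoly_span_induct)
  case zero
  then show ?case using lin_on_zero assms(1,2) cp.subspace_span by metis
next
  case (step c x y)
  then have "x \<in> cp.span B" "Const c * x \<in> cp.span B" "f x = g x"
    using assms(3) by (auto simp: cp.span_base cp.span_scale)
  then show ?case using step lin_onD[OF assms(1)] lin_onD[OF assms(2)] by metis
qed

text \<open>Membership in a span is later proved by duality: a missing element would be detected by
  a functional that kills the span.\<close>

lemma not_in_span_functional: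
  assumes "p \<notin> cp.span B"
  obtains f where "lin_on UNIV f" "\<And>b. b \<in> B \<Longrightarrow> f b = 0" "f p = 1"
proof -
  obtain C where C: "C \<subseteq> B" "cp.independent C" "B \<subseteq> cp.span C"
    using cp.maximal_independent_subset[of B] by blast
  then have p: "p \<notin> cp.span C" using assms cp.span_mono by blast
  then have "cp.independent (insert p C)" using C cp.independent_insertI by blast
  from cpc.linear_independent_extend[OF this, of "\<lambda>x. if x = p then 1 else 0"]
  obtain g where g: "Vector_Spaces.linear scal (*) g" "\<And>x. x \<in> insert p C \<Longrightarrow> g x = (if x = p then 1 else 0)"
    by blast
  then have lin: "lin_on UNIV g"
    by (auto simp: lin_on_def Vector_Spaces.linear_iff)
  have "p \<notin> C" using p cp.span_base by blast
  then have g0: "g c = 0" if "c \<in> C" for c using g(2)[of c] that by auto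
  have "g b = 0" if "b \<in> B" for b
    using lin_on_eq_span[of C g "\<lambda>_. 0" b] lin C that g0 by (auto simp: lin_on_def)
  with lin g(2)[of p] that show ?thesis by auto
qed

section \<open>Even and odd functions on the plane\<close>

definition xymon :: "nat \<Rightarrow> nat \<Rightarrow> opoly" where
  "xymon a b = Var (X 0) ^ a * Var (Y 0) ^ b"

text \<open>\<open>True\<close> stands for even and \<open>False\<close> for odd. With this coding
  the parity of a product or bracket is \<open>e = e'\<close>, so one lemma covers all
  combinations.\<close>

definition parity_space :: "bool \<Rightarrow> opoly set" where
  "parity_space e = cp.span {xymon a b | a b. even (a + b) = e}"

definition plane :: "coord set" where "plane = {X 0, Y 0}"

definition br :: "opoly \<Rightarrow> opoly \<Rightarrow> opoly" where
  "br f g = pdiff (X 0) f * pdiff (Y 0) g - pdiff (Y 0) f * pdiff (X 0) g"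

lemma subspace_parity_space [simp]: "cp.subspace (parity_space e)"
  by (simp add: parity_space_def cp.subspace_span)

lemmas parity_space_zero [simp] = cp.subspace_0[OF subspace_parity_space]
lemmas parity_space_add = cp.subspace_add[OF subspace_parity_space]
lemmas parity_space_diff = cp.subspace_diff[OF subspace_parity_space]
lemmas parity_space_uminus = cp.subspace_neg[OF subspace_parity_space]
lemmas parity_space_scale = cp.subspace_scale[OF subspace_parity_space]
lemmas parity_space_sum = cp.subspace_sum[OF subspace_parity_space]

lemma xymon_in_parity_space: "even (a + b) = e \<Longrightarrow> xymon a b \<in> parity_space e"
  unfolding parity_space_def by (intro cp.span_base) blast

lemma parity_space_induct [consumes 1, case_names zero step]:
  assumes "p \<in> parity_space e" "P 0"
    and "\<And>c a b q. even (a + b) = e \<Longrightarrow> q \<in> parity_space e \<Longrightarrow> P q \<Longrightarrow> P (Const c * xymon a b + q)"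
  shows "P p"
  using assms(1) unfolding parity_space_def
  by (induction rule: cpoly_span_induct)
    (auto intro: assms(2) assms(3)[unfolded parity_space_def])

lemma xymon_mult: "xymon a b * xymon c d = xymon (a + c) (b + d)"
  by (simp add: xymon_def power_add mult_ac)

lemma xymon_zero: "xymon 0 0 = 1" by (simp add: xymon_def)
lemma xymon_x: "xymon (Suc 0) 0 = Var (X 0)" by (simp add: xymon_def)
lemma xymon_y: "xymon 0 (Suc 0) = Var (Y 0)" by (simp add: xymon_def)

lemma Const_in_parity_space [simp]: "Const c \<in> parity_space True"
  using parity_space_scale[OF xymon_in_parity_space[of 0 0 True], of c] by (simp add: xymon_zero)

lemma one_in_parity_space [simp]: "1 \<in> parity_space True"
  using Const_in_parity_space[of 1] by simp

lemma Var_in_parity_space [simp]: "Var (X 0) \<in> parity_space False" "Var (Y 0) \<in> parity_space False"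
  using xymon_in_parity_space[of 1 0 False] xymon_in_parity_space[of 0 1 False]
  by (simp_all add: xymon_x xymon_y)

lemma parity_space_mult:
  assumes "f \<in> parity_space e" "g \<in> parity_space e'"
  shows "f * g \<in> parity_space (e = e')"
proof -
  have 1: "xymon a b * g \<in> parity_space (e = e')" if "even (a + b) = e" for a b
    using assms(2)
  proof (induction rule: parity_space_induct)
    case (step c a' b' q)
    have "xymon a b * (Const c * xymon a' b' + q) = Const c * xymon (a + a') (b + b') + xymon a b * q"
      by (simp add: xymon_mult[symmetric] algebra_simps)
    moreover have "even (a + a' + (b + b')) = (e = e')" using that step by auto
    ultimately show ?case
      using step by (auto intro!: parity_space_add parity_space_scale xymon_in_parity_space)
  qed simp
  show ?thesis using assms(1)
  proof (induction rule: parity_space_induct)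
    case (step c a b q)
    then show ?case using 1[of a b]
      by (auto simp: ring_distribs mult.assoc intro!: parity_space_add parity_space_scale)
  qed simp
qed

lemma parity_space_mult_even:
  "f \<in> parity_space True \<Longrightarrow> g \<in> parity_space e \<Longrightarrow> f * g \<in> parity_space e"
  using parity_space_mult[of f True g e] by simp

lemma parity_space_power:
  "f \<in> parity_space e \<Longrightarrow> f ^ k \<in> parity_space (e \<or> even k)"
proof (induction k)
  case (Suc k)
  then show ?case using parity_space_mult[of f e "f ^ k" "e \<or> even k"] by (cases e) auto
qed simp

lemma pdiff_xymon:
  "pdiff (X 0) (xymon a b) = Const (of_nat a) * xymon (a - 1) b"
  "pdiff (Y 0) (xymon a b) = Const (of_nat b) * xymon a (b - 1)"
  by (simp_all add: xymon_def pdiff_power Const_of_nat algebra_simps)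

lemma pdiff_parity_space:
  assumes "f \<in> parity_space e"
  shows "pdiff (X 0) f \<in> parity_space (\<not> e)" "pdiff (Y 0) f \<in> parity_space (\<not> e)"
  using assms
proof (induction rule: parity_space_induct)
  case (step c a b q)
  \<comment> \<open>For a = 0 the truncated exponent a - 1 would have the wrong parity, but then the
    scalar is 0; hence the case distinction.\<close>
  have x: "Const (of_nat a) * xymon (a - 1) b \<in> parity_space (\<not> e)"
    using step(1) xymon_in_parity_space[of "a - 1" b "\<not> e"]
    by (cases a) (auto intro: parity_space_scale)
  have y: "Const (of_nat b) * xymon a (b - 1) \<in> parity_space (\<not> e)"
    using step(1) xymon_in_parity_space[of a "b - 1" "\<not> e"]
    by (cases b) (auto intro: parity_space_scale)
  {
    case 1 show ?case
      using parity_space_add[OF parity_space_scale[OF x, of c] step(3)] by (simp add: pdiff_xymon)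
  next
    case 2 show ?case
      using parity_space_add[OF parity_space_scale[OF y, of c] step(4)] by (simp add: pdiff_xymon)
  }
qed simp_all

lemma br_parity_space:
  assumes "f \<in> parity_space e" "g \<in> parity_space e'"
  shows "br f g \<in> parity_space (e = e')"
  using parity_space_mult[OF pdiff_parity_space(1)[OF assms(1)] pdiff_parity_space(2)[OF assms(2)]]
    parity_space_mult[OF pdiff_parity_space(2)[OF assms(1)] pdiff_parity_space(1)[OF assms(2)]]
  unfolding br_def by (auto intro: parity_space_diff)

lemma br_even: "h \<in> parity_space True \<Longrightarrow> g \<in> parity_space e \<Longrightarrow> br h g \<in> parity_space e"
  using br_parity_space[of h True g e] by simp

lemma indets_xymon: "indets (xymon a b) \<subseteq> plane"
  unfolding xymon_def plane_def
  using indets_mult[of "Var (X 0) ^ a" "Var (Y 0) ^ b"] indets_power[of "Var (X 0)" a]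
    indets_power[of "Var (Y 0)" b] by auto

lemma parity_space_indets:
  assumes "f \<in> parity_space e" shows "indets f \<subseteq> plane"
  using assms
proof (induction rule: parity_space_induct)
  case (step c a b q)
  then show ?case
    using indets_add[of "Const c * xymon a b" q] indets_mult[of "Const c" "xymon a b"] indets_xymon[of a b]
    by auto
qed simp

lemma br_add_left: "br (f + g) h = br f h + br g h" by (simp add: br_def algebra_simps)
lemma br_scale_left: "br (Const c * f) h = Const c * br f h" by (simp add: br_def algebra_simps)
lemma br_zero [simp]: "br 0 h = 0" "br h 0 = 0" by (simp_all add: br_def)

section \<open>Tensors\<close>

lemma shift_hom [simp]:
  "shift m (Const a) = Const a" "shift m (Var (X i)) = Var (X (i + m))" "shift m (Var (Y i)) = Var (Y (i + m))"
  "shift m (p + q) = shift m p + shift m q" "shift m (p * q) = shift m p * shift m q"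
  "shift m (p - q) = shift m p - shift m q" "shift m (- p) = - shift m p"
  "shift m 0 = 0" "shift m 1 = 1" "shift m (p ^ k) = shift m p ^ k"
  "shift m (\<Sum>i\<in>I. f i) = (\<Sum>i\<in>I. shift m (f i))"
  "shift m (\<Prod>i\<in>I. f i) = (\<Prod>i\<in>I. shift m (f i))"
  by (simp_all add: shift_def)

lemma shift_shift: "shift m (shift k p) = shift (k + m) p"
  by (induction p rule: cpoly_induct_UNIV) (auto split: coord.splits simp: shift_def add_ac)

lemma indets_shift:
  assumes "indets a \<subseteq> plane" shows "indets (shift i a) \<subseteq> {X i, Y i}"
  using assms indets_psubst[of _ a] unfolding shift_def plane_def by fastforce

lemma pdiff_shift:
  assumes "indets a \<subseteq> plane"
  shows "pdiff (X k) (shift i a) = (if k = i then shift i (pdiff (X 0) a) else 0)"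
    "pdiff (Y k) (shift i a) = (if k = i then shift i (pdiff (Y 0) a) else 0)"
  using assms by (induction a rule: cpoly_induct) (auto simp: plane_def)

text \<open>The pure tensor with factors a_0, ..., a_(n-1): \<open>shift i\<close> places the i-th
  factor in the i-th copy of the plane.\<close>

definition tens :: "nat \<Rightarrow> (nat \<Rightarrow> opoly) \<Rightarrow> opoly" where
  "tens n a = (\<Prod>i<n. shift i (a i))"

abbreviation pw :: "nat \<Rightarrow> opoly \<Rightarrow> opoly" where "pw n f \<equiv> tens n (\<lambda>_. f)"

lemma tens_cong: "(\<And>i. i < n \<Longrightarrow> a i = b i) \<Longrightarrow> tens n a = tens n b"
  by (simp add: tens_def)

lemma tens_upd: "p < n \<Longrightarrow> tens n (a(p := u)) = shift p u * (\<Prod>i\<in>{..<n} - {p}. shift i (a i))"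
  unfolding tens_def by (subst prod.remove[of _ p]) auto

lemma tens_upd_add: "p < n \<Longrightarrow> tens n (a(p := u + v)) = tens n (a(p := u)) + tens n (a(p := v))"
  by (simp add: tens_upd ring_distribs)
lemma tens_upd_scale: "p < n \<Longrightarrow> tens n (a(p := Const c * u)) = Const c * tens n (a(p := u))"
  by (simp add: tens_upd mult.assoc)

lemma tens_mult: "tens n a * tens n b = tens n (\<lambda>i. a i * b i)"
  by (simp add: tens_def prod.distrib)

lemma pdiff_tens:
  assumes "\<And>i. indets (a i) \<subseteq> plane" "k < n"
  shows "pdiff (X k) (tens n a) = tens n (a(k := pdiff (X 0) (a k)))"
    "pdiff (Y k) (tens n a) = tens n (a(k := pdiff (Y 0) (a k)))"
proof -
  have "pdiff (X k) (tens n a) = (\<Sum>i<n. pdiff (X k) (shift i (a i)) * (\<Prod>j\<in>{..<n} - {i}. shift j (a j)))"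
    unfolding tens_def by (rule pdiff_prod) simp
  also have "\<dots> = (\<Sum>i<n. if i = k then tens n (a(k := pdiff (X 0) (a k))) else 0)"
    using assms by (intro sum.cong) (auto simp: pdiff_shift tens_upd)
  finally show "pdiff (X k) (tens n a) = tens n (a(k := pdiff (X 0) (a k)))"
    using assms(2) by (simp add: sum.delta')
  have "pdiff (Y k) (tens n a) = (\<Sum>i<n. pdiff (Y k) (shift i (a i)) * (\<Prod>j\<in>{..<n} - {i}. shift j (a j)))"
    unfolding tens_def by (rule pdiff_prod) simp
  also have "\<dots> = (\<Sum>i<n. if i = k then tens n (a(k := pdiff (Y 0) (a k))) else 0)"
    using assms by (intro sum.cong) (auto simp: pdiff_shift tens_upd)
  finally show "pdiff (Y k) (tens n a) = tens n (a(k := pdiff (Y 0) (a k)))"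
    using assms(2) by (simp add: sum.delta')
qed

text \<open>Functions of different copies of the plane Poisson commute, so each summand brackets one
  pair of factors and multiplies the others.\<close>

lemma poisson_tens:
  assumes "\<And>i. indets (a i) \<subseteq> plane" "\<And>i. indets (b i) \<subseteq> plane"
  shows "poisson n (tens n a) (tens n b) =
    (\<Sum>j<n. tens n ((\<lambda>i. a i * b i)(j := br (a j) (b j))))"
  unfolding poisson_def
proof (intro sum.cong refl)
  fix j assume "j \<in> {..<n}"
  then have j: "j < n" by simp
  have "tens n (a(j := u)) * tens n (b(j := v)) = tens n ((\<lambda>i. a i * b i)(j := u * v))" for u v
    unfolding tens_mult by (rule tens_cong) auto
  then show "pdiff (X j) (tens n a) * pdiff (Y j) (tens n b) - pdiff (Y j) (tens n a) * pdiff (X j) (tens n b)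
    = tens n ((\<lambda>i. a i * b i)(j := br (a j) (b j)))"
    using j assms by (simp add: pdiff_tens br_def tens_upd left_diff_distrib)
qed

text \<open>The Hamiltonian h acting on all n copies of the plane at once; its bracket is the
  derivation of the tensor algebra that extends {h, -}.\<close>

definition psum :: "nat \<Rightarrow> opoly \<Rightarrow> opoly" where
  "psum n h = (\<Sum>i<n. shift i h)"

lemma psum_mult_tens: "psum n h * tens n a = (\<Sum>j<n. tens n (a(j := h * a j)))"
  unfolding psum_def sum_distrib_right
proof (intro sum.cong refl)
  fix j assume "j \<in> {..<n}"
  then show "shift j h * tens n a = tens n (a(j := h * a j))"
    using tens_upd[of j n a "a j"] tens_upd[of j n a "h * a j"] by (simp add: mult.assoc)
qed

lemma poisson_psum_tens:
  assumes "\<And>i. indets (a i) \<subseteq> plane" "indets h \<subseteq> plane"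
  shows "poisson n (psum n h) (tens n a) = (\<Sum>j<n. tens n (a(j := br h (a j))))"
  unfolding poisson_def
proof (intro sum.cong refl)
  fix j assume "j \<in> {..<n}"
  then have j: "j < n" by simp
  have "pdiff (X j) (psum n h) = shift j (pdiff (X 0) h)" "pdiff (Y j) (psum n h) = shift j (pdiff (Y 0) h)"
    using j assms by (simp_all add: psum_def pdiff_shift sum.delta)
  then show "pdiff (X j) (psum n h) * pdiff (Y j) (tens n a) - pdiff (Y j) (psum n h) * pdiff (X j) (tens n a)
    = tens n (a(j := br h (a j)))"
    using j assms by (simp add: pdiff_tens br_def tens_upd algebra_simps)
qed

text \<open>Symmetrization without the factor 1/n!, which is the source of the factors
  \<open>fact n\<close> below.\<close>

definition symt :: "nat \<Rightarrow> (nat \<Rightarrow> opoly) \<Rightarrow> opoly" where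
  "symt n a = (\<Sum>\<sigma> | \<sigma> permutes {..<n}. tens n (a \<circ> \<sigma>))"

lemma symt_const: "symt n (\<lambda>_. f) = Const (fact n) * pw n f"
  by (simp add: symt_def o_def card_permutations Const_of_nat[symmetric])

text \<open>Since all slots are summed over, it does not matter whether the modified slot is named
  by its position in the tensor or by the index of the argument placed there. This carries Leibniz
  sums from pure tensors over to symmetrized ones.\<close>

lemma symt_sum_upd:
  "(\<Sum>\<sigma> | \<sigma> permutes {..<n}. \<Sum>j<n. tens n ((a \<circ> \<sigma>)(j := F (\<sigma> j)))) = (\<Sum>j<n. symt n (a(j := F j)))"
proof -
  have "(\<Sum>j<n. tens n ((a \<circ> \<sigma>)(j := F (\<sigma> j)))) = (\<Sum>j<n. tens n (a(j := F j) \<circ> \<sigma>))"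
    if s: "\<sigma> permutes {..<n}" for \<sigma>
  proof -
    have "(\<Sum>j<n. tens n (a(j := F j) \<circ> \<sigma>)) = (\<Sum>j<n. tens n (a(\<sigma> j := F (\<sigma> j)) \<circ> \<sigma>))"
      using sum.permute[OF s, of "\<lambda>j. tens n (a(j := F j) \<circ> \<sigma>)"] by (simp add: o_def)
    also have "\<dots> = (\<Sum>j<n. tens n ((a \<circ> \<sigma>)(j := F (\<sigma> j))))"
    proof (intro sum.cong refl arg_cong[of _ _ "tens n"])
      show "a(\<sigma> j := F (\<sigma> j)) \<circ> \<sigma> = (a \<circ> \<sigma>)(j := F (\<sigma> j))" for j
        using permutes_inj[OF s] by (auto simp: fun_eq_iff inj_def)
    qed
    finally show ?thesis by simp
  qed
  then have "(\<Sum>\<sigma> | \<sigma> permutes {..<n}. \<Sum>j<n. tens n ((a \<circ> \<sigma>)(j := F (\<sigma> j)))) =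
    (\<Sum>\<sigma> | \<sigma> permutes {..<n}. \<Sum>j<n. tens n (a(j := F j) \<circ> \<sigma>))"
    by (rule sum.cong[OF refl]) simp
  also have "\<dots> = (\<Sum>j<n. symt n (a(j := F j)))"
    unfolding symt_def by (rule sum.swap)
  finally show ?thesis .
qed

lemma psum_mult_symt: "psum n h * symt n a = (\<Sum>j<n. symt n (a(j := h * a j)))"
  unfolding symt_sum_upd[symmetric]
  by (simp add: symt_def sum_distrib_left psum_mult_tens)

lemma poisson_add_right: "poisson n f (g + h) = poisson n f g + poisson n f h"
  by (simp add: poisson_def algebra_simps sum.distrib sum_subtractf)
lemma poisson_add_left: "poisson n (f + g) h = poisson n f h + poisson n g h"
  by (simp add: poisson_def algebra_simps sum.distrib sum_subtractf)
lemma poisson_scale_right: "poisson n f (Const c * g) = Const c * poisson n f g"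
  by (simp add: poisson_def algebra_simps sum.distrib sum_distrib_left sum_subtractf)
lemma poisson_scale_left: "poisson n (Const c * f) g = Const c * poisson n f g"
  by (simp add: poisson_def algebra_simps sum.distrib sum_distrib_left sum_subtractf)
lemma poisson_zero [simp]: "poisson n f 0 = 0" "poisson n 0 f = 0"
  by (simp_all add: poisson_def)
lemma poisson_sum_right: "poisson n f (\<Sum>i\<in>I. g i) = (\<Sum>i\<in>I. poisson n f (g i))"
  by (induction I rule: infinite_finite_induct) (auto simp: poisson_add_right)
lemma poisson_sum_left: "poisson n (\<Sum>i\<in>I. g i) f = (\<Sum>i\<in>I. poisson n (g i) f)"
  by (induction I rule: infinite_finite_induct) (auto simp: poisson_add_left)
lemma poisson_mult_right: "poisson n h (f * g) = poisson n h f * g + f * poisson n h g"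
  by (simp add: poisson_def algebra_simps sum.distrib sum_distrib_left sum_subtractf)
lemma poisson_mult_left: "poisson n (f * g) h = f * poisson n g h + poisson n f h * g"
  by (simp add: poisson_def algebra_simps sum.distrib sum_distrib_left sum_subtractf)
lemma poisson_commute: "poisson n f g = - poisson n g f"
  by (simp add: poisson_def sum_negf[symmetric] algebra_simps)
lemma poisson_Const [simp]: "poisson n (Const c) f = 0" "poisson n f (Const c) = 0"
  by (simp_all add: poisson_def)

lemma poisson_psum_symt:
  assumes "\<And>i. indets (a i) \<subseteq> plane" "indets h \<subseteq> plane"
  shows "poisson n (psum n h) (symt n a) = (\<Sum>j<n. symt n (a(j := br h (a j))))"
  unfolding symt_sum_upd[symmetric]
  using poisson_psum_tens[of "a \<circ> \<sigma>" h n for \<sigma>] assms by (simp add: symt_def poisson_sum_right)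

lemma poisson_pw_symt:
  assumes "indets f \<subseteq> plane" "\<And>i. indets (b i) \<subseteq> plane"
  shows "poisson n (pw n f) (symt n b) = (\<Sum>j<n. symt n ((\<lambda>i. f * b i)(j := br f (b j))))"
  unfolding symt_sum_upd[symmetric]
  using poisson_tens[of "\<lambda>_. f" "b \<circ> \<sigma>" n for \<sigma>] assms
  by (simp add: symt_def poisson_sum_right o_def)

text \<open>In each argument the difference of the two sides is a derivation once the other
  arguments are fixed, so the identity reduces to variables, whose mutual brackets are
  constants.\<close>

lemma poisson_jacobi:
  "poisson n f (poisson n g h) = poisson n (poisson n f g) h + poisson n g (poisson n f h)"
proof -
  have cst: "pdiff w (poisson n (Var u) (Var v)) = 0" for u v w
    by (auto simp: poisson_def intro!: sum.neutral)
  have c0: "poisson n q (poisson n (Var u) (Var v)) = 0" "poisson n (poisson n (Var u) (Var v)) q = 0" for u v q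
    by (simp_all add: poisson_def[of n q] poisson_def[of n "poisson n (Var u) (Var v)"] cst)
  have 1: "poisson n (Var u) (poisson n (Var v) h) =
      poisson n (poisson n (Var u) (Var v)) h + poisson n (Var v) (poisson n (Var u) h)" for u v h
    by (induction h rule: cpoly_induct_UNIV)
      (simp_all add: poisson_add_right poisson_mult_right c0 algebra_simps)
  have 2: "poisson n (Var u) (poisson n g h) =
      poisson n (poisson n (Var u) g) h + poisson n g (poisson n (Var u) h)" for u g h
  proof (induction g rule: cpoly_induct_UNIV)
    case (Var v)
    show ?case by (rule 1)
  next
    case (mult p q)
    then show ?case
      using poisson_commute[of n p "poisson n (Var u) h"] poisson_commute[of n q "Var u"] poisson_commute[of n p "Var u"]
      by (simp add: poisson_add_right poisson_add_left poisson_mult_right poisson_mult_left ring_distribs)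
  qed (simp_all add: poisson_add_right poisson_add_left)
  show ?thesis
  proof (induction f rule: cpoly_induct_UNIV)
    case (Var v)
    show ?case by (rule 2)
  next
    case (mult p q)
    then show ?case
      using poisson_commute[of n g p] poisson_commute[of n g q]
      by (simp add: poisson_add_right poisson_add_left poisson_mult_right poisson_mult_left ring_distribs)
  qed (simp_all add: poisson_add_right poisson_add_left)
qed

section \<open>Symmetric multilinear forms\<close>

text \<open>Argument lists are functions on all natural numbers; the last clause says that only the
  first n entries count. Symmetry is required for transpositions, the only permutations applied
  later.\<close>

definition sym_multilinear ::
    "nat \<Rightarrow> 'v cpoly set \<Rightarrow> ((nat \<Rightarrow> 'v cpoly) \<Rightarrow> complex) \<Rightarrow> bool" where
  "sym_multilinear n V S \<longleftrightarrow>
     (\<forall>a p u v. (\<forall>i. a i \<in> V) \<longrightarrow> p < n \<longrightarrow> u \<in> V \<longrightarrow> v \<in> V \<longrightarrow>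
        S (a(p := u + v)) = S (a(p := u)) + S (a(p := v))) \<and>
     (\<forall>a p c u. (\<forall>i. a i \<in> V) \<longrightarrow> p < n \<longrightarrow> u \<in> V \<longrightarrow>
        S (a(p := Const c * u)) = c * S (a(p := u))) \<and>
     (\<forall>a p q. (\<forall>i. a i \<in> V) \<longrightarrow> p < n \<longrightarrow> q < n \<longrightarrow>
        S (a \<circ> Transposition.transpose p q) = S a) \<and>
     (\<forall>a b. (\<forall>i. a i \<in> V) \<longrightarrow> (\<forall>i<n. b i = a i) \<longrightarrow> S b = S a)"

context
  fixes n :: nat and V :: "'v cpoly set" and S :: "(nat \<Rightarrow> 'v cpoly) \<Rightarrow> complex"
  assumes S: "sym_multilinear n V S"
begin

lemma sml_add: "(\<And>i. a i \<in> V) \<Longrightarrow> p < n \<Longrightarrow> u \<in> V \<Longrightarrow> v \<in> V \<Longrightarrow>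
    S (a(p := u + v)) = S (a(p := u)) + S (a(p := v))"
  using S[unfolded sym_multilinear_def, THEN conjunct1] by blast
lemma sml_scale: "(\<And>i. a i \<in> V) \<Longrightarrow> p < n \<Longrightarrow> u \<in> V \<Longrightarrow> S (a(p := Const c * u)) = c * S (a(p := u))"
  using S[unfolded sym_multilinear_def, THEN conjunct2, THEN conjunct1] by blast
lemma sml_transpose: "(\<And>i. a i \<in> V) \<Longrightarrow> p < n \<Longrightarrow> q < n \<Longrightarrow> S (a \<circ> Transposition.transpose p q) = S a"
  using S[unfolded sym_multilinear_def, THEN conjunct2, THEN conjunct2, THEN conjunct1] by blast
lemma sml_cong: "(\<And>i. a i \<in> V) \<Longrightarrow> (\<And>i. i < n \<Longrightarrow> b i = a i) \<Longrightarrow> S b = S a"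
  using S[unfolded sym_multilinear_def, THEN conjunct2, THEN conjunct2, THEN conjunct2] by blast

lemma sml_move:
  assumes a: "\<And>i. a i \<in> V" and pq: "p < n" "q < n" and eq: "a p = a q" and u: "u \<in> V"
  shows "S (a(q := u)) = S (a(p := u))"
proof -
  have "(a(p := u)) i \<in> V" for i
    using a u by simp
  then have "S (a(p := u) \<circ> Transposition.transpose p q) = S (a(p := u))"
    using pq by (rule sml_transpose)
  moreover have "a(p := u) \<circ> Transposition.transpose p q = a(q := u)"
  proof
    fix i show "(a(p := u) \<circ> Transposition.transpose p q) i = (a(q := u)) i"
      by (cases "i = p"; cases "i = q") (simp_all add: eq)
  qed
  ultimately show ?thesis by simp
qed

text \<open>The multilinear binomial formula, with I the set of slots that receive w. It is kept as
  a polynomial in t so that single coefficients can be extracted.\<close>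

lemma sml_expand:
  assumes V: "cp.subspace V" "v \<in> V" "w \<in> V"
    and "finite J" "J \<subseteq> {..<n}" "\<And>i. a i \<in> V"
  shows "S (\<lambda>i. if i \<in> J then v + Const t * w else a i) =
    (\<Sum>I\<in>Pow J. t ^ card I * S (\<lambda>i. if i \<in> I then w else if i \<in> J then v else a i))"
  using assms(4,5,6)
proof (induction J arbitrary: a)
  case (insert x F)
  let ?u = "v + Const t * w"
  have tw: "Const t * w \<in> V" "?u \<in> V" by (auto intro!: cp.subspace_add[OF V(1)] cp.subspace_scale[OF V(1)] V(2,3))
  define b where "b = (\<lambda>i. if i \<in> F then ?u else a i)"
  have b: "b i \<in> V" for i using insert.prems(2) tw by (auto simp: b_def)
  have upd: "b(x := z) = (\<lambda>i. if i \<in> F then ?u else (a(x := z)) i)" for z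
    using insert.hyps(2) by (auto simp: b_def)
  have IH: "S (b(x := z)) = (\<Sum>I\<in>Pow F. t ^ card I *
      S (\<lambda>i. if i \<in> I then w else if i \<in> F then v else (a(x := z)) i))" if "z \<in> V" for z
    unfolding upd using insert.prems that by (intro insert.IH) auto
  have "S (\<lambda>i. if i \<in> insert x F then ?u else a i) = S (b(x := ?u))"
    by (intro arg_cong[of _ _ S]) (auto simp: b_def fun_eq_iff)
  also have "\<dots> = S (b(x := v)) + t * S (b(x := w))"
    using sml_add[OF b, of x v "Const t * w"] sml_scale[OF b, where p = x and u = w and c = t] V tw insert.prems(1) by simp
  also have "S (b(x := v)) = (\<Sum>I\<in>Pow F. t ^ card I *
      S (\<lambda>i. if i \<in> I then w else if i \<in> insert x F then v else a i))"
    unfolding IH[OF V(2)] by (intro sum.cong refl arg_cong2[of _ _ _ _ "(*)"] arg_cong[of _ _ S])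
      (auto simp: fun_eq_iff)
  also have "t * S (b(x := w)) = (\<Sum>I\<in>Pow F. t ^ card (insert x I) *
      S (\<lambda>i. if i \<in> insert x I then w else if i \<in> insert x F then v else a i))"
    unfolding IH[OF V(3)] sum_distrib_left
  proof (intro sum.cong refl)
    fix I assume "I \<in> Pow F"
    then have "x \<notin> I" "finite I" using insert.hyps finite_subset by auto
    moreover have "(\<lambda>i. if i \<in> I then w else if i \<in> F then v else (a(x := w)) i) =
      (\<lambda>i. if i \<in> insert x I then w else if i \<in> insert x F then v else a i)"
      using insert.hyps(2) by (auto simp: fun_eq_iff)
    ultimately show "t * (t ^ card I * S (\<lambda>i. if i \<in> I then w else if i \<in> F then v else (a(x := w)) i)) =
      t ^ card (insert x I) * S (\<lambda>i. if i \<in> insert x I then w else if i \<in> insert x F then v else a i)"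
      by simp
  qed
  also have "\<dots> = (\<Sum>I\<in>insert x ` Pow F. t ^ card I *
      S (\<lambda>i. if i \<in> I then w else if i \<in> insert x F then v else a i))"
    by (subst sum.reindex) (use insert.hyps(2) in \<open>auto simp: inj_on_def\<close>)
  finally show ?case
    unfolding Pow_insert using insert.hyps by (subst sum.union_disjoint) auto
qed simp

end

text \<open>A polynomial with only zero values has zero coefficients. This is how one homogeneous
  component is isolated from an identity with a free parameter.\<close>

lemma sum_powers_zero_coeff:
  fixes c :: "'i \<Rightarrow> complex"
  assumes "finite F" "\<And>t::complex. (\<Sum>I\<in>F. t ^ k I * c I) = 0"
  shows "(\<Sum>I\<in>{I\<in>F. k I = m}. c I) = 0"
proof -
  define P where "P = (\<Sum>I\<in>F. monom (c I) (k I))"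
  have "poly P t = 0" for t
    using assms(2)[of t] by (simp add: P_def poly_sum poly_monom mult_ac)
  then have "P = 0" using poly_all_0_iff_0 by blast
  then have "0 = coeff P m" by simp
  also have "\<dots> = (\<Sum>I\<in>F. if k I = m then c I else 0)"
    by (simp add: P_def coeff_sum)
  also have "\<dots> = (\<Sum>I\<in>{I\<in>F. k I = m}. c I)"
    using assms(1) by (simp add: sum.inter_filter)
  finally show ?thesis by simp
qed

text \<open>Polarization by induction on the number of slots outside J. To free a slot p, the vector
  \<nu> is varied by t times the entry at p in all slots of J and in p; the coefficient of t is a
  nonzero multiple of the wanted value.\<close>

lemma sml_polarize:
  assumes S: "sym_multilinear n V S" and V: "cp.subspace V" and N: "cp.subspace N" "N \<subseteq> V" and e: "e \<in> V"
    and diag: "\<And>\<nu>. \<nu> \<in> N \<Longrightarrow> S (\<lambda>_. e + \<nu>) = 0"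
    and "J \<subseteq> {..<n}" "\<nu> \<in> N" "\<And>i. a i \<in> N"
  shows "S (\<lambda>i. if i \<in> J then e + \<nu> else a i) = 0"
proof -
  have "\<forall>J \<nu> a. J \<subseteq> {..<n} \<and> n - card J = r \<and> \<nu> \<in> N \<and> (\<forall>i. a i \<in> N) \<longrightarrow>
      S (\<lambda>i. if i \<in> J then e + \<nu> else a i) = 0" for r
  proof (induction r)
    case 0
    show ?case
    proof (intro allI impI, elim conjE)
      fix J \<nu> and a :: "nat \<Rightarrow> _" assume J: "J \<subseteq> {..<n}" "n - card J = 0" and \<nu>: "\<nu> \<in> N"
      then have "J = {..<n}" using card_subset_eq[of "{..<n}" J] card_mono[of "{..<n}" J] by auto
      have "S (\<lambda>i. if i \<in> J then e + \<nu> else a i) = S (\<lambda>_. e + \<nu>)"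
        by (rule sml_cong[OF S]) (use \<nu> N e V cp.subspace_add \<open>J = _\<close> in auto)
      with diag \<nu> show "S (\<lambda>i. if i \<in> J then e + \<nu> else a i) = 0" by simp
    qed
  next
    case (Suc r)
    show ?case
    proof (intro allI impI, elim conjE)
      fix J \<nu> and a :: "nat \<Rightarrow> _" assume J: "J \<subseteq> {..<n}" "n - card J = Suc r" and \<nu>: "\<nu> \<in> N" and a: "\<forall>i. a i \<in> N"
      have "finite J" using J finite_subset by blast
      have "J \<noteq> {..<n}" using J by auto
      then obtain p where p: "p < n" "p \<notin> J" using J by auto
      define J' where "J' = insert p J"
      have J': "J' \<subseteq> {..<n}" "n - card J' = r" "finite J'" using p J \<open>finite J\<close> by (auto simp: J'_def)
      let ?v = "e + \<nu>" and ?w = "a p"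
      have vw: "?v \<in> V" "?w \<in> V" "\<And>i. a i \<in> V" using a N \<nu> e V cp.subspace_add by blast+
      let ?T = "\<lambda>I. S (\<lambda>i. if i \<in> I then ?w else if i \<in> J' then ?v else a i)"
      have "(\<Sum>I\<in>Pow J'. t ^ card I * ?T I) = 0" for t
      proof -
        have "\<nu> + Const t * ?w \<in> N" using a \<nu> N cp.subspace_add cp.subspace_scale by blast
        then have "S (\<lambda>i. if i \<in> J' then e + (\<nu> + Const t * ?w) else a i) = 0"
          using Suc J' a by blast
        then show ?thesis using sml_expand[OF S V, where a = a and t = t, OF vw(1,2) J'(3,1) vw(3)]
            by (simp only: add.assoc)
      qed
      \<comment> \<open>The coefficient of t: one summand for each slot of \<open>J'\<close> that
        receives the new entry. By symmetry all of them equal the summand for p, and their number is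
        nonzero.\<close>
      then have "(\<Sum>I\<in>{I\<in>Pow J'. card I = 1}. ?T I) = 0"
        by (intro sum_powers_zero_coeff) (use J' in auto)
      also have "{I\<in>Pow J'. card I = 1} = (\<lambda>q. {q}) ` J'"
        by (auto simp: card_1_singleton_iff)
      also have "(\<Sum>I\<in>(\<lambda>q. {q}) ` J'. ?T I) = (\<Sum>q\<in>J'. ?T {q})"
        by (subst sum.reindex) auto
      also have "\<dots> = (\<Sum>q\<in>J'. ?T {p})"
      proof (intro sum.cong refl)
        fix q assume q: "q \<in> J'"
        let ?b = "\<lambda>i. if i \<in> J' then ?v else a i"
        have "S (?b(q := ?w)) = S (?b(p := ?w))"
          by (rule sml_move[OF S]) (use vw q p J' in \<open>auto simp: J'_def\<close>)
        moreover have "?b(q := ?w) = (\<lambda>i. if i \<in> {q} then ?w else ?b i)"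
          "?b(p := ?w) = (\<lambda>i. if i \<in> {p} then ?w else ?b i)" by auto
        ultimately show "?T {q} = ?T {p}" by simp
      qed
      also have "\<dots> = of_nat (card J') * ?T {p}" by simp
      finally have "?T {p} = 0" using J' by (auto simp: J'_def)
      moreover have "(\<lambda>i. if i \<in> {p} then ?w else if i \<in> J' then ?v else a i)
          = (\<lambda>i. if i \<in> J then ?v else a i)"
        using p by (auto simp: J'_def)
      ultimately show "S (\<lambda>i. if i \<in> J then e + \<nu> else a i) = 0" by simp
    qed
  qed
  then show ?thesis using assms by blast
qed

text \<open>Polarizing, the hypothesis on the diagonal kills all values with arguments in \<open>{e} \<union> N\<close>; every
  other argument is \<open>X e + \<nu>\<close>, and applying the derivation \<open>X\<close> to the whole form trades \<open>X e\<close> for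
  one more argument \<open>e\<close>.\<close>

lemma sml_slice:
  assumes ml: "\<And>S. S \<in> \<S> \<Longrightarrow> sym_multilinear n V S"
    and V: "cp.subspace V" and N: "cp.subspace N" "N \<subseteq> V" and e: "e \<in> V"
    and ops: "\<And>X v. X \<in> ops \<Longrightarrow> v \<in> V \<Longrightarrow> X v \<in> V"
    and inv: "\<And>X S. X \<in> ops \<Longrightarrow> S \<in> \<S> \<Longrightarrow>
        \<exists>S'\<in>\<S>. \<forall>a. (\<forall>i. a i \<in> V) \<longrightarrow> S' a = (\<Sum>j<n. S (a(j := X (a j))))"
    and decomp: "\<And>v. v \<in> V \<Longrightarrow> v \<in> N \<or> (\<exists>X\<in>ops. \<exists>\<nu>\<in>N. v = X e + \<nu>)"
    and diag: "\<And>S \<nu>. S \<in> \<S> \<Longrightarrow> \<nu> \<in> N \<Longrightarrow> S (\<lambda>_. e + \<nu>) = 0"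
    and "S \<in> \<S>" "\<And>i. a i \<in> V"
  shows "S a = 0"
proof -
  \<comment> \<open>Outer induction on the number r of slots that do not hold e. The inner induction
    is on the number of remaining slots with an entry outside N; at 0 polarization applies.\<close>
  have main: "\<forall>S\<in>\<S>. \<forall>J a. J \<subseteq> {..<n} \<and> n - card J = r \<and> (\<forall>i. a i \<in> V) \<longrightarrow>
      S (\<lambda>i. if i \<in> J then e else a i) = 0" for r
  proof (induction r rule: less_induct)
    case (less r)
    have inner: "\<forall>S\<in>\<S>. \<forall>J a. J \<subseteq> {..<n} \<and> n - card J = r \<and> (\<forall>i. a i \<in> V) \<and>
      card {i\<in>{..<n} - J. a i \<notin> N} = k \<longrightarrow> S (\<lambda>i. if i \<in> J then e else a i) = 0" for k
    proof (induction k)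
      case 0
      show ?case
      proof (intro ballI allI impI, elim conjE)
        fix S J and a :: "nat \<Rightarrow> _" assume S: "S \<in> \<S>" and J: "J \<subseteq> {..<n}" and a: "\<forall>i. a i \<in> V"
          and "card {i\<in>{..<n} - J. a i \<notin> N} = 0"
        then have aN: "a i \<in> N" if "i < n" "i \<notin> J" for i using that by auto
        define a' where "a' = (\<lambda>i. if i \<in> {..<n} - J then a i else 0)"
        have a': "a' i \<in> N" for i using aN N cp.subspace_0 by (auto simp: a'_def)
        have "S (\<lambda>i. if i \<in> J then e + 0 else a' i) = 0"
          by (rule sml_polarize[OF ml[OF S] V N e diag[OF S] J _ a']) (use N cp.subspace_0 in auto)
        moreover have "S (\<lambda>i. if i \<in> J then e else a i) = S (\<lambda>i. if i \<in> J then e + 0 else a' i)"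
        proof (rule sml_cong[OF ml[OF S]])
          show "(if i \<in> J then e + 0 else a' i) \<in> V" for i
            using a'[of i] N(2) e by auto
        qed (simp_all add: a'_def)
        ultimately show "S (\<lambda>i. if i \<in> J then e else a i) = 0" by simp
      qed
    next
      case (Suc k)
      show ?case
      proof (intro ballI allI impI, elim conjE)
        fix S J and a :: "nat \<Rightarrow> _" assume S: "S \<in> \<S>" and J: "J \<subseteq> {..<n}" "n - card J = r" and a: "\<forall>i. a i \<in> V"
          and Q: "card {i\<in>{..<n} - J. a i \<notin> N} = Suc k"
        note m = ml[OF S]
        have "{i\<in>{..<n} - J. a i \<notin> N} \<noteq> {}" using Q by (metis card.empty nat.distinct(1))
        then obtain p where p: "p < n" "p \<notin> J" "a p \<notin> N" by auto
        have "a p \<in> V" using a by blast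
        with decomp[OF this] p(3) obtain X \<nu> where X: "X \<in> ops" "\<nu> \<in> N" "a p = X e + \<nu>" by blast
        have "finite J" using J finite_subset by blast
        define J' where "J' = insert p J"
        have J': "J' \<subseteq> {..<n}" "n - card J' < r" "finite J'" "p \<in> J'"
          using p J \<open>finite J\<close> card_mono[of "{..<n}" "insert p J"] by (auto simp: J'_def)
        define b where "b = (\<lambda>i. if i \<in> J then e else a i)"
        have b: "b i \<in> V" for i using a e by (auto simp: b_def)
        have Xe: "X e \<in> V" using ops X e by blast
        have nV: "\<nu> \<in> V" using X N by blast
        have "b = b(p := X e + \<nu>)" using p X by (auto simp: b_def)
        then have "S b = S (b(p := X e)) + S (b(p := \<nu>))"
          using sml_add[OF m, where a = b, OF b p(1) Xe nV] by simp
        also have "S (b(p := \<nu>)) = 0"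
        proof -
          have "{i\<in>{..<n} - J. (a(p := \<nu>)) i \<notin> N} = {i\<in>{..<n} - J. a i \<notin> N} - {p}"
            using X by auto
          then have "card {i\<in>{..<n} - J. (a(p := \<nu>)) i \<notin> N} = k" using Q p by simp
          then have "S (\<lambda>i. if i \<in> J then e else (a(p := \<nu>)) i) = 0"
            using Suc S J a nV by auto
          moreover have "b(p := \<nu>) = (\<lambda>i. if i \<in> J then e else (a(p := \<nu>)) i)"
            using p by (auto simp: b_def)
          ultimately show ?thesis by simp
        qed
        also have "S (b(p := X e)) = 0"
        proof -
          define c where "c = b(p := e)"
          have c: "c i \<in> V" for i using b e by (auto simp: c_def)
          have c': "c = (\<lambda>i. if i \<in> J' then e else a i)" by (auto simp: c_def b_def J'_def)
          obtain S' where S': "S' \<in> \<S>" "\<forall>a. (\<forall>i. a i \<in> V) \<longrightarrow> S' a = (\<Sum>j<n. S (a(j := X (a j))))"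
            using inv[OF X(1) S] by blast
          have "S' c = 0" unfolding c' using less.IH[OF J'(2)] S'(1) J' a by blast
          then have "0 = (\<Sum>j<n. S (c(j := X (c j))))" using S'(2) c by auto
          \<comment> \<open>The total derivative of S along X vanishes at c. Slots holding e
            contribute equal terms by symmetry; the other terms still contain e in all slots of
            \<open>J'\<close> and vanish by the outer induction hypothesis.\<close>
          also have "\<dots> = (\<Sum>j<n. if j \<in> J' then S (c(p := X e)) else 0)"
          proof (intro sum.cong refl)
            fix j assume j: "j \<in> {..<n}"
            show "S (c(j := X (c j))) = (if j \<in> J' then S (c(p := X e)) else 0)"
            proof (cases "j \<in> J'")
              case True
              have "S (c(j := X e)) = S (c(p := X e))"
                by (rule sml_move[OF m c p(1) _ _ Xe]) (use j True J' in \<open>auto simp: c'\<close>)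
              then show ?thesis using True by (simp add: c')
            next
              case False
              have "S (\<lambda>i. if i \<in> J' then e else (a(j := X (a j))) i) = 0"
                using less.IH[OF J'(2)] S J' a ops[OF X(1)] by auto
              moreover have "c(j := X (c j)) = (\<lambda>i. if i \<in> J' then e else (a(j := X (a j))) i)"
                using False by (auto simp: c')
              ultimately show ?thesis using False by simp
            qed
          qed
          also have "\<dots> = of_nat (card J') * S (c(p := X e))"
            using J' by (simp add: sum.If_cases Int_absorb1)
          finally have "S (c(p := X e)) = 0" using J' by auto
          then show ?thesis by (simp add: c_def)
        qed
        finally show "S (\<lambda>i. if i \<in> J then e else a i) = 0" by (simp add: b_def)
      qed
    qed
    then show ?case by blast
  qed
  have "S (\<lambda>i. if i \<in> {} then e else a i) = 0"
    using main[of n, rule_format, OF assms(10), of "{}" a] assms(11) by auto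
  then show ?thesis by simp
qed

section \<open>Symmetric powers\<close>

text \<open>The symmetric power, presented as the span of pure powers; in characteristic 0 this is
  everything, and linear statements then need checking on powers only.\<close>

definition sym_power :: "nat \<Rightarrow> bool \<Rightarrow> opoly set" where
  "sym_power n e = cp.span (pw n ` parity_space e)"

lemma subspace_sym_power [simp]: "cp.subspace (sym_power n e)"
  by (simp add: sym_power_def cp.subspace_span)

lemmas sym_power_zero [simp] = cp.subspace_0[OF subspace_sym_power]
lemmas sym_power_add = cp.subspace_add[OF subspace_sym_power]
lemmas sym_power_diff = cp.subspace_diff[OF subspace_sym_power]
lemmas sym_power_neg = cp.subspace_neg[OF subspace_sym_power]
lemmas sym_power_scale = cp.subspace_scale[OF subspace_sym_power]
lemmas sym_power_sum = cp.subspace_sum[OF subspace_sym_power]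

lemma pw_in_sym_power: "f \<in> parity_space e \<Longrightarrow> pw n f \<in> sym_power n e"
  unfolding sym_power_def by (intro cp.span_base) blast

lemma sym_power_induct [consumes 1, case_names zero step]:
  assumes "p \<in> sym_power n e" "P 0"
    and "\<And>c f q. f \<in> parity_space e \<Longrightarrow> q \<in> sym_power n e \<Longrightarrow> P q \<Longrightarrow> P (Const c * pw n f + q)"
  shows "P p"
  using assms(1) unfolding sym_power_def
  by (induction rule: cpoly_span_induct) (auto intro: assms(2) assms(3)[unfolded sym_power_def])

lemma sym_power_cancel:
  assumes "c \<noteq> 0" "Const c * p \<in> sym_power n e" shows "p \<in> sym_power n e"
  using sym_power_scale[OF assms(2), of "1 / c"] Const_mult_cancel[OF assms(1), of p] by simp

lemma symt_upd:
  assumes "p < n"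
  shows "symt n (a(p := u)) = (\<Sum>\<sigma> | \<sigma> permutes {..<n}. tens n ((a \<circ> \<sigma>)(inv \<sigma> p := u)))"
  unfolding symt_def
proof (intro sum.cong refl arg_cong[of _ _ "tens n"])
  fix \<sigma> assume "\<sigma> \<in> {\<sigma>. \<sigma> permutes {..<n}}"
  then have "\<sigma> permutes {..<n}" by simp
  then have "\<sigma> i = p \<longleftrightarrow> i = inv \<sigma> p" for i
    using permutes_inverses[of \<sigma> "{..<n}"] by auto
  then show "a(p := u) \<circ> \<sigma> = (a \<circ> \<sigma>)(inv \<sigma> p := u)"
    by (simp add: fun_eq_iff)
qed

lemma inv_perm_less: "\<sigma> permutes {..<n} \<Longrightarrow> p < n \<Longrightarrow> inv \<sigma> p < n"
  using permutes_in_image[OF permutes_inv, of \<sigma> "{..<n}" p] by simp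

lemma symt_transpose:
  assumes "\<pi> permutes {..<n}" shows "symt n (a \<circ> \<pi>) = symt n a"
  using setum_permutations_compose_left[OF assms, of "\<lambda>\<sigma>. tens n (a \<circ> \<sigma>)"]
  by (simp add: symt_def o_assoc)

text \<open>Makes the slice argument, which concerns multilinear forms, available for linear
  functionals on symmetric tensors.\<close>

lemma symt_sml:
  assumes "lin_on W l" "cp.subspace W" "cp.subspace V" "\<And>a. (\<And>i. a i \<in> V) \<Longrightarrow> symt n a \<in> W"
  shows "sym_multilinear n V (\<lambda>a. l (symt n a))"
  unfolding sym_multilinear_def
proof (intro conjI allI impI)
  fix a :: "nat \<Rightarrow> opoly" and p u v assume a: "\<forall>i. a i \<in> V" and p: "p < n" and u: "u \<in> V"
  have in_W: "symt n (a(p := z)) \<in> W" if "z \<in> V" for z using that a by (intro assms(4)) auto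
  {
    assume v: "v \<in> V"
    have "symt n (a(p := u + v)) = symt n (a(p := u)) + symt n (a(p := v))"
      unfolding symt_upd[OF p] using p by (simp add: tens_upd_add inv_perm_less sum.distrib)
    then show "l (symt n (a(p := u + v))) = l (symt n (a(p := u))) + l (symt n (a(p := v)))"
      using in_W u v lin_onD(1)[OF assms(1)] by simp
  }
  have "symt n (a(p := Const c * u)) = Const c * symt n (a(p := u))" for c
    unfolding symt_upd[OF p] using p by (simp add: tens_upd_scale inv_perm_less sum_distrib_left)
  then show "l (symt n (a(p := Const c * u))) = c * l (symt n (a(p := u)))" for c
    using in_W u lin_onD(2)[OF assms(1)] by simp
next
  fix a :: "nat \<Rightarrow> opoly" and p q assume "p < n" "q < n"
  then have "Transposition.transpose p q permutes {..<n}" by (intro permutes_swap_id) auto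
  then show "l (symt n (a \<circ> Transposition.transpose p q)) = l (symt n a)" by (simp add: symt_transpose)
next
  fix a b :: "nat \<Rightarrow> opoly" assume ab: "\<forall>i<n. b i = a i"
  have "tens n (b \<circ> \<sigma>) = tens n (a \<circ> \<sigma>)" if "\<sigma> permutes {..<n}" for \<sigma>
    using ab permutes_in_image[OF that] by (intro tens_cong) auto
  then show "l (symt n b) = l (symt n a)" by (simp add: symt_def)
qed

text \<open>Polarization in dual form: a functional that kills all pure powers kills all symmetrized
  tensors. It is the degenerate slice e = 0, N the whole space, without operators.\<close>

lemma symt_in_sym_power:
  assumes "\<And>i. a i \<in> parity_space e"
  shows "symt n a \<in> sym_power n e"
proof (rule ccontr)
  assume "symt n a \<notin> sym_power n e"
  then obtain l where l: "lin_on UNIV l" "\<And>b. b \<in> pw n ` parity_space e \<Longrightarrow> l b = 0" "l (symt n a) = 1"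
    unfolding sym_power_def using not_in_span_functional by blast
  define S0 where "S0 = (\<lambda>a. l (symt n a))"
  have "S0 a = 0"
  proof (rule sml_slice[where \<S> = "{S0}" and V = "parity_space e" and N = "parity_space e"
        and e = 0 and ops = "{}" and n = n])
    show "sym_multilinear n (parity_space e) S" if "S \<in> {S0}" for S
      using that symt_sml[OF l(1) _ subspace_parity_space] by (simp add: S0_def)
    show "S (\<lambda>_. 0 + \<nu>) = 0" if "S \<in> {S0}" "\<nu> \<in> parity_space e" for S \<nu>
      using that l(2) lin_onD(2)[OF l(1)] by (simp add: symt_const S0_def)
  qed (use assms in auto)
  with l(3) show False by (simp add: S0_def)
qed

text \<open>The derivative of the n-th tensor power at f in the direction u.\<close>

definition dpw :: "nat \<Rightarrow> opoly \<Rightarrow> opoly \<Rightarrow> opoly" where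
  "dpw n f u = (\<Sum>j<n. tens n ((\<lambda>_. f)(j := u)))"

lemma symt_dpw: "(\<Sum>j<n. symt n ((\<lambda>_. f)(j := u))) = Const (fact n) * dpw n f u"
  using symt_sum_upd[of n "\<lambda>_. f" "\<lambda>_. u"]
  by (simp add: dpw_def o_def card_permutations Const_of_nat[symmetric])

lemma dpw_in_sym_power:
  assumes "f \<in> parity_space e" "u \<in> parity_space e"
  shows "dpw n f u \<in> sym_power n e"
proof (rule sym_power_cancel[of "fact n"])
  show "Const (fact n) * dpw n f u \<in> sym_power n e"
    unfolding symt_dpw[symmetric] using assms by (intro sym_power_sum symt_in_sym_power) auto
qed simp

lemma dpw_add: "dpw n f (u + v) = dpw n f u + dpw n f v"
  by (simp add: dpw_def tens_upd_add sum.distrib)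
lemma dpw_scale: "dpw n f (Const c * u) = Const c * dpw n f u"
  by (simp add: dpw_def tens_upd_scale sum_distrib_left)

lemma poisson_pw_pw:
  assumes "indets f \<subseteq> plane" "indets g \<subseteq> plane"
  shows "poisson n (pw n f) (pw n g) = dpw n (f * g) (br f g)"
  using poisson_tens[of "\<lambda>_. f" "\<lambda>_. g" n] assms by (simp add: dpw_def)

lemma poisson_psum_pw:
  assumes "indets h \<subseteq> plane" "indets f \<subseteq> plane"
  shows "poisson n (psum n h) (pw n f) = dpw n f (br h f)"
  using poisson_psum_tens[of "\<lambda>_. f" h n] assms by (simp add: dpw_def)

lemma poisson_sym_power:
  assumes "p \<in> sym_power n e" "q \<in> sym_power n e'"
  shows "poisson n p q \<in> sym_power n (e = e')"
proof -
  have 1: "poisson n (pw n f) q \<in> sym_power n (e = e')" if f: "f \<in> parity_space e" for f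
    using assms(2)
  proof (induction rule: sym_power_induct)
    case (step c g r)
    then have "poisson n (pw n f) (pw n g) \<in> sym_power n (e = e')"
      using f by (simp add: poisson_pw_pw parity_space_indets dpw_in_sym_power parity_space_mult br_parity_space)
    with step show ?case
      by (auto simp: poisson_add_right poisson_scale_right intro!: sym_power_add sym_power_scale)
  qed simp
  show ?thesis using assms(1)
    by (induction rule: sym_power_induct)
      (auto simp: poisson_add_left poisson_scale_left intro!: sym_power_add sym_power_scale 1)
qed

lemma psum_in_sym_power:
  assumes "h \<in> parity_space True"
  shows "psum n h \<in> sym_power n True"
proof (rule sym_power_cancel[of "fact n"])
  have "Const (fact n) * psum n h = psum n h * symt n (\<lambda>_. 1)"
    by (simp add: symt_const tens_def mult.commute)
  also have "\<dots> \<in> sym_power n True"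
    unfolding psum_mult_symt using assms by (intro sym_power_sum symt_in_sym_power) auto
  finally show "Const (fact n) * psum n h \<in> sym_power n True" .
qed simp

lemma psum_mult_sym_power:
  assumes "h \<in> parity_space True" "q \<in> sym_power n e"
  shows "psum n h * q \<in> sym_power n e"
  using assms(2)
proof (induction rule: sym_power_induct)
  case (step c f q)
  have "psum n h * pw n f = dpw n f (h * f)"
    by (simp add: psum_mult_tens dpw_def)
  then have "psum n h * pw n f \<in> sym_power n e"
    using step assms(1) by (simp add: dpw_in_sym_power parity_space_mult_even)
  moreover have "psum n h * (Const c * pw n f + q) = Const c * (psum n h * pw n f) + psum n h * q"
    by (simp add: algebra_simps)
  ultimately show ?case using step by (auto intro!: sym_power_add sym_power_scale)
qed simp

section \<open>Invariants as symmetric powers\<close>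

definition parity_sign :: "bool \<Rightarrow> complex" where "parity_sign e = (if e then 1 else - 1)"

lemma act_hom [simp]:
  "act g (p + q) = act g p + act g q" "act g (p * q) = act g p * act g q" "act g (Const c) = Const c"
  "act g 0 = 0" "act g 1 = 1" "act g (p ^ k) = act g p ^ k" "act g (- p) = - act g p"
  "act g (\<Sum>i\<in>I. F i) = (\<Sum>i\<in>I. act g (F i))"
  "act g (\<Prod>i\<in>I. F i) = (\<Prod>i\<in>I. act g (F i))"
  by (simp_all add: act_def)

lemma act_Var:
  "act g (Var (X i)) = (if i \<in> snd g then - Var (X (fst g i)) else Var (X (fst g i)))"
  "act g (Var (Y i)) = (if i \<in> snd g then - Var (Y (fst g i)) else Var (Y (fst g i)))"
  by (simp_all add: act_def)

lemma act_shift: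
  assumes "a \<in> parity_space e"
  shows "act (\<sigma>, E) (shift j a) = Const (if j \<in> E then parity_sign e else 1) * shift (\<sigma> j) a"
  using assms
proof (induction rule: parity_space_induct)
  case (step c a b q)
  have neg: "(- Var (X k)) ^ a * (- Var (Y k)) ^ b = Const (parity_sign e) * (Var (X k) ^ a * Var (Y k) ^ b)" for k
  proof -
    have "(- Var (X k)) ^ a * (- Var (Y k)) ^ b = (- 1) ^ (a + b) * (Var (X k) ^ a * Var (Y k) ^ b)"
      by (subst (1 2) power_minus) (simp add: power_add mult_ac)
    moreover have "(- 1 :: opoly) ^ (a + b) = Const (parity_sign e)"
      using step(1) by (cases e) (auto simp: parity_sign_def Const_uminus)
    ultimately show ?thesis by (simp only:)
  qed
  have "act (\<sigma>, E) (shift j (xymon a b)) = Const (if j \<in> E then parity_sign e else 1) * shift (\<sigma> j) (xymon a b)"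
    using neg[of "\<sigma> j"] by (auto simp: xymon_def act_Var)
  with step show ?case by (simp add: algebra_simps)
qed simp

lemma act_tens:
  assumes "\<And>j. a j \<in> parity_space (e j)" "\<sigma> permutes {..<n}"
  shows "act (\<sigma>, E) (tens n a) = Const (\<Prod>j<n. if j \<in> E then parity_sign (e j) else 1) * tens n (a \<circ> inv \<sigma>)"
proof -
  have "act (\<sigma>, E) (tens n a) = (\<Prod>j<n. Const (if j \<in> E then parity_sign (e j) else 1) * shift (\<sigma> j) (a j))"
    unfolding tens_def by (simp add: act_shift[OF assms(1)])
  also have "\<dots> = (\<Prod>j<n. Const (if j \<in> E then parity_sign (e j) else 1)) * (\<Prod>j<n. shift (\<sigma> j) (a j))"
    by (simp add: prod.distrib)
  also have "(\<Prod>j<n. Const (f j)) = Const (\<Prod>j<n. f j)" for f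
    by (induction n) (auto simp: Const_mult)
  also have "(\<Prod>j<n. shift (\<sigma> j) (a j)) = (\<Prod>j<n. shift j ((a \<circ> inv \<sigma>) j))"
    using prod.permute[OF assms(2), of "\<lambda>j. shift j ((a \<circ> inv \<sigma>) j)"] permutes_inverses[OF assms(2)]
    by (simp add: o_def)
  finally show ?thesis by (simp add: tens_def)
qed

lemma act_pw:
  assumes "f \<in> parity_space e" "\<sigma> permutes {..<n}" "E \<subseteq> {..<n}"
  shows "act (\<sigma>, E) (pw n f) = Const (parity_sign e ^ card E) * pw n f"
proof -
  have "(\<Prod>j<n. if j \<in> E then parity_sign e else 1) = parity_sign e ^ card E"
    using assms(3) by (simp add: prod.If_cases Int_absorb1)
  then show ?thesis using act_tens[of "\<lambda>_. f" "\<lambda>_. e", OF _ assms(2), of E] assms(1)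
    by (simp add: o_def)
qed

lemma indets_tens:
  assumes "\<And>i. indets (a i) \<subseteq> plane"
  shows "tens n a \<in> polys n"
  using indets_prod[of "\<lambda>i. shift i (a i)" "{..<n}"] indets_shift[OF assms]
  unfolding polys_def tens_def by fastforce

lemma polys_add: "p \<in> polys n \<Longrightarrow> q \<in> polys n \<Longrightarrow> p + q \<in> polys n"
  using indets_add[of p q] by (auto simp: polys_def)
lemma polys_scale: "p \<in> polys n \<Longrightarrow> Const c * p \<in> polys n"
  using indets_mult[of "Const c" p] by (auto simp: polys_def)

lemma sym_power_polys: "p \<in> sym_power n e \<Longrightarrow> p \<in> polys n"
proof (induction rule: sym_power_induct)
  case (step c f q)
  then show ?case
    using indets_tens[of "\<lambda>_. f" n] parity_space_indets[of f e] by (intro polys_add polys_scale) auto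
qed (simp add: polys_def)

lemma act_sym_power:
  assumes "p \<in> sym_power n e" "\<sigma> permutes {..<n}" "E \<subseteq> {..<n}"
  shows "act (\<sigma>, E) p = Const (parity_sign e ^ card E) * p"
  using assms(1)
  by (induction rule: sym_power_induct) (simp_all add: act_pw[OF _ assms(2,3)] algebra_simps)

abbreviation mon_tuple :: "(coord \<Rightarrow>\<^sub>0 nat) \<Rightarrow> nat \<Rightarrow> opoly" where
  "mon_tuple m \<equiv> \<lambda>i. xymon (Poly_Mapping.lookup m (X i)) (Poly_Mapping.lookup m (Y i))"

lemma mon_val_tens:
  assumes "Poly_Mapping.keys m \<subseteq> X ` {..<n} \<union> Y ` {..<n}"
  shows "mon_val Var m = tens n (mon_tuple m)"
proof -
  have "mon_val Var m = (\<Prod>v\<in>X ` {..<n} \<union> Y ` {..<n}. Var v ^ Poly_Mapping.lookup m v)"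
    by (rule mon_val_superset) (use assms in auto)
  also have "\<dots> = (\<Prod>v\<in>X ` {..<n}. Var v ^ Poly_Mapping.lookup m v) * (\<Prod>v\<in>Y ` {..<n}. Var v ^ Poly_Mapping.lookup m v)"
    by (rule prod.union_disjoint) auto
  also have "\<dots> = (\<Prod>i<n. Var (X i) ^ Poly_Mapping.lookup m (X i)) * (\<Prod>i<n. Var (Y i) ^ Poly_Mapping.lookup m (Y i))"
    by (simp add: prod.reindex inj_on_def)
  also have "\<dots> = tens n (mon_tuple m)"
    by (simp add: tens_def xymon_def prod.distrib)
  finally show ?thesis .
qed

lemma polys_expand:
  assumes "p \<in> polys n"
  shows "p = (\<Sum>m\<in>Poly_Mapping.keys p. Const (Poly_Mapping.lookup p m) * tens n (mon_tuple m))"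
proof -
  have "mon_val Var m = tens n (mon_tuple m)" if "m \<in> Poly_Mapping.keys p" for m
    by (rule mon_val_tens) (use assms that in \<open>auto simp: polys_def indets_def\<close>)
  then show ?thesis by (subst cpoly_expand) (simp cong: sum.cong)
qed

lemma act_polys_expand:
  assumes "p \<in> polys n"
  shows "act g p = (\<Sum>m\<in>Poly_Mapping.keys p. Const (Poly_Mapping.lookup p m) * act g (tens n (mon_tuple m)))"
  using arg_cong[OF polys_expand[OF assms], of "act g"] by (simp only: act_hom)

lemma lookup_sum_mon_val:
  assumes "finite K" "k \<in> K"
  shows "Poly_Mapping.lookup (\<Sum>m\<in>K. Const (c m) * mon_val Var m) k = c k"
  using assms by (simp add: single_conv_mon_val[symmetric] lookup_sum lookup_single when_def sum.delta')

lemma xymon_tuple_parity: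
  "mon_tuple m j \<in> parity_space (even (Poly_Mapping.lookup m (X j) + Poly_Mapping.lookup m (Y j)))"
  by (rule xymon_in_parity_space) simp

text \<open>Sign changes act diagonally on monomials, so invariance forces eigenvalue 1 on every
  monomial that occurs.\<close>

lemma sign_invariant_parity:
  assumes "p \<in> polys n" "act (id, E) p = p" "m \<in> Poly_Mapping.keys p" "E \<subseteq> {..<n}"
  shows "(\<Prod>j\<in>E. parity_sign (even (Poly_Mapping.lookup m (X j) + Poly_Mapping.lookup m (Y j)))) = 1"
proof -
  let ?s = "\<lambda>m. \<Prod>j<n. if j \<in> E then parity_sign (even (Poly_Mapping.lookup m (X j) + Poly_Mapping.lookup m (Y j))) else 1"
  have mt: "mon_val Var m = tens n (mon_tuple m)" if "m \<in> Poly_Mapping.keys p" for m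
    by (rule mon_val_tens) (use assms that in \<open>auto simp: polys_def indets_def\<close>)
  have "act (id, E) (tens n (mon_tuple m)) = Const (?s m) * tens n (mon_tuple m)" for m
    using act_tens[of "mon_tuple m", OF xymon_tuple_parity permutes_id, where n = n and E = E] by simp
  then have "act (id, E) p = (\<Sum>m\<in>Poly_Mapping.keys p. Const (Poly_Mapping.lookup p m * ?s m) * tens n (mon_tuple m))"
    by (simp only: act_polys_expand[OF assms(1)] Const_mult mult.assoc)
  also have "\<dots> = (\<Sum>m\<in>Poly_Mapping.keys p. Const (Poly_Mapping.lookup p m * ?s m) * mon_val Var m)"
    by (rule sum.cong) (simp_all add: mt)
  finally have "Poly_Mapping.lookup p m = Poly_Mapping.lookup p m * ?s m"
    using assms(2) lookup_sum_mon_val[of "Poly_Mapping.keys p" m "\<lambda>m. Poly_Mapping.lookup p m * ?s m"] assms(3)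
    by simp
  then have "?s m = 1" using assms(3) by (simp add: in_keys_iff)
  moreover have "?s m = (\<Prod>j\<in>E. parity_sign (even (Poly_Mapping.lookup m (X j) + Poly_Mapping.lookup m (Y j))))"
    using assms(4) by (simp add: prod.If_cases Int_absorb1)
  ultimately show ?thesis by simp
qed

text \<open>Averaging over all permutations replaces each monomial by its symmetrization; the
  inverses disappear because they run through the same group.\<close>

lemma symmetric_expand:
  assumes "p \<in> polys n" "\<And>\<sigma>. \<sigma> permutes {..<n} \<Longrightarrow> act (\<sigma>, {}) p = p"
  shows "Const (fact n) * p = (\<Sum>m\<in>Poly_Mapping.keys p. Const (Poly_Mapping.lookup p m) * symt n (mon_tuple m))"
proof -
  have "Const (fact n) * p = (\<Sum>\<sigma> | \<sigma> permutes {..<n}. act (\<sigma>, {}) p)"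
    using assms(2) by (simp add: card_permutations Const_of_nat[symmetric])
  also have "\<dots> = (\<Sum>\<sigma> | \<sigma> permutes {..<n}. \<Sum>m\<in>Poly_Mapping.keys p.
      Const (Poly_Mapping.lookup p m) * tens n (mon_tuple m \<circ> inv \<sigma>))"
  proof (intro sum.cong refl)
    fix \<sigma> assume "\<sigma> \<in> {\<sigma>. \<sigma> permutes {..<n}}"
    then have "act (\<sigma>, {}) (tens n (mon_tuple m)) = tens n (mon_tuple m \<circ> inv \<sigma>)" for m
      using act_tens[of "mon_tuple m", OF xymon_tuple_parity, of \<sigma> n "{}"] by simp
    then show "act (\<sigma>, {}) p = (\<Sum>m\<in>Poly_Mapping.keys p.
      Const (Poly_Mapping.lookup p m) * tens n (mon_tuple m \<circ> inv \<sigma>))"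
      by (simp only: act_polys_expand[OF assms(1)])
  qed
  also have "\<dots> = (\<Sum>m\<in>Poly_Mapping.keys p. Const (Poly_Mapping.lookup p m) *
      (\<Sum>\<sigma> | \<sigma> permutes {..<n}. tens n (mon_tuple m \<circ> inv \<sigma>)))"
    unfolding sum_distrib_left by (rule sum.swap)
  also have "\<dots> = (\<Sum>m\<in>Poly_Mapping.keys p. Const (Poly_Mapping.lookup p m) * symt n (mon_tuple m))"
  proof (rule sum.cong)
    show "Const (Poly_Mapping.lookup p m) * (\<Sum>\<sigma> | \<sigma> permutes {..<n}. tens n (mon_tuple m \<circ> inv \<sigma>)) =
        Const (Poly_Mapping.lookup p m) * symt n (mon_tuple m)" for m
      using sum_permutations_inverse[of "\<lambda>\<sigma>. tens n (mon_tuple m \<circ> \<sigma>)" "{..<n}"]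
      by (simp add: symt_def)
  qed simp
  finally show ?thesis .
qed

text \<open>In type B a single sign may be changed, which forces even degree in each pair of
  variables separately.\<close>

lemma O_B_symt:
  assumes "p \<in> O_B n" "m \<in> Poly_Mapping.keys p"
  shows "symt n (mon_tuple m) \<in> sym_power n True"
proof -
  have p: "p \<in> polys n" and inv: "\<And>\<sigma> E. \<sigma> permutes {..<n} \<Longrightarrow> E \<subseteq> {..<n} \<Longrightarrow> act (\<sigma>, E) p = p"
    using assms(1) by (auto simp: invariants_def type_B_def)
  have ev: "even (Poly_Mapping.lookup m (X j) + Poly_Mapping.lookup m (Y j))" if "j < n" for j
    using sign_invariant_parity[OF p inv assms(2), of "{j}"] that
    by (auto simp: permutes_id parity_sign_def split: if_splits)
  \<comment> \<open>Entries with index at least n do not matter but have uncontrolled parity;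
    replacing them by 0 puts the whole list into the even space.\<close>
  have "symt n (mon_tuple m) = symt n (\<lambda>i. if i < n then mon_tuple m i else 0)"
    unfolding symt_def
  proof (intro sum.cong refl tens_cong)
    fix \<sigma> i assume "\<sigma> \<in> {\<sigma>. \<sigma> permutes {..<n}}" "i < n"
    then have "\<sigma> i < n" using permutes_in_image[of \<sigma> "{..<n}" i] by simp
    then show "(mon_tuple m \<circ> \<sigma>) i = ((\<lambda>i. if i < n then mon_tuple m i else 0) \<circ> \<sigma>) i" by simp
  qed
  also have "\<dots> \<in> sym_power n True"
  proof (rule symt_in_sym_power)
    show "(if i < n then mon_tuple m i else 0) \<in> parity_space True" for i
      using xymon_tuple_parity[of m i] ev[of i] by auto
  qed
  finally show ?thesis .
qed

lemma O_B_eq: "O_B n = sym_power n True"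
proof (intro equalityI subsetI)
  fix p assume "p \<in> sym_power n True"
  then show "p \<in> O_B n"
    by (auto simp: invariants_def type_B_def sym_power_polys act_sym_power parity_sign_def)
next
  fix p assume B: "p \<in> O_B n"
  then have p: "p \<in> polys n" and inv: "\<And>\<sigma> E. \<sigma> permutes {..<n} \<Longrightarrow> E \<subseteq> {..<n} \<Longrightarrow> act (\<sigma>, E) p = p"
    by (auto simp: invariants_def type_B_def)
  have "Const (fact n) * p \<in> sym_power n True"
    using inv[of _ "{}"] O_B_symt[OF B]
    by (subst symmetric_expand[OF p]) (auto intro!: sym_power_sum sym_power_scale)
  then show "p \<in> sym_power n True" by (rule sym_power_cancel[rotated]) simp
qed

text \<open>Type D contains the sign changes in two positions j and k, which force the degrees in
  the pairs j and k to have the same parity. So each monomial is even in all pairs or odd in all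
  pairs.\<close>

lemma O_D_split:
  assumes "p \<in> O_D n"
  obtains p1 p2 where "p1 \<in> sym_power n True" "p2 \<in> sym_power n False" "p = p1 + p2"
proof -
  have p: "p \<in> polys n" and inv: "\<And>\<sigma> E. \<sigma> permutes {..<n} \<Longrightarrow> E \<subseteq> {..<n} \<Longrightarrow> even (card E) \<Longrightarrow> act (\<sigma>, E) p = p"
    using assms by (auto simp: invariants_def type_B_def type_D_def)
  let ?e = "\<lambda>m. \<forall>j<n. even (Poly_Mapping.lookup m (X j) + Poly_Mapping.lookup m (Y j))"
  have mem: "symt n (mon_tuple m) \<in> sym_power n (?e m)" if m: "m \<in> Poly_Mapping.keys p" for m
  proof -
    have ev: "even (Poly_Mapping.lookup m (X j) + Poly_Mapping.lookup m (Y j)) =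
        even (Poly_Mapping.lookup m (X k) + Poly_Mapping.lookup m (Y k))" if "j < n" "k < n" "j \<noteq> k" for j k
      using sign_invariant_parity[OF p inv m, of "{j, k}"] that
      by (auto simp: permutes_id parity_sign_def split: if_splits)
    have "symt n (mon_tuple m) = symt n (\<lambda>i. if i < n then mon_tuple m i else 0)"
      unfolding symt_def
    proof (intro sum.cong refl tens_cong)
      fix \<sigma> i assume "\<sigma> \<in> {\<sigma>. \<sigma> permutes {..<n}}" "i < n"
      then have "\<sigma> i < n" using permutes_in_image[of \<sigma> "{..<n}" i] by simp
      then show "(mon_tuple m \<circ> \<sigma>) i = ((\<lambda>i. if i < n then mon_tuple m i else 0) \<circ> \<sigma>) i" by simp
    qed
    also have "\<dots> \<in> sym_power n (?e m)"
    proof (rule symt_in_sym_power)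
      fix i
      have "even (Poly_Mapping.lookup m (X i) + Poly_Mapping.lookup m (Y i)) = ?e m" if "i < n"
        using ev[OF that] that by blast
      then show "(if i < n then mon_tuple m i else 0) \<in> parity_space (?e m)"
        using xymon_tuple_parity[of m i] by auto
    qed
    finally show ?thesis .
  qed
  let ?q = "\<lambda>e. \<Sum>m | m \<in> Poly_Mapping.keys p \<and> ?e m = e. Const (Poly_Mapping.lookup p m) * symt n (mon_tuple m)"
  have q: "?q e \<in> sym_power n e" for e
    using mem by (intro sym_power_sum sym_power_scale) auto
  have "Const (fact n) * p = (\<Sum>m\<in>Poly_Mapping.keys p. Const (Poly_Mapping.lookup p m) * symt n (mon_tuple m))"
    using inv[of _ "{}"] by (intro symmetric_expand[OF p]) auto
  also have "\<dots> = ?q True + ?q False"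
    by (subst sum.union_disjoint[symmetric]) (auto intro!: sum.cong)
  finally have "p = Const (1 / fact n) * ?q True + Const (1 / fact n) * ?q False"
    using Const_mult_cancel[of "fact n" p] by (simp add: ring_distribs)
  with q that show ?thesis using sym_power_scale by blast
qed

lemma sym_power_O_D: "p \<in> sym_power n e \<Longrightarrow> p \<in> O_D n"
  by (auto simp: invariants_def type_B_def type_D_def sym_power_polys act_sym_power parity_sign_def)

lemma O_B_subset_O_D: "O_B n \<subseteq> O_D n"
  by (auto simp: O_B_eq sym_power_O_D)

lemma subspace_O_D: "cp.subspace (O_D n)"
  unfolding cp.subspace_def
proof (intro conjI ballI allI)
  show "0 \<in> O_D n" using sym_power_O_D[OF sym_power_zero] .
  fix p q c assume p: "p \<in> O_D n"
  obtain p1 p2 where P: "p1 \<in> sym_power n True" "p2 \<in> sym_power n False" "p = p1 + p2"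
    using O_D_split[OF p] .
  show "p + q \<in> O_D n" if q: "q \<in> O_D n" using p q by (auto simp: invariants_def polys_add)
  show "Const c * p \<in> O_D n" using p by (auto simp: invariants_def polys_scale)
qed

lemma dual_iff: "\<phi> \<in> dual A \<longleftrightarrow> lin_on A \<phi> \<and> (\<forall>p. p \<notin> A \<longrightarrow> \<phi> p = 0)"
  by (auto simp: dual_def lin_on_def)

section \<open>Invariant functionals\<close>

lemma sml_zero:
  assumes "sym_multilinear n V S" "\<And>i. a i \<in> V" "p < n"
  shows "S (a(p := 0)) = 0"
  using sml_scale[OF assms(1), where a = a and p = p and c = 0 and u = "a p", OF assms(2,3,2)] by simp

lemma sml_sum:
  assumes S: "sym_multilinear n V S" and V: "cp.subspace V" and a: "\<And>i. a i \<in> V" and p: "p < n"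
    and g: "\<And>j. j \<in> J \<Longrightarrow> g j \<in> V"
  shows "S (a(p := \<Sum>j\<in>J. Const (c j) * g j)) = (\<Sum>j\<in>J. c j * S (a(p := g j)))"
  using g
proof (induction J rule: infinite_finite_induct)
  case (insert x F)
  have m: "Const (c x) * g x \<in> V" "(\<Sum>j\<in>F. Const (c j) * g j) \<in> V"
    using insert.prems by (auto intro!: cp.subspace_scale[OF V] cp.subspace_sum[OF V])
  have "S (a(p := g x)) * c x = S (a(p := Const (c x) * g x))"
    using sml_scale[OF S, where a = a and p = p and c = "c x" and u = "g x", OF a p] insert.prems by simp
  then show ?case
    using insert sml_add[OF S, where a = a, OF a p m]
    by (simp add: mult.commute del: fun_upd_apply)
qed (simp_all add: sml_zero[OF S a p])

lemma poly_sum_upto: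
  fixes p :: "'a::comm_semiring_1 poly"
  assumes "degree p \<le> d" shows "poly p x = (\<Sum>i\<le>d. coeff p i * x ^ i)"
  unfolding poly_altdef
  by (rule sum.mono_neutral_left) (use assms in \<open>auto simp: coeff_eq_0\<close>)

text \<open>Along a polynomial curve the form is a polynomial in the time, with the Leibniz sum as
  linear coefficient. Slots are made variable one at a time, and the constant coefficient is carried
  along because it enters the linear coefficient at the next slot.\<close>

lemma sml_curve:
  assumes S: "sym_multilinear n V S" and V: "cp.subspace V"
    and c: "\<And>i k. coeff (c i) k \<in> V"
  shows "\<exists>U :: complex poly. (\<forall>t. poly U t = S (\<lambda>i. poly (c i) (Const t))) \<and>
    coeff U 1 = (\<Sum>k<n. S ((\<lambda>i. coeff (c i) 0)(k := coeff (c k) 1)))"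
proof -
  have pV: "poly (c i) (Const t) \<in> V" for i t
    unfolding poly_altdef
    by (intro cp.subspace_sum[OF V]) (simp add: Const_power[symmetric] mult.commute[of _ "Const _"] cp.subspace_scale[OF V] c)
  have "\<forall>a. (\<forall>i. a i \<in> V) \<longrightarrow> (\<exists>U.
      (\<forall>t. poly U t = S (\<lambda>i. if i < r then poly (c i) (Const t) else a i)) \<and>
      coeff U 0 = S (\<lambda>i. if i < r then coeff (c i) 0 else a i) \<and>
      coeff U 1 = (\<Sum>k<r. S ((\<lambda>i. if i < r then coeff (c i) 0 else a i)(k := coeff (c k) 1))))"
    if "r \<le> n" for r
    using that
  proof (induction r)
    case 0
    show ?case
    proof (intro allI impI exI[of _ "[:S _:]"])
      fix a :: "nat \<Rightarrow> _" show "(\<forall>t. poly [:S a:] t = S (\<lambda>i. if i < 0 then poly (c i) (Const t) else a i)) \<and>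
        coeff [:S a:] 0 = S (\<lambda>i. if i < 0 then coeff (c i) 0 else a i) \<and>
        coeff [:S a:] 1 = (\<Sum>k<0. S ((\<lambda>i. if i < 0 then coeff (c i) 0 else a i)(k := coeff (c k) 1)))"
        by simp
    qed
  next
    case (Suc r)
    show ?case
    proof (intro allI impI)
      fix a :: "nat \<Rightarrow> 'a cpoly" assume a: "\<forall>i. a i \<in> V"
      \<comment> \<open>One more than the degree, so that the indices 0 and 1 both occur in the sum
        over \<open>{..d}\<close> even if the curve is constant in this slot.\<close>
      define d where "d = Suc (degree (c r))"
      have "\<forall>j. \<exists>U. (\<forall>t. poly U t = S (\<lambda>i. if i < r then poly (c i) (Const t) else (a(r := coeff (c r) j)) i)) \<and>
        coeff U 0 = S (\<lambda>i. if i < r then coeff (c i) 0 else (a(r := coeff (c r) j)) i) \<and>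
        coeff U 1 = (\<Sum>k<r. S ((\<lambda>i. if i < r then coeff (c i) 0 else (a(r := coeff (c r) j)) i)(k := coeff (c k) 1)))"
      proof
        fix j
        have "r \<le> n" and m: "\<forall>i. (a(r := coeff (c r) j)) i \<in> V" using Suc.prems a c by auto
        show "\<exists>U. (\<forall>t. poly U t = S (\<lambda>i. if i < r then poly (c i) (Const t) else (a(r := coeff (c r) j)) i)) \<and>
        coeff U 0 = S (\<lambda>i. if i < r then coeff (c i) 0 else (a(r := coeff (c r) j)) i) \<and>
        coeff U 1 = (\<Sum>k<r. S ((\<lambda>i. if i < r then coeff (c i) 0 else (a(r := coeff (c r) j)) i)(k := coeff (c k) 1)))"
          by (rule Suc.IH[OF \<open>r \<le> n\<close>, THEN spec, THEN mp, OF m])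
      qed
      then obtain U where U: "\<And>j t. poly (U j) t = S (\<lambda>i. if i < r then poly (c i) (Const t) else (a(r := coeff (c r) j)) i)"
        "\<And>j. coeff (U j) 0 = S (\<lambda>i. if i < r then coeff (c i) 0 else (a(r := coeff (c r) j)) i)"
        "\<And>j. coeff (U j) 1 = (\<Sum>k<r. S ((\<lambda>i. if i < r then coeff (c i) 0 else (a(r := coeff (c r) j)) i)(k := coeff (c k) 1)))"
        by metis
      define W where "W = (\<Sum>j\<le>d. monom 1 j * U j)"
      have "poly W t = S (\<lambda>i. if i < Suc r then poly (c i) (Const t) else a i)" for t
      proof -
        define b where "b = (\<lambda>i. if i < r then poly (c i) (Const t) else a i)"
        have b: "b i \<in> V" for i using a pV by (auto simp: b_def)
        have upd: "b(r := z) = (\<lambda>i. if i < r then poly (c i) (Const t) else (a(r := z)) i)" for z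
          by (auto simp: b_def)
        have "poly (c r) (Const t) = (\<Sum>j\<le>d. Const (t ^ j) * coeff (c r) j)"
          by (subst poly_sum_upto[of _ d]) (simp_all add: d_def Const_power mult.commute)
        then have "S (b(r := poly (c r) (Const t))) = (\<Sum>j\<le>d. t ^ j * S (b(r := coeff (c r) j)))"
          using sml_sum[OF S V, where a = b and p = r and J = "{..d}" and c = "\<lambda>j. t ^ j" and g = "coeff (c r)"]
            b c Suc.prems by simp
        also have "\<dots> = poly W t" by (simp add: W_def poly_sum poly_monom U(1) upd)
        also have "b(r := poly (c r) (Const t)) = (\<lambda>i. if i < Suc r then poly (c i) (Const t) else a i)"
          by (auto simp: b_def fun_eq_iff less_Suc_eq)
        finally show ?thesis by simp
      qed
      moreover have "coeff W 0 = S (\<lambda>i. if i < Suc r then coeff (c i) 0 else a i)"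
      proof -
        have "coeff W 0 = (\<Sum>j\<le>d. if j = 0 then coeff (U 0) 0 else 0)"
          unfolding W_def coeff_sum by (intro sum.cong) (auto simp: coeff_monom_mult)
        also have "\<dots> = coeff (U 0) 0" by simp
        also have "\<dots> = S (\<lambda>i. if i < Suc r then coeff (c i) 0 else a i)"
          unfolding U(2) by (intro arg_cong[of _ _ S]) (auto simp: less_Suc_eq)
        finally show ?thesis .
      qed
      moreover have "coeff W 1 = (\<Sum>k<Suc r. S ((\<lambda>i. if i < Suc r then coeff (c i) 0 else a i)(k := coeff (c k) 1)))"
      proof -
        have "coeff W 1 = (\<Sum>j\<le>d. (if j = 0 then coeff (U 0) 1 else 0) + (if j = 1 then coeff (U 1) 0 else 0))"
          unfolding W_def coeff_sum
        proof (intro sum.cong refl)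
          fix j show "coeff (monom 1 j * U j) 1 = (if j = 0 then coeff (U 0) 1 else 0) + (if j = 1 then coeff (U 1) 0 else 0)"
            by (cases "j = 0"; cases "j = 1") (auto simp: coeff_monom_mult)
        qed
        also have "\<dots> = coeff (U 0) 1 + coeff (U 1) 0"
          by (simp add: sum.distrib d_def)
        also have "coeff (U 0) 1 = (\<Sum>k<r. S ((\<lambda>i. if i < Suc r then coeff (c i) 0 else a i)(k := coeff (c k) 1)))"
          unfolding U(3) by (intro sum.cong arg_cong[of _ _ S] refl) (auto simp: less_Suc_eq fun_eq_iff)
        also have "coeff (U 1) 0 = S ((\<lambda>i. if i < Suc r then coeff (c i) 0 else a i)(r := coeff (c r) 1))"
          unfolding U(2) by (intro arg_cong[of _ _ S]) (auto simp: less_Suc_eq fun_eq_iff)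
        finally show ?thesis by (simp del: fun_upd_apply)
      qed
      ultimately show "\<exists>U. (\<forall>t. poly U t = S (\<lambda>i. if i < Suc r then poly (c i) (Const t) else a i)) \<and>
        coeff U 0 = S (\<lambda>i. if i < Suc r then coeff (c i) 0 else a i) \<and>
        coeff U 1 = (\<Sum>k<Suc r. S ((\<lambda>i. if i < Suc r then coeff (c i) 0 else a i)(k := coeff (c k) 1)))"
        by blast
    qed
  qed
  note main = this
  have m: "\<forall>i. (\<lambda>i. coeff (c i) 0) i \<in> V" using c by simp
  obtain U where U: "\<forall>t. poly U t = S (\<lambda>i. if i < n then poly (c i) (Const t) else coeff (c i) 0)"
    "coeff U 1 = (\<Sum>k<n. S ((\<lambda>i. if i < n then coeff (c i) 0 else coeff (c i) 0)(k := coeff (c k) 1)))"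
    using main[OF order_refl, THEN spec, THEN mp, OF m] by (elim exE conjE)
  have "S (\<lambda>i. if i < n then poly (c i) (Const t) else coeff (c i) 0) = S (\<lambda>i. poly (c i) (Const t))" for t
    by (rule sml_cong[OF S]) (use pV in auto)
  with U(1) have "poly U t = S (\<lambda>i. poly (c i) (Const t))" for t by simp
  moreover have "coeff U 1 = (\<Sum>k<n. S ((\<lambda>i. coeff (c i) 0)(k := coeff (c k) 1)))"
    using U(2) by (simp only: if_cancel)
  ultimately show ?thesis by blast
qed

lemma sym_power_mult_even:
  assumes "p \<in> sym_power n True" "q \<in> sym_power n e"
  shows "p * q \<in> sym_power n e"
proof -
  have 1: "pw n f * q \<in> sym_power n e" if f: "f \<in> parity_space True" for f
    using assms(2)
  proof (induction rule: sym_power_induct)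
    case (step c g r)
    have "pw n f * (Const c * pw n g + r) = Const c * pw n (f * g) + pw n f * r"
      by (simp add: tens_mult[symmetric] algebra_simps)
    with step f show ?case
      by (auto intro!: sym_power_add sym_power_scale pw_in_sym_power parity_space_mult_even)
  qed simp
  show ?thesis using assms(1)
    by (induction rule: sym_power_induct)
      (auto simp: ring_distribs mult.assoc intro!: sym_power_add sym_power_scale 1)
qed

section \<open>Brackets of symmetric powers and the dual of HP_0 in type B\<close>

lemma bracket_vanish:
  assumes "lin_on (sym_power n (e = e')) \<phi>"
    and "\<And>f g. f \<in> parity_space e \<Longrightarrow> g \<in> parity_space e' \<Longrightarrow> \<phi> (poisson n (pw n f) (pw n g)) = 0"
    and p: "p \<in> sym_power n e" and q: "q \<in> sym_power n e'"
  shows "\<phi> (poisson n p q) = 0"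
proof -
  note mem = poisson_sym_power[where e = e and e' = e' and n = n]
  note z = lin_on_zero[OF assms(1) subspace_sym_power]
  have 1: "\<phi> (poisson n (pw n f) q) = 0" if f: "f \<in> parity_space e" for f
    using q
  proof (induction rule: sym_power_induct)
    case (step c g r)
    then show ?case
      using f by (simp add: poisson_add_right poisson_scale_right lin_onD[OF assms(1)] mem pw_in_sym_power
          sym_power_scale assms(2))
  qed (simp add: z)
  show ?thesis using p
  proof (induction rule: sym_power_induct)
    case (step c g r)
    then show ?case
      using q by (simp add: poisson_add_left poisson_scale_left lin_onD[OF assms(1)] mem pw_in_sym_power
          sym_power_scale 1)
  qed (simp add: z)
qed

lemma bracket_space_single: "p \<in> A \<Longrightarrow> q \<in> A \<Longrightarrow> poisson n p q \<in> bracket_space n A"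
  unfolding bracket_space_def by (rule CollectI, rule exI[of _ "Suc 0"], rule exI[of _ "\<lambda>_. p"], rule exI[of _ "\<lambda>_. q"]) simp

lemma lin_on_bracket_space:
  assumes "lin_on A \<phi>" "cp.subspace A" "\<And>p q. p \<in> A \<Longrightarrow> q \<in> A \<Longrightarrow> poisson n p q \<in> A"
    "\<And>p q. p \<in> A \<Longrightarrow> q \<in> A \<Longrightarrow> \<phi> (poisson n p q) = 0" "p \<in> bracket_space n A"
  shows "\<phi> p = 0"
proof -
  from assms(5) obtain N :: nat and f g where fg: "\<forall>j<N. f j \<in> A \<and> g j \<in> A" "p = (\<Sum>j<N. poisson n (f j) (g j))"
    by (auto simp: bracket_space_def)
  have "\<phi> p = (\<Sum>j<N. \<phi> (poisson n (f j) (g j)))"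
    unfolding fg(2) by (rule lin_on_sum[OF assms(1,2)]) (use fg(1) assms(3) in auto)
  then show ?thesis using fg(1) assms(4) by simp
qed

lemma HP0_B_D:
  assumes "\<phi> \<in> HP0_dual n (O_B n)"
  shows "lin_on (sym_power n True) \<phi>"
    "p \<in> sym_power n True \<Longrightarrow> q \<in> sym_power n True \<Longrightarrow> \<phi> (poisson n p q) = 0"
    "p \<notin> sym_power n True \<Longrightarrow> \<phi> p = 0"
  using assms bracket_space_single[of p "O_B n" q n] by (auto simp: HP0_dual_def dual_iff O_B_eq)

lemma HP0_B_I:
  assumes "lin_on (sym_power n True) \<phi>" "\<And>p. p \<notin> sym_power n True \<Longrightarrow> \<phi> p = 0"
    and "\<And>f g. f \<in> parity_space True \<Longrightarrow> g \<in> parity_space True \<Longrightarrow> \<phi> (poisson n (pw n f) (pw n g)) = 0"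
  shows "\<phi> \<in> HP0_dual n (O_B n)"
proof -
  have "\<phi> p = 0" if "p \<in> bracket_space n (O_B n)" for p
  proof (rule lin_on_bracket_space[OF _ _ _ _ that])
    show "\<phi> (poisson n p q) = 0" if "p \<in> O_B n" "q \<in> O_B n" for p q
      using bracket_vanish[of n True True \<phi>] assms that by (simp add: O_B_eq)
    show "poisson n p q \<in> O_B n" if "p \<in> O_B n" "q \<in> O_B n" for p q
      using poisson_sym_power[of p n True q True] that by (simp add: O_B_eq)
  qed (use assms(1) in \<open>simp_all add: O_B_eq\<close>)
  then show ?thesis using assms by (auto simp: HP0_dual_def dual_iff O_B_eq)
qed

lemma lin_on_poisson:
  assumes "lin_on W \<phi>" "\<And>p. p \<in> V \<Longrightarrow> poisson n p q \<in> W"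
  shows "lin_on V (\<lambda>p. \<phi> (poisson n p q))"
  using assms unfolding lin_on_def by (simp add: poisson_add_left poisson_scale_left)

lemma lin_on_poisson':
  assumes "lin_on W \<phi>" "\<And>p. p \<in> V \<Longrightarrow> poisson n q p \<in> W"
  shows "lin_on V (\<lambda>p. \<phi> (poisson n q p))"
  using assms unfolding lin_on_def by (simp add: poisson_add_right poisson_scale_right)

text \<open>The power sums generate the invariants; the slice argument at \<open>e = 1\<close> with the multiplication
  operators replaces the usual induction.\<close>

lemma HP0_B_of_psum:
  assumes lin: "lin_on (sym_power n True) \<phi>" and out: "\<And>p. p \<notin> sym_power n True \<Longrightarrow> \<phi> p = 0"
    and inv: "\<And>h q. h \<in> parity_space True \<Longrightarrow> q \<in> sym_power n True \<Longrightarrow> \<phi> (poisson n (psum n h) q) = 0"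
  shows "\<phi> \<in> HP0_dual n (O_B n)"
proof (rule HP0_B_I[OF lin out])
  fix f g assume f: "f \<in> parity_space True" and g: "g \<in> parity_space True"
  \<comment> \<open>The second argument q of the bracket stays free: multiplying it by
    \<open>psum n l\<close> moves from one form of the family to another, which is the closure that
    the slice argument asks for.\<close>
  let ?S = "\<lambda>q a. \<phi> (poisson n (symt n a) q)"
  have mem: "p \<in> sym_power n True \<Longrightarrow> q \<in> sym_power n True \<Longrightarrow> poisson n p q \<in> sym_power n True" for p q
    using poisson_sym_power[of p n True q True] by simp
  have "?S (pw n g) (\<lambda>_. f) = 0"
  proof (rule sml_slice[where \<S> = "?S ` sym_power n True" and V = "parity_space True" and N = "{0}"
        and e = 1 and ops = "(*) ` parity_space True" and n = n and S = "?S (pw n g)"])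
    show "sym_multilinear n (parity_space True) S" if "S \<in> ?S ` sym_power n True" for S
    proof -
      from that obtain q where q: "q \<in> sym_power n True" "S = ?S q" by blast
      show ?thesis unfolding q(2)
        by (rule symt_sml[OF lin_on_poisson[OF lin mem[OF _ q(1)]] subspace_sym_power subspace_parity_space symt_in_sym_power])
    qed
    show "\<exists>S'\<in>?S ` sym_power n True. \<forall>a. (\<forall>i. a i \<in> parity_space True) \<longrightarrow> S' a = (\<Sum>j<n. S (a(j := X (a j))))"
      if X: "X \<in> (*) ` parity_space True" and S: "S \<in> ?S ` sym_power n True" for X S
    proof -
      obtain l where l: "l \<in> parity_space True" "X = (*) l" using X by blast
      obtain q where q: "q \<in> sym_power n True" "S = ?S q" using S by blast
      let ?l = "psum n l"
      have "?S (?l * q) a = (\<Sum>j<n. S (a(j := X (a j))))" if a: "\<forall>i. a i \<in> parity_space True" for a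
      proof -
        have sa: "symt n a \<in> sym_power n True" using a symt_in_sym_power by blast
        have "(\<Sum>j<n. S (a(j := X (a j)))) = (\<Sum>j<n. \<phi> (poisson n (symt n (a(j := l * a j))) q))"
          by (simp add: q l)
        also have "\<dots> = \<phi> (\<Sum>j<n. poisson n (symt n (a(j := l * a j))) q)"
          by (rule lin_on_sum[OF lin subspace_sym_power, symmetric])
            (use a l q in \<open>auto intro!: mem symt_in_sym_power parity_space_mult_even\<close>)
        also have "(\<Sum>j<n. poisson n (symt n (a(j := l * a j))) q) = poisson n (?l * symt n a) q"
          by (simp add: psum_mult_symt poisson_sum_left)
        \<comment> \<open>The identity {l a, q} = {a, l q} + {l, a q}; its last term is killed by
          the hypothesis on power sums.\<close>
        also have "\<dots> = poisson n (symt n a) (?l * q) + poisson n ?l (symt n a * q)"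
          using poisson_commute[of n ?l "symt n a"]
          by (simp add: poisson_mult_left poisson_mult_right algebra_simps)
        also have "\<phi> \<dots> = \<phi> (poisson n (symt n a) (?l * q)) + \<phi> (poisson n ?l (symt n a * q))"
          by (rule lin_onD[OF lin])
            (use l q sa in \<open>auto intro!: mem psum_mult_sym_power psum_in_sym_power sym_power_mult_even\<close>)
        also have "\<phi> (poisson n ?l (symt n a * q)) = 0"
          using inv l q sa sym_power_mult_even by blast
        finally show ?thesis by (simp del: fun_upd_apply)
      qed
      then have "\<forall>a. (\<forall>i. a i \<in> parity_space True) \<longrightarrow> ?S (?l * q) a = (\<Sum>j<n. S (a(j := X (a j))))"
        by (intro allI impI)
      moreover have "?S (?l * q) \<in> ?S ` sym_power n True"
        by (rule imageI) (rule psum_mult_sym_power[OF l(1) q(1)])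
      ultimately show ?thesis by (rule bexI)
    qed
    show "S (\<lambda>_. 1 + \<nu>) = 0" if S: "S \<in> ?S ` sym_power n True" and "\<nu> \<in> {0}" for S \<nu>
      using that lin_on_zero[OF lin] by (auto simp: symt_const tens_def)
    show "v \<in> {0} \<or> (\<exists>X\<in>(*) ` parity_space True. \<exists>\<nu>\<in>{0}. v = X 1 + \<nu>)" if "v \<in> parity_space True" for v
      using that by auto
    show "?S (pw n g) \<in> ?S ` sym_power n True" using g pw_in_sym_power by blast
  qed (use f in \<open>auto simp: parity_space_mult_even cp.subspace_single_0\<close>)
  then show "\<phi> (poisson n (pw n f) (pw n g)) = 0"
    using lin_onD(2)[OF lin mem, of "pw n f" "pw n g" "fact n"] f g
    by (simp add: symt_const poisson_scale_left pw_in_sym_power)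
qed

section \<open>Slices for the diagonal action of even Hamiltonians\<close>

lemma psum_symt_sum:
  assumes lin: "lin_on (sym_power n e) \<phi>" and h: "h \<in> parity_space True" and a: "\<And>i. a i \<in> parity_space e"
  shows "(\<Sum>j<n. \<phi> (symt n (a(j := br h (a j))))) = \<phi> (poisson n (psum n h) (symt n a))"
proof -
  have "poisson n (psum n h) (symt n a) = (\<Sum>j<n. symt n (a(j := br h (a j))))"
    using parity_space_indets h a by (intro poisson_psum_symt) blast+
  then show ?thesis
    using lin_on_sum[OF lin subspace_sym_power, of "{..<n}" "\<lambda>j. symt n (a(j := br h (a j)))"] h a
    by (simp add: symt_in_sym_power br_even)
qed

lemma psum_sym_power: "h \<in> parity_space True \<Longrightarrow> p \<in> sym_power n e \<Longrightarrow> poisson n (psum n h) p \<in> sym_power n e"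
  using poisson_sym_power[of "psum n h" n True p e] psum_in_sym_power by simp

text \<open>The slice argument for linear functionals, with even Hamiltonians as operators. The
  assumption \<open>decomp\<close> says that the directions {h, u} and N together give all functions
  of the chosen parity.\<close>

lemma psum_slice:
  assumes lin: "\<And>\<phi>. \<phi> \<in> \<F> \<Longrightarrow> lin_on (sym_power n e) \<phi>"
    and closed: "\<And>\<phi> h. \<phi> \<in> \<F> \<Longrightarrow> h \<in> parity_space True \<Longrightarrow>
      \<exists>\<phi>'\<in>\<F>. \<forall>p\<in>sym_power n e. \<phi>' p = \<phi> (poisson n (psum n h) p)"
    and N: "cp.subspace N" "N \<subseteq> parity_space e" and u: "u \<in> parity_space e"
    and decomp: "\<And>v. v \<in> parity_space e \<Longrightarrow> \<exists>h\<in>parity_space True. \<exists>\<nu>\<in>N. v = br h u + \<nu>"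
    and diag: "\<And>\<phi> \<nu>. \<phi> \<in> \<F> \<Longrightarrow> \<nu> \<in> N \<Longrightarrow> \<phi> (pw n (u + \<nu>)) = 0"
    and "\<phi> \<in> \<F>" "p \<in> sym_power n e"
  shows "\<phi> p = 0"
proof -
  let ?S = "\<lambda>\<phi> a. \<phi> (symt n a)"
  have S: "?S \<phi> a = 0" if a: "\<And>i. a i \<in> parity_space e" for a
  proof (rule sml_slice[where \<S> = "?S ` \<F>" and V = "parity_space e" and N = N
        and e = u and ops = "br ` parity_space True" and n = n and S = "?S \<phi>"])
    show "sym_multilinear n (parity_space e) S" if "S \<in> ?S ` \<F>" for S
      using that symt_sml[OF lin subspace_sym_power subspace_parity_space symt_in_sym_power] by auto
    show "\<exists>S'\<in>?S ` \<F>. \<forall>a. (\<forall>i. a i \<in> parity_space e) \<longrightarrow> S' a = (\<Sum>j<n. S (a(j := X (a j))))"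
      if X: "X \<in> br ` parity_space True" and S: "S \<in> ?S ` \<F>" for X S
    proof -
      obtain h where h: "h \<in> parity_space True" "X = br h" using X by blast
      obtain \<psi> where \<psi>: "\<psi> \<in> \<F>" "S = ?S \<psi>" using S by blast
      obtain \<psi>' where \<psi>': "\<psi>' \<in> \<F>" "\<forall>p\<in>sym_power n e. \<psi>' p = \<psi> (poisson n (psum n h) p)"
        using closed[OF \<psi>(1) h(1)] by blast
      have "?S \<psi>' a = (\<Sum>j<n. S (a(j := X (a j))))" if a: "\<forall>i. a i \<in> parity_space e" for a
      proof -
        have "\<psi>' (symt n a) = \<psi> (poisson n (psum n h) (symt n a))"
          using \<psi>'(2) symt_in_sym_power a by blast
        also have "\<dots> = (\<Sum>j<n. \<psi> (symt n (a(j := br h (a j)))))"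
          by (rule psum_symt_sum[OF lin[OF \<psi>(1)] h(1), symmetric]) (use a in blast)
        finally show ?thesis by (simp add: \<psi>(2) h(2))
      qed
      then have "\<forall>a. (\<forall>i. a i \<in> parity_space e) \<longrightarrow> ?S \<psi>' a = (\<Sum>j<n. S (a(j := X (a j))))"
        by (intro allI impI)
      moreover have "?S \<psi>' \<in> ?S ` \<F>"
        by (rule imageI) (rule \<psi>'(1))
      ultimately show ?thesis by (rule bexI)
    qed
    show "v \<in> N \<or> (\<exists>X\<in>br ` parity_space True. \<exists>\<nu>\<in>N. v = X u + \<nu>)" if "v \<in> parity_space e" for v
      using decomp[OF that] by blast
    show "S (\<lambda>_. u + \<nu>) = 0" if S: "S \<in> ?S ` \<F>" and \<nu>: "\<nu> \<in> N" for S \<nu>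
    proof -
      obtain \<psi> where \<psi>: "\<psi> \<in> \<F>" "S = ?S \<psi>" using S by blast
      have "u + \<nu> \<in> parity_space e" using u \<nu> N parity_space_add by blast
      then show ?thesis
        using lin_onD(2)[OF lin[OF \<psi>(1)] pw_in_sym_power] diag[OF \<psi>(1) \<nu>] by (simp add: \<psi>(2) symt_const)
    qed
  qed (use assms(8) a N u br_even in auto)
  have "\<phi> (pw n f) = 0" if f: "f \<in> parity_space e" for f
    using S[of "\<lambda>_. f"] f lin_onD(2)[OF lin[OF assms(8)] pw_in_sym_power[OF f], of "fact n"]
    by (simp add: symt_const)
  then show ?thesis
    using lin_on_eq_span[of "pw n ` parity_space e" \<phi> "\<lambda>_. 0" p] lin[OF assms(8)] assms(9)
    by (auto simp: sym_power_def lin_on_def)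
qed

text \<open>The polynomials in x alone: the even ones complement the orbit directions at y^2 and
  give the normal forms, the odd ones are the square roots \<theta>.\<close>

definition even_x :: "opoly set" where "even_x = cp.span {xymon (2 * i) 0 | i. True}"
definition odd_x :: "opoly set" where "odd_x = cp.span {xymon (2 * i + 1) 0 | i. True}"

lemma even_x_parity: "even_x \<subseteq> parity_space True"
  unfolding even_x_def by (rule cp.span_minimal) (auto intro: xymon_in_parity_space)
lemma odd_x_parity: "odd_x \<subseteq> parity_space False"
  unfolding odd_x_def by (rule cp.span_minimal) (auto intro: xymon_in_parity_space)
lemma subspace_even_x [simp]: "cp.subspace even_x" by (simp add: even_x_def)
lemma subspace_odd_x [simp]: "cp.subspace odd_x" by (simp add: odd_x_def)

lemma odd_x_induct [consumes 1, case_names zero step]: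
  assumes "p \<in> odd_x" "P 0" "\<And>c i q. q \<in> odd_x \<Longrightarrow> P q \<Longrightarrow> P (Const c * xymon (2 * i + 1) 0 + q)"
  shows "P p"
  using assms(1) unfolding odd_x_def
proof (induction rule: cpoly_span_induct)
  case (step c x y)
  then obtain i where x: "x = xymon (2 * i + 1) 0" by blast
  show ?case unfolding x by (rule assms(3)) (use step in \<open>simp_all add: odd_x_def\<close>)
qed (rule assms(2))

lemma pdiff_Y_odd_x: "\<theta> \<in> odd_x \<Longrightarrow> pdiff (Y 0) \<theta> = 0"
  by (induction rule: odd_x_induct) (simp_all add: pdiff_xymon)

lemma antiderivative_x:
  assumes "v \<in> parity_space (\<not> e)"
  obtains h where "h \<in> parity_space e" "pdiff (X 0) h = v"
proof -
  have "\<exists>h\<in>parity_space e. pdiff (X 0) h = v" using assms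
  proof (induction rule: parity_space_induct)
    case (step c a b q)
    then obtain h where h: "h \<in> parity_space e" "pdiff (X 0) h = q" by blast
    let ?k = "Const (c / of_nat (Suc a)) * xymon (Suc a) b"
    have "even (Suc a + b) = e" using step(1) by auto
    then have "?k \<in> parity_space e" by (intro parity_space_scale xymon_in_parity_space)
    moreover have "pdiff (X 0) ?k = Const c * xymon a b"
      by (simp add: pdiff_xymon mult.assoc[symmetric] Const_mult[symmetric] del: of_nat_Suc)
    ultimately show ?case using h by (intro bexI[of _ "?k + h"]) (auto intro: parity_space_add)
  qed (auto intro: bexI[of _ 0])
  with that show ?thesis by blast
qed

lemma antiderivative_odd_x:
  assumes "\<theta> \<in> odd_x"
  obtains h where "h \<in> parity_space True" "pdiff (X 0) h = \<theta>" "pdiff (Y 0) h = 0"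
proof -
  have "\<exists>h\<in>parity_space True. pdiff (X 0) h = \<theta> \<and> pdiff (Y 0) h = 0" using assms
  proof (induction rule: odd_x_induct)
    case (step c a q)
    then obtain h where h: "h \<in> parity_space True" "pdiff (X 0) h = q" "pdiff (Y 0) h = 0" by blast
    let ?k = "Const (c / of_nat (2 * a + 2)) * xymon (2 * a + 2) 0"
    have "?k \<in> parity_space True" by (intro parity_space_scale xymon_in_parity_space) simp
    moreover have "pdiff (X 0) ?k = Const c * xymon (2 * a + 1) 0"
    proof -
      have "pdiff (X 0) ?k = Const (c / of_nat (2 * a + 2) * of_nat (2 * a + 2)) * xymon (2 * a + 1) 0"
        unfolding Const_mult mult.assoc by (simp add: pdiff_xymon)
      also have "c / of_nat (2 * a + 2) * of_nat (2 * a + 2) = c"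
        using of_nat_neq_0[of "2 * a + 1", where 'a = complex] by simp
      finally show ?thesis .
    qed
    moreover have "pdiff (Y 0) ?k = 0" by (simp add: pdiff_xymon)
    ultimately show ?case using h by (intro bexI[of _ "?k + h"]) (auto intro: parity_space_add)
  qed (auto intro: bexI[of _ 0])
  with that show ?thesis by blast
qed

text \<open>Since {h, y^2} = 2 y dh/dx and antiderivatives in x exist, every even multiple of y is
  an orbit direction at y^2; what remains is a polynomial in x. This is the infinitesimal shadow of
  the reduction to normal form.\<close>

lemma normal_form_decomp:
  assumes "v \<in> parity_space True"
  shows "\<exists>h\<in>parity_space True. \<exists>\<nu>\<in>even_x. v = br h (Var (Y 0) ^ 2) + \<nu>"
  using assms
proof (induction rule: parity_space_induct)
  case zero
  then show ?case using cp.subspace_0[OF subspace_even_x] by (auto intro!: bexI[of _ 0])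
next
  case (step c a b q)
  then obtain h \<nu> where h: "h \<in> parity_space True" "\<nu> \<in> even_x" "q = br h (Var (Y 0) ^ 2) + \<nu>" by blast
  show ?case
  proof (cases b)
    case 0
    then obtain i where "a = 2 * i" using step(1) by (auto elim: evenE)
    then have "Const c * xymon a b \<in> even_x"
      using 0 unfolding even_x_def by (intro cp.span_scale cp.span_base) auto
    then have "Const c * xymon a b + \<nu> \<in> even_x" using h cp.subspace_add[OF subspace_even_x] by blast
    then show ?thesis using h by (intro bexI[of _ h] bexI[of _ "Const c * xymon a b + \<nu>"]) (auto simp: algebra_simps)
  next
    case (Suc b')
    have "xymon a b' \<in> parity_space (\<not> True)" using step(1) Suc by (intro xymon_in_parity_space) auto
    then obtain k where k: "k \<in> parity_space True" "pdiff (X 0) k = xymon a b'" by (rule antiderivative_x)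
    let ?k = "Const (c / 2) * k"
    have "br ?k (Var (Y 0) ^ 2) = Const c * xymon a b"
    proof -
      have "br ?k (Var (Y 0) ^ 2) = Const (c / 2) * (xymon a b' * (2 * Var (Y 0)))"
        by (simp add: br_scale_left br_def k pdiff_power)
      also have "\<dots> = (Const (c / 2) * Const 2) * xymon a b"
        by (simp add: Suc xymon_def mult_ac)
      finally show ?thesis by (simp add: Const_mult[symmetric] del: Const_numeral)
    qed
    then show ?thesis using h k
      by (intro bexI[of _ "?k + h"] bexI[of _ \<nu>])
        (auto simp: br_add_left intro!: parity_space_add parity_space_scale)
  qed
qed

lemma normal_forms_slice:
  assumes lin: "\<And>\<phi>. \<phi> \<in> \<F> \<Longrightarrow> lin_on (sym_power n True) \<phi>"
    and closed: "\<And>\<phi> h. \<phi> \<in> \<F> \<Longrightarrow> h \<in> parity_space True \<Longrightarrow>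
      \<exists>\<phi>'\<in>\<F>. \<forall>p\<in>sym_power n True. \<phi>' p = \<phi> (poisson n (psum n h) p)"
    and diag: "\<And>\<phi> \<nu>. \<phi> \<in> \<F> \<Longrightarrow> \<nu> \<in> even_x \<Longrightarrow> \<phi> (pw n (Var (Y 0) ^ 2 + \<nu>)) = 0"
    and "\<phi> \<in> \<F>" "p \<in> sym_power n True"
  shows "\<phi> p = 0"
proof (rule psum_slice[where N = even_x and u = "Var (Y 0) ^ 2" and e = True and \<F> = \<F> and n = n])
  show "Var (Y 0) ^ 2 \<in> parity_space True" using parity_space_power[of "Var (Y 0)" False 2] by auto
qed (use assms even_x_parity normal_form_decomp in auto)

text \<open>The difference of the two functionals is annihilated by all Hamiltonian derivations, so
  together with 0 it belongs to a closed family that vanishes on the slice of normal forms.\<close>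

lemma HP0_B_determined:
  assumes "\<phi> \<in> HP0_dual n (O_B n)" "\<psi> \<in> HP0_dual n (O_B n)"
    and eq: "\<And>\<nu>. \<nu> \<in> even_x \<Longrightarrow> \<phi> (pw n (Var (Y 0) ^ 2 + \<nu>)) = \<psi> (pw n (Var (Y 0) ^ 2 + \<nu>))"
  shows "\<phi> = \<psi>"
proof -
  let ?F = "{\<chi>. lin_on (sym_power n True) \<chi> \<and> (\<forall>h\<in>parity_space True. \<forall>q\<in>sym_power n True.
      \<chi> (poisson n (psum n h) q) = 0) \<and> (\<forall>\<nu>\<in>even_x. \<chi> (pw n (Var (Y 0) ^ 2 + \<nu>)) = 0)}"
  have y2: "Var (Y 0) ^ 2 + \<nu> \<in> parity_space True" if "\<nu> \<in> even_x" for \<nu>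
    using parity_space_power[of "Var (Y 0)" False 2] even_x_parity that by (intro parity_space_add) auto
  have "(\<lambda>p. \<phi> p - \<psi> p) p = 0" if "p \<in> sym_power n True" for p
  proof (rule normal_forms_slice[where \<F> = ?F and n = n])
    show "(\<lambda>p. \<phi> p - \<psi> p) \<in> ?F"
      using HP0_B_D[OF assms(1)] HP0_B_D[OF assms(2)] psum_in_sym_power[of _ n] eq
      by (auto simp: lin_on_def algebra_simps)
    show "\<exists>\<phi>'\<in>?F. \<forall>p\<in>sym_power n True. \<phi>' p = \<chi> (poisson n (psum n h) p)"
      if "\<chi> \<in> ?F" "h \<in> parity_space True" for \<chi> h
      using that psum_sym_power by (intro bexI[of _ "\<lambda>_. 0"]) (auto simp: lin_on_def)
  qed (use that in auto)
  then show ?thesis using HP0_B_D(3)[OF assms(1)] HP0_B_D(3)[OF assms(2)] by (intro ext) (metis eq_iff_diff_eq_0)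
qed

text \<open>Here {h, y} = dh/dx runs through all odd functions, so the slice at y shrinks to a
  point.\<close>

lemma odd_slice:
  assumes lin: "\<And>\<phi>. \<phi> \<in> \<F> \<Longrightarrow> lin_on (sym_power n False) \<phi>"
    and closed: "\<And>\<phi> h. \<phi> \<in> \<F> \<Longrightarrow> h \<in> parity_space True \<Longrightarrow>
      \<exists>\<phi>'\<in>\<F>. \<forall>p\<in>sym_power n False. \<phi>' p = \<phi> (poisson n (psum n h) p)"
    and diag: "\<And>\<phi>. \<phi> \<in> \<F> \<Longrightarrow> \<phi> (pw n (Var (Y 0))) = 0"
    and "\<phi> \<in> \<F>" "p \<in> sym_power n False"
  shows "\<phi> p = 0"
proof (rule psum_slice[OF lin closed, where N = "{0}" and u = "Var (Y 0)"])
  show "\<exists>h\<in>parity_space True. \<exists>\<nu>\<in>{0}. v = br h (Var (Y 0)) + \<nu>" if v: "v \<in> parity_space False" for v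
  proof -
    obtain h where "h \<in> parity_space True" "pdiff (X 0) h = v" using antiderivative_x[of v True] v by auto
    then show ?thesis by (auto simp: br_def)
  qed
qed (use assms in auto)

text \<open>Since {x y, y} = y, the Hamiltonian x y multiplies the n-th power of y by n. Invariance
  therefore kills the value there if n > 0, and the one-point slice does the rest.\<close>

lemma odd_functional_vanish:
  assumes "n > 0" "lin_on (sym_power n False) \<phi>"
    and "\<And>h q. h \<in> parity_space True \<Longrightarrow> q \<in> sym_power n False \<Longrightarrow> \<phi> (poisson n (psum n h) q) = 0"
    and "p \<in> sym_power n False"
  shows "\<phi> p = 0"
proof (rule odd_slice[where \<F> = "{\<chi>. lin_on (sym_power n False) \<chi> \<and> (\<forall>h\<in>parity_space True. \<forall>q\<in>sym_power n False.
      \<chi> (poisson n (psum n h) q) = 0)}" and n = n], goal_cases)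
  case (2 \<chi> h)
  then show ?case using psum_sym_power by (intro bexI[of _ "\<lambda>_. 0"]) (auto simp: lin_on_def)
next
  case (3 \<chi>)
  let ?h = "Var (X 0) * Var (Y 0)"
  have h: "?h \<in> parity_space True" using parity_space_mult[of "Var (X 0)" False "Var (Y 0)" False] by simp
  have "poisson n (psum n ?h) (pw n (Var (Y 0))) = dpw n (Var (Y 0)) (br ?h (Var (Y 0)))"
    using parity_space_indets[OF h] by (intro poisson_psum_pw) (auto simp: plane_def)
  also have "br ?h (Var (Y 0)) = Var (Y 0)" by (simp add: br_def)
  also have "dpw n (Var (Y 0)) (Var (Y 0)) = Const (of_nat n) * pw n (Var (Y 0))"
    by (simp add: dpw_def Const_of_nat fun_upd_idem)
  finally have eq: "poisson n (psum n ?h) (pw n (Var (Y 0))) = Const (of_nat n) * pw n (Var (Y 0))" .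
  have "\<chi> (poisson n (psum n ?h) (pw n (Var (Y 0)))) = 0"
    using 3 h pw_in_sym_power[OF Var_in_parity_space(2)] by blast
  then have "0 = \<chi> (Const (of_nat n) * pw n (Var (Y 0)))"
    unfolding eq by simp
  also have "\<dots> = of_nat n * \<chi> (pw n (Var (Y 0)))"
    using 3 pw_in_sym_power[of "Var (Y 0)" False n] by (auto simp: lin_on_def)
  finally show ?case using assms(1) by simp
qed (use assms in auto)

section \<open>Extension of functionals from type B to type D\<close>

text \<open>The condition for an extension by 0 to survive in type D: apart from brackets of two
  even elements, only those of two odd elements land in the even summand.\<close>

definition odd_bracket_free :: "nat \<Rightarrow> functional \<Rightarrow> bool" where
  "odd_bracket_free n \<phi> \<longleftrightarrow> \<phi> \<in> HP0_dual n (O_B n) \<and>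
     (\<forall>f\<in>parity_space False. \<forall>g\<in>parity_space False. \<phi> (poisson n (pw n f) (pw n g)) = 0)"

lemma poisson_O_D: "p \<in> O_D n \<Longrightarrow> q \<in> O_D n \<Longrightarrow> poisson n p q \<in> O_D n"
proof -
  assume p: "p \<in> O_D n" and q: "q \<in> O_D n"
  obtain p1 p2 where P: "p1 \<in> sym_power n True" "p2 \<in> sym_power n False" "p = p1 + p2" using O_D_split[OF p] .
  obtain q1 q2 where Q: "q1 \<in> sym_power n True" "q2 \<in> sym_power n False" "q = q1 + q2" using O_D_split[OF q] .
  show "poisson n p q \<in> O_D n"
    unfolding P(3) Q(3) poisson_add_left poisson_add_right
    by (intro cp.subspace_add[OF subspace_O_D]) (use P Q in \<open>blast intro: sym_power_O_D poisson_sym_power\<close>)+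
qed

lemma HP0_D_D:
  assumes "\<Phi> \<in> HP0_dual n (O_D n)"
  shows "lin_on (O_D n) \<Phi>" "p \<in> O_D n \<Longrightarrow> q \<in> O_D n \<Longrightarrow> \<Phi> (poisson n p q) = 0"
    "p \<notin> O_D n \<Longrightarrow> \<Phi> p = 0" "lin_on (sym_power n e) \<Phi>"
proof -
  show lin: "lin_on (O_D n) \<Phi>" "p \<in> O_D n \<Longrightarrow> q \<in> O_D n \<Longrightarrow> \<Phi> (poisson n p q) = 0"
    "p \<notin> O_D n \<Longrightarrow> \<Phi> p = 0"
    using assms bracket_space_single[of p "O_D n" q n] by (auto simp: HP0_dual_def dual_iff)
  show "lin_on (sym_power n e) \<Phi>"
    by (rule lin_on_subset[OF lin(1)]) (use sym_power_O_D in blast)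
qed

lemma odd_bracket_free_restrict:
  assumes "\<Phi> \<in> HP0_dual n (O_D n)"
  shows "odd_bracket_free n (restrict_functional (O_B n) \<Phi>)"
proof -
  let ?\<phi> = "restrict_functional (O_B n) \<Phi>"
  have eq: "?\<phi> p = \<Phi> p" if "p \<in> sym_power n True" for p
    using that by (simp add: restrict_functional_def O_B_eq)
  have br0: "?\<phi> (poisson n (pw n f) (pw n g)) = 0" if "f \<in> parity_space e" "g \<in> parity_space e" for f g e
  proof -
    have m: "pw n f \<in> sym_power n e" "pw n g \<in> sym_power n e" using that pw_in_sym_power by auto
    then have "poisson n (pw n f) (pw n g) \<in> sym_power n True" using poisson_sym_power[OF m] by simp
    with eq HP0_D_D(2)[OF assms] m sym_power_O_D show ?thesis by metis
  qed
  have "?\<phi> \<in> HP0_dual n (O_B n)"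
  proof (rule HP0_B_I)
    show "?\<phi> p = 0" if "p \<notin> sym_power n True" for p
      using that by (simp add: restrict_functional_def O_B_eq)
    show "lin_on (sym_power n True) ?\<phi>"
      using HP0_D_D(4)[OF assms, of True] by (simp add: lin_on_def eq sym_power_add sym_power_scale)
  qed (rule br0)
  then show ?thesis using br0 by (simp add: odd_bracket_free_def)
qed

text \<open>The projection onto the type B invariants: the sign change at position 0 acts as 1 on
  the even and as -1 on the odd summand. For n = 0 that position does not exist, and both summands
  are the constants.\<close>

definition even_part :: "nat \<Rightarrow> opoly \<Rightarrow> opoly" where
  "even_part n p = (if n = 0 then p else Const (1 / 2) * (p + act (id, {0}) p))"

definition extend_by_zero :: "nat \<Rightarrow> functional \<Rightarrow> functional" where
  "extend_by_zero n \<phi> = (\<lambda>p. if p \<in> O_D n then \<phi> (even_part n p) else 0)"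

lemma half_plus_half: "Const (1 / 2) * (p + p) = p"
proof -
  have "Const (1 / 2) * (p + p) = Const (1 / 2 + 1 / 2) * p" by (simp only: Const_add ring_distribs)
  then show ?thesis by simp
qed

lemma half_two: "Const (1 / 2) * (2 * p) = p"
  using half_plus_half[of p] by (simp only: mult_2)

lemma even_part_split:
  assumes "n > 0" "p \<in> sym_power n True" "q \<in> sym_power n False"
  shows "even_part n (p + q) = p"
  using assms act_sym_power[OF assms(2) permutes_id, of "{0}"] act_sym_power[OF assms(3) permutes_id, of "{0}"]
  by (simp add: even_part_def parity_sign_def Const_uminus half_two)

lemma sym_power_0: "sym_power 0 e = sym_power 0 e'"
proof -
  have "pw 0 ` parity_space e = {1}" for e
    using parity_space_zero[of e] by (auto simp: tens_def intro!: image_eqI[where x = 0])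
  then show ?thesis by (simp add: sym_power_def)
qed

lemma O_D_0: "O_D 0 = sym_power 0 True"
proof
  show "O_D 0 \<subseteq> sym_power 0 True"
    using sym_power_0[of False True] by (auto elim!: O_D_split intro: sym_power_add)
qed (use sym_power_O_D in auto)

lemma even_part_mem: "p \<in> O_D n \<Longrightarrow> even_part n p \<in> sym_power n True"
proof (cases "n = 0")
  case True
  then show "p \<in> O_D n \<Longrightarrow> ?thesis" by (simp add: even_part_def O_D_0)
next
  case False
  assume "p \<in> O_D n"
  then obtain p1 p2 where "p1 \<in> sym_power n True" "p2 \<in> sym_power n False" "p = p1 + p2" by (rule O_D_split)
  then show ?thesis using even_part_split False by simp
qed

lemma even_part_id: "p \<in> sym_power n True \<Longrightarrow> even_part n p = p"
  using even_part_split[of n p 0] by (cases "n = 0") (simp_all add: even_part_def)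

lemma even_part_add: "even_part n (p + q) = even_part n p + even_part n q"
  by (simp add: even_part_def algebra_simps)
lemma even_part_scale: "even_part n (Const c * p) = Const c * even_part n p"
  by (simp add: even_part_def algebra_simps)

lemma extend_by_zero_zero: "extend_by_zero n (\<lambda>_. 0) = (\<lambda>_. 0)"
  by (simp add: extend_by_zero_def)

text \<open>Split both arguments of a bracket into even and odd parts. The mixed brackets are odd
  and go to 0, the even-even bracket is killed in type B, and the odd-odd bracket by
  \<open>odd_bracket_free\<close>.\<close>

lemma extend_by_zero_HP0:
  assumes "odd_bracket_free n \<phi>"
  shows "extend_by_zero n \<phi> \<in> HP0_dual n (O_D n)"
    "restrict_functional (O_B n) (extend_by_zero n \<phi>) = \<phi>"
proof -
  have \<phi>: "\<phi> \<in> HP0_dual n (O_B n)" using assms by (simp add: odd_bracket_free_def)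
  note lin = HP0_B_D(1)[OF \<phi>]
  let ?E = "extend_by_zero n \<phi>"
  have E: "?E p = \<phi> (even_part n p)" if "p \<in> O_D n" for p using that by (simp add: extend_by_zero_def)
  have linE: "lin_on (O_D n) ?E"
    unfolding lin_on_def
    using cp.subspace_add[OF subspace_O_D[of n]] cp.subspace_scale[OF subspace_O_D[of n]]
    by (simp add: E even_part_add even_part_scale even_part_mem lin_onD[OF lin])
  have br: "?E (poisson n p q) = 0" if p: "p \<in> O_D n" and q: "q \<in> O_D n" for p q
  proof (cases "n = 0")
    case True
    then have "poisson n p q = 0" by (simp add: poisson_def)
    then show ?thesis using lin_on_zero[OF linE subspace_O_D] by simp
  next
    case False
    obtain p1 p2 where P: "p1 \<in> sym_power n True" "p2 \<in> sym_power n False" "p = p1 + p2" using O_D_split[OF p] .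
    obtain q1 q2 where Q: "q1 \<in> sym_power n True" "q2 \<in> sym_power n False" "q = q1 + q2" using O_D_split[OF q] .
    have T: "poisson n p1 q1 \<in> sym_power n True" "poisson n p2 q2 \<in> sym_power n True"
      using poisson_sym_power[OF P(1) Q(1)] poisson_sym_power[OF P(2) Q(2)] by simp_all
    have F: "poisson n p1 q2 \<in> sym_power n False" "poisson n p2 q1 \<in> sym_power n False"
      using poisson_sym_power[OF P(1) Q(2)] poisson_sym_power[OF P(2) Q(1)] by simp_all
    have "poisson n p q = (poisson n p1 q1 + poisson n p2 q2) + (poisson n p1 q2 + poisson n p2 q1)"
      unfolding P(3) Q(3) poisson_add_left poisson_add_right by (simp add: algebra_simps)
    then have "even_part n (poisson n p q) = poisson n p1 q1 + poisson n p2 q2"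
      using False T F by (simp add: even_part_split sym_power_add)
    then have "?E (poisson n p q) = \<phi> (poisson n p1 q1) + \<phi> (poisson n p2 q2)"
      using E[OF poisson_O_D[OF p q]] lin_onD(1)[OF lin T] by simp
    moreover have "\<phi> (poisson n p1 q1) = 0" using HP0_B_D(2)[OF \<phi>] P Q by blast
    moreover have "\<phi> (poisson n p2 q2) = 0"
      by (rule bracket_vanish[of n False False]) (use lin P Q assms in \<open>auto simp: odd_bracket_free_def\<close>)
    ultimately show ?thesis by simp
  qed
  have "?E p = 0" if "p \<in> bracket_space n (O_D n)" for p
    by (rule lin_on_bracket_space[OF linE subspace_O_D poisson_O_D br that])
  then show "?E \<in> HP0_dual n (O_D n)"
    using linE by (auto simp: HP0_dual_def dual_iff extend_by_zero_def)
  show "restrict_functional (O_B n) ?E = \<phi>"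
    using HP0_B_D(3)[OF \<phi>] sym_power_O_D[of _ n True]
    by (auto simp: fun_eq_iff restrict_functional_def O_B_eq E even_part_id)
qed

text \<open>For n > 0 both functionals vanish on the odd summand, being invariant under power sums;
  for n = 0 that summand lies in the even one, where they agree.\<close>

lemma HP0_D_determined:
  assumes "\<Phi> \<in> HP0_dual n (O_D n)" "\<Psi> \<in> HP0_dual n (O_D n)"
    and "restrict_functional (O_B n) \<Phi> = restrict_functional (O_B n) \<Psi>"
  shows "\<Phi> = \<Psi>"
proof
  fix p
  have eq: "\<Phi> q = \<Psi> q" if "q \<in> sym_power n True" for q
    using fun_cong[OF assms(3), of q] that by (simp add: restrict_functional_def O_B_eq)
  show "\<Phi> p = \<Psi> p"
  proof (cases "p \<in> O_D n")
    case False
    then show ?thesis using HP0_D_D(3)[OF assms(1)] HP0_D_D(3)[OF assms(2)] by simp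
  next
    case True
    then obtain p1 p2 where P: "p1 \<in> sym_power n True" "p2 \<in> sym_power n False" "p = p1 + p2" by (rule O_D_split)
    have odd: "\<Phi>' q = 0" if "n > 0" "q \<in> sym_power n False" "\<Phi>' \<in> HP0_dual n (O_D n)" for \<Phi>' q
    proof (rule odd_functional_vanish[OF that(1) HP0_D_D(4)[OF that(3)] _ that(2)])
      fix h q assume "h \<in> parity_space True" "q \<in> sym_power n False"
      then show "\<Phi>' (poisson n (psum n h) q) = 0"
        using HP0_D_D(2)[OF that(3)] psum_in_sym_power sym_power_O_D by blast
    qed
    have "\<Phi> p2 = \<Psi> p2"
      using odd[OF _ P(2) assms(1)] odd[OF _ P(2) assms(2)] eq[of p2] P(2) sym_power_0[of False True]
      by (cases "n = 0") auto
    then show ?thesis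
      unfolding P(3) using lin_onD(1)[OF HP0_D_D(1)[OF assms(1)]] lin_onD(1)[OF HP0_D_D(1)[OF assms(2)]]
        sym_power_O_D[OF P(1)] sym_power_O_D[OF P(2)] eq[OF P(1)] by simp
  qed
qed

section \<open>Reduction of the odd bracket condition to y^2 + \<theta>^2\<close>

abbreviation yv :: opoly where "yv \<equiv> Var (Y 0)"

definition kappa_free :: "nat \<Rightarrow> functional \<Rightarrow> bool" where
  "kappa_free n \<phi> \<longleftrightarrow> (\<forall>\<theta>\<in>odd_x. \<phi> (dpw n (yv ^ 2 + \<theta> ^ 2) (pdiff (X 0) \<theta>)) = 0)"

lemma dpw_even: "f \<in> parity_space True \<Longrightarrow> u \<in> parity_space True \<Longrightarrow> dpw n f u \<in> sym_power n True"
  by (rule dpw_in_sym_power)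

lemma square_parity: "f \<in> parity_space e \<Longrightarrow> f ^ 2 \<in> parity_space True"
  using parity_space_mult[of f e f e] by (simp add: power2_eq_square)

lemma normal_parity: "\<theta> \<in> odd_x \<Longrightarrow> yv ^ 2 + \<theta> ^ 2 \<in> parity_space True" "\<theta> \<in> odd_x \<Longrightarrow> pdiff (X 0) \<theta> \<in> parity_space True"
  using odd_x_parity pdiff_parity_space(1)[of \<theta> False] by (auto intro!: parity_space_add square_parity[OF Var_in_parity_space(2)] square_parity[of \<theta> False])

text \<open>The factorization \<open>y\<^sup>2 + \<theta>\<^sup>2 = (y - i \<theta>) (y + i \<theta>)\<close> into odd functions has bracket \<open>-2 i \<theta>'\<close>.\<close>

lemma odd_bracket_free_imp_kappa_free:
  assumes "odd_bracket_free n \<phi>"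
  shows "kappa_free n \<phi>"
  unfolding kappa_free_def
proof
  fix \<theta> assume \<theta>: "\<theta> \<in> odd_x"
  have \<phi>: "\<phi> \<in> HP0_dual n (O_B n)" using assms by (simp add: odd_bracket_free_def)
  let ?f = "yv - Const \<i> * \<theta>" and ?g = "yv + Const \<i> * \<theta>"
  have th: "Const \<i> * \<theta> \<in> parity_space False" using \<theta> odd_x_parity parity_space_scale by blast
  have fg: "?f \<in> parity_space False" "?g \<in> parity_space False"
    using parity_space_diff[OF Var_in_parity_space(2) th] parity_space_add[OF Var_in_parity_space(2) th] by auto
  have "?f * ?g = yv ^ 2 - (Const \<i> * \<theta>) ^ 2"
    by (simp add: algebra_simps power2_eq_square)
  also have "(Const \<i> * \<theta>) ^ 2 = - (\<theta> ^ 2)"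
    by (simp add: power_mult_distrib Const_power[symmetric] Const_uminus)
  finally have "?f * ?g = yv ^ 2 + \<theta> ^ 2" by simp
  moreover have "br ?f ?g = Const (- 2 * \<i>) * pdiff (X 0) \<theta>"
    using pdiff_Y_odd_x[OF \<theta>] by (simp add: br_def Const_mult Const_uminus algebra_simps)
  ultimately have "poisson n (pw n ?f) (pw n ?g) = Const (- 2 * \<i>) * dpw n (yv ^ 2 + \<theta> ^ 2) (pdiff (X 0) \<theta>)"
    using poisson_pw_pw[OF parity_space_indets[OF fg(1)] parity_space_indets[OF fg(2)], of n]
    by (simp only: dpw_scale)
  then have "0 = (- 2 * \<i>) * \<phi> (dpw n (yv ^ 2 + \<theta> ^ 2) (pdiff (X 0) \<theta>))"
    using assms fg lin_onD(2)[OF HP0_B_D(1)[OF \<phi>] dpw_even[OF normal_parity(1)[OF \<theta>] normal_parity(2)[OF \<theta>]]]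
    by (metis odd_bracket_free_def)
  then show "\<phi> (dpw n (yv ^ 2 + \<theta> ^ 2) (pdiff (X 0) \<theta>)) = 0" by simp
qed

text \<open>Infinitesimal invariance at every time, stated through linear coefficients, makes the
  derivative of the polynomial vanish identically. This takes the place of integrating a
  flow.\<close>

lemma poly_locally_stationary:
  fixes u :: "complex \<Rightarrow> complex"
  assumes "\<And>t0. \<exists>U. (\<forall>t. poly U t = u (t0 + t)) \<and> coeff U 1 = 0"
  shows "u s = u t"
proof -
  obtain U where U: "\<And>t. poly U t = u t" using assms[of 0] by auto
  have "poly (pderiv U) t0 = 0" for t0
  proof -
    obtain W where W: "\<And>t. poly W t = u (t0 + t)" "coeff W 1 = 0" using assms[of t0] by blast
    have "poly W = poly (pcompose U [:t0, 1:])" by (rule ext) (simp add: W U poly_pcompose)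
    then have "W = pcompose U [:t0, 1:]" by (simp add: poly_eq_poly_eq_iff)
    then have "pderiv W = pcompose (pderiv U) [:t0, 1:]" by (simp add: pderiv_pcompose pderiv_pCons)
    then have "poly (pderiv W) 0 = poly (pderiv U) t0" by (simp add: poly_pcompose)
    moreover have "poly (pderiv W) 0 = coeff W 1" by (simp add: poly_0_coeff_0 coeff_pderiv)
    ultimately show ?thesis using W by simp
  qed
  then have "pderiv U = 0" using poly_all_0_iff_0 by blast
  then obtain c where "U = [:c:]" using pderiv_iszero by blast
  then show ?thesis using U by (metis poly_pCons poly_0 mult_zero_right)
qed

lemma sml_zero_form: "sym_multilinear n V (\<lambda>_. 0)"
  by (simp add: sym_multilinear_def)

context
  fixes n :: nat and \<phi> :: functional
  assumes \<phi>: "\<phi> \<in> HP0_dual n (O_B n)"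
begin

lemma symt_form: "sym_multilinear n (parity_space True) (\<lambda>a. \<phi> (symt n a))"
  by (rule symt_sml[OF HP0_B_D(1)[OF \<phi>] subspace_sym_power subspace_parity_space symt_in_sym_power])

lemma symt_form_invariant:
  assumes "h \<in> parity_space True" "\<And>i. a i \<in> parity_space True"
  shows "(\<Sum>k<n. \<phi> (symt n (a(k := br h (a k))))) = 0"
  using psum_symt_sum[OF HP0_B_D(1)[OF \<phi>], where a = a, OF assms(1) assms(2)]
    HP0_B_D(2)[OF \<phi> psum_in_sym_power[OF assms(1)] symt_in_sym_power[OF assms(2)]] by simp

lemma symt_form_dpw:
  assumes "f \<in> parity_space True" "u \<in> parity_space True"
  shows "(\<Sum>j<n. \<phi> (symt n ((\<lambda>_. f)(j := u)))) = fact n * \<phi> (dpw n f u)"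
proof -
  have "(\<Sum>j<n. \<phi> (symt n ((\<lambda>_. f)(j := u)))) = \<phi> (\<Sum>j<n. symt n ((\<lambda>_. f)(j := u)))"
    by (rule lin_on_sum[OF HP0_B_D(1)[OF \<phi>] subspace_sym_power, symmetric])
      (use assms in \<open>auto intro!: symt_in_sym_power\<close>)
  then show ?thesis
    using lin_onD(2)[OF HP0_B_D(1)[OF \<phi>] dpw_even[OF assms]] by (simp add: symt_dpw)
qed

text \<open>The function \<open>q t\<close> arises from \<open>q 0\<close> by the shear y -> y + t
  \<theta>, the flow of an antiderivative H of \<theta>. As H depends on x only, the shear also
  fixes the direction d\<theta>/dx, so invariance makes the value independent of t.\<close>

lemma shear_invariance:
  assumes \<theta>: "\<theta> \<in> odd_x"
  defines "q \<equiv> \<lambda>t. (yv + Const t * \<theta>) * (yv + Const (1 + t) * \<theta>)"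
  shows "\<phi> (dpw n (q s) (pdiff (X 0) \<theta>)) = \<phi> (dpw n (q t) (pdiff (X 0) \<theta>))"
proof -
  let ?d = "pdiff (X 0) \<theta>"
  have \<theta>o: "\<theta> \<in> parity_space False" using \<theta> odd_x_parity by blast
  have lin: "yv + Const c * \<theta> \<in> parity_space False" for c
    using \<theta>o by (intro parity_space_add parity_space_scale) auto
  have q: "q t \<in> parity_space True" for t
    unfolding q_def using parity_space_mult[OF lin lin, of t "1 + t"] by simp
  have d: "?d \<in> parity_space True" using normal_parity \<theta> by blast
  obtain H where H: "H \<in> parity_space True" "pdiff (X 0) H = \<theta>" "pdiff (Y 0) H = 0"
    using antiderivative_odd_x[OF \<theta>] .
  have dy: "pdiff (Y 0) ?d = 0"
    using pdiff_commute[of "Y 0" "X 0" \<theta>] pdiff_Y_odd_x[OF \<theta>] by simp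
  have u: "\<phi> (symt n ((\<lambda>_. q s)(j := ?d))) = \<phi> (symt n ((\<lambda>_. q t)(j := ?d)))" if j: "j < n" for j
  proof (rule poly_locally_stationary[where u = "\<lambda>t. \<phi> (symt n ((\<lambda>_. q t)(j := ?d)))"])
    fix t0
    let ?B = "br H (q t0)"
    have B: "?B \<in> parity_space True" using br_even H q by blast
    \<comment> \<open>The polynomial with coefficients \<open>q t0\<close>, {H, \<open>q t0\<close>}
      and \<theta>^2 is exactly \<open>q (t0 + t)\<close> in powers of t; slot j keeps the constant
      direction.\<close>
    define c where "c = (\<lambda>i. if i = j then [:?d:] else [:q t0, ?B, \<theta> ^ 2:])"
    have cV: "coeff (c i) k \<in> parity_space True" for i k
      using d q B square_parity[OF \<theta>o] by (auto simp: c_def coeff_pCons split: nat.splits)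
    obtain U where U: "\<forall>t. poly U t = \<phi> (symt n (\<lambda>i. poly (c i) (Const t)))"
      "coeff U 1 = (\<Sum>k<n. \<phi> (symt n ((\<lambda>i. coeff (c i) 0)(k := coeff (c k) 1))))"
      using sml_curve[OF symt_form subspace_parity_space, where c = c, OF cV] by (elim exE conjE)
    have "poly [:q t0, ?B, \<theta> ^ 2:] (Const t) = q (t0 + t)" for t
    proof -
      define a b where "a = yv + Const t0 * \<theta>" and "b = yv + Const (1 + t0) * \<theta>"
      have "pdiff (Y 0) (q t0) = b + a"
        by (simp add: q_def a_def b_def pdiff_Y_odd_x[OF \<theta>])
      then have "?B = \<theta> * (b + a)" by (simp add: br_def H)
      moreover have "q t0 = a * b" by (simp add: q_def a_def b_def)
      moreover have "q (t0 + t) = (a + Const t * \<theta>) * (b + Const t * \<theta>)"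
        by (simp add: q_def a_def b_def Const_add ring_distribs add.assoc)
      ultimately show ?thesis by (simp add: algebra_simps power2_eq_square)
    qed
    then have "(\<lambda>i. poly (c i) (Const t)) = (\<lambda>_. q (t0 + t))(j := ?d)" for t
      by (auto simp: c_def fun_eq_iff)
    then have "poly U t = \<phi> (symt n ((\<lambda>_. q (t0 + t))(j := ?d)))" for t using U(1) by simp
    moreover have "coeff U 1 = 0"
    proof -
      let ?a = "(\<lambda>_. q t0)(j := ?d)"
      have "(\<lambda>i. coeff (c i) 0)(k := coeff (c k) 1) = ?a(k := br H (?a k))" for k
        by (auto simp: c_def fun_eq_iff br_def H dy)
      then show ?thesis
        unfolding U(2) using symt_form_invariant[OF H(1), of ?a] q d by simp
    qed
    ultimately show "\<exists>U. (\<forall>t. poly U t = \<phi> (symt n ((\<lambda>_. q (t0 + t))(j := ?d)))) \<and> coeff U 1 = 0" by blast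
  qed
  have "fact n * \<phi> (dpw n (q s) ?d) = fact n * \<phi> (dpw n (q t) ?d)"
    unfolding symt_form_dpw[OF q d, symmetric] using u by (intro sum.cong) auto
  then show ?thesis by simp
qed

text \<open>Multiplying one factor by \<open>1 + \<epsilon> l\<close> and the other by \<open>1 - \<epsilon> l\<close> does not change the product
  \<open>f g\<close> to first order and changes \<open>{f, g}\<close> by \<open>{l, f g}\<close>, an infinitesimal symmetry. Together with the
  Hamiltonian \<open>h\<close> it can be arranged to fix the first factor \<open>y\<close>.\<close>

definition gauge_ops :: "(opoly \<Rightarrow> opoly) set" where
  "gauge_ops = {\<lambda>g. br h g - l * g | h l. h \<in> parity_space True \<and> l \<in> parity_space True \<and> pdiff (X 0) h = - (l * yv)}"

text \<open>With dh/dx = - l y the operator sends y to -2 l y. So the operators reach every odd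
  multiple of y, and what remains is an odd polynomial in x.\<close>

lemma gauge_decomp:
  assumes "v \<in> parity_space False"
  shows "\<exists>X\<in>gauge_ops. \<exists>\<nu>\<in>odd_x. v = X yv + \<nu>"
proof -
  have "\<exists>l\<in>parity_space True. \<exists>\<nu>\<in>odd_x. v = Const (- 2) * (l * yv) + \<nu>"
    using assms
  proof (induction rule: parity_space_induct)
    case zero
    show ?case using cp.subspace_0[OF subspace_odd_x] by (intro bexI[of _ 0]) auto
  next
    case (step c a b q)
    then obtain l \<nu> where l: "l \<in> parity_space True" "\<nu> \<in> odd_x" "q = Const (- 2) * (l * yv) + \<nu>" by blast
    show ?case
    proof (cases b)
      case 0
      then obtain i where "a = 2 * i + 1" using step(1) by (auto elim: oddE)
      then have "Const c * xymon a b \<in> odd_x"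
        using 0 unfolding odd_x_def by (intro cp.span_scale cp.span_base) auto
      then have "Const c * xymon a b + \<nu> \<in> odd_x" using l cp.subspace_add[OF subspace_odd_x] by blast
      then show ?thesis using l by (intro bexI[of _ l] bexI[of _ "Const c * xymon a b + \<nu>"]) (auto simp: algebra_simps)
    next
      case (Suc b')
      have "xymon a b' \<in> parity_space True" using step(1) Suc by (intro xymon_in_parity_space) auto
      then have k: "Const (- c / 2) * xymon a b' + l \<in> parity_space True"
        using l by (intro parity_space_add parity_space_scale)
      have "Const c * xymon a b = Const (- 2 * (- c / 2)) * (xymon a b' * yv)"
        by (simp add: Suc xymon_def mult_ac)
      also have "\<dots> = Const (- 2) * (Const (- c / 2) * xymon a b' * yv)"
        by (simp only: Const_mult mult.assoc)
      finally have "Const c * xymon a b + q = Const (- 2) * ((Const (- c / 2) * xymon a b' + l) * yv) + \<nu>"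
        using l(3) by (simp only: ring_distribs add.assoc)
      with k l(2) show ?thesis by blast
    qed
  qed
  then obtain l \<nu> where l: "l \<in> parity_space True" "\<nu> \<in> odd_x" "v = Const (- 2) * (l * yv) + \<nu>" by blast
  have "- (l * yv) \<in> parity_space (\<not> True)"
    using parity_space_mult[OF l(1) Var_in_parity_space(2)] by (auto intro: parity_space_uminus)
  then obtain h where h: "h \<in> parity_space True" "pdiff (X 0) h = - (l * yv)" by (rule antiderivative_x)
  have "br h yv - l * yv = Const (- 2) * (l * yv)"
    by (simp add: br_def h Const_uminus algebra_simps)
  with l h show ?thesis unfolding gauge_ops_def by force
qed

text \<open>The first factor is held at y and the slice argument is applied to g with the gauge
  operators. At g = y + \<theta> the bracket is, up to sign, the derivative at y (y + \<theta>)
  along d\<theta>/dx, and a shear by half of \<theta> makes this product a difference of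
  squares.\<close>

lemma bracket_with_y_vanish:
  assumes kappa: "kappa_free n \<phi>" and g: "g \<in> parity_space False"
  shows "\<phi> (poisson n (pw n yv) (pw n g)) = 0"
proof -
  note lin = HP0_B_D(1)[OF \<phi>]
  note F = symt_form
  let ?S = "\<lambda>a. \<phi> (symt n a)"
  define L where "L = (\<lambda>b. \<phi> (poisson n (pw n yv) (symt n b)))"
  have yodd: "pw n yv \<in> sym_power n False" by (simp add: pw_in_sym_power)
  have L_sml: "sym_multilinear n (parity_space False) L"
    unfolding L_def
    by (rule symt_sml[OF lin_on_poisson'[OF lin] subspace_sym_power subspace_parity_space symt_in_sym_power])
      (use poisson_sym_power[OF yodd, where e' = False] in simp)
  have yb: "yv * f \<in> parity_space True" if "f \<in> parity_space False" for f
    using parity_space_mult[OF Var_in_parity_space(2) that] by simp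
  have yd: "br yv f \<in> parity_space True" if "f \<in> parity_space False" for f
    using br_parity_space[OF Var_in_parity_space(2) that] by simp
  have L_eq: "L b = (\<Sum>j<n. ?S ((\<lambda>i. yv * b i)(j := br yv (b j))))" if b: "\<And>i. b i \<in> parity_space False" for b
  proof -
    have "poisson n (pw n yv) (symt n b) = (\<Sum>j<n. symt n ((\<lambda>i. yv * b i)(j := br yv (b j))))"
      using b parity_space_indets by (intro poisson_pw_symt) (auto simp: plane_def)
    then show ?thesis unfolding L_def
      by (simp only:) (rule lin_on_sum[OF lin subspace_sym_power], use b yb yd in \<open>auto intro!: symt_in_sym_power\<close>)
  qed
  have "L (\<lambda>_. g) = 0"
  proof (rule sml_slice[where \<S> = "{L, \<lambda>_. 0}" and V = "parity_space False" and N = odd_x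
        and e = yv and ops = gauge_ops and n = n and S = L])
    show "sym_multilinear n (parity_space False) S" if "S \<in> {L, \<lambda>_. 0}" for S
      using that L_sml sml_zero_form by blast
    show "X v \<in> parity_space False" if X: "X \<in> gauge_ops" and v: "v \<in> parity_space False" for X v
      using X v unfolding gauge_ops_def by (auto intro!: parity_space_diff br_even parity_space_mult_even)
    show "v \<in> odd_x \<or> (\<exists>X\<in>gauge_ops. \<exists>\<nu>\<in>odd_x. v = X yv + \<nu>)" if "v \<in> parity_space False" for v
      using gauge_decomp[OF that] by blast
    show "S (\<lambda>_. yv + \<theta>) = 0" if S: "S \<in> {L, \<lambda>_. 0}" and \<theta>: "\<theta> \<in> odd_x" for S \<theta>
    proof -
      let ?d = "pdiff (X 0) \<theta>"
      have yt: "yv + \<theta> \<in> parity_space False" using \<theta> odd_x_parity by (intro parity_space_add) auto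
      let ?q = "\<lambda>t. (yv + Const t * \<theta>) * (yv + Const (1 + t) * \<theta>)"
      have "\<phi> (dpw n (?q 0) ?d) = \<phi> (dpw n (?q (- 1 / 2)) ?d)" by (rule shear_invariance[OF \<theta>])
      also have "\<dots> = 0"
      proof -
        \<comment> \<open>The sheared product is y^2 - (\<theta>/2)^2, which is y^2 plus the square
          of i \<theta>/2. This rescaled \<theta> is where \<open>kappa_free\<close> is
          applied.\<close>
        let ?\<theta> = "Const (\<i> / 2) * \<theta>"
        have t: "?\<theta> \<in> odd_x" using \<theta> cp.subspace_scale[OF subspace_odd_x] by blast
        have "?q (- 1 / 2) = (yv - Const (1 / 2) * \<theta>) * (yv + Const (1 / 2) * \<theta>)"
          using Const_uminus[of "1 / 2"] by simp
        also have "\<dots> = yv ^ 2 - (Const (1 / 2) * \<theta>) ^ 2" by (simp add: algebra_simps power2_eq_square)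
        also have "(Const (1 / 2) * \<theta>) ^ 2 = - (?\<theta> ^ 2)"
        proof -
          have "?\<theta> = Const \<i> * (Const (1 / 2) * \<theta>)"
            by (simp only: mult.assoc[symmetric] Const_mult[symmetric]) simp
          then have "?\<theta> ^ 2 = Const \<i> ^ 2 * (Const (1 / 2) * \<theta>) ^ 2" by (simp only: power_mult_distrib)
          then show ?thesis by (simp only: Const_power[symmetric] power2_i Const_uminus Const_1) simp
        qed
        finally have q: "?q (- 1 / 2) = yv ^ 2 + ?\<theta> ^ 2" by simp
        have "0 = \<phi> (dpw n (yv ^ 2 + ?\<theta> ^ 2) (pdiff (X 0) ?\<theta>))"
          using kappa[unfolded kappa_free_def, THEN bspec, OF t] by (simp only:)
        also have "\<dots> = \<i> / 2 * \<phi> (dpw n (yv ^ 2 + ?\<theta> ^ 2) ?d)"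
          using lin_onD(2)[OF lin dpw_even[OF normal_parity(1)[OF t] normal_parity(2)[OF \<theta>]]]
          by (simp add: dpw_scale)
        finally show ?thesis unfolding q by simp
      qed
      finally have z: "\<phi> (dpw n (?q 0) ?d) = 0" .
      have "poisson n (pw n yv) (symt n (\<lambda>_. yv + \<theta>)) = Const (fact n) * dpw n (yv * (yv + \<theta>)) (br yv (yv + \<theta>))"
        using parity_space_indets[OF yt] by (simp add: symt_const poisson_scale_right poisson_pw_pw plane_def)
      also have "br yv (yv + \<theta>) = Const (- 1) * ?d" by (simp add: br_def Const_uminus)
      finally have "L (\<lambda>_. yv + \<theta>) = \<phi> (Const (fact n) * (Const (- 1) * dpw n (?q 0) ?d))"
        by (simp only: L_def dpw_scale) simp
      also have "\<dots> = 0"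
      proof -
        have "dpw n (?q 0) ?d \<in> sym_power n True"
          by (rule dpw_even) (use yb[OF yt] normal_parity(2)[OF \<theta>] in auto)
        then show ?thesis by (simp only: lin_onD(2)[OF lin] sym_power_scale z mult_zero_right)
      qed
      finally show ?thesis using S by auto
    qed
    show "\<exists>S'\<in>{L, \<lambda>_. 0}. \<forall>a. (\<forall>i. a i \<in> parity_space False) \<longrightarrow> S' a = (\<Sum>j<n. S (a(j := Z (a j))))"
      if X: "Z \<in> gauge_ops" and S: "S \<in> {L, \<lambda>_. 0}" for Z S
    proof -
      obtain h l where h: "h \<in> parity_space True" and l: "l \<in> parity_space True"
        and hx: "pdiff (X 0) h = - (l * yv)" and Xdef: "Z = (\<lambda>g. br h g - l * g)"
        using X unfolding gauge_ops_def by blast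
      have y1: "yv * Z g = br h (yv * g)" for g
        by (simp add: Xdef br_def hx algebra_simps)
      \<comment> \<open>By the Jacobi identity: the product y g moves by {h, -} alone, while the
        bracket {y, g} moves by {h, -} and the extra term {l, y g}. Summed over the slots, both
        contributions vanish by invariance under h and under l.\<close>
      have y2: "br yv (Z g) = br h (br yv g) + br l (yv * g)" for g
        by (simp add: Xdef br_def hx pdiff_commute[of "X 0" "Y 0"] algebra_simps)
      have "(\<Sum>k<n. L (b(k := Z (b k)))) = 0" if b: "\<And>i. b i \<in> parity_space False" for b
      proof -
        have Xb: "Z (b i) \<in> parity_space False" for i
          using h l b unfolding Xdef by (auto intro!: parity_space_diff br_even parity_space_mult_even)
        define M where "M = (\<lambda>i. yv * b i)"
        define c where "c = (\<lambda>j. M(j := br yv (b j)))"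
        have M: "M i \<in> parity_space True" for i using b yb by (simp add: M_def)
        have c: "c j i \<in> parity_space True" for i j using M yd b by (simp add: c_def)
        have "L (b(k := Z (b k))) = (\<Sum>j<n. ?S ((c j)(k := br h (c j k))) +
            (if j = k then ?S (M(k := br l (M k))) else 0))" if k: "k < n" for k
        proof -
          have bk: "(b(k := Z (b k))) i \<in> parity_space False" for i using b Xb by simp
          show ?thesis unfolding L_eq[OF bk]
          proof (intro sum.cong refl)
            fix j assume j: "j \<in> {..<n}"
            let ?a = "(\<lambda>i. yv * (b(k := Z (b k))) i)(j := br yv ((b(k := Z (b k))) j))"
            show "?S ?a = ?S ((c j)(k := br h (c j k))) + (if j = k then ?S (M(k := br l (M k))) else 0)"
            proof (cases "j = k")
              case True
              have "?a = M(k := br h (br yv (b k)) + br l (M k))"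
                using True by (auto simp: fun_eq_iff M_def y2)
              moreover have "?S (M(k := br h (br yv (b k)) + br l (M k))) =
                ?S (M(k := br h (br yv (b k)))) + ?S (M(k := br l (M k)))"
                by (rule sml_add[OF F M k]) (use h l M yd b br_even in auto)
              moreover have "(c j)(k := br h (c j k)) = M(k := br h (br yv (b k)))"
                using True by (auto simp: c_def)
              ultimately show ?thesis using True by (simp only: if_True refl)
            next
              case False
              then have "?a = (c j)(k := br h (c j k))"
                by (auto simp: fun_eq_iff c_def M_def y1)
              then show ?thesis using False by (simp only: if_False add_0_right refl)
            qed
          qed
        qed
        then have "(\<Sum>k<n. L (b(k := Z (b k)))) = (\<Sum>k<n. (\<Sum>j<n. ?S ((c j)(k := br h (c j k))) +
            (if j = k then ?S (M(k := br l (M k))) else 0)))"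
          by (intro sum.cong refl) (simp only: lessThan_iff)
        also have "\<dots> = (\<Sum>j<n. \<Sum>k<n. ?S ((c j)(k := br h (c j k)))) + (\<Sum>k<n. ?S (M(k := br l (M k))))"
          unfolding sum.distrib by (subst sum.swap) (simp add: sum.delta del: fun_upd_apply)
        also have "\<dots> = 0"
          using symt_form_invariant[OF h, of "c j" for j] symt_form_invariant[OF l, of M] c M by simp
        finally show ?thesis .
      qed
      then have "\<forall>a. (\<forall>i. a i \<in> parity_space False) \<longrightarrow> (\<lambda>_. 0) a = (\<Sum>j<n. S (a(j := Z (a j))))"
        using S by auto
      then show ?thesis by (intro bexI[of _ "\<lambda>_. 0"]) auto
    qed
  qed (use g odd_x_parity in auto)
  then have "\<phi> (Const (fact n) * poisson n (pw n yv) (pw n g)) = 0"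
    by (simp add: L_def symt_const poisson_scale_right)
  then show ?thesis
    using lin_onD(2)[OF lin, of "poisson n (pw n yv) (pw n g)" "fact n"]
      poisson_sym_power[OF yodd pw_in_sym_power[OF g]] by simp
qed

text \<open>The second argument q of the bracket stays free, so that the first one can be moved to y
  by the one-point slice for odd functions; there \<open>bracket_with_y_vanish\<close>
  applies.\<close>

lemma kappa_free_imp_odd_bracket_free:
  assumes kappa: "kappa_free n \<phi>"
  shows "odd_bracket_free n \<phi>"
  unfolding odd_bracket_free_def
proof (intro conjI ballI)
  note lin = HP0_B_D(1)[OF \<phi>]
  fix f g assume f: "f \<in> parity_space False" and g: "g \<in> parity_space False"
  let ?F = "\<lambda>q p. \<phi> (poisson n p q)"
  have mem: "poisson n p q \<in> sym_power n True" if "p \<in> sym_power n False" "q \<in> sym_power n False" for p q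
    using poisson_sym_power[OF that] by simp
  show "\<phi> (poisson n (pw n f) (pw n g)) = 0"
  proof (rule odd_slice[where \<F> = "?F ` sym_power n False" and n = n and \<phi> = "?F (pw n g)" and p = "pw n f"])
    show "lin_on (sym_power n False) \<chi>" if "\<chi> \<in> ?F ` sym_power n False" for \<chi>
      using that lin_on_poisson[OF lin mem] by blast
    show "\<exists>\<chi>'\<in>?F ` sym_power n False. \<forall>p\<in>sym_power n False. \<chi>' p = \<chi> (poisson n (psum n h) p)"
      if \<chi>: "\<chi> \<in> ?F ` sym_power n False" and h: "h \<in> parity_space True" for \<chi> h
    proof -
      obtain q where q: "q \<in> sym_power n False" "\<chi> = ?F q" using \<chi> by blast
      \<comment> \<open>Invariance of \<phi> and the Jacobi identity move the derivation by
        \<open>psum n h\<close> from one argument of the bracket to the other at the cost of a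
        sign.\<close>
      let ?q = "Const (- 1) * poisson n (psum n h) q"
      have q': "?q \<in> sym_power n False" using psum_sym_power[OF h q(1)] by (rule sym_power_scale)
      have "?F ?q p = \<chi> (poisson n (psum n h) p)" if p: "p \<in> sym_power n False" for p
      proof -
        have 1: "poisson n (psum n h) p \<in> sym_power n False" "poisson n (psum n h) q \<in> sym_power n False"
          using psum_sym_power[OF h] p q by auto
        have "0 = \<phi> (poisson n (psum n h) (poisson n p q))"
          using HP0_B_D(2)[OF \<phi>] psum_in_sym_power[OF h] mem[OF p q(1)] by simp
        also have "\<dots> = \<phi> (poisson n (poisson n (psum n h) p) q) + \<phi> (poisson n p (poisson n (psum n h) q))"
          unfolding poisson_jacobi[of n "psum n h"]
          by (rule lin_onD(1)[OF lin]) (use 1 p q mem in blast)+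
        finally have "\<chi> (poisson n (psum n h) p) = - \<phi> (poisson n p (poisson n (psum n h) q))"
          unfolding q(2) by (simp add: eq_neg_iff_add_eq_0)
        then show ?thesis
          using lin_onD(2)[OF lin mem[OF p 1(2)], of "- 1"]
            by (simp only: poisson_scale_right) simp
      qed
      then have "\<forall>p\<in>sym_power n False. ?F ?q p = \<chi> (poisson n (psum n h) p)" by (intro ballI)
      moreover have "?F ?q \<in> ?F ` sym_power n False" using q' by (rule imageI)
      ultimately show ?thesis by (rule bexI)
    qed
    show "\<chi> (pw n yv) = 0" if \<chi>: "\<chi> \<in> ?F ` sym_power n False" for \<chi>
    proof -
      obtain q where q: "q \<in> sym_power n False" "\<chi> = ?F q" using \<chi> by blast
      have "lin_on (sym_power n False) (\<lambda>q. \<phi> (poisson n (pw n yv) q))"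
        by (rule lin_on_poisson'[OF lin]) (rule mem[OF pw_in_sym_power[OF Var_in_parity_space(2)]])
      then have "(\<lambda>q. \<phi> (poisson n (pw n yv) q)) q = (\<lambda>_. 0) q"
        by (intro lin_on_eq_span[where B = "pw n ` parity_space False" and p = q
            and f = "\<lambda>q. \<phi> (poisson n (pw n yv) q)" and g = "\<lambda>_. 0"])
          (use q bracket_with_y_vanish[OF kappa] in \<open>auto simp: sym_power_def lin_on_def\<close>)
      then show ?thesis by (simp add: q)
    qed
  qed (use f g pw_in_sym_power in auto)
qed (rule \<phi>)

end

section \<open>Products of functionals\<close>

lemma lookup_scale: "Poly_Mapping.lookup (Const c * p) k = c * Poly_Mapping.lookup p k"
proof -
  have "Const c * p = Poly_Mapping.map ((*) c) p"
    by (simp add: Const_def mult_map_scale_conv_mult)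
  then show ?thesis by (simp add: Poly_Mapping.map.rep_eq when_def)
qed

text \<open>Needed because the external product is defined on monomials, which in general do not lie
  in the symmetric powers.\<close>

lemma lin_on_extend:
  assumes "lin_on A \<phi>" "cp.subspace A"
  shows "\<exists>\<phi>'. lin_on UNIV \<phi>' \<and> (\<forall>p\<in>A. \<phi>' p = \<phi> p)"
proof -
  obtain B where B: "B \<subseteq> A" "cp.independent B" "A \<subseteq> cp.span B"
    using cp.maximal_independent_subset[of A] by blast
  from cpc.linear_independent_extend[OF B(2), of \<phi>]
  obtain g where g: "Vector_Spaces.linear scal (*) g" "\<And>x. x \<in> B \<Longrightarrow> g x = \<phi> x" by blast
  then have lin: "lin_on UNIV g" by (auto simp: lin_on_def Vector_Spaces.linear_iff)
  have "cp.span B \<subseteq> A" using B assms(2) by (simp add: cp.span_minimal)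
  then have "g p = \<phi> p" if "p \<in> A" for p
    using lin_on_eq_span[of B g \<phi> p] lin_on_subset[OF lin] lin_on_subset[OF assms(1)] g(2) B(3) that by auto
  with lin show ?thesis by (intro exI[of _ g]) simp
qed

lemma tens_append:
  "tens m a * shift m (tens n b) = tens (m + n) (\<lambda>i. if i < m then a i else b (i - m))"
proof -
  have "shift m (tens n b) = (\<Prod>i<n. shift (i + m) (b i))" by (simp add: tens_def shift_shift)
  also have "\<dots> = (\<Prod>i\<in>{m..<m + n}. shift i (b (i - m)))"
    by (rule prod.reindex_bij_witness[of _ "\<lambda>i. i - m" "\<lambda>i. i + m"]) auto
  finally have "tens m a * shift m (tens n b) = (\<Prod>i\<in>{..<m}. shift i (if i < m then a i else b (i - m))) *
      (\<Prod>i\<in>{m..<m + n}. shift i (if i < m then a i else b (i - m)))"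
    by (simp add: tens_def)
  also have "\<dots> = tens (m + n) (\<lambda>i. if i < m then a i else b (i - m))"
    unfolding tens_def by (subst prod.union_disjoint[symmetric]) (auto intro!: prod.cong)
  finally show ?thesis .
qed

lemma pw_append: "pw m f * shift m (pw n f) = pw (m + n) f"
  by (simp add: tens_append)

lemma dpw_append:
  "dpw (m + n) f u = dpw m f u * shift m (pw n f) + pw m f * shift m (dpw n f u)"
proof -
  have "dpw (m + n) f u = (\<Sum>j\<in>{..<m}. tens (m + n) ((\<lambda>_. f)(j := u))) + (\<Sum>j\<in>{m..<m + n}. tens (m + n) ((\<lambda>_. f)(j := u)))"
    unfolding dpw_def by (subst sum.union_disjoint[symmetric]) (auto intro!: sum.cong)
  also have "(\<Sum>j\<in>{..<m}. tens (m + n) ((\<lambda>_. f)(j := u))) = dpw m f u * shift m (pw n f)"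
    unfolding dpw_def sum_distrib_right tens_append by (intro sum.cong tens_cong) auto
  also have "(\<Sum>j\<in>{m..<m + n}. tens (m + n) ((\<lambda>_. f)(j := u))) = (\<Sum>j<n. tens (m + n) ((\<lambda>_. f)(j + m := u)))"
    by (rule sum.reindex_bij_witness[of _ "\<lambda>i. i + m" "\<lambda>i. i - m"]) auto
  also have "\<dots> = pw m f * shift m (dpw n f u)"
    unfolding dpw_def shift_hom sum_distrib_left tens_append by (intro sum.cong tens_cong) auto
  finally show ?thesis .
qed

lemma mon_val_sum: "mon_val h (\<Sum>i\<in>I. m i) = (\<Prod>i\<in>I. mon_val h (m i))"
  by (induction I rule: infinite_finite_induct) (auto simp: mon_val_add)

lemma tens_xymon:
  "\<exists>\<mu>. tens n (\<lambda>i. xymon (a i) (b i)) = mon_val Var \<mu> \<and>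
    (\<forall>i<n. Poly_Mapping.lookup \<mu> (X i) = a i \<and> Poly_Mapping.lookup \<mu> (Y i) = b i)"
proof -
  let ?\<mu> = "\<Sum>i<n. Poly_Mapping.single (X i) (a i) + Poly_Mapping.single (Y i) (b i)"
  have "tens n (\<lambda>i. xymon (a i) (b i)) = mon_val Var ?\<mu>"
    by (simp add: mon_val_sum mon_val_add tens_def xymon_def)
  moreover have "Poly_Mapping.lookup ?\<mu> (X i) = a i" "Poly_Mapping.lookup ?\<mu> (Y i) = b i" if "i < n" for i
    using that by (simp_all add: lookup_sum lookup_add lookup_single when_def sum.delta)
  ultimately show ?thesis by (intro exI[of _ ?\<mu>]) simp
qed

lemma lin_on_sum_UNIV: "lin_on UNIV f \<Longrightarrow> f (\<Sum>i\<in>I. Const (c i) * g i) = (\<Sum>i\<in>I. c i * f (g i))"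
  by (rule lin_on_sum_scale) auto

text \<open>Defined on monomials by separating the first m pairs of variables from the next n. A
  linear functional with these values shows that \<open>boxtimes\<close> is independent of the
  chosen sum of products.\<close>

lemma external_product:
  assumes \<phi>: "lin_on UNIV \<phi>" and \<psi>: "lin_on UNIV \<psi>"
  shows "\<exists>\<Lambda>. lin_on UNIV \<Lambda> \<and> (\<forall>G\<in>polys m. \<forall>H\<in>polys n. \<Lambda> (G * shift m H) = \<phi> G * \<psi> H)"
proof -
  let ?v = "\<lambda>\<mu>. \<phi> (tens m (mon_tuple \<mu>)) * \<psi> (tens n (\<lambda>i. mon_tuple \<mu> (i + m)))"
  define \<Lambda> where "\<Lambda> = (\<lambda>p. \<Sum>\<mu>\<in>Poly_Mapping.keys p. Poly_Mapping.lookup p \<mu> * ?v \<mu>)"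
  have sup: "\<Lambda> p = (\<Sum>\<mu>\<in>K. Poly_Mapping.lookup p \<mu> * ?v \<mu>)" if "finite K" "Poly_Mapping.keys p \<subseteq> K" for p K
    unfolding \<Lambda>_def by (rule sum.mono_neutral_left) (use that in \<open>auto simp: in_keys_iff\<close>)
  have lin: "lin_on UNIV \<Lambda>"
    unfolding lin_on_def
  proof (intro conjI ballI allI)
    fix p q :: opoly and c
    let ?K = "Poly_Mapping.keys p \<union> Poly_Mapping.keys q"
    show "\<Lambda> (p + q) = \<Lambda> p + \<Lambda> q"
      using sup[of ?K p] sup[of ?K q] sup[of ?K "p + q"] Poly_Mapping.keys_add[of p q]
      by (simp add: lookup_add ring_distribs sum.distrib)
    note l = lookup_scale[of c p]
    have "Poly_Mapping.keys (Const c * p) \<subseteq> Poly_Mapping.keys p" by (auto simp: in_keys_iff l)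
    then have "\<Lambda> (Const c * p) = (\<Sum>\<mu>\<in>Poly_Mapping.keys p. Poly_Mapping.lookup (Const c * p) \<mu> * ?v \<mu>)"
      by (intro sup) auto
    also have "\<dots> = c * \<Lambda> p"
      unfolding l \<Lambda>_def sum_distrib_left by (simp only: mult.assoc)
    finally show "\<Lambda> (Const c * p) = c * \<Lambda> p" .
  qed
  have mono: "\<Lambda> (tens (m + n) (\<lambda>i. xymon (a i) (b i))) =
      \<phi> (tens m (\<lambda>i. xymon (a i) (b i))) * \<psi> (tens n (\<lambda>i. xymon (a (i + m)) (b (i + m))))" for a b
  proof -
    obtain \<mu> where \<mu>: "tens (m + n) (\<lambda>i. xymon (a i) (b i)) = mon_val Var \<mu>"
      "\<forall>i<m + n. Poly_Mapping.lookup \<mu> (X i) = a i \<and> Poly_Mapping.lookup \<mu> (Y i) = b i"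
      using tens_xymon[of "m + n" a b] by (elim exE conjE)
    have "tens m (mon_tuple \<mu>) = tens m (\<lambda>i. xymon (a i) (b i))"
      "tens n (\<lambda>i. mon_tuple \<mu> (i + m)) = tens n (\<lambda>i. xymon (a (i + m)) (b (i + m)))"
      by (rule tens_cong, simp add: \<mu>)+
    then show ?thesis by (simp add: \<mu>(1) Var_mon_val \<Lambda>_def)
  qed
  have "\<Lambda> (G * shift m H) = \<phi> G * \<psi> H" if G: "G \<in> polys m" and H: "H \<in> polys n" for G H
  proof -
    let ?g = "\<lambda>k. Poly_Mapping.lookup G k" and ?h = "\<lambda>k. Poly_Mapping.lookup H k"
    have one: "\<Lambda> (tens m (mon_tuple k) * shift m (tens n (mon_tuple k'))) = \<phi> (tens m (mon_tuple k)) * \<psi> (tens n (mon_tuple k'))" for k k'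
    proof -
      let ?a = "\<lambda>i. if i < m then Poly_Mapping.lookup k (X i) else Poly_Mapping.lookup k' (X (i - m))"
      let ?b = "\<lambda>i. if i < m then Poly_Mapping.lookup k (Y i) else Poly_Mapping.lookup k' (Y (i - m))"
      have "tens m (mon_tuple k) * shift m (tens n (mon_tuple k')) = tens (m + n) (\<lambda>i. xymon (?a i) (?b i))"
        unfolding tens_append by (rule tens_cong) simp
      moreover have "tens m (\<lambda>i. xymon (?a i) (?b i)) = tens m (mon_tuple k)"
        "tens n (\<lambda>i. xymon (?a (i + m)) (?b (i + m))) = tens n (mon_tuple k')"
        by (rule tens_cong, simp)+
      ultimately show ?thesis using mono[of ?a ?b] by simp
    qed
    have "G * shift m H = (\<Sum>k\<in>Poly_Mapping.keys G. \<Sum>k'\<in>Poly_Mapping.keys H.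
        Const (?g k) * tens m (mon_tuple k) * (Const (?h k') * shift m (tens n (mon_tuple k'))))"
      using arg_cong2[OF polys_expand[OF G] arg_cong[OF polys_expand[OF H], of "shift m"], of "(*)"]
      by (simp only: sum_product shift_hom)
    also have "\<dots> = (\<Sum>k\<in>Poly_Mapping.keys G. Const (?g k) * (\<Sum>k'\<in>Poly_Mapping.keys H.
        Const (?h k') * (tens m (mon_tuple k) * shift m (tens n (mon_tuple k')))))"
      by (simp add: sum_distrib_left mult_ac)
    finally have "\<Lambda> (G * shift m H) = (\<Sum>k\<in>Poly_Mapping.keys G. ?g k * (\<Sum>k'\<in>Poly_Mapping.keys H.
        ?h k' * (\<phi> (tens m (mon_tuple k)) * \<psi> (tens n (mon_tuple k')))))"
      by (simp only: lin_on_sum_UNIV[OF lin] one)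
    also have "\<dots> = (\<Sum>k\<in>Poly_Mapping.keys G. ?g k * \<phi> (tens m (mon_tuple k))) *
        (\<Sum>k'\<in>Poly_Mapping.keys H. ?h k' * \<psi> (tens n (mon_tuple k')))"
      unfolding sum_product by (simp only: sum_distrib_left mult_ac)
    also have "(\<Sum>k\<in>Poly_Mapping.keys G. ?g k * \<phi> (tens m (mon_tuple k))) = \<phi> G"
      using arg_cong[OF polys_expand[OF G], of \<phi>] by (simp only: lin_on_sum_UNIV[OF \<phi>])
    also have "(\<Sum>k'\<in>Poly_Mapping.keys H. ?h k' * \<psi> (tens n (mon_tuple k'))) = \<psi> H"
      using arg_cong[OF polys_expand[OF H], of \<psi>] by (simp only: lin_on_sum_UNIV[OF \<psi>])
    finally show ?thesis .
  qed
  note main = this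
  show ?thesis
    by (rule exI[of _ \<Lambda>], intro conjI ballI, rule lin, rule main)
qed

lemma sym_power_tensor_rep:
  assumes "F \<in> sym_power (m + n) True"
  shows "\<exists>(N::nat) G H. (\<forall>j<N. G j \<in> sym_power m True \<and> H j \<in> sym_power n True) \<and>
      F = (\<Sum>j<N. G j * shift m (H j))"
  using assms
proof (induction rule: sym_power_induct)
  case zero
  show ?case by (rule exI[of _ 0]) auto
next
  case (step c f q)
  then obtain N :: nat and G H where r: "\<forall>j<N. G j \<in> sym_power m True \<and> H j \<in> sym_power n True"
    "q = (\<Sum>j<N. G j * shift m (H j))" by blast
  let ?G = "G(N := Const c * pw m f)" and ?H = "H(N := pw n f)"
  have "\<forall>j<Suc N. ?G j \<in> sym_power m True \<and> ?H j \<in> sym_power n True"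
    using r(1) step(1) by (auto simp: less_Suc_eq pw_in_sym_power sym_power_scale)
  moreover have "Const c * pw (m + n) f + q = (\<Sum>j<Suc N. ?G j * shift m (?H j))"
    by (simp add: r(2) pw_append mult.assoc)
  ultimately show ?case by blast
qed

text \<open>The tensor power of order m + n splits into those of orders m and n. So on powers the
  product multiplies values, and on their derivatives it obeys the Leibniz rule; later arguments see
  the product only through these facts.\<close>

lemma fun_mult_props:
  assumes \<phi>: "lin_on (sym_power m True) \<phi>" and \<psi>: "lin_on (sym_power n True) \<psi>"
  shows "lin_on (sym_power (m + n) True) (fun_mult m n \<phi> \<psi>)"
    and "p \<notin> sym_power (m + n) True \<Longrightarrow> fun_mult m n \<phi> \<psi> p = 0"
    and "f \<in> parity_space True \<Longrightarrow> fun_mult m n \<phi> \<psi> (pw (m + n) f) = \<phi> (pw m f) * \<psi> (pw n f)"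
    and "f \<in> parity_space True \<Longrightarrow> u \<in> parity_space True \<Longrightarrow> fun_mult m n \<phi> \<psi> (dpw (m + n) f u) =
      \<phi> (dpw m f u) * \<psi> (pw n f) + \<phi> (pw m f) * \<psi> (dpw n f u)"
proof -
  obtain \<phi>' where \<phi>': "lin_on UNIV \<phi>'" "\<forall>p\<in>sym_power m True. \<phi>' p = \<phi> p"
    using lin_on_extend[OF \<phi> subspace_sym_power] by (elim exE conjE)
  obtain \<psi>' where \<psi>': "lin_on UNIV \<psi>'" "\<forall>p\<in>sym_power n True. \<psi>' p = \<psi> p"
    using lin_on_extend[OF \<psi> subspace_sym_power] by (elim exE conjE)
  obtain \<Lambda> where \<Lambda>: "lin_on UNIV \<Lambda>"
    "\<forall>G\<in>polys m. \<forall>H\<in>polys n. \<Lambda> (G * shift m H) = \<phi>' G * \<psi>' H"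
    using external_product[OF \<phi>'(1) \<psi>'(1), of m n] by (elim exE conjE)
  have \<Lambda>2: "\<Lambda> (G * shift m H) = \<phi> G * \<psi> H" if "G \<in> sym_power m True" "H \<in> sym_power n True" for G H
    using \<Lambda>(2) \<phi>'(2) \<psi>'(2) that by (simp add: sym_power_polys)
  have eq: "fun_mult m n \<phi> \<psi> F = \<Lambda> F" if F: "F \<in> sym_power (m + n) True" for F
  proof -
    have "boxtimes m n \<phi> \<psi> F = \<Lambda> F"
      unfolding boxtimes_def O_B_eq
    proof (rule the_equality)
      have rep: "\<Lambda> (\<Sum>j<N. G j * shift m (H j)) = (\<Sum>j<N. \<phi> (G j) * \<psi> (H j))"
        if "\<forall>j<N. G j \<in> sym_power m True \<and> H j \<in> sym_power n True" for N :: nat and G H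
        using lin_on_sum[OF \<Lambda>(1), of "{..<N}" "\<lambda>j. G j * shift m (H j)"] that by (simp add: \<Lambda>2)
      show "\<exists>(N::nat) G H. (\<forall>j<N. G j \<in> sym_power m True \<and> H j \<in> sym_power n True) \<and>
          F = (\<Sum>j<N. G j * shift m (H j)) \<and> \<Lambda> F = (\<Sum>j<N. \<phi> (G j) * \<psi> (H j))"
      proof -
        obtain N :: nat and G H where r: "\<forall>j<N. G j \<in> sym_power m True \<and> H j \<in> sym_power n True"
          "F = (\<Sum>j<N. G j * shift m (H j))"
          using sym_power_tensor_rep[OF F] by (elim exE conjE)
        show ?thesis
          by (rule exI[of _ N], rule exI[of _ G], rule exI[of _ H]) (use r rep[OF r(1)] in auto)
      qed
      show "c = \<Lambda> F" if "\<exists>(N::nat) G H. (\<forall>j<N. G j \<in> sym_power m True \<and> H j \<in> sym_power n True) \<and>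
          F = (\<Sum>j<N. G j * shift m (H j)) \<and> c = (\<Sum>j<N. \<phi> (G j) * \<psi> (H j))" for c
        using that by (elim exE conjE) (simp only: rep)
    qed
    then show ?thesis using F by (simp add: fun_mult_def restrict_functional_def O_B_eq)
  qed
  show "lin_on (sym_power (m + n) True) (fun_mult m n \<phi> \<psi>)"
    using \<Lambda>(1) by (simp add: lin_on_def eq sym_power_add sym_power_scale)
  show "p \<notin> sym_power (m + n) True \<Longrightarrow> fun_mult m n \<phi> \<psi> p = 0"
    by (simp add: fun_mult_def restrict_functional_def O_B_eq)
  show "fun_mult m n \<phi> \<psi> (pw (m + n) f) = \<phi> (pw m f) * \<psi> (pw n f)" if "f \<in> parity_space True"
    using that eq[of "pw (m + n) f"] \<Lambda>2[of "pw m f" "pw n f"] by (simp add: pw_in_sym_power pw_append)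
  show "fun_mult m n \<phi> \<psi> (dpw (m + n) f u) = \<phi> (dpw m f u) * \<psi> (pw n f) + \<phi> (pw m f) * \<psi> (dpw n f u)"
    if f: "f \<in> parity_space True" and u: "u \<in> parity_space True"
  proof -
    have "fun_mult m n \<phi> \<psi> (dpw (m + n) f u) = \<Lambda> (dpw m f u * shift m (pw n f) + pw m f * shift m (dpw n f u))"
      using eq[OF dpw_even[OF f u]] by (simp add: dpw_append)
    also have "\<dots> = \<Lambda> (dpw m f u * shift m (pw n f)) + \<Lambda> (pw m f * shift m (dpw n f u))"
      using lin_onD(1)[OF \<Lambda>(1)] by simp
    finally show ?thesis using f u by (simp add: \<Lambda>2 pw_in_sym_power dpw_even)
  qed
qed

lemma poisson_pw_dpw:
  assumes "f \<in> parity_space e" "g \<in> parity_space e"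
  shows "poisson n (pw n f) (pw n g) = dpw n (f * g) (br f g)" "f * g \<in> parity_space True" "br f g \<in> parity_space True"
  using poisson_pw_pw[OF parity_space_indets[OF assms(1)] parity_space_indets[OF assms(2)]]
    parity_space_mult[OF assms] br_parity_space[OF assms] by auto

text \<open>The bracket of two powers is a \<open>dpw\<close>, and by the Leibniz rule each summand
  contains the value of one of the two functionals at a bracket, which is 0.\<close>

lemma fun_mult_HP0:
  assumes \<phi>: "\<phi> \<in> HP0_dual m (O_B m)" and \<psi>: "\<psi> \<in> HP0_dual n (O_B n)"
  shows "fun_mult m n \<phi> \<psi> \<in> HP0_dual (m + n) (O_B (m + n))"
proof -
  note F = fun_mult_props[OF HP0_B_D(1)[OF \<phi>] HP0_B_D(1)[OF \<psi>]]
  show ?thesis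
  proof (rule HP0_B_I[OF F(1,2)])
    fix f g assume fg: "f \<in> parity_space True" "g \<in> parity_space True"
    have "\<phi> (dpw m (f * g) (br f g)) = 0" "\<psi> (dpw n (f * g) (br f g)) = 0"
      using HP0_B_D(2)[OF \<phi>, of "pw m f" "pw m g"] HP0_B_D(2)[OF \<psi>, of "pw n f" "pw n g"] fg
      by (simp_all add: pw_in_sym_power poisson_pw_dpw(1)[OF fg])
    then show "fun_mult m n \<phi> \<psi> (poisson (m + n) (pw (m + n) f) (pw (m + n) g)) = 0"
      using F(4)[OF poisson_pw_dpw(2,3)[OF fg]] by (simp add: poisson_pw_dpw(1)[OF fg])
  qed
qed

text \<open>The same Leibniz argument for odd f and g, whose product and bracket are even; this is
  what closes the type D part under multiplication.\<close>

lemma fun_mult_odd_bracket_free: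
  assumes \<phi>: "odd_bracket_free m \<phi>" and \<psi>: "odd_bracket_free n \<psi>"
  shows "odd_bracket_free (m + n) (fun_mult m n \<phi> \<psi>)"
  unfolding odd_bracket_free_def
proof (intro conjI ballI)
  have h: "\<phi> \<in> HP0_dual m (O_B m)" "\<psi> \<in> HP0_dual n (O_B n)" using assms by (auto simp: odd_bracket_free_def)
  then show "fun_mult m n \<phi> \<psi> \<in> HP0_dual (m + n) (O_B (m + n))" by (rule fun_mult_HP0)
  note F = fun_mult_props[OF HP0_B_D(1)[OF h(1)] HP0_B_D(1)[OF h(2)]]
  fix f g assume fg: "f \<in> parity_space False" "g \<in> parity_space False"
  have "\<phi> (dpw m (f * g) (br f g)) = 0" "\<psi> (dpw n (f * g) (br f g)) = 0"
    using assms fg unfolding odd_bracket_free_def poisson_pw_dpw(1)[OF fg, symmetric] by blast+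
  then show "fun_mult m n \<phi> \<psi> (poisson (m + n) (pw (m + n) f) (pw (m + n) g)) = 0"
    using F(4)[OF poisson_pw_dpw(2,3)[OF fg]] by (simp add: poisson_pw_dpw(1)[OF fg])
qed

lemma lin_on_zero_fun: "lin_on A (\<lambda>_. 0)" by (simp add: lin_on_def)

lemma lin_on_pw_eq:
  assumes "lin_on (sym_power n e) \<phi>" "lin_on (sym_power n e) \<psi>"
    "\<And>f. f \<in> parity_space e \<Longrightarrow> \<phi> (pw n f) = \<psi> (pw n f)" "p \<in> sym_power n e"
  shows "\<phi> p = \<psi> p"
  using lin_on_eq_span[of "pw n ` parity_space e" \<phi> \<psi> p] assms by (auto simp: sym_power_def)

lemma fun_mult_zero:
  assumes "lin_on (sym_power m True) \<phi>" "lin_on (sym_power n True) \<psi>" "\<phi> = (\<lambda>_. 0) \<or> \<psi> = (\<lambda>_. 0)"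
  shows "fun_mult m n \<phi> \<psi> = (\<lambda>_. 0)"
proof
  fix p
  note F = fun_mult_props[OF assms(1,2)]
  show "fun_mult m n \<phi> \<psi> p = 0"
  proof (cases "p \<in> sym_power (m + n) True")
    case True
    show ?thesis
      by (rule lin_on_pw_eq[OF F(1) lin_on_zero_fun _ True]) (use F(3) assms(3) in auto)
  qed (rule F(2))
qed

lemma gmult_gin:
  assumes \<phi>: "lin_on (sym_power i True) \<phi>" and \<psi>: "lin_on (sym_power n True) \<psi>"
  shows "gmult (gin i \<phi>) (gin n \<psi>) = gin (i + n) (fun_mult i n \<phi> \<psi>)"
proof (intro ext)
  fix N p
  have z: "fun_mult m (N - m) (gin i \<phi> m) (gin n \<psi> (N - m)) = (\<lambda>_. 0)" if "m \<noteq> i \<or> N - m \<noteq> n" for m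
  proof (rule fun_mult_zero)
    show "lin_on (sym_power m True) (gin i \<phi> m)"
      using \<phi> lin_on_zero_fun by (cases "m = i") (simp_all add: gin_def)
    show "lin_on (sym_power (N - m) True) (gin n \<psi> (N - m))"
      using \<psi> lin_on_zero_fun by (cases "N - m = n") (simp_all add: gin_def)
    show "gin i \<phi> m = (\<lambda>_. 0) \<or> gin n \<psi> (N - m) = (\<lambda>_. 0)"
      using that by (cases "m = i") (simp_all add: gin_def)
  qed
  have "gmult (gin i \<phi>) (gin n \<psi>) N p = (\<Sum>m\<le>N. if m = i \<and> N = i + n then fun_mult i n \<phi> \<psi> p else 0)"
    unfolding gmult_def
  proof (intro sum.cong refl)
    fix m assume m: "m \<in> {..N}"
    show "fun_mult m (N - m) (gin i \<phi> m) (gin n \<psi> (N - m)) p = (if m = i \<and> N = i + n then fun_mult i n \<phi> \<psi> p else 0)"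
    proof (cases "m = i \<and> N - m = n")
      case True
      then show ?thesis using m by (auto simp: gin_def)
    next
      case False
      then show ?thesis using z[of m] m by auto
    qed
  qed
  also have "\<dots> = gin (i + n) (fun_mult i n \<phi> \<psi>) N p"
    by (cases "N = i + n") (auto simp: gin_def)
  finally show "gmult (gin i \<phi>) (gin n \<psi>) N p = gin (i + n) (fun_mult i n \<phi> \<psi>) N p" .
qed

definition unit_functional :: functional where
  "unit_functional = restrict_functional (O_B 0) (\<lambda>p. Poly_Mapping.lookup p 0)"

lemma gone_eq: "gone = gin 0 unit_functional"
  by (simp add: gone_def unit_functional_def)

lemma unit_functional: "odd_bracket_free 0 unit_functional" "unit_functional (pw 0 f) = 1"
proof -
  have lin: "lin_on (sym_power 0 True) unit_functional"
    by (simp add: unit_functional_def restrict_functional_def O_B_eq lin_on_def lookup_add lookup_scale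
        sym_power_add sym_power_scale)
  have br: "poisson 0 p q = 0" for p q by (simp add: poisson_def)
  have z: "unit_functional 0 = 0" using lin_on_zero[OF lin] by simp
  have "unit_functional \<in> HP0_dual 0 (O_B 0)"
    by (rule HP0_B_I[OF lin]) (simp_all add: br z, simp add: unit_functional_def restrict_functional_def O_B_eq)
  then show "odd_bracket_free 0 unit_functional" by (simp add: odd_bracket_free_def br z)
  have "1 \<in> sym_power 0 True" using pw_in_sym_power[of 1 True 0] by (simp add: tens_def)
  then show "unit_functional (pw 0 f) = 1"
    by (simp add: unit_functional_def restrict_functional_def O_B_eq tens_def)
qed

section \<open>Graded pieces of polynomials\<close>

text \<open>Two choices of w matter: w i = i for the symmetric power degree, and w i = 4 (i - 1) for
  the negative of the weight.\<close>

definition mweight :: "(nat \<Rightarrow> nat) \<Rightarrow> (nat \<Rightarrow>\<^sub>0 nat) \<Rightarrow> nat" where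
  "mweight w m = (\<Sum>i\<in>Poly_Mapping.keys m. w i * Poly_Mapping.lookup m i)"

lemma mweight_superset:
  assumes "finite S" "Poly_Mapping.keys m \<subseteq> S"
  shows "mweight w m = (\<Sum>i\<in>S. w i * Poly_Mapping.lookup m i)"
  unfolding mweight_def by (rule sum.mono_neutral_left) (use assms in \<open>auto simp: in_keys_iff\<close>)

lemma mweight_add: "mweight w (m + m') = mweight w m + mweight w m'"
proof -
  let ?S = "Poly_Mapping.keys m \<union> Poly_Mapping.keys m'"
  show ?thesis
    using mweight_superset[of ?S "m + m'" w] mweight_superset[of ?S m w] mweight_superset[of ?S m' w]
    by (simp add: keys_nat_add lookup_add ring_distribs sum.distrib)
qed

lemma mweight_zero [simp]: "mweight w 0 = 0" by (simp add: mweight_def)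
lemma mweight_single [simp]: "mweight w (Poly_Mapping.single i k) = w i * k" by (simp add: mweight_def)
lemma mweight_sum: "mweight w (\<Sum>i\<in>I. m i) = (\<Sum>i\<in>I. mweight w (m i))"
  by (induction I rule: infinite_finite_induct) (auto simp: mweight_add)

lemma mon_val_scale: "mon_val (\<lambda>i. t ^ w i * c i) m = t ^ mweight w m * mon_val c m"
  by (simp add: mon_val_def mweight_def power_mult_distrib prod.distrib power_sum power_mult)

definition graded_part :: "(nat \<Rightarrow> nat) \<Rightarrow> nat \<Rightarrow> spoly \<Rightarrow> spoly" where
  "graded_part w n f = (\<Sum>m | m \<in> Poly_Mapping.keys f \<and> mweight w m = n. Poly_Mapping.single m (Poly_Mapping.lookup f m))"

lemma lookup_graded_part:
  "Poly_Mapping.lookup (graded_part w n f) m = (if mweight w m = n then Poly_Mapping.lookup f m else 0)"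
  by (simp add: graded_part_def lookup_sum lookup_single when_def sum.delta' in_keys_iff)

lemma keys_graded_part: "Poly_Mapping.keys (graded_part w n f) = {m \<in> Poly_Mapping.keys f. mweight w m = n}"
  by (auto simp: in_keys_iff lookup_graded_part split: if_splits)

lemma indets_graded_part: "indets (graded_part w n f) \<subseteq> indets f"
  by (auto simp: indets_def keys_graded_part)

lemma peval_expand: "peval c f = (\<Sum>m\<in>Poly_Mapping.keys f. Poly_Mapping.lookup f m * mon_val c m)"
  by (simp add: peval_def eval_with_def mon_val_def)

lemma peval_graded_part: "peval c (graded_part w n f) =
    (\<Sum>m | m \<in> Poly_Mapping.keys f \<and> mweight w m = n. Poly_Mapping.lookup f m * mon_val c m)"
  unfolding peval_expand keys_graded_part by (intro sum.cong) (auto simp: lookup_graded_part)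

lemma sum_graded_parts:
  assumes "finite D" "mweight w ` Poly_Mapping.keys f \<subseteq> D"
  shows "f = (\<Sum>d\<in>D. graded_part w d f)"
proof (rule poly_mapping_eqI)
  fix k
  have "k \<notin> Poly_Mapping.keys f \<or> mweight w k \<in> D" using assms(2) by blast
  then show "Poly_Mapping.lookup f k = Poly_Mapping.lookup (\<Sum>d\<in>D. graded_part w d f) k"
    using assms(1) by (auto simp: lookup_sum lookup_graded_part in_keys_iff)
qed

lemma peval_scale_graded:
  assumes "finite D" "mweight w ` Poly_Mapping.keys f \<subseteq> D"
  shows "peval (\<lambda>i. t ^ w i * c i) f = (\<Sum>d\<in>D. t ^ d * peval c (graded_part w d f))"
proof -
  have "peval (\<lambda>i. t ^ w i * c i) f = (\<Sum>m\<in>Poly_Mapping.keys f. t ^ mweight w m * (Poly_Mapping.lookup f m * mon_val c m))"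
    by (simp only: peval_expand mon_val_scale mult.left_commute)
  also have "\<dots> = (\<Sum>d\<in>D. \<Sum>m | m \<in> Poly_Mapping.keys f \<and> mweight w m = d. t ^ mweight w m * (Poly_Mapping.lookup f m * mon_val c m))"
    using assms by (intro sum.group[symmetric]) auto
  also have "\<dots> = (\<Sum>d\<in>D. t ^ d * peval c (graded_part w d f))"
    unfolding peval_graded_part sum_distrib_left by (intro sum.cong refl) auto
  finally show ?thesis .
qed

section \<open>The identification map\<close>

abbreviation wt :: "(nat \<Rightarrow>\<^sub>0 nat) \<Rightarrow> nat" where "wt \<equiv> mweight (\<lambda>i. i)"

text \<open>Each factor \<open>s i\<close> raises the symmetric degree by i and multiplies the value
  on powers by \<open>s i (pw i f)\<close>, so the recursion defining \<open>gmonomial\<close> can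
  be followed step by step.\<close>

lemma gmonomial_props:
  assumes s: "\<And>i. i \<ge> 1 \<Longrightarrow> s i \<in> HP0_dual i (O_B i)" and m: "Poly_Mapping.keys m \<subseteq> {1..}"
  shows "\<exists>\<psi>. gmonomial s m = gin (wt m) \<psi> \<and> \<psi> \<in> HP0_dual (wt m) (O_B (wt m)) \<and>
    (\<forall>f\<in>parity_space True. \<psi> (pw (wt m) f) = mon_val (\<lambda>i. s i (pw i f)) m)"
proof -
  let ?P = "\<lambda>\<Phi> N v. \<exists>\<psi>. \<Phi> = gin N \<psi> \<and> \<psi> \<in> HP0_dual N (O_B N) \<and>
      (\<forall>f\<in>parity_space True. \<psi> (pw N f) = v f)"
  have mult: "?P (gmult (gin i (s i)) \<Phi>) (i + N) (\<lambda>f. s i (pw i f) * v f)" if P: "?P \<Phi> N v" and i: "i \<ge> 1" for \<Phi> N v i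
  proof -
    obtain \<psi> where \<psi>: "\<Phi> = gin N \<psi>" "\<psi> \<in> HP0_dual N (O_B N)" "\<forall>f\<in>parity_space True. \<psi> (pw N f) = v f"
      using P by blast
    note l = HP0_B_D(1)[OF s[OF i]] HP0_B_D(1)[OF \<psi>(2)]
    show ?thesis
    proof (intro exI[of _ "fun_mult i N (s i) \<psi>"] conjI ballI)
      show "gmult (gin i (s i)) \<Phi> = gin (i + N) (fun_mult i N (s i) \<psi>)"
        unfolding \<psi>(1) by (rule gmult_gin[OF l])
      show "fun_mult i N (s i) \<psi> (pw (i + N) f) = s i (pw i f) * v f" if "f \<in> parity_space True" for f
        using fun_mult_props(3)[OF l that] \<psi>(3) that by simp
    qed (rule fun_mult_HP0[OF s[OF i] \<psi>(2)])
  qed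
  have pow: "?P ((gmult (gin i (s i)) ^^ k) \<Phi>) (i * k + N) (\<lambda>f. s i (pw i f) ^ k * v f)"
    if P: "?P \<Phi> N v" and i: "i \<ge> 1" for \<Phi> N v i k
  proof (induction k)
    case 0
    then show ?case using P by simp
  next
    case (Suc k)
    from mult[OF Suc i] show ?case by (simp only: funpow.simps o_apply mult_Suc_right power_Suc add.assoc mult.assoc)
  qed
  have base: "?P gone 0 (\<lambda>_. 1)"
    using unit_functional by (intro exI[of _ unit_functional]) (auto simp: gone_eq odd_bracket_free_def)
  have list: "?P (foldr (\<lambda>i. gmult (gin i (s i)) ^^ Poly_Mapping.lookup m i) l gone)
      (\<Sum>i\<leftarrow>l. i * Poly_Mapping.lookup m i) (\<lambda>f. \<Prod>i\<leftarrow>l. s i (pw i f) ^ Poly_Mapping.lookup m i)"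
    if "set l \<subseteq> {1..}" for l
    using that
  proof (induction l)
    case Nil
    then show ?case using base by simp
  next
    case (Cons i l)
    then have "?P (foldr (\<lambda>i. gmult (gin i (s i)) ^^ Poly_Mapping.lookup m i) l gone)
      (\<Sum>i\<leftarrow>l. i * Poly_Mapping.lookup m i) (\<lambda>f. \<Prod>i\<leftarrow>l. s i (pw i f) ^ Poly_Mapping.lookup m i)" by simp
    from pow[OF this, of i "Poly_Mapping.lookup m i"] Cons.prems show ?case by simp
  qed
  let ?l = "sorted_list_of_set (Poly_Mapping.keys m)"
  have a: "(\<Sum>i\<leftarrow>?l. i * Poly_Mapping.lookup m i) = wt m"
    by (simp add: mweight_def sum_list_distinct_conv_sum_set)
  have b: "(\<Prod>i\<leftarrow>?l. s i (pw i f) ^ Poly_Mapping.lookup m i) = mon_val (\<lambda>i. s i (pw i f)) m" for f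
    using prod.distinct_set_conv_list[of ?l "\<lambda>i. s i (pw i f) ^ Poly_Mapping.lookup m i"] by (simp add: mon_val_def)
  have "set ?l \<subseteq> {1..}" using m by simp
  from list[OF this] show ?thesis by (simp only: gmonomial_def a b)
qed

lemma identification_component:
  "identification s f n = (\<lambda>p. \<Sum>m\<in>Poly_Mapping.keys f. Poly_Mapping.lookup f m * gmonomial s m n p)"
  by (simp add: identification_def)

lemma lin_on_sum_fun:
  assumes "\<And>i. i \<in> I \<Longrightarrow> lin_on A (\<phi> i)"
  shows "lin_on A (\<lambda>p. \<Sum>i\<in>I. c i * \<phi> i p)"
  unfolding lin_on_def
proof (intro conjI ballI allI)
  fix p q assume pq: "p \<in> A" "q \<in> A"
  have "(\<Sum>i\<in>I. c i * \<phi> i (p + q)) = (\<Sum>i\<in>I. c i * \<phi> i p + c i * \<phi> i q)"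
    by (rule sum.cong) (simp_all add: lin_onD(1)[OF assms pq] ring_distribs)
  then show "(\<Sum>i\<in>I. c i * \<phi> i (p + q)) = (\<Sum>i\<in>I. c i * \<phi> i p) + (\<Sum>i\<in>I. c i * \<phi> i q)"
    by (simp only: sum.distrib)
next
  fix d p assume p: "p \<in> A"
  show "(\<Sum>i\<in>I. c i * \<phi> i (Const d * p)) = d * (\<Sum>i\<in>I. c i * \<phi> i p)"
    unfolding sum_distrib_left by (rule sum.cong) (simp_all add: lin_onD(2)[OF assms p])
qed

lemma HP0_B_sum:
  assumes "\<And>i. i \<in> I \<Longrightarrow> \<phi> i \<in> HP0_dual n (O_B n)"
  shows "(\<lambda>p. \<Sum>i\<in>I. c i * \<phi> i p) \<in> HP0_dual n (O_B n)"
proof (rule HP0_B_I)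
  show "lin_on (sym_power n True) (\<lambda>p. \<Sum>i\<in>I. c i * \<phi> i p)"
    by (rule lin_on_sum_fun) (rule HP0_B_D(1)[OF assms])
  fix f g assume "f \<in> parity_space True" "g \<in> parity_space True"
  then have "\<phi> i (poisson n (pw n f) (pw n g)) = 0" if "i \<in> I" for i
    using HP0_B_D(2)[OF assms[OF that]] pw_in_sym_power by blast
  then show "(\<Sum>i\<in>I. c i * \<phi> i (poisson n (pw n f) (pw n g))) = 0" by simp
next
  fix p assume "p \<notin> sym_power n True"
  then show "(\<Sum>i\<in>I. c i * \<phi> i p) = 0" using HP0_B_D(3)[OF assms] by simp
qed

lemma odd_bracket_free_sum:
  assumes "\<And>i. i \<in> I \<Longrightarrow> odd_bracket_free n (\<phi> i)"
  shows "odd_bracket_free n (\<lambda>p. \<Sum>i\<in>I. c i * \<phi> i p)"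
  using HP0_B_sum[of I \<phi> n c] assms by (auto simp: odd_bracket_free_def)

context
  fixes s :: "nat \<Rightarrow> functional"
  assumes s_HP0: "\<And>i. i \<ge> 1 \<Longrightarrow> s i \<in> HP0_dual i (O_B i)"
begin

lemma gmonomial_HP0:
  assumes "Poly_Mapping.keys m \<subseteq> {1..}"
  shows "gmonomial s m n \<in> HP0_dual n (O_B n)" "n \<noteq> wt m \<Longrightarrow> gmonomial s m n = (\<lambda>_. 0)"
    "f \<in> parity_space True \<Longrightarrow> gmonomial s m n (pw n f) = (if n = wt m then mon_val (\<lambda>i. s i (pw i f)) m else 0)"
proof -
  have "\<exists>\<psi>. gmonomial s m = gin (wt m) \<psi> \<and> \<psi> \<in> HP0_dual (wt m) (O_B (wt m)) \<and>
    (\<forall>f\<in>parity_space True. \<psi> (pw (wt m) f) = mon_val (\<lambda>i. s i (pw i f)) m)"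
    by (rule gmonomial_props[OF _ assms]) (rule s_HP0)
  then obtain \<psi> where \<psi>: "gmonomial s m = gin (wt m) \<psi>" "\<psi> \<in> HP0_dual (wt m) (O_B (wt m))"
    "\<forall>f\<in>parity_space True. \<psi> (pw (wt m) f) = mon_val (\<lambda>i. s i (pw i f)) m"
    by (elim exE conjE)
  have z: "(\<lambda>_. 0) \<in> HP0_dual n (O_B n)" using HP0_B_sum[of "{}" _ n] by simp
  show "gmonomial s m n \<in> HP0_dual n (O_B n)"
    using \<psi>(2) z by (cases "n = wt m") (simp_all add: \<psi>(1) gin_def)
  show "n \<noteq> wt m \<Longrightarrow> gmonomial s m n = (\<lambda>_. 0)"
    by (simp add: \<psi>(1) gin_def)
  show "f \<in> parity_space True \<Longrightarrow> gmonomial s m n (pw n f) = (if n = wt m then mon_val (\<lambda>i. s i (pw i f)) m else 0)"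
    using \<psi>(3) by (simp add: \<psi>(1) gin_def)
qed

lemma s_ring_keys: "f \<in> s_ring \<Longrightarrow> m \<in> Poly_Mapping.keys f \<Longrightarrow> Poly_Mapping.keys m \<subseteq> {1..}"
  by (auto simp: s_ring_def indets_def)

lemma identification_HP0: "f \<in> s_ring \<Longrightarrow> identification s f n \<in> HP0_dual n (O_B n)"
  unfolding identification_component by (rule HP0_B_sum) (rule gmonomial_HP0(1)[OF s_ring_keys])

text \<open>The bridge from functionals to polynomial functions: only monomials of symmetric degree
  n contribute on n-th powers.\<close>

lemma identification_pw:
  assumes "f \<in> s_ring" "g \<in> parity_space True"
  shows "identification s f n (pw n g) = peval (\<lambda>i. s i (pw i g)) (graded_part (\<lambda>i. i) n f)"
proof -
  have "identification s f n (pw n g) = (\<Sum>m\<in>Poly_Mapping.keys f.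
      if wt m = n then Poly_Mapping.lookup f m * mon_val (\<lambda>i. s i (pw i g)) m else 0)"
    unfolding identification_component
    using gmonomial_HP0(3)[OF s_ring_keys[OF assms(1)] assms(2)] by (intro sum.cong) auto
  then show ?thesis by (simp add: peval_graded_part sum.inter_filter)
qed

lemma identification_zero: "f \<in> s_ring \<Longrightarrow> n \<notin> wt ` Poly_Mapping.keys f \<Longrightarrow> identification s f n = (\<lambda>_. 0)"
  unfolding identification_component
  using gmonomial_HP0(2)[OF s_ring_keys] by (intro ext sum.neutral) fastforce

lemma identification_HP_B: 
  assumes "f \<in> s_ring" shows "identification s f \<in> HP_B"
proof -
  have "{n. \<exists>p. identification s f n p \<noteq> 0} \<subseteq> wt ` Poly_Mapping.keys f"
    using identification_zero[OF assms] by fastforce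
  then have "finite {n. \<exists>p. identification s f n p \<noteq> 0}" by (rule finite_subset) simp
  then show ?thesis using identification_HP0[OF assms] by (simp add: HP_B_def direct_sum_def)
qed

end

section \<open>Polynomials as formal functions\<close>

text \<open>In \<open>formal\<close> the outer series variable is y, so x becomes a constant series.
  The index of a coordinate is ignored, as only functions on one plane are embedded.\<close>

definition emb :: "opoly \<Rightarrow> formal" where
  "emb = eval_with (\<lambda>c. fps_const (fps_const c)) (\<lambda>v. case v of X i \<Rightarrow> fps_const fps_X | Y i \<Rightarrow> fps_X)"

lemma coeff_hom_fps: "coeff_hom (\<lambda>c. fps_const (fps_const c) :: formal)"
  by (simp add: coeff_hom_def)

lemma emb_hom [simp]:
  "emb (Const a) = fps_const (fps_const a)" "emb (Var (X i)) = fps_const fps_X" "emb (Var (Y i)) = fps_X"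
  "emb (p + q) = emb p + emb q" "emb (p * q) = emb p * emb q" "emb (p - q) = emb p - emb q"
  "emb 0 = 0" "emb 1 = 1" "emb (p ^ k) = emb p ^ k" "emb (\<Sum>i\<in>I. f i) = (\<Sum>i\<in>I. emb (f i))"
  by (simp_all add: emb_def eval_with_hom coeff_hom_fps)

lemma emb_xymon_nth: "emb (xymon a b) $ j $ i = (if i = a \<and> j = b then 1 else 0)"
  by (simp add: xymon_def fps_const_power fps_X_power_mult_right_nth)

lemma emb_scale_nth: "emb (Const c * p) $ j $ i = c * (emb p $ j $ i)"
  by simp

lemma formal_parity_emb:
  assumes "p \<in> parity_space e" "even (i + j) \<noteq> e"
  shows "emb p $ j $ i = 0"
  using assms
proof (induction rule: parity_space_induct)
  case (step c a b q)
  then have "emb (xymon a b) $ j $ i = 0" by (auto simp: emb_xymon_nth)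
  then show ?case using step by simp
qed simp

lemma diff_x_add: "diff_x (f + g) = diff_x f + diff_x g"
  by (rule fps_ext) (simp add: diff_x_def)

lemma diff_x_mult: "diff_x (f * g) = diff_x f * g + f * diff_x g"
  by (rule fps_ext) (simp add: diff_x_def fps_mult_nth fps_deriv_sum sum.distrib)

lemma diff_emb:
  assumes "indets p \<subseteq> plane"
  shows "diff_x (emb p) = emb (pdiff (X 0) p)" "diff_y (emb p) = emb (pdiff (Y 0) p)"
  using assms
proof (induction p rule: cpoly_induct)
  case (Const c)
  { case 1 show ?case by (rule fps_ext) (simp add: diff_x_def)
  next case 2 show ?case by (simp add: diff_y_def) }
next
  case (Var v)
  have x: "diff_x (fps_const fps_X) = 1" by (rule fps_ext) (simp add: diff_x_def fps_one_nth)
  have y: "diff_x fps_X = 0" by (rule fps_ext) (simp add: diff_x_def fps_X_nth)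
  { case 1 show ?case using Var x y by (auto simp: plane_def)
  next case 2 show ?case using Var by (auto simp: plane_def diff_y_def) }
next
  case (add p q)
  { case 1 show ?case using add by (simp add: diff_x_add)
  next case 2 show ?case using add by (simp add: diff_y_def) }
next
  case (mult p q)
  { case 1 show ?case using mult by (simp add: diff_x_mult)
  next case 2 show ?case using mult by (simp add: diff_y_def algebra_simps) }
qed

lemma even_symplectomorphism_emb:
  assumes "P \<in> parity_space False" "Q \<in> parity_space False" "br P Q = 1"
  shows "even_symplectomorphism (emb P) (emb Q)"
proof -
  have "diff_x (emb P) * diff_y (emb Q) - diff_y (emb P) * diff_x (emb Q) = emb (br P Q)"
    using diff_emb[OF parity_space_indets[OF assms(1)]] diff_emb[OF parity_space_indets[OF assms(2)]]
    by (simp add: br_def)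
  then show ?thesis
    using formal_parity_emb[OF assms(1)] formal_parity_emb[OF assms(2)] assms(3)
    by (auto simp: even_symplectomorphism_def formal_odd_def)
qed

definition vanishing_order :: "nat \<Rightarrow> formal \<Rightarrow> bool" where
  "vanishing_order k F \<longleftrightarrow> (\<forall>a b. a + b < k \<longrightarrow> F $ b $ a = 0)"

lemma vanishing_order_mult:
  assumes "vanishing_order k F" "vanishing_order l G"
  shows "vanishing_order (k + l) (F * G)"
  unfolding vanishing_order_def
proof (intro allI impI)
  fix a b :: nat assume ab: "a + b < k + l"
  have "(F * G) $ b $ a = (\<Sum>j=0..b. \<Sum>i=0..a. F $ j $ i * G $ (b - j) $ (a - i))"
    by (simp add: fps_mult_nth fps_sum_nth)
  also have "\<dots> = 0"
  proof (intro sum.neutral ballI)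
    fix i j assume "j \<in> {0..b}" "i \<in> {0..a}"
    then have "i + j < k \<or> (a - i) + (b - j) < l" using ab by auto
    then show "F $ j $ i * G $ (b - j) $ (a - i) = 0"
      using assms by (auto simp: vanishing_order_def)
  qed
  finally show "(F * G) $ b $ a = 0" .
qed

lemma vanishing_order_power: "vanishing_order 1 F \<Longrightarrow> vanishing_order k (F ^ k)"
proof (induction k)
  case 0
  show ?case by (simp add: vanishing_order_def)
next
  case (Suc k)
  then show ?case using vanishing_order_mult[of 1 F k "F ^ k"] by simp
qed

lemma vanishing_order_emb: "p \<in> parity_space False \<Longrightarrow> vanishing_order 1 (emb p)"
  using formal_parity_emb[of p False] by (auto simp: vanishing_order_def)

abbreviation psub :: "opoly \<Rightarrow> opoly \<Rightarrow> opoly \<Rightarrow> opoly" where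
  "psub P Q \<equiv> psubst (\<lambda>v. case v of X _ \<Rightarrow> P | Y _ \<Rightarrow> Q)"

lemma monomial_vanishes:
  assumes "P \<in> parity_space False" "Q \<in> parity_space False" "a + b < k + l"
  shows "(emb P ^ k * emb Q ^ l) $ b $ a = 0"
  using vanishing_order_mult[OF vanishing_order_power[OF vanishing_order_emb[OF assms(1)]]
      vanishing_order_power[OF vanishing_order_emb[OF assms(2)]], of k l] assms(3)
  by (simp add: vanishing_order_def)

text \<open>Odd P and Q have no constant term, so P^i Q^j has order at least i + j, and the
  truncated sums in \<open>formal_subst\<close> lose nothing.\<close>

lemma formal_subst_emb:
  assumes PQ: "P \<in> parity_space False" "Q \<in> parity_space False" and f: "f \<in> parity_space e"
  shows "formal_subst (emb f) (emb P) (emb Q) = emb (psub P Q f)"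
proof (intro fps_ext)
  fix b a
  show "formal_subst (emb f) (emb P) (emb Q) $ b $ a = emb (psub P Q f) $ b $ a"
    using f
  proof (induction rule: parity_space_induct)
    case zero
    show ?case by (simp add: formal_subst_def)
  next
    case (step c k l q)
    let ?M = "\<lambda>i j. (emb P ^ i * emb Q ^ j) $ b $ a"
    have nth: "formal_subst F (emb P) (emb Q) $ b $ a = (\<Sum>i\<le>a + b. \<Sum>j\<le>a + b. F $ j $ i * ?M i j)" for F
      by (simp add: formal_subst_def)
    have "(\<Sum>i\<le>a + b. \<Sum>j\<le>a + b. emb (xymon k l) $ j $ i * ?M i j) =
        (\<Sum>i\<le>a + b. \<Sum>j\<le>a + b. if i = k \<and> j = l then ?M k l else 0)"
      by (intro sum.cong refl) (auto simp: emb_xymon_nth)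
    also have "\<dots> = (\<Sum>i\<le>a + b. if i = k then (if l \<le> a + b then ?M k l else 0) else 0)"
      by (intro sum.cong refl) (auto simp: sum.delta')
    \<comment> \<open>If k or l lies outside the range of summation, the coefficient
      \<open>?M k l\<close> vanishes for reasons of order.\<close>
    also have "\<dots> = ?M k l"
      using monomial_vanishes[OF PQ, of a b k l] by (auto simp: sum.delta')
    also have "\<dots> = emb (psub P Q (xymon k l)) $ b $ a"
      by (simp add: xymon_def)
    finally have m: "(\<Sum>i\<le>a + b. \<Sum>j\<le>a + b. emb (xymon k l) $ j $ i * ?M i j) = emb (psub P Q (xymon k l)) $ b $ a" .
    have "formal_subst (emb (Const c * xymon k l + q)) (emb P) (emb Q) $ b $ a =
        c * (\<Sum>i\<le>a + b. \<Sum>j\<le>a + b. emb (xymon k l) $ j $ i * ?M i j) +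
        formal_subst (emb q) (emb P) (emb Q) $ b $ a"
    proof -
      have "emb (Const c * xymon k l + q) $ j $ i = c * emb (xymon k l) $ j $ i + emb q $ j $ i" for i j
        by simp
      then show ?thesis
        unfolding nth by (simp only: ring_distribs sum.distrib sum_distrib_left mult.assoc)
    qed
    then show ?case using step(3) by (simp add: m)
  qed
qed

definition nform :: "nat \<Rightarrow> (nat \<Rightarrow> complex) \<Rightarrow> opoly" where
  "nform M c = yv ^ 2 + (\<Sum>i\<in>{1..M}. Const (c i) * xymon (2 * (i - 1)) 0)"

lemma nform_parity: "nform M c \<in> parity_space True"
  unfolding nform_def
  by (intro parity_space_add parity_space_sum parity_space_scale xymon_in_parity_space
      square_parity[OF Var_in_parity_space(2)]) simp

lemma nform_extend:
  assumes "M \<le> M'" "\<forall>i>M. c i = 0" shows "nform M' c = nform M c"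
proof -
  have "(\<Sum>i\<in>{1..M}. Const (c i) * xymon (2 * (i - 1)) 0) = (\<Sum>i\<in>{1..M'}. Const (c i) * xymon (2 * (i - 1)) 0)"
    by (rule sum.mono_neutral_left) (use assms in auto)
  then show ?thesis by (simp add: nform_def)
qed

lemma even_x_nform:
  assumes "\<nu> \<in> even_x"
  shows "\<exists>M c. (\<forall>i>M. c i = 0) \<and> yv ^ 2 + \<nu> = nform M c"
  using assms unfolding even_x_def
proof (induction rule: cpoly_span_induct)
  case zero
  show ?case by (intro exI[of _ 0] exI[of _ "\<lambda>_. 0"]) (simp add: nform_def)
next
  case (step d x y)
  then obtain k where k: "x = xymon (2 * k) 0" by blast
  from step obtain M c where c: "\<forall>i>M. c i = 0" "yv ^ 2 + y = nform M c" by blast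
  let ?M = "max M (k + 1)" and ?c = "\<lambda>i. c i + (if i = k + 1 then d else 0)"
  have "nform ?M ?c = nform ?M c + (\<Sum>i\<in>{1..?M}. Const (if i = k + 1 then d else 0) * xymon (2 * (i - 1)) 0)"
    by (simp add: nform_def Const_add ring_distribs sum.distrib add.assoc)
  also have "(\<Sum>i\<in>{1..?M}. Const (if i = k + 1 then d else 0) * xymon (2 * (i - 1)) 0) =
      (\<Sum>i\<in>{1..?M}. if i = k + 1 then Const d * xymon (2 * k) 0 else 0)"
    by (intro sum.cong) auto
  also have "\<dots> = Const d * x" by (simp add: k sum.delta')
  also have "nform ?M c = yv ^ 2 + y" using nform_extend[of M ?M c] c by simp
  finally have "yv ^ 2 + (Const d * x + y) = nform ?M ?c" by (simp add: algebra_simps)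
  moreover have "\<forall>i>?M. ?c i = 0" using c by auto
  ultimately show ?case by (intro exI[of _ ?M] exI[of _ ?c]) simp
qed

lemma emb_nform:
  assumes "\<forall>i>M. c i = 0"
  shows "emb (nform M c) = normal_form c"
proof -
  have "(\<Sum>i\<in>{1..M}. fps_const (c i) * fps_X ^ (2 * (i - 1))) =
      Abs_fps (\<lambda>m. if even m then c (m div 2 + 1) else 0)" (is "?A = ?B")
  proof (rule fps_ext)
    fix m
    have "?A $ m = (\<Sum>i\<in>{1..M}. if i = m div 2 + 1 then (if even m then c (m div 2 + 1) else 0) else 0)"
      unfolding fps_sum_nth by (intro sum.cong refl) (auto simp: fps_X_power_nth elim!: evenE)
    also have "\<dots> = ?B $ m" using assms by (auto simp: sum.delta')
    finally show "?A $ m = ?B $ m" .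
  qed
  moreover have "emb (nform M c) = fps_X ^ 2 + fps_const ?A"
  proof -
    have "emb (Const (c i) * xymon (2 * (i - 1)) 0) = fps_const (fps_const (c i) * fps_X ^ (2 * (i - 1)))" for i
      by (simp add: xymon_def fps_const_power)
    moreover have "(\<Sum>i\<in>I. fps_const (f i)) = fps_const (\<Sum>i\<in>I. f i)" for I and f :: "nat \<Rightarrow> complex fps"
      by (induction I rule: infinite_finite_induct) auto
    ultimately show ?thesis by (simp add: nform_def del: emb_hom(5))
  qed
  ultimately show ?thesis by (simp add: normal_form_def)
qed

lemma tensor_power_emb:
  assumes "f \<in> parity_space e"
  shows "eventually (\<lambda>N. tensor_power n N (emb f) = pw n f) sequentially"
proof -
  let ?t = "\<lambda>N f. \<Sum>b\<le>N. \<Sum>a\<le>N - b. Const (emb f $ b $ a) * xymon a b"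
  have "\<exists>N0. \<forall>N\<ge>N0. ?t N f = f" using assms
  proof (induction rule: parity_space_induct)
    case zero
    show ?case by simp
  next
    case (step c k l q)
    then obtain N0 where N0: "\<And>N. N \<ge> N0 \<Longrightarrow> ?t N q = q" by blast
    have "?t N (Const c * xymon k l + q) = Const c * xymon k l + q" if N: "N \<ge> max N0 (k + l)" for N
    proof -
      have "?t N (xymon k l) = (\<Sum>b\<le>N. \<Sum>a\<le>N - b. if a = k \<and> b = l then xymon k l else 0)"
        by (intro sum.cong refl) (auto simp: emb_xymon_nth)
      also have "\<dots> = (\<Sum>b\<le>N. if b = l then xymon k l else 0)"
        using N by (intro sum.cong refl) (auto simp: sum.delta')
      also have "\<dots> = xymon k l" using N by (simp add: sum.delta')
      finally have m: "?t N (xymon k l) = xymon k l" .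
      have "?t N (Const c * xymon k l + q) = Const c * ?t N (xymon k l) + ?t N q"
      proof -
        have "Const (emb (Const c * xymon k l + q) $ b $ a) * xymon a b =
            Const c * (Const (emb (xymon k l) $ b $ a) * xymon a b) + Const (emb q $ b $ a) * xymon a b" for a b
          by (simp add: Const_add Const_mult ring_distribs mult.assoc del: cp.scale_scale)
        then show ?thesis by (simp only: sum.distrib sum_distrib_left)
      qed
      then show ?thesis using N0[of N] N m by simp
    qed
    then show ?case by blast
  qed
  then obtain N0 where N0: "\<And>N. N \<ge> N0 \<Longrightarrow> ?t N f = f" by blast
  have "tensor_power n N (emb f) = pw n f" if "N \<ge> N0" for N
  proof -
    have "tensor_power n N (emb f) = (\<Prod>i<n. shift i (?t N f))"
      unfolding tensor_power_def by (intro prod.cong refl) (simp add: xymon_def mult.assoc)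
    then show ?thesis using N0[OF that] by (simp add: tens_def)
  qed
  then show ?thesis by (auto simp: eventually_sequentially)
qed

section \<open>Polynomial symplectomorphisms and the invariance of the \<open>s\<^sub>i\<close>\<close>

lemma psub_parity:
  assumes "P \<in> parity_space False" "Q \<in> parity_space False" "f \<in> parity_space e"
  shows "psub P Q f \<in> parity_space e"
  using assms(3)
proof (induction rule: parity_space_induct)
  case (step c a b q)
  have "P ^ a * Q ^ b \<in> parity_space ((False \<or> even a) = (False \<or> even b))"
    by (intro parity_space_mult parity_space_power assms)
  moreover have "(even a = even b) = e" using step(1) by auto
  ultimately show ?case using step
    by (simp add: xymon_def) (intro parity_space_add parity_space_scale, simp_all)
qed simp

lemma br_psub:
  assumes "indets f \<subseteq> plane" "indets g \<subseteq> plane"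
  shows "br (psub P Q f) (psub P Q g) = psub P Q (br f g) * br P Q"
proof -
  have d: "pdiff v (psub P Q f) = psub P Q (pdiff (X 0) f) * pdiff v P + psub P Q (pdiff (Y 0) f) * pdiff v Q"
    if "indets f \<subseteq> plane" for f v
    using pdiff_psubst[of plane f v "\<lambda>v. case v of X _ \<Rightarrow> P | Y _ \<Rightarrow> Q"] that by (simp add: plane_def)
  show ?thesis unfolding br_def d[OF assms(1)] d[OF assms(2)] by (simp add: algebra_simps)
qed

definition reducible_to :: "nat \<Rightarrow> (nat \<Rightarrow> complex) \<Rightarrow> opoly \<Rightarrow> bool" where
  "reducible_to M c f \<longleftrightarrow> f \<in> parity_space True \<and>
     (\<exists>P\<in>parity_space False. \<exists>Q\<in>parity_space False. br P Q = 1 \<and> psub P Q f = nform M c)"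

lemma psub_plane: "indets f \<subseteq> plane \<Longrightarrow> psub (Var (X 0)) yv f = f"
  by (rule psubst_ident) (auto simp: plane_def)

lemma reducible_nform: "reducible_to M c (nform M c)"
  unfolding reducible_to_def
proof (intro conjI bexI)
  show "psub (Var (X 0)) yv (nform M c) = nform M c"
    by (rule psub_plane[OF parity_space_indets[OF nform_parity]])
qed (simp_all add: nform_parity br_def)

section \<open>Polynomial flows of powers of linear forms\<close>

definition lin_form :: "complex \<Rightarrow> opoly" where "lin_form t = Var (X 0) + Const t * yv"
text \<open>The flow at time u of the Hamiltonian l^(k+1)/(k+1) with l = x + t y. As l is conserved,
  the flow is affine in u and polynomial in x and y; for odd k the Hamiltonian is even.\<close>

definition flow_x :: "complex \<Rightarrow> nat \<Rightarrow> complex \<Rightarrow> opoly" where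
  "flow_x t k u = Var (X 0) - Const u * (Const t * lin_form t ^ k)"
definition flow_y :: "complex \<Rightarrow> nat \<Rightarrow> complex \<Rightarrow> opoly" where
  "flow_y t k u = yv + Const u * lin_form t ^ k"

abbreviation flow :: "complex \<Rightarrow> nat \<Rightarrow> complex \<Rightarrow> opoly \<Rightarrow> opoly" where
  "flow t k u \<equiv> psub (flow_x t k u) (flow_y t k u)"

lemma lin_form_parity: "lin_form t \<in> parity_space False"
  unfolding lin_form_def by (intro parity_space_add parity_space_scale) auto

lemma flow_parity:
  assumes "odd k" shows "flow_x t k u \<in> parity_space False" "flow_y t k u \<in> parity_space False"
  using parity_space_power[OF lin_form_parity, of t k] assms unfolding flow_x_def flow_y_def
  by (auto intro!: parity_space_add parity_space_diff parity_space_scale)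

lemma flow_lin_form: "flow t k u (lin_form t) = lin_form t"
  by (simp add: lin_form_def flow_x_def flow_y_def algebra_simps)

lemma flow_inverse:
  "flow t k u (flow_x t k (- u)) = Var (X 0)" "flow t k u (flow_y t k (- u)) = yv"
  using flow_lin_form[of t k u]
  by (simp_all add: flow_x_def[of t k "- u"] flow_y_def[of t k "- u"] Const_uminus)
    (simp_all add: flow_x_def flow_y_def)

lemma br_flow: "br (flow_x t k u) (flow_y t k u) = 1"
proof -
  obtain A where "pdiff (X 0) (lin_form t ^ k) = A" "pdiff (Y 0) (lin_form t ^ k) = Const t * A"
    by (simp add: pdiff_power) (simp add: lin_form_def)
  then show ?thesis by (simp add: br_def flow_x_def flow_y_def Const_mult algebra_simps del: cp.scale_scale)
qed

text \<open>Composing a reducing substitution with the flow at time -u undoes the flow at time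
  u.\<close>

lemma reducible_flow:
  assumes "reducible_to M c f" "odd k"
  shows "reducible_to M c (flow t k u f)"
proof -
  obtain P Q where PQ: "P \<in> parity_space False" "Q \<in> parity_space False" "br P Q = 1" "psub P Q f = nform M c"
    and f: "f \<in> parity_space True"
    using assms by (auto simp: reducible_to_def)
  let ?P = "psub P Q (flow_x t k (- u))" and ?Q = "psub P Q (flow_y t k (- u))"
  note fl = flow_parity[OF assms(2), of t]
  have PQ': "?P \<in> parity_space False" "?Q \<in> parity_space False"
    using psub_parity[OF PQ(1,2)] fl by auto
  have b: "br ?P ?Q = 1"
    using br_psub[OF parity_space_indets[OF fl(1)] parity_space_indets[OF fl(2)]] PQ(3) by (simp add: br_flow)
  have comp: "psub ?P ?Q g = psub P Q (flow t k (- u) g)" if "indets g \<subseteq> plane" for g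
    unfolding psubst_psubst by (rule psubst_cong) (auto split: coord.splits)
  have "psub ?P ?Q (flow t k u f) = psub (psub ?P ?Q (flow_x t k u)) (psub ?P ?Q (flow_y t k u)) f"
    unfolding psubst_psubst[of _ _ f] by (rule psubst_cong) (auto split: coord.splits)
  also have "psub ?P ?Q (flow_x t k u) = P"
    using comp[OF parity_space_indets[OF fl(1)]] flow_inverse(1)[of t k "- u"] by simp
  also have "psub ?P ?Q (flow_y t k u) = Q"
    using comp[OF parity_space_indets[OF fl(2)]] flow_inverse(2)[of t k "- u"] by simp
  finally show ?thesis
    unfolding reducible_to_def using PQ' b PQ(4) psub_parity[OF fl(1) fl(2) f, of u u]
    by (intro conjI bexI[of _ ?P] bexI[of _ ?Q]) simp_all
qed

text \<open>The flow as a polynomial in the time with polynomial coefficients, the form of a curve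
  that \<open>sml_curve\<close> accepts.\<close>

definition flow_curve :: "complex \<Rightarrow> nat \<Rightarrow> opoly \<Rightarrow> opoly poly" where
  "flow_curve t k = eval_with (\<lambda>c. [:Const c:])
     (\<lambda>v. case v of X _ \<Rightarrow> [:Var (X 0), - (Const t * lin_form t ^ k):] | Y _ \<Rightarrow> [:yv, lin_form t ^ k:])"

lemma coeff_hom_poly: "coeff_hom (\<lambda>c. [:Const c:] :: opoly poly)"
  by (simp add: coeff_hom_def Const_add Const_mult one_pCons)

lemma flow_curve_hom [simp]:
  "flow_curve t k (Const a) = [:Const a:]" "flow_curve t k (p + q) = flow_curve t k p + flow_curve t k q"
  "flow_curve t k (p * q) = flow_curve t k p * flow_curve t k q"
  "flow_curve t k (Var (X i)) = [:Var (X 0), - (Const t * lin_form t ^ k):]"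
  "flow_curve t k (Var (Y i)) = [:yv, lin_form t ^ k:]" "flow_curve t k (p ^ j) = flow_curve t k p ^ j" "flow_curve t k 0 = 0"
  by (simp_all add: flow_curve_def eval_with_hom coeff_hom_poly)

lemma poly_flow_curve: "poly (flow_curve t k f) (Const u) = flow t k u f"
  by (induction f rule: cpoly_induct_UNIV)
    (auto split: coord.splits simp: flow_x_def flow_y_def psubst_hom(2) elim: coord.exhaust, (case_tac v; simp add: flow_x_def flow_y_def)?)

lemma coeff_flow_curve:
  assumes "indets f \<subseteq> plane"
  shows "coeff (flow_curve t k f) 0 = f"
    "coeff (flow_curve t k f) 1 = lin_form t ^ k * pdiff (Y 0) f - Const t * lin_form t ^ k * pdiff (X 0) f"
  using assms
proof (induction f rule: cpoly_induct)
  case (Const c)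
  { case 1 show ?case by simp next case 2 show ?case by simp }
next
  case (Var v)
  { case 1 show ?case using Var by (auto simp: plane_def) next case 2 show ?case using Var by (auto simp: plane_def) }
next
  case (add p q)
  { case 1 show ?case using add by simp next case 2 show ?case using add by (simp add: algebra_simps) }
next
  case (mult p q)
  { case 1 show ?case using mult by (simp add: coeff_mult) 
  next
    case 2
    have "coeff (flow_curve t k (p * q)) 1 = coeff (flow_curve t k p) 0 * coeff (flow_curve t k q) 1 +
        coeff (flow_curve t k p) 1 * coeff (flow_curve t k q) 0"
      by (simp add: coeff_mult)
    then show ?case by (simp only: mult pdiff_mult) (simp only: algebra_simps)
  }
qed

lemma coeff_flow_curve_parity:
  assumes "odd k" "f \<in> parity_space e"
  shows "coeff (flow_curve t k f) j \<in> parity_space e"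
proof -
  let ?PP = "\<lambda>e C. \<forall>j. coeff C j \<in> parity_space e"
  have mult: "?PP (e1 = e2) (C * D)" if "?PP e1 C" "?PP e2 D" for e1 e2 C D
    unfolding coeff_mult using that by (intro allI parity_space_sum parity_space_mult) auto
  have pow: "?PP (even i) (C ^ i)" if "?PP False C" for C i
  proof (induction i)
    case 0
    show ?case by (simp add: one_pCons coeff_pCons split: nat.splits)
  next
    case (Suc i)
    show ?case using mult[OF that Suc] by simp
  qed
  have lk: "lin_form t ^ k \<in> parity_space False" using parity_space_power[OF lin_form_parity, of t k] assms(1) by simp
  have x: "?PP False [:Var (X 0), - (Const t * lin_form t ^ k):]" "?PP False [:yv, lin_form t ^ k:]"
    using lk by (auto simp: coeff_pCons split: nat.splits intro: parity_space_uminus parity_space_scale)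
  have "?PP e (flow_curve t k f)" using assms(2)
  proof (induction rule: parity_space_induct)
    case (step c a b q)
    have "?PP (even a = even b) (flow_curve t k (xymon a b))"
      unfolding xymon_def flow_curve_hom by (rule mult[OF pow[OF x(1)] pow[OF x(2)]])
    moreover have "(even a = even b) = e" using step(1) by auto
    ultimately have "?PP e (flow_curve t k (xymon a b))" by simp
    then show ?case using step(3) by (auto intro!: parity_space_add parity_space_scale)
  qed simp
  then show ?thesis by blast
qed

lemma lin_symt_dpw:
  assumes "lin_on (sym_power n e) l" "f \<in> parity_space e" "u \<in> parity_space e"
  shows "(\<Sum>j<n. l (symt n ((\<lambda>_. f)(j := u)))) = fact n * l (dpw n f u)"
proof -
  have "(\<Sum>j<n. l (symt n ((\<lambda>_. f)(j := u)))) = l (\<Sum>j<n. symt n ((\<lambda>_. f)(j := u)))"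
    by (rule lin_on_sum[OF assms(1) subspace_sym_power, symmetric])
      (use assms in \<open>auto intro!: symt_in_sym_power\<close>)
  then show ?thesis
    using lin_onD(2)[OF assms(1) dpw_in_sym_power[OF assms(2,3)]] by (simp add: symt_dpw)
qed

text \<open>A polynomial in the time that is constant has zero linear coefficient. Up to the factor
  k + 1 from differentiating the power, that coefficient is the derivative along the
  Hamiltonian.\<close>

lemma flow_derivative:
  assumes l: "lin_on (sym_power n True) l" and f: "f \<in> parity_space True" and k: "odd k"
    and const: "\<And>u. l (pw n (flow t k u f)) = v"
  shows "l (dpw n f (br (lin_form t ^ Suc k) f)) = 0"
proof -
  let ?C = "flow_curve t k f"
  note C = coeff_flow_curve_parity[OF k f, of t]
  have sml: "sym_multilinear n (parity_space True) (\<lambda>a. l (symt n a))"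
    by (rule symt_sml[OF l subspace_sym_power subspace_parity_space symt_in_sym_power])
  obtain U where U: "\<forall>u. poly U u = l (symt n (\<lambda>i. poly ?C (Const u)))"
    "coeff U 1 = (\<Sum>j<n. l (symt n ((\<lambda>i. coeff ?C 0)(j := coeff ?C 1))))"
    using sml_curve[OF sml subspace_parity_space, where c = "\<lambda>_. ?C", OF C] by (elim exE conjE)
  have "poly U u = fact n * v" for u
  proof -
    have "pw n (flow t k u f) \<in> sym_power n True"
      by (rule pw_in_sym_power[OF psub_parity[OF flow_parity(1)[OF k] flow_parity(2)[OF k] f]])
    then show ?thesis
      using U(1) const[of u] lin_onD(2)[OF l] by (simp add: poly_flow_curve symt_const)
  qed
  then have "poly U = poly [:fact n * v:]" by (intro ext) simp
  then have "U = [:fact n * v:]" by (simp add: poly_eq_poly_eq_iff)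
  then have "coeff U 1 = 0" by simp
  let ?d = "lin_form t ^ k * pdiff (Y 0) f - Const t * lin_form t ^ k * pdiff (X 0) f"
  have d: "?d \<in> parity_space True" "coeff ?C 0 = f" "coeff ?C 1 = ?d"
    using C[of 1] coeff_flow_curve[OF parity_space_indets[OF f]] by simp_all
  have "fact n * l (dpw n f ?d) = 0"
    using lin_symt_dpw[OF l f d(1)] U(2) \<open>coeff U 1 = 0\<close> unfolding d(2,3) by simp
  moreover have "br (lin_form t ^ Suc k) f = Const (of_nat (Suc k)) * ?d"
    unfolding br_def pdiff_power by (simp add: lin_form_def Const_of_nat algebra_simps)
  ultimately show ?thesis
    using lin_onD(2)[OF l dpw_even[OF f d(1)]] by (simp add: dpw_scale)
qed

text \<open>The powers (x + t y)^(2m) span the even polynomials: the coefficient of t^j is a nonzero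
  binomial multiple of x^(2m-j) y^j, and comparing coefficients isolates each monomial.\<close>

lemma flow_derivatives:
  assumes l: "lin_on (sym_power n True) l" and f: "f \<in> parity_space True"
    and const: "\<And>t k u. odd k \<Longrightarrow> l (pw n (flow t k u f)) = v"
    and h: "h \<in> parity_space True"
  shows "l (dpw n f (br h f)) = 0"
proof -
  define L where "L = (\<lambda>h. l (dpw n f (br h f)))"
  have L: "lin_on (parity_space True) L"
    unfolding L_def lin_on_def
    by (auto simp: br_add_left br_scale_left dpw_add dpw_scale
        lin_onD(1)[OF l dpw_even[OF f br_even] dpw_even[OF f br_even]] lin_onD(2)[OF l dpw_even[OF f br_even]] f)
  have pow: "L (lin_form t ^ (2 * m)) = 0" for t m
  proof (cases m)
    case 0
    have "dpw n f 0 = Const 0 * dpw n f 0" using dpw_scale[of n f 0 0] by simp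
    then have "dpw n f 0 = 0" by simp
    then show ?thesis using 0 lin_on_zero[OF l] by (simp add: L_def br_def)
  next
    case (Suc m')
    then show ?thesis using flow_derivative[OF l f, of "Suc (2 * m')" t v] const by (simp add: L_def)
  qed
  have mon: "L (xymon a b) = 0" if "even (a + b)" for a b
  proof -
    obtain m where m: "a + b = 2 * m" using \<open>even (a + b)\<close> by (elim evenE)
    have X: "xymon (2 * m - j) j \<in> parity_space True" if "j \<le> 2 * m" for j
      using that by (intro xymon_in_parity_space) auto
    have "(\<Sum>j\<in>{..2 * m}. t ^ j * (of_nat (2 * m choose j) * L (xymon (2 * m - j) j))) = 0" for t
    proof -
      have "lin_form t ^ (2 * m) = (\<Sum>j\<le>2 * m. Const (of_nat (2 * m choose j) * t ^ j) * xymon (2 * m - j) j)"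
        unfolding lin_form_def add.commute[of "Var (X 0)"] binomial_ring
        by (intro sum.cong refl)
          (simp only: xymon_def Const_mult Const_of_nat Const_power power_mult_distrib mult_ac)
      then have "L (lin_form t ^ (2 * m)) =
          L (\<Sum>j\<le>2 * m. Const (of_nat (2 * m choose j) * t ^ j) * xymon (2 * m - j) j)"
        by (simp only:)
      also have "\<dots> = (\<Sum>j\<le>2 * m. of_nat (2 * m choose j) * t ^ j * L (xymon (2 * m - j) j))"
        by (rule lin_on_sum_scale[OF L subspace_parity_space]) (rule X, simp)
      finally show ?thesis using pow[of t m] by (simp only: mult.assoc mult.left_commute)
    qed
    then have "(\<Sum>j\<in>{j\<in>{..2 * m}. j = b}. of_nat (2 * m choose j) * L (xymon (2 * m - j) j)) = 0"
      by (intro sum_powers_zero_coeff[where k = "\<lambda>j. j"]) auto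
    moreover have "{j\<in>{..2 * m}. j = b} = {b}" "2 * m - b = a" using m by auto
    moreover have "2 * m choose b \<noteq> 0" using m by (simp add: binomial_eq_0_iff)
    ultimately show ?thesis by simp
  qed
  have "L h = 0"
    using h
  proof (induction rule: parity_space_induct)
    case zero
    show ?case using lin_on_zero[OF L] by simp
  next
    case (step c a b q)
    then show ?case using mon[of a b] lin_onD[OF L] xymon_in_parity_space[of a b True]
      by (simp add: parity_space_scale)
  qed
  then show ?thesis by (simp add: L_def)
qed

text \<open>The normal form has coefficient 1 at y^2. After an odd substitution into an even f,
  constant terms of f give only constants and terms of degree above 2 vanish to higher order, so
  this coefficient must come from the quadratic part of f.\<close>

lemma nonvanishing_reducible:
  assumes f: "f \<in> parity_space True" and PQ: "P \<in> parity_space False" "Q \<in> parity_space False"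
    and eq: "psub P Q f = nform M c"
  shows "nonvanishing_second_derivative (emb f)"
proof (rule ccontr)
  assume no: "\<not> nonvanishing_second_derivative (emb f)"
  have "emb (nform M c) $ 2 $ 0 = 1"
  proof -
    have "emb (Const (c i) * xymon (2 * (i - 1)) 0) $ 2 $ 0 = 0" for i
      unfolding emb_scale_nth emb_xymon_nth by simp
    moreover have "emb (yv ^ 2) $ 2 $ 0 = 1" by (simp add: fps_X_power_nth)
    ultimately show ?thesis unfolding nform_def emb_hom(4,10) by (simp add: fps_sum_nth del: emb_hom(5))
  qed
  moreover have "formal_subst (emb f) (emb P) (emb Q) $ 2 $ 0 = 0"
    unfolding formal_subst_def fps_nth_Abs_fps
  proof (intro sum.neutral ballI)
    fix i j :: nat
    have "i + j = 0 \<or> odd (i + j) \<or> i + j = 2 \<or> 2 < i + j" by presburger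
    then consider "i + j = 0" | "odd (i + j)" | "i + j = 2" | "2 < i + j" by blast
    then show "emb f $ j $ i * (emb P ^ i * emb Q ^ j) $ 2 $ 0 = 0"
    proof cases
      case 1
      then show ?thesis by simp
    next
      case 2
      then show ?thesis using formal_parity_emb[OF f, of i j] by simp
    next
      case 3
      then show ?thesis using no by (auto simp: nonvanishing_second_derivative_def)
    next
      case 4
      then show ?thesis using monomial_vanishes[OF PQ, of 0 2 i j] by simp
    qed
  qed
  ultimately show False using formal_subst_emb[OF PQ f] eq by simp
qed

lemma s_functional_value:
  assumes s: "is_s_functional i \<psi>" and f: "reducible_to M c f" and c: "\<forall>i>M. c i = 0"
  shows "\<psi> (pw i f) = c i"
proof -
  obtain P Q where PQ: "P \<in> parity_space False" "Q \<in> parity_space False" "br P Q = 1" "psub P Q f = nform M c"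
    and fe: "f \<in> parity_space True"
    using f by (auto simp: reducible_to_def)
  have "normal_form c = formal_subst (emb f) (emb P) (emb Q)"
    using formal_subst_emb[OF PQ(1,2) fe] emb_nform[OF c] PQ(4) by simp
  then have "equivalent (emb f) (normal_form c)"
    using even_symplectomorphism_emb[OF PQ(1-3)] unfolding equivalent_def by blast
  moreover have "formal_even (emb f)"
    using formal_parity_emb[OF fe] by (auto simp: formal_even_def)
  ultimately have "eventually (\<lambda>N. \<psi> (tensor_power i N (emb f)) = c i) sequentially"
    using s nonvanishing_reducible[OF fe PQ(1,2,4)] by (simp add: is_s_functional_def)
  with tensor_power_emb[OF fe, of i] have "eventually (\<lambda>N. \<psi> (pw i f) = c i) sequentially"
    by eventually_elim simp
  then show ?thesis by simp
qed

text \<open>The functions reducible to a normal form by polynomial symplectomorphisms are stable under the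
  flows of \<open>(x + t y)\<^sup>2\<^sup>m\<close>, and these Hamiltonians span. So the functionals vanishing on the powers of
  such functions form a class to which the slice argument applies.\<close>

lemma s_functional_HP0:
  assumes s: "is_s_functional i \<psi>"
  shows "\<psi> \<in> HP0_dual i (O_B i)"
proof (rule HP0_B_of_psum)
  show lin: "lin_on (sym_power i True) \<psi>" and "\<And>p. p \<notin> sym_power i True \<Longrightarrow> \<psi> p = 0"
    using s by (auto simp: is_s_functional_def dual_iff O_B_eq)
  let ?F = "{l. lin_on (sym_power i True) l \<and> (\<forall>M c f. (\<forall>i>M. c i = 0) \<and> reducible_to M c f \<longrightarrow> l (pw i f) = 0)}"
  \<comment> \<open>The common value v is \<open>c i\<close> when l is \<psi> itself and 0 for
    members of the family. In both cases constancy along the flows kills the derivative.\<close>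
  have red: "l (poisson i (psum i h) (pw i f)) = 0"
    if l: "lin_on (sym_power i True) l" and h: "h \<in> parity_space True" and c: "\<forall>i>M. c i = 0" and f: "reducible_to M c f"
      and v: "\<And>f. reducible_to M c f \<Longrightarrow> l (pw i f) = v" for l h M c f v
  proof -
    have fe: "f \<in> parity_space True" using f by (simp add: reducible_to_def)
    have "l (dpw i f (br h f)) = 0"
      by (rule flow_derivatives[OF l fe _ h]) (rule v[OF reducible_flow[OF f]])
    then show ?thesis using poisson_psum_pw[OF parity_space_indets[OF h] parity_space_indets[OF fe]] by simp
  qed
  fix h q assume h: "h \<in> parity_space True" and q: "q \<in> sym_power i True"
  show "\<psi> (poisson i (psum i h) q) = 0"
  proof (rule normal_forms_slice[where \<F> = ?F and n = i and \<phi> = "\<lambda>p. \<psi> (poisson i (psum i h) p)"])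
    show "(\<lambda>p. \<psi> (poisson i (psum i h) p)) \<in> ?F"
      using lin_on_poisson'[OF lin psum_sym_power[OF h]] red[OF lin h] s_functional_value[OF s]
      by (simp, blast)
    show "\<exists>l'\<in>?F. \<forall>p\<in>sym_power i True. l' p = l (poisson i (psum i h) p)"
      if l: "l \<in> ?F" and h: "h \<in> parity_space True" for l h
    proof (rule bexI[where x = "\<lambda>p. l (poisson i (psum i h) p)"])
      have ll: "lin_on (sym_power i True) l" using l by simp
      show "(\<lambda>p. l (poisson i (psum i h) p)) \<in> ?F"
        using lin_on_poisson'[OF ll psum_sym_power[OF h]] red[OF ll h, where v = 0] l by (simp, blast)
    qed simp
    show "l (pw i (yv ^ 2 + \<nu>)) = 0" if l: "l \<in> ?F" and \<nu>: "\<nu> \<in> even_x" for l \<nu>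
    proof -
      obtain M c where c: "\<forall>i>M. c i = 0" "yv ^ 2 + \<nu> = nform M c" using even_x_nform[OF \<nu>] by blast
      have "l (pw i (nform M c)) = 0" using l c(1) reducible_nform by blast
      then show ?thesis unfolding c(2) .
    qed
    show "lin_on (sym_power i True) l" if "l \<in> ?F" for l using that by simp
  qed (rule q)
qed

lemma s_functional_nform:
  assumes "is_s_functional i \<psi>" "\<forall>i>M. c i = 0"
  shows "\<psi> (pw i (nform M c)) = c i"
  by (rule s_functional_value[OF assms(1) reducible_nform assms(2)])

section \<open>All invariant functionals are polynomials in the \<open>s\<^sub>i\<close>\<close>

lemma Const_prod: "Const (\<Prod>i\<in>I. f i) = (\<Prod>i\<in>I. Const (f i))"
  by (induction I rule: infinite_finite_induct) (auto simp: Const_mult)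

lemma pw_sum_expand:
  assumes "finite I"
  shows "pw n (\<Sum>i\<in>I. Const (k i) * b i) =
    (\<Sum>\<tau>\<in>Pi\<^sub>E {..<n} (\<lambda>_. I). Const (\<Prod>j<n. k (\<tau> j)) * tens n (\<lambda>j. b (\<tau> j)))"
proof -
  have "pw n (\<Sum>i\<in>I. Const (k i) * b i) = (\<Prod>j<n. \<Sum>i\<in>I. Const (k i) * shift j (b i))"
    by (simp add: tens_def)
  also have "\<dots> = (\<Sum>\<tau>\<in>Pi\<^sub>E {..<n} (\<lambda>_. I). \<Prod>j<n. Const (k (\<tau> j)) * shift j (b (\<tau> j)))"
    using assms by (intro prod_sum_PiE) auto
  finally show ?thesis by (simp only: prod.distrib Const_prod tens_def)
qed

text \<open>The pure tensors of the multinomial expansion are not symmetric. Averaging over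
  permutations makes each term a symmetric tensor, to which a functional on the symmetric power
  applies termwise.\<close>

lemma symt_sum_expand:
  assumes I: "finite I" and b: "\<And>i. b i \<in> parity_space True"
  shows "Const (fact n) * pw n (\<Sum>i\<in>I. Const (k i) * b i) =
    (\<Sum>\<tau>\<in>Pi\<^sub>E {..<n} (\<lambda>_. I). Const (\<Prod>j<n. k (\<tau> j)) * symt n (\<lambda>j. b (\<tau> j)))"
proof -
  let ?v = "\<Sum>i\<in>I. Const (k i) * b i" and ?P = "Pi\<^sub>E {..<n} (\<lambda>_. I)"
  have v: "?v \<in> parity_space True" using b by (intro parity_space_sum parity_space_scale)
  have t: "act (\<sigma>, {}) (tens n (\<lambda>j. b (\<tau> j))) = tens n ((\<lambda>j. b (\<tau> j)) \<circ> inv \<sigma>)" if "\<sigma> permutes {..<n}" for \<sigma> \<tau>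
    using act_tens[of "\<lambda>j. b (\<tau> j)" "\<lambda>_. True", OF b that, of "{}"] by simp
  have "Const (fact n) * pw n ?v = (\<Sum>\<sigma> | \<sigma> permutes {..<n}. act (\<sigma>, {}) (pw n ?v))"
    using act_pw[OF v, of _ n "{}"] by (simp add: card_permutations Const_of_nat[symmetric])
  also have "\<dots> = (\<Sum>\<sigma> | \<sigma> permutes {..<n}. \<Sum>\<tau>\<in>?P. Const (\<Prod>j<n. k (\<tau> j)) * tens n ((\<lambda>j. b (\<tau> j)) \<circ> inv \<sigma>))"
    by (intro sum.cong refl) (simp only: pw_sum_expand[OF I] act_hom t mem_Collect_eq)
  also have "\<dots> = (\<Sum>\<tau>\<in>?P. Const (\<Prod>j<n. k (\<tau> j)) * (\<Sum>\<sigma> | \<sigma> permutes {..<n}. tens n ((\<lambda>j. b (\<tau> j)) \<circ> inv \<sigma>)))"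
    unfolding sum_distrib_left by (rule sum.swap)
  also have "\<dots> = (\<Sum>\<tau>\<in>?P. Const (\<Prod>j<n. k (\<tau> j)) * symt n (\<lambda>j. b (\<tau> j)))"
    using sum_permutations_inverse[of "\<lambda>\<sigma>. tens n ((\<lambda>j. b (\<tau> j)) \<circ> \<sigma>)" "{..<n}" for \<tau>]
    by (simp add: symt_def)
  finally show ?thesis .
qed

text \<open>Putting y^2 at index 0 makes 2 - 2 i the eigenvalue of {x y, -} on every basis
  element.\<close>

definition nform_basis :: "nat \<Rightarrow> opoly" where
  "nform_basis i = (if i = 0 then yv ^ 2 else xymon (2 * (i - 1)) 0)"

lemma nform_basis_parity: "nform_basis i \<in> parity_space True"
  by (auto simp: nform_basis_def intro: xymon_in_parity_space square_parity[OF Var_in_parity_space(2)])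

lemma nform_eq: "nform M c = (\<Sum>i\<in>{..M}. Const (if i = 0 then 1 else c i) * nform_basis i)"
proof -
  have "{..M} = insert 0 {1..M}" by auto
  then show ?thesis by (simp add: nform_def nform_basis_def)
qed

lemma br_xy_basis:
  "br (Var (X 0) * yv) (nform_basis i) = Const (2 - 2 * of_nat i) * nform_basis i"
proof (cases i)
  case 0
  then show ?thesis by (simp add: nform_basis_def br_def pdiff_power power2_eq_square)
next
  case (Suc i')
  have nb: "nform_basis i = Var (X 0) ^ (2 * i')" by (simp add: Suc nform_basis_def xymon_def)
  have a: "Var (X 0) * (of_nat (2 * i') * Var (X 0) ^ (2 * i' - 1)) = of_nat (2 * i') * (Var (X 0) ^ (2 * i') :: opoly)"
    by (cases i') simp_all
  have b: "Const (2 - 2 * of_nat i) = - of_nat (2 * i')"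
  proof -
    have "2 - 2 * of_nat i = - (of_nat (2 * i') :: complex)" by (simp add: Suc)
    then show ?thesis by (simp only: Const_uminus Const_of_nat)
  qed
  have "br (Var (X 0) * yv) (nform_basis i) = - (Var (X 0) * (of_nat (2 * i') * Var (X 0) ^ (2 * i' - 1)))"
    unfolding nb br_def pdiff_power by simp
  then show ?thesis by (simp only: a b nb mult_minus_left)
qed

text \<open>The Hamiltonian \<open>x y\<close> generates the torus scaling \<open>x\<close> and \<open>y\<close> oppositely.\<close>

lemma torus_weight:
  assumes \<phi>: "\<phi> \<in> HP0_dual n (O_B n)" and "\<phi> (symt n (\<lambda>j. nform_basis (\<tau> j))) \<noteq> 0"
  shows "(\<Sum>j<n. \<tau> j) = n"
proof -
  let ?a = "\<lambda>j. nform_basis (\<tau> j)" and ?h = "Var (X 0) * yv"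
  have h: "?h \<in> parity_space True"
    using parity_space_mult[of "Var (X 0)" False yv False] by simp
  have "(\<Sum>k<n. \<phi> (symt n (?a(k := br ?h (?a k))))) = 0"
    by (rule symt_form_invariant[OF \<phi> h nform_basis_parity])
  also have "(\<Sum>k<n. \<phi> (symt n (?a(k := br ?h (?a k))))) = (\<Sum>k<n. (2 - 2 * of_nat (\<tau> k)) * \<phi> (symt n ?a))"
  proof (intro sum.cong refl)
    fix k assume "k \<in> {..<n}"
    then have k: "k < n" by simp
    have "\<phi> (symt n (?a(k := Const (2 - 2 * of_nat (\<tau> k)) * ?a k))) =
        (2 - 2 * of_nat (\<tau> k)) * \<phi> (symt n (?a(k := ?a k)))"
      by (rule sml_scale[OF symt_form[OF \<phi>] nform_basis_parity k nform_basis_parity])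
    moreover have "?a(k := ?a k) = ?a" by auto
    ultimately show "\<phi> (symt n (?a(k := br ?h (?a k)))) = (2 - 2 * of_nat (\<tau> k)) * \<phi> (symt n ?a)"
      by (simp only: br_xy_basis)
  qed
  finally have "(\<Sum>k<n. (2 - 2 * of_nat (\<tau> k) :: complex)) = 0"
    using assms(2) by (simp add: sum_distrib_right[symmetric])
  then have "of_nat n = (\<Sum>k<n. of_nat (\<tau> k) :: complex)"
    by (simp add: sum_subtractf sum_distrib_left[symmetric])
  then have "(of_nat n :: complex) = of_nat (\<Sum>k<n. \<tau> k)" by simp
  then show ?thesis using of_nat_eq_iff by metis
qed

text \<open>Expand the power of a normal form multinomially. Invariance under x y leaves only index
  tuples with sum n; their entries are at most n, so one finite polynomial serves normal forms of
  any length.\<close>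

lemma HP0_B_polynomial:
  assumes \<phi>: "\<phi> \<in> HP0_dual n (O_B n)"
  shows "\<exists>f\<in>s_ring. (\<forall>m\<in>Poly_Mapping.keys f. wt m = n) \<and>
    (\<forall>M c. (\<forall>i>M. c i = 0) \<longrightarrow> \<phi> (pw n (nform M c)) = peval c f)"
proof -
  note lin = HP0_B_D(1)[OF \<phi>]
  let ?v = "\<lambda>\<tau>. \<phi> (symt n (\<lambda>j. nform_basis (\<tau> j)))"
  let ?P = "\<lambda>M. Pi\<^sub>E {..<n} (\<lambda>_. {..M::nat})"
  define T where "T = {\<tau> \<in> ?P n. (\<Sum>j<n. \<tau> j) = n}"
  \<comment> \<open>An index 0 stands for y^2, whose coefficient in a normal form is 1, and
    therefore contributes no variable.\<close>
  define \<mu> where "\<mu> = (\<lambda>\<tau>. \<Sum>j<n. if \<tau> j = (0::nat) then 0 else Poly_Mapping.single (\<tau> j) (1::nat))"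
  define f where "f = (\<Sum>\<tau>\<in>T. Poly_Mapping.single (\<mu> \<tau>) (?v \<tau> / fact n))"
  have finP: "finite (?P M)" for M by (intro finite_PiE) auto
  then have finT: "finite T" by (simp add: T_def)
  have mon: "mon_val c (\<mu> \<tau>) = (\<Prod>j<n. if \<tau> j = 0 then 1 else c (\<tau> j))" for c \<tau>
    unfolding \<mu>_def mon_val_sum by (intro prod.cong refl) simp
  have wt: "wt (\<mu> \<tau>) = (\<Sum>j<n. \<tau> j)" for \<tau>
    unfolding \<mu>_def mweight_sum by (intro sum.cong refl) simp
  have zero: "Poly_Mapping.lookup (\<mu> \<tau>) 0 = 0" for \<tau>
    unfolding \<mu>_def lookup_sum by (intro sum.neutral) (auto simp: lookup_single)
  have keys: "\<exists>\<tau>\<in>T. m = \<mu> \<tau>" if "m \<in> Poly_Mapping.keys f" for m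
  proof -
    have "(\<Sum>\<tau>\<in>T. Poly_Mapping.lookup (Poly_Mapping.single (\<mu> \<tau>) (?v \<tau> / fact n)) m) \<noteq> 0"
      using that by (simp add: f_def in_keys_iff lookup_sum)
    then obtain \<tau> where "\<tau> \<in> T" "Poly_Mapping.lookup (Poly_Mapping.single (\<mu> \<tau>) (?v \<tau> / fact n)) m \<noteq> 0"
      by (rule sum.not_neutral_contains_not_neutral)
    then show ?thesis by (auto simp: lookup_single when_def split: if_splits)
  qed
  have "f \<in> s_ring"
  proof -
    have "i \<ge> 1" if "m \<in> Poly_Mapping.keys f" "i \<in> Poly_Mapping.keys m" for i m
      using keys[OF that(1)] that(2) zero by (cases i) (auto simp: in_keys_iff)
    then show ?thesis by (auto simp: s_ring_def indets_def)
  qed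
  moreover have "\<forall>m\<in>Poly_Mapping.keys f. wt m = n"
    using keys wt by (force simp: T_def)
  moreover have "\<phi> (pw n (nform M c)) = peval c f" if c: "\<forall>i>M. c i = 0" for M c
  proof -
    define M' where "M' = max M n"
    let ?k = "\<lambda>i. if i = 0 then 1 else c i"
    have nf: "nform M c = (\<Sum>i\<in>{..M'}. Const (?k i) * nform_basis i)"
      using nform_extend[of M M' c] c by (simp add: nform_eq[symmetric] M'_def)
    have mem: "symt n (\<lambda>j. nform_basis (\<tau> j)) \<in> sym_power n True" for \<tau>
      by (rule symt_in_sym_power[OF nform_basis_parity])
    have "fact n * \<phi> (pw n (nform M c)) = \<phi> (Const (fact n) * pw n (nform M c))"
      using lin_onD(2)[OF lin pw_in_sym_power[OF nform_parity]] by simp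
    also have "\<dots> = (\<Sum>\<tau>\<in>?P M'. (\<Prod>j<n. ?k (\<tau> j)) * ?v \<tau>)"
      unfolding nf symt_sum_expand[of "{..M'}" nform_basis, OF finite_atMost nform_basis_parity]
      by (rule lin_on_sum_scale[OF lin subspace_sym_power mem])
    also have "\<dots> = (\<Sum>\<tau>\<in>T. (\<Prod>j<n. ?k (\<tau> j)) * ?v \<tau>)"
    proof (rule sum.mono_neutral_right[OF finP])
      have "?P n \<subseteq> ?P M'" by (rule PiE_mono) (simp add: M'_def)
      then show "T \<subseteq> ?P M'" by (auto simp: T_def)
      show "\<forall>\<tau>\<in>?P M' - T. (\<Prod>j<n. ?k (\<tau> j)) * ?v \<tau> = 0"
      proof
        fix \<tau> assume \<tau>: "\<tau> \<in> ?P M' - T"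
        have "?v \<tau> = 0"
        proof (rule ccontr)
          assume "?v \<tau> \<noteq> 0"
          then have s: "(\<Sum>j<n. \<tau> j) = n" by (rule torus_weight[OF \<phi>])
          have "\<tau> j \<le> n" if "j < n" for j
            using member_le_sum[of j "{..<n}" \<tau>] that s by simp
          then have "\<tau> \<in> T" using \<tau> s by (auto simp: T_def PiE_iff)
          with \<tau> show False by simp
        qed
        then show "(\<Prod>j<n. ?k (\<tau> j)) * ?v \<tau> = 0" by simp
      qed
    qed
    also have "\<dots> = fact n * peval c f"
    proof -
      have "peval c f = (\<Sum>\<tau>\<in>T. ?v \<tau> / fact n * (\<Prod>j<n. ?k (\<tau> j)))"
        unfolding f_def peval_hom(10) single_conv_mon_val
        by (intro sum.cong refl) (simp add: mon[symmetric], simp add: mon_val_def)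
      then show ?thesis by (simp add: sum_distrib_left mult.commute)
    qed
    finally show ?thesis by simp
  qed
  ultimately show ?thesis by blast
qed

section \<open>Weights\<close>

text \<open>The numbers 2^d are pairwise distinct, so scaling all coordinates by 2 detects
  homogeneity and replaces a grading by one eigenvalue equation.\<close>

definition dil :: "opoly \<Rightarrow> opoly" where
  "dil = psubst (\<lambda>v. Const 2 * Var v)"

definition total_degree :: "('v \<Rightarrow>\<^sub>0 nat) \<Rightarrow> nat" where
  "total_degree m = (\<Sum>v\<in>Poly_Mapping.keys m. Poly_Mapping.lookup m v)"

lemma dil_expand: "dil p = (\<Sum>m\<in>Poly_Mapping.keys p. Const (Poly_Mapping.lookup p m * 2 ^ total_degree m) * mon_val Var m)"
proof -
  have "mon_val (\<lambda>v. Const 2 * Var v :: opoly) m = Const (2 ^ total_degree m) * mon_val Var m" for m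
    by (simp only: mon_val_def total_degree_def power_mult_distrib prod.distrib power_sum Const_power Const_prod)
  then show ?thesis
    unfolding dil_def psubst_def eval_with_def mon_val_def[symmetric] Const_mult mult.assoc
    by (simp only:)
qed

lemma dil_homogeneous: "homogeneous e p \<Longrightarrow> dil p = Const (2 ^ e) * p"
proof -
  assume h: "homogeneous e p"
  have "dil p = (\<Sum>m\<in>Poly_Mapping.keys p. Const (2 ^ e) * (Const (Poly_Mapping.lookup p m) * mon_val Var m))"
    unfolding dil_expand
  proof (intro sum.cong refl)
    fix m assume "m \<in> Poly_Mapping.keys p"
    then have "total_degree m = e" using h by (simp add: homogeneous_def total_degree_def)
    then show "Const (Poly_Mapping.lookup p m * 2 ^ total_degree m) * mon_val Var m =
        Const (2 ^ e) * (Const (Poly_Mapping.lookup p m) * mon_val Var m)"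
      by (simp only: Const_mult mult_ac)
  qed
  then show ?thesis using arg_cong[OF cpoly_expand[of p], of "\<lambda>q. Const (2 ^ e) * q"]
    by (simp only: sum_distrib_left)
qed

lemma homogeneous_of_dil:
  assumes "dil p = Const (2 ^ e) * p" shows "homogeneous e p"
  unfolding homogeneous_def total_degree_def[symmetric]
proof
  fix m assume m: "m \<in> Poly_Mapping.keys p"
  have "Poly_Mapping.lookup (dil p) m = Poly_Mapping.lookup p m * 2 ^ total_degree m"
    unfolding dil_expand by (rule lookup_sum_mon_val) (use m in auto)
  then have "2 ^ e * Poly_Mapping.lookup p m = Poly_Mapping.lookup p m * 2 ^ total_degree m"
    using assms by (simp add: lookup_scale)
  then have "(2::complex) ^ e = 2 ^ total_degree m" using m by (simp add: in_keys_iff)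
  then have "(of_nat (2 ^ e) :: complex) = of_nat (2 ^ total_degree m)" by simp
  then have "(2::nat) ^ e = 2 ^ total_degree m" using of_nat_eq_iff by blast
  then show "total_degree m = e" by simp
qed

lemma dil_hom [simp]:
  "dil (Const a) = Const a" "dil (Var v) = Const 2 * Var v" "dil (p + q) = dil p + dil q"
  "dil (p * q) = dil p * dil q" "dil 0 = 0" "dil (p ^ k) = dil p ^ k"
  "dil (\<Sum>i\<in>I. g i) = (\<Sum>i\<in>I. dil (g i))" "dil (\<Prod>i\<in>I. g i) = (\<Prod>i\<in>I. dil (g i))"
  unfolding dil_def by (rule psubst_hom)+

lemma dil_xymon: "dil (xymon a b) = Const (2 ^ (a + b)) * xymon a b"
  by (simp only: xymon_def dil_hom power_mult_distrib power_add Const_mult Const_power mult_ac)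

lemma dil_shift: "dil (shift j a) = shift j (dil a)"
proof (induction a rule: cpoly_induct_UNIV)
  case (Var v)
  show ?case by (cases v) (simp_all only: dil_hom shift_hom)
qed simp_all

lemma dil_tens: "dil (tens n a) = tens n (\<lambda>j. dil (a j))"
  by (simp add: tens_def dil_shift)

lemma dil_parity: "f \<in> parity_space e \<Longrightarrow> dil f \<in> parity_space e"
proof (induction rule: parity_space_induct)
  case (step c a b q)
  have "dil (Const c * xymon a b + q) = Const c * (Const (2 ^ (a + b)) * xymon a b) + dil q"
    by (simp only: dil_hom dil_xymon)
  then show ?case
    using step by (simp only:) (intro parity_space_add parity_space_scale xymon_in_parity_space, auto)
qed simp

lemma dil_sym_power: "p \<in> sym_power n e \<Longrightarrow> dil p \<in> sym_power n e"
  by (induction rule: sym_power_induct)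
    (auto simp: dil_tens intro!: sym_power_add sym_power_scale pw_in_sym_power dil_parity)

lemma lin_on_dil: "lin_on (sym_power n e) \<phi> \<Longrightarrow> lin_on (sym_power n e) (\<lambda>p. \<phi> (dil p))"
  using dil_sym_power by (simp add: lin_on_def)

lemma dil_symt_monomials:
  "dil (symt n (mon_tuple m)) =
    Const (2 ^ (\<Sum>j<n. Poly_Mapping.lookup m (X j) + Poly_Mapping.lookup m (Y j))) * symt n (mon_tuple m)"
proof -
  let ?d = "\<lambda>j. Poly_Mapping.lookup m (X j) + Poly_Mapping.lookup m (Y j)"
  have "dil (tens n (mon_tuple m \<circ> \<sigma>)) = Const (2 ^ (\<Sum>j<n. ?d j)) * tens n (mon_tuple m \<circ> \<sigma>)"
    if \<sigma>: "\<sigma> permutes {..<n}" for \<sigma>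
  proof -
    have "dil (tens n (mon_tuple m \<circ> \<sigma>)) = (\<Prod>j<n. Const (2 ^ ?d (\<sigma> j)) * shift j (mon_tuple m (\<sigma> j)))"
      unfolding dil_tens by (simp add: tens_def dil_xymon)
    also have "\<dots> = Const (2 ^ (\<Sum>j<n. ?d (\<sigma> j))) * tens n (mon_tuple m \<circ> \<sigma>)"
      by (simp only: prod.distrib Const_prod power_sum tens_def o_apply)
    also have "(\<Sum>j<n. ?d (\<sigma> j)) = (\<Sum>j<n. ?d j)"
      using sum.permute[OF \<sigma>, of ?d] by (simp only: o_def)
    finally show ?thesis .
  qed
  then show ?thesis by (simp add: symt_def sum_distrib_left)
qed

definition scales_with :: "nat \<Rightarrow> nat \<Rightarrow> functional \<Rightarrow> bool" where
  "scales_with n d \<phi> \<longleftrightarrow> (\<forall>f\<in>parity_space True. \<phi> (pw n (dil f)) = 2 ^ d * \<phi> (pw n f))"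

lemma has_weight_of_scales:
  assumes lin: "lin_on (sym_power n True) \<phi>" and sc: "scales_with n d \<phi>"
  shows "has_weight (O_B n) (- int d) \<phi>"
  unfolding has_weight_def O_B_eq
proof (intro allI ballI impI, elim conjE)
  fix e p assume p: "p \<in> sym_power n True" and h: "homogeneous e p" and ne: "int e \<noteq> - (- int d)"
  have "(\<lambda>p. \<phi> (dil p)) p = (\<lambda>p. 2 ^ d * \<phi> p) p"
  proof (rule lin_on_pw_eq[OF lin_on_dil[OF lin] _ _ p])
    show "lin_on (sym_power n True) (\<lambda>p. 2 ^ d * \<phi> p)"
      using lin by (simp add: lin_on_def ring_distribs)
    show "\<phi> (dil (pw n f)) = 2 ^ d * \<phi> (pw n f)" if "f \<in> parity_space True" for f
      using sc that by (simp add: scales_with_def dil_tens)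
  qed
  then have "2 ^ e * \<phi> p = 2 ^ d * \<phi> p"
    using dil_homogeneous[OF h] lin_onD(2)[OF lin p] by simp
  moreover have "(2::complex) ^ e \<noteq> 2 ^ d"
  proof
    assume "(2::complex) ^ e = 2 ^ d"
    then have "(of_nat (2 ^ e) :: complex) = of_nat (2 ^ d)" by simp
    then have "(2::nat) ^ e = 2 ^ d" using of_nat_eq_iff by blast
    with ne show False by simp
  qed
  ultimately show "\<phi> p = 0" by auto
qed

text \<open>Weights are tested on homogeneous elements, but the power of a general f is not
  homogeneous. Its symmetrized monomials are, and those of degree other than d are killed.\<close>

lemma scales_of_has_weight:
  assumes lin: "lin_on (sym_power n True) \<phi>" and w: "has_weight (O_B n) (- int d) \<phi>"
  shows "scales_with n d \<phi>"
  unfolding scales_with_def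
proof
  fix f assume f: "f \<in> parity_space True"
  let ?p = "pw n f"
  have pS: "?p \<in> sym_power n True" using f by (rule pw_in_sym_power)
  then have pB: "?p \<in> O_B n" by (simp add: O_B_eq)
  let ?t = "\<lambda>m. symt n (mon_tuple m)"
  have t: "\<phi> (dil (?t m)) = 2 ^ d * \<phi> (?t m)" if "m \<in> Poly_Mapping.keys ?p" for m
  proof -
    have m: "?t m \<in> sym_power n True" by (rule O_B_symt[OF pB that])
    define e where "e = (\<Sum>j<n. Poly_Mapping.lookup m (X j) + Poly_Mapping.lookup m (Y j))"
    have dl: "dil (?t m) = Const (2 ^ e) * ?t m" unfolding e_def by (rule dil_symt_monomials)
    then have "homogeneous e (?t m)" by (rule homogeneous_of_dil)
    then have "e = d \<or> \<phi> (?t m) = 0" using w m unfolding has_weight_def O_B_eq by auto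
    then show ?thesis using dl lin_onD(2)[OF lin m] by auto
  qed
  have inv: "act (\<sigma>, {}) ?p = ?p" if "\<sigma> permutes {..<n}" for \<sigma>
    using act_pw[OF f that, of "{}"] by simp
  have ex: "Const (fact n) * ?p = (\<Sum>m\<in>Poly_Mapping.keys ?p. Const (Poly_Mapping.lookup ?p m) * ?t m)"
    by (rule symmetric_expand[OF sym_power_polys[OF pS] inv])
  have "fact n * \<phi> (dil ?p) = \<phi> (dil (Const (fact n) * ?p))"
    using lin_onD(2)[OF lin dil_sym_power[OF pS]] by simp
  also have "\<dots> = \<phi> (\<Sum>m\<in>Poly_Mapping.keys ?p. Const (Poly_Mapping.lookup ?p m) * dil (?t m))"
    unfolding ex by (simp only: dil_hom)
  also have "\<dots> = (\<Sum>m\<in>Poly_Mapping.keys ?p. Poly_Mapping.lookup ?p m * \<phi> (dil (?t m)))"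
    by (rule lin_on_sum_scale[OF lin subspace_sym_power dil_sym_power[OF O_B_symt[OF pB]]])
  also have "\<dots> = 2 ^ d * (\<Sum>m\<in>Poly_Mapping.keys ?p. Poly_Mapping.lookup ?p m * \<phi> (?t m))"
    unfolding sum_distrib_left by (intro sum.cong refl) (simp add: t)
  also have "(\<Sum>m\<in>Poly_Mapping.keys ?p. Poly_Mapping.lookup ?p m * \<phi> (?t m)) = \<phi> (Const (fact n) * ?p)"
    unfolding ex by (rule lin_on_sum_scale[OF lin subspace_sym_power O_B_symt[OF pB], symmetric])
  also have "\<dots> = fact n * \<phi> ?p" using lin_onD(2)[OF lin pS] by simp
  finally show "\<phi> (pw n (dil f)) = 2 ^ d * \<phi> (pw n f)"
    by (simp add: dil_tens)
qed

declare cp.scale_scale [simp del] cpc.vs2.scale_scale [simp del]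

section \<open>The extension condition on polynomials\<close>

text \<open>For \<open>\<theta> = \<Sum>\<^sub>j t\<^sub>j x\<^sup>2\<^sup>j\<^sup>+\<^sup>1\<close>, these are the coordinates \<open>s\<^sub>i\<close> of \<open>\<theta>\<^sup>2\<close> and of \<open>\<theta>'\<close>.\<close>

definition square_coords :: "(nat \<Rightarrow> complex) \<Rightarrow> nat \<Rightarrow> complex" where
  "square_coords t i = (if i < 2 then 0 else \<Sum>j\<le>i - 2. t j * t (i - 2 - j))"

definition deriv_coords :: "(nat \<Rightarrow> complex) \<Rightarrow> nat \<Rightarrow> complex" where
  "deriv_coords t i = (2 * of_nat i - 1) * t (i - 1)"

definition theta_deriv :: "(nat \<Rightarrow> complex) \<Rightarrow> spoly \<Rightarrow> complex" where
  "theta_deriv t f = (\<Sum>i\<in>indets f. deriv_coords t i * peval (square_coords t) (pdiff i f))"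

lemma theta_deriv_superset:
  assumes "finite V" "indets f \<subseteq> V"
  shows "theta_deriv t f = (\<Sum>i\<in>V. deriv_coords t i * peval (square_coords t) (pdiff i f))"
  unfolding theta_deriv_def
  by (rule sum.mono_neutral_left) (use assms in \<open>auto simp: pdiff_notin_indets\<close>)

lemma peval_has_derivative:
  assumes "finite V" "indets f \<subseteq> V"
  shows "((\<lambda>z. peval (\<lambda>i. c i + z * d i) f) has_field_derivative (\<Sum>i\<in>V. d i * peval c (pdiff i f))) (at 0)"
  using assms(2)
proof (induction f rule: cpoly_induct)
  case (Var v)
  have "(\<Sum>i\<in>V. d i * peval c (pdiff i (Var v))) = (\<Sum>i\<in>V. if i = v then d v else 0)"
    by (intro sum.cong) auto
  also have "\<dots> = d v" using Var assms(1) by (simp add: sum.delta')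
  finally show ?case by (auto intro!: derivative_eq_intros)
next
  case (add p q)
  from DERIV_add[OF add] show ?case by (simp add: ring_distribs sum.distrib)
next
  case (mult p q)
  have "(\<Sum>i\<in>V. d i * peval c (pdiff i (p * q))) =
      (\<Sum>i\<in>V. d i * peval c (pdiff i p) * peval c q + d i * peval c (pdiff i q) * peval c p)"
    by (intro sum.cong refl) (simp only: pdiff_mult peval_hom distrib_left mult_ac)
  then show ?case using DERIV_mult[OF mult]
    by (simp add: sum.distrib sum_distrib_right)
qed simp

lemma theta_deriv_has_derivative:
  "((\<lambda>z. peval (\<lambda>i. square_coords t i + z * deriv_coords t i) f) has_field_derivative theta_deriv t f) (at 0)"
  unfolding theta_deriv_def by (rule peval_has_derivative) auto

lemma s_ring_indets: "f \<in> s_ring \<Longrightarrow> i \<in> indets f \<Longrightarrow> 1 \<le> i"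
  by (auto simp: s_ring_def)

lemma graded_part_s_ring: "f \<in> s_ring \<Longrightarrow> graded_part w d f \<in> s_ring"
  using indets_graded_part[of w d f] by (auto simp: s_ring_def)

text \<open>The substitution t_j -> u^(e j) t_j multiplies the i-th coordinate of \<theta>^2 by u^(w
  i) and that of d\<theta>/dx by u^(w i + q). Vanishing for all t is thus a polynomial identity in
  u, whose coefficients are the conditions on the graded parts.\<close>

lemma theta_deriv_graded:
  assumes f: "f \<in> s_ring" and e: "\<And>j k. e j + e k = w (j + k + 2)" and q: "\<And>i. i \<ge> 1 \<Longrightarrow> e (i - 1) = w i + q"
    and zero: "\<And>t. theta_deriv t f = 0"
  shows "theta_deriv t (graded_part w d f) = 0"
proof -
  define D where "D = mweight w ` Poly_Mapping.keys f"
  have D: "finite D" "mweight w ` Poly_Mapping.keys f \<subseteq> D" by (simp_all add: D_def)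
  let ?c = "square_coords t" and ?d = "deriv_coords t"
  have eq: "(\<Sum>k\<in>D. u ^ (k + q) * theta_deriv t (graded_part w k f)) = 0" for u
  proof -
    let ?t = "\<lambda>j. u ^ e j * t j"
    have c: "square_coords ?t i = u ^ w i * ?c i" for i
    proof (cases "i < 2")
      case False
      have "?t j * ?t (i - 2 - j) = u ^ w i * (t j * t (i - 2 - j))" if "j \<le> i - 2" for j
      proof -
        have "j + (i - 2 - j) + 2 = i" using that False by linarith
        then have "e j + e (i - 2 - j) = w i" using e[of j "i - 2 - j"] by (simp only:)
        then show ?thesis by (metis (no_types, lifting) mult.assoc mult.left_commute power_add)
      qed
      then have "(\<Sum>j\<le>i - 2. ?t j * ?t (i - 2 - j)) = (\<Sum>j\<le>i - 2. u ^ w i * (t j * t (i - 2 - j)))"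
        by (intro sum.cong) auto
      then show ?thesis using False by (simp only: square_coords_def sum_distrib_left if_False)
    qed (simp add: square_coords_def)
    have d: "deriv_coords ?t i = u ^ w i * (u ^ q * ?d i)" if "i \<ge> 1" for i
      using q[OF that] by (simp add: deriv_coords_def power_add mult_ac)
    have "peval (\<lambda>i. square_coords ?t i + z * deriv_coords ?t i) f =
        (\<Sum>k\<in>D. u ^ k * peval (\<lambda>i. ?c i + (z * u ^ q) * ?d i) (graded_part w k f))" for z
    proof -
      have "peval (\<lambda>i. square_coords ?t i + z * deriv_coords ?t i) f =
          peval (\<lambda>i. u ^ w i * (?c i + (z * u ^ q) * ?d i)) f"
        by (rule peval_cong) (use s_ring_indets[OF f] c d in \<open>simp add: algebra_simps\<close>)
      then show ?thesis by (simp only: peval_scale_graded[OF D])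
    qed
    moreover have "((\<lambda>z. \<Sum>k\<in>D. u ^ k * peval (\<lambda>i. ?c i + (z * u ^ q) * ?d i) (graded_part w k f)) has_field_derivative
        (\<Sum>k\<in>D. u ^ k * (theta_deriv t (graded_part w k f) * u ^ q))) (at 0)"
    proof (rule DERIV_sum)
      fix k
      have 1: "((\<lambda>z. peval (\<lambda>i. ?c i + z * ?d i) (graded_part w k f)) has_field_derivative
          theta_deriv t (graded_part w k f)) (at (0 * u ^ q))"
        using theta_deriv_has_derivative by simp
      have 2: "((\<lambda>z. z * u ^ q) has_field_derivative u ^ q) (at 0)"
        by (auto intro!: derivative_eq_intros)
      show "((\<lambda>z. u ^ k * peval (\<lambda>i. ?c i + (z * u ^ q) * ?d i) (graded_part w k f)) has_field_derivative
          u ^ k * (theta_deriv t (graded_part w k f) * u ^ q)) (at 0)"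
        by (rule DERIV_cmult) (rule DERIV_chain2[OF 1 2])
    qed
    ultimately have "theta_deriv ?t f = (\<Sum>k\<in>D. u ^ k * (theta_deriv t (graded_part w k f) * u ^ q))"
      using theta_deriv_has_derivative[of ?t f] DERIV_unique by simp
    then show ?thesis using zero by (simp add: power_add mult_ac)
  qed
  have "(\<Sum>k\<in>{k\<in>D. k + q = d + q}. theta_deriv t (graded_part w k f)) = 0"
    by (rule sum_powers_zero_coeff[OF D(1) eq])
  moreover have "{k\<in>D. k + q = d + q} = (if d \<in> D then {d} else {})" by auto
  ultimately show ?thesis
  proof (cases "d \<in> D")
    case False
    then have "graded_part w d f = 0"
      by (intro poly_mapping_eqI) (auto simp: lookup_graded_part D_def in_keys_iff)
    then show ?thesis by (simp add: theta_deriv_def)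
  qed simp
qed

lemma theta_deriv_sum_parts:
  assumes "\<And>d. d \<in> D \<Longrightarrow> indets (g d) \<subseteq> V" "finite V" "\<And>d. d \<in> D \<Longrightarrow> theta_deriv t (g d) = 0"
  shows "theta_deriv t (\<Sum>d\<in>D. g d) = 0"
proof -
  have "indets (\<Sum>d\<in>D. g d) \<subseteq> V" using indets_sum[of g D] assms(1) by blast
  then have "theta_deriv t (\<Sum>d\<in>D. g d) = (\<Sum>d\<in>D. \<Sum>i\<in>V. deriv_coords t i * peval (square_coords t) (pdiff i (g d)))"
    using assms(2) by (simp add: theta_deriv_superset sum_distrib_left) (rule sum.swap)
  also have "\<dots> = (\<Sum>d\<in>D. theta_deriv t (g d))"
    using assms by (intro sum.cong) (auto simp: theta_deriv_superset)
  finally show ?thesis using assms(3) by simp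
qed

section \<open>Odd polynomials in x and their coordinates\<close>

definition theta_poly :: "nat \<Rightarrow> (nat \<Rightarrow> complex) \<Rightarrow> opoly" where
  "theta_poly K t = (\<Sum>j<K. Const (t j) * xymon (2 * j + 1) 0)"

lemma theta_poly_odd_x: "theta_poly K t \<in> odd_x"
  unfolding theta_poly_def odd_x_def by (intro cp.span_sum cp.span_scale cp.span_base) blast

lemma theta_poly_extend:
  assumes "K \<le> K'" "\<forall>j\<ge>K. t j = 0" shows "theta_poly K' t = theta_poly K t"
  unfolding theta_poly_def by (rule sum.mono_neutral_right) (use assms in auto)

lemma odd_x_theta_poly:
  assumes "\<theta> \<in> odd_x" shows "\<exists>K t. (\<forall>j\<ge>K. t j = 0) \<and> \<theta> = theta_poly K t"
  using assms
proof (induction rule: odd_x_induct)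
  case zero
  show ?case by (intro exI[of _ 0] exI[of _ "\<lambda>_. 0"]) (simp add: theta_poly_def)
next
  case (step c i q)
  then obtain K t where t: "\<forall>j\<ge>K. t j = 0" "q = theta_poly K t" by blast
  let ?K = "max K (i + 1)" and ?t = "\<lambda>j. t j + (if j = i then c else 0)"
  have "theta_poly ?K ?t = theta_poly ?K t + (\<Sum>j<?K. Const (if j = i then c else 0) * xymon (2 * j + 1) 0)"
    by (simp add: theta_poly_def Const_add ring_distribs sum.distrib)
  also have "(\<Sum>j<?K. Const (if j = i then c else 0) * xymon (2 * j + 1) 0) =
      (\<Sum>j<?K. if j = i then Const c * xymon (2 * i + 1) 0 else 0)"
    by (intro sum.cong) auto
  also have "\<dots> = Const c * xymon (2 * i + 1) 0" by (simp add: sum.delta')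
  also have "theta_poly ?K t = q" using theta_poly_extend[of K ?K t] t by simp
  finally have "Const c * xymon (2 * i + 1) 0 + q = theta_poly ?K ?t" by (simp add: add.commute)
  moreover have "\<forall>j\<ge>?K. ?t j = 0" using t by auto
  ultimately show ?case by (intro exI[of _ ?K] exI[of _ ?t]) simp
qed

lemma theta_poly_deriv:
  "pdiff (X 0) (theta_poly K t) = (\<Sum>i\<in>{1..K}. Const (deriv_coords t i) * xymon (2 * (i - 1)) 0)"
proof -
  have "pdiff (X 0) (theta_poly K t) = (\<Sum>j<K. Const (deriv_coords t (Suc j)) * xymon (2 * j) 0)"
    unfolding theta_poly_def pdiff_sum
  proof (intro sum.cong refl)
    fix j
    have "pdiff (X 0) (Const (t j) * xymon (2 * j + 1) 0) = Const (t j) * (Const (of_nat (2 * j + 1)) * xymon (2 * j) 0)"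
      by (simp only: pdiff_mult pdiff_Const pdiff_xymon mult_zero_left add_0_left add_diff_cancel_right')
    moreover have "deriv_coords t (Suc j) = t j * of_nat (2 * j + 1)" by (simp add: deriv_coords_def algebra_simps)
    ultimately show "pdiff (X 0) (Const (t j) * xymon (2 * j + 1) 0) = Const (deriv_coords t (Suc j)) * xymon (2 * j) 0"
      by (simp only: Const_mult mult.assoc)
  qed
  also have "\<dots> = (\<Sum>i\<in>{1..K}. Const (deriv_coords t i) * xymon (2 * (i - 1)) 0)"
    by (rule sum.reindex_bij_witness[of _ "\<lambda>i. i - 1" Suc]) auto
  finally show ?thesis .
qed

lemma theta_poly_square:
  assumes "\<forall>j\<ge>K. t j = 0"
  shows "theta_poly K t ^ 2 = (\<Sum>i\<in>{1..2 * K}. Const (square_coords t i) * xymon (2 * (i - 1)) 0)"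
proof -
  let ?g = "\<lambda>j k. Const (t j * t k) * xymon (2 * (j + k + 1)) 0"
  let ?A = "{..<K} \<times> {..<K}" and ?B = "Sigma {2..2 * K} (\<lambda>i. {..i - 2})"
  have "theta_poly K t ^ 2 = (\<Sum>j<K. \<Sum>k<K. ?g j k)"
    unfolding power2_eq_square theta_poly_def sum_product
  proof (intro sum.cong refl)
    fix j k
    have "Const (t j) * xymon (2 * j + 1) 0 * (Const (t k) * xymon (2 * k + 1) 0) =
        Const (t j) * Const (t k) * (xymon (2 * j + 1) 0 * xymon (2 * k + 1) 0)"
      by (simp only: mult_ac)
    also have "xymon (2 * j + 1) 0 * xymon (2 * k + 1) 0 = xymon (2 * (j + k + 1)) 0"
      by (simp add: xymon_mult)
    finally show "Const (t j) * xymon (2 * j + 1) 0 * (Const (t k) * xymon (2 * k + 1) 0) = ?g j k"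
      by (simp only: Const_mult)
  qed
  also have "\<dots> = (\<Sum>(j, k)\<in>?A. ?g j k)" by (simp add: sum.cartesian_product)
  also have "\<dots> = (\<Sum>(i, j)\<in>?B. ?g j (i - 2 - j))"
  \<comment> \<open>The second index set also contains pairs with an index beyond K. There t
    vanishes, so the correspondence is needed only between terms with a nonzero product.\<close>
  proof (rule sum.reindex_bij_witness_not_neutral[of "{p \<in> ?A. t (fst p) * t (snd p) = 0}" "{p \<in> ?B. t (snd p) * t (fst p - 2 - snd p) = 0}" _ "\<lambda>(i, j). (j, i - 2 - j)" "\<lambda>(j, k). (j + k + 2, j)"])
    show "(case b of (i, j) \<Rightarrow> (j, i - 2 - j)) \<in> ?A - {p \<in> ?A. t (fst p) * t (snd p) = 0}"
      if b: "b \<in> ?B - {p \<in> ?B. t (snd p) * t (fst p - 2 - snd p) = 0}" for b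
    proof -
      obtain i j where ij: "b = (i, j)" by (cases b)
      then have "t j \<noteq> 0" "t (i - 2 - j) \<noteq> 0" using b by auto
      then have "j < K" "i - 2 - j < K" using assms by (metis not_le)+
      then show ?thesis using \<open>t j \<noteq> 0\<close> \<open>t (i - 2 - j) \<noteq> 0\<close> by (simp add: ij)
    qed
  qed (auto simp: split_beta)
  also have "\<dots> = (\<Sum>i\<in>{2..2 * K}. \<Sum>j\<le>i - 2. ?g j (i - 2 - j))"
    by (subst sum.Sigma) auto
  also have "\<dots> = (\<Sum>i\<in>{2..2 * K}. Const (square_coords t i) * xymon (2 * (i - 1)) 0)"
  proof (intro sum.cong refl)
    fix i assume i: "i \<in> {2..2 * K}"
    have "?g j (i - 2 - j) = Const (t j * t (i - 2 - j)) * xymon (2 * (i - 1)) 0" if "j \<le> i - 2" for j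
    proof -
      have "j + (i - 2 - j) + 1 = i - 1" using that i by auto
      then show ?thesis by (simp only:)
    qed
    then have "(\<Sum>j\<le>i - 2. ?g j (i - 2 - j)) = (\<Sum>j\<le>i - 2. Const (t j * t (i - 2 - j)) * xymon (2 * (i - 1)) 0)"
      by (intro sum.cong) auto
    moreover have "\<not> i < 2" using i by simp
    ultimately show "(\<Sum>j\<le>i - 2. ?g j (i - 2 - j)) = Const (square_coords t i) * xymon (2 * (i - 1)) 0"
      by (simp only: square_coords_def Const_sum sum_distrib_right if_False)
  qed
  also have "\<dots> = (\<Sum>i\<in>{1..2 * K}. Const (square_coords t i) * xymon (2 * (i - 1)) 0)"
    by (rule sum.mono_neutral_left) (auto simp: square_coords_def)
  finally show ?thesis .
qed

lemma square_coords_support: "\<forall>j\<ge>K. t j = 0 \<Longrightarrow> i > 2 * K \<Longrightarrow> square_coords t i = 0"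
  unfolding square_coords_def
proof -
  assume t: "\<forall>j\<ge>K. t j = 0" and i: "i > 2 * K"
  have "t j * t (i - 2 - j) = 0" if "j \<le> i - 2" "\<not> i < 2" for j
  proof -
    show ?thesis
    proof (cases "j \<ge> K")
      case False
      then have "i - 2 - j \<ge> K" using that i by linarith
      then show ?thesis using t by simp
    qed (use t in simp)
  qed
  then show "(if i < 2 then 0 else \<Sum>j\<le>i - 2. t j * t (i - 2 - j)) = 0" by (auto intro!: sum.neutral)
qed

lemma nform_theta:
  assumes "\<forall>j\<ge>K. t j = 0"
  shows "yv ^ 2 + theta_poly K t ^ 2 + Const z * pdiff (X 0) (theta_poly K t) =
    nform (2 * K) (\<lambda>i. square_coords t i + z * deriv_coords t i)"
proof -
  have "(\<Sum>i\<in>{1..K}. Const (deriv_coords t i) * xymon (2 * (i - 1)) 0) =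
      (\<Sum>i\<in>{1..2 * K}. Const (deriv_coords t i) * xymon (2 * (i - 1)) 0)"
    by (rule sum.mono_neutral_left) (use assms in \<open>auto simp: deriv_coords_def\<close>)
  then have "yv ^ 2 + theta_poly K t ^ 2 + Const z * pdiff (X 0) (theta_poly K t) =
      yv ^ 2 + ((\<Sum>i\<in>{1..2 * K}. Const (square_coords t i) * xymon (2 * (i - 1)) 0) +
       Const z * (\<Sum>i\<in>{1..2 * K}. Const (deriv_coords t i) * xymon (2 * (i - 1)) 0))"
    by (simp only: theta_poly_deriv theta_poly_square[OF assms] add.assoc)
  also have "\<dots> = nform (2 * K) (\<lambda>i. square_coords t i + z * deriv_coords t i)"
    unfolding nform_def sum_distrib_left sum.distrib[symmetric]
    by (simp only: Const_add Const_mult ring_distribs mult.assoc)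
  finally show ?thesis .
qed

text \<open>As f involves finitely many variables, only finitely many t_j enter; this passes from
  arbitrary sequences to polynomials \<theta>.\<close>

lemma theta_deriv_truncate:
  assumes f: "f \<in> s_ring" and N: "indets f \<subseteq> {..N}"
  shows "theta_deriv (\<lambda>j. if j < N then t j else 0) f = theta_deriv t f"
proof -
  let ?t = "\<lambda>j. if j < N then t j else 0"
  have sq: "square_coords ?t i = square_coords t i" if "i \<le> N" for i
    using that by (auto simp: square_coords_def intro!: sum.cong)
  show ?thesis unfolding theta_deriv_def
  proof (intro sum.cong refl)
    fix i assume i: "i \<in> indets f"
    then have "1 \<le> i" "i \<le> N" using s_ring_indets[OF f] N by auto
    then have "deriv_coords ?t i = deriv_coords t i" by (auto simp: deriv_coords_def)
    moreover have "peval (square_coords ?t) (pdiff i f) = peval (square_coords t) (pdiff i f)"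
      by (rule peval_cong) (use indets_pdiff[of i f] N sq in auto)
    ultimately show "deriv_coords ?t i * peval (square_coords ?t) (pdiff i f) =
      deriv_coords t i * peval (square_coords t) (pdiff i f)" by simp
  qed
qed

lemma dpw_derivative:
  assumes l: "lin_on (sym_power n True) l" and f: "f \<in> parity_space True" and u: "u \<in> parity_space True"
  shows "((\<lambda>z. l (pw n (f + Const z * u))) has_field_derivative l (dpw n f u)) (at 0)"
proof -
  have sml: "sym_multilinear n (parity_space True) (\<lambda>a. l (symt n a))"
    by (rule symt_sml[OF l subspace_sym_power subspace_parity_space symt_in_sym_power])
  have C: "coeff [:f, u:] k \<in> parity_space True" for k
    using f u by (auto simp: coeff_pCons split: nat.splits)
  obtain U where U: "\<forall>z. poly U z = l (symt n (\<lambda>i. poly [:f, u:] (Const z)))"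
    "coeff U 1 = (\<Sum>j<n. l (symt n ((\<lambda>i. coeff [:f, u:] 0)(j := coeff [:f, u:] 1))))"
    using sml_curve[OF sml subspace_parity_space, where c = "\<lambda>_. [:f, u:]", OF C] by (elim exE conjE)
  have "poly U z = fact n * l (pw n (f + Const z * u))" for z
    using U(1) lin_onD(2)[OF l pw_in_sym_power[OF parity_space_add[OF f parity_space_scale[OF u]]], of "fact n" z]
    by (simp add: symt_const)
  then have "l (pw n (f + Const z * u)) = poly U z / fact n" for z by simp
  moreover have "coeff U 1 = fact n * l (dpw n f u)"
    using U(2) lin_symt_dpw[OF l f u] by simp
  moreover have "((\<lambda>z. poly U z / fact n) has_field_derivative poly (pderiv U) 0 / fact n) (at 0)"
    by (auto intro!: derivative_eq_intros poly_DERIV)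
  moreover have "poly (pderiv U) 0 = coeff U 1" by (simp add: poly_0_coeff_0 coeff_pderiv)
  ultimately show ?thesis by simp
qed

text \<open>Both conditions are derivatives at z = 0 of one function, the value of \<phi> on the
  power of y^2 + \<theta>^2 + z d\<theta>/dx, which is again a normal form.\<close>

lemma kappa_free_iff:
  fixes f :: spoly
  assumes \<phi>: "\<phi> \<in> HP0_dual n (O_B n)" and f: "f \<in> s_ring"
    and val: "\<And>M (c :: nat \<Rightarrow> complex). \<forall>i>M. c i = 0 \<Longrightarrow> \<phi> (pw n (nform M c)) = peval c f"
  shows "kappa_free n \<phi> \<longleftrightarrow> (\<forall>t. theta_deriv t f = 0)"
proof -
  note lin = HP0_B_D(1)[OF \<phi>]
  have eq: "\<phi> (dpw n (yv ^ 2 + theta_poly K t ^ 2) (pdiff (X 0) (theta_poly K t))) = theta_deriv t f"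
    if t: "\<forall>j\<ge>K. t j = 0" for K t
  proof -
    let ?\<theta> = "theta_poly K t"
    have supp: "\<forall>i>2 * K. square_coords t i + z * deriv_coords t i = 0" for z
      using square_coords_support[OF t] t by (auto simp: deriv_coords_def)
    have "((\<lambda>z. \<phi> (pw n (yv ^ 2 + ?\<theta> ^ 2 + Const z * pdiff (X 0) ?\<theta>))) has_field_derivative
        \<phi> (dpw n (yv ^ 2 + ?\<theta> ^ 2) (pdiff (X 0) ?\<theta>))) (at 0)"
      by (rule dpw_derivative[OF lin normal_parity(1)[OF theta_poly_odd_x] normal_parity(2)[OF theta_poly_odd_x]])
    then have "((\<lambda>z. peval (\<lambda>i. square_coords t i + z * deriv_coords t i) f) has_field_derivative
        \<phi> (dpw n (yv ^ 2 + ?\<theta> ^ 2) (pdiff (X 0) ?\<theta>))) (at 0)"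
      unfolding nform_theta[OF t] val[OF supp] .
    from DERIV_unique[OF this theta_deriv_has_derivative] show ?thesis .
  qed
  show ?thesis
  proof
    assume k: "kappa_free n \<phi>"
    show "\<forall>t. theta_deriv t f = 0"
    proof
      fix t :: "nat \<Rightarrow> complex"
      obtain N where N: "indets f \<subseteq> {..N}" using finite_nat_iff_bounded_le[of "indets f"] by auto
      let ?t = "\<lambda>j. if j < N then t j else 0"
      have "theta_deriv ?t f = 0"
        using k theta_poly_odd_x[of N ?t] eq[of N ?t] by (simp add: kappa_free_def)
      then show "theta_deriv t f = 0" using theta_deriv_truncate[OF f N] by simp
    qed
  next
    assume z: "\<forall>t. theta_deriv t f = 0"
    show "kappa_free n \<phi>"
      unfolding kappa_free_def
    proof
      fix \<theta> assume "\<theta> \<in> odd_x"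
      then obtain K t where "\<forall>j\<ge>K. t j = 0" "\<theta> = theta_poly K t" using odd_x_theta_poly by blast
      then show "\<phi> (dpw n (yv ^ 2 + \<theta> ^ 2) (pdiff (X 0) \<theta>)) = 0" using eq z by simp
    qed
  qed
qed

section \<open>The vector fields \<open>\<xi>\<^sub>k\<close>\<close>

text \<open>The series version of \<theta>, with t not necessarily of finite support: the square
  roots in \<open>xi\<close> are infinite series.\<close>

definition odd_series :: "(nat \<Rightarrow> complex) \<Rightarrow> complex fps" where
  "odd_series t = Abs_fps (\<lambda>n. if odd n then t (n div 2) else 0)"

lemma odd_series_eq:
  assumes "\<And>n. even n \<Longrightarrow> F $ n = 0"
  shows "odd_series (\<lambda>j. F $ (2 * j + 1)) = F"
  by (rule fps_ext) (use assms in \<open>auto simp: odd_series_def elim!: oddE\<close>)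

lemma odd_series_square_odd: "odd n \<Longrightarrow> (odd_series t * odd_series t) $ n = 0"
  by (auto simp: odd_series_def fps_mult_nth intro!: sum.neutral)

lemma odd_series_square:
  assumes "1 \<le> i"
  shows "(odd_series t * odd_series t) $ (2 * i - 2) = square_coords t i"
proof (cases "i = 1")
  case True
  then show ?thesis by (simp add: odd_series_def square_coords_def)
next
  case False
  then have i: "2 \<le> i" using assms by simp
  let ?F = "odd_series t" and ?n = "2 * i - 2"
  have "(?F * ?F) $ ?n = (\<Sum>m=0..?n. ?F $ m * ?F $ (?n - m))" by (rule fps_mult_nth)
  also have "\<dots> = (\<Sum>m\<in>(\<lambda>j. 2 * j + 1) ` {..i - 2}. ?F $ m * ?F $ (?n - m))"
  proof (rule sum.mono_neutral_right)
    show "\<forall>m\<in>{0..?n} - (\<lambda>j. 2 * j + 1) ` {..i - 2}. ?F $ m * ?F $ (?n - m) = 0"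
    proof
      fix m assume m: "m \<in> {0..?n} - (\<lambda>j. 2 * j + 1) ` {..i - 2}"
      have "even m"
      proof (rule ccontr)
        assume "odd m"
        then obtain j where j: "m = 2 * j + 1" by (elim oddE)
        then have "j \<le> i - 2" using m i by auto
        then show False using m j by auto
      qed
      then show "?F $ m * ?F $ (?n - m) = 0" by (simp add: odd_series_def)
    qed
    show "(\<lambda>j. 2 * j + 1) ` {..i - 2} \<subseteq> {0..?n}"
    proof
      fix m assume "m \<in> (\<lambda>j. 2 * j + 1) ` {..i - 2}"
      then obtain j where "m = 2 * j + 1" "j \<le> i - 2" by auto
      then show "m \<in> {0..?n}" using i by simp
    qed
  qed simp
  also have "\<dots> = (\<Sum>j\<le>i - 2. ?F $ (2 * j + 1) * ?F $ (?n - (2 * j + 1)))"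
    by (subst sum.reindex) (auto simp: inj_on_def)
  also have "\<dots> = (\<Sum>j\<le>i - 2. t j * t (i - 2 - j))"
  proof (rule sum.cong[OF refl])
    fix j assume "j \<in> {..i - 2}"
    then have "?n - (2 * j + 1) = 2 * (i - 2 - j) + 1" using i by auto
    then show "?F $ (2 * j + 1) * ?F $ (?n - (2 * j + 1)) = t j * t (i - 2 - j)"
      by (simp add: odd_series_def)
  qed
  finally show ?thesis using i by (simp add: square_coords_def)
qed

lemma odd_series_deriv:
  assumes "1 \<le> i"
  shows "fps_deriv (odd_series t) $ (2 * i - 2) = deriv_coords t i"
proof -
  obtain l where l: "i = Suc l" using assms by (cases i) auto
  have "fps_deriv (odd_series t) $ (2 * l) = of_nat (2 * l + 1) * t l"
    unfolding fps_deriv_nth by (simp add: odd_series_def)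
  then show ?thesis by (simp add: l deriv_coords_def)
qed

definition xi_value :: "(nat \<Rightarrow> complex) \<Rightarrow> complex fps \<Rightarrow> spoly \<Rightarrow> complex" where
  "xi_value a G f = (\<Sum>i | Suc i \<in> indets f. G $ (2 * i) * peval a (pdiff (Suc i) f))"

text \<open>The numerical counterpart of \<open>Q_arg\<close>, with each variable s_i replaced by
  the number a_i; \<open>num_theta\<close> below is that of the series differentiated in
  \<open>xi_series\<close>.\<close>

definition num_arg :: "nat \<Rightarrow> (nat \<Rightarrow> complex) \<Rightarrow> complex fps" where
  "num_arg k a = fps_const (1 / a (2 * k)) * Abs_fps (\<lambda>m. if even m \<and> m > 0 then a (2 * k + m div 2) else 0)"

definition num_theta :: "nat \<Rightarrow> (nat \<Rightarrow> complex) \<Rightarrow> complex fps" where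
  "num_theta k a = fps_X ^ (2 * k - 1) * fps_compose (fps_binomial (1/2)) (num_arg k a)"

lemma even_fps_power:
  fixes F :: "complex fps"
  assumes "\<And>n. odd n \<Longrightarrow> F $ n = 0"
  shows "odd n \<Longrightarrow> (F ^ i) $ n = 0"
proof (induction i arbitrary: n)
  case (Suc i)
  show ?case
    unfolding power_Suc fps_mult_nth
  proof (intro sum.neutral ballI)
    fix m assume m: "m \<in> {0..n}"
    show "F $ m * (F ^ i) $ (n - m) = 0"
    proof (cases "odd m")
      case False
      then have "odd (n - m)" using Suc.prems m by simp
      then show ?thesis using Suc.IH by simp
    qed (use assms in simp)
  qed
qed (auto simp: fps_one_nth odd_pos)

lemma num_theta_even:
  assumes "k \<ge> 1" "even n" shows "num_theta k a $ n = 0"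
proof -
  have even: "odd n \<Longrightarrow> num_arg k a $ n = 0" for n by (auto simp: num_arg_def odd_pos)
  have "odd n \<Longrightarrow> fps_compose (fps_binomial (1/2)) (num_arg k a) $ n = 0" for n
    using even_fps_power[OF even] by (simp add: fps_compose_nth)
  then show ?thesis using assms by (auto simp: num_theta_def fps_X_power_mult_nth)
qed

text \<open>The binomial series with exponent 1/2 squares to 1 + x, and composition with a series
  without constant term is multiplicative.\<close>

lemma num_theta_square:
  "num_theta k a * num_theta k a = fps_X ^ (2 * (2 * k - 1)) * (1 + num_arg k a)"
proof -
  let ?B = "fps_binomial (1/2) :: complex fps" and ?g = "num_arg k a"
  have 0: "?g $ 0 = 0" by (simp add: num_arg_def)
  have "fps_compose ?B ?g * fps_compose ?B ?g = fps_compose (?B * ?B) ?g"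
    by (rule fps_compose_mult_distrib[OF 0, symmetric])
  also have "?B * ?B = 1 + fps_X"
    using fps_binomial_add_mult[of "1/2 :: complex" "1/2"] by (simp add: fps_binomial_1)
  also have "fps_compose (1 + fps_X) ?g = 1 + ?g" using 0 by (simp add: fps_compose_add_distrib)
  finally have B: "fps_compose ?B ?g * fps_compose ?B ?g = 1 + ?g" .
  have "num_theta k a * num_theta k a =
      (fps_X ^ (2 * k - 1) * fps_X ^ (2 * k - 1)) * (fps_compose ?B ?g * fps_compose ?B ?g)"
    unfolding num_theta_def by (simp only: mult_ac)
  also have "\<dots> = fps_X ^ (2 * (2 * k - 1)) * (1 + ?g)"
    unfolding B by (simp only: power_add[symmetric] mult_2)
  finally show ?thesis .
qed

text \<open>On the locus \<open>s\<^sub>1 = \<dots> = s\<^bsub>2k-1\<^esub> = 0\<close>, \<open>s\<^sub>2\<^sub>k = r\<^sup>2\<close>, the series \<open>r num_theta\<close> is the square root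
  of \<open>\<Sum>\<^sub>i s\<^sub>i x\<^bsup>2(i-1)\<^esup>\<close>.\<close>

lemma num_theta_coords:
  assumes k: "k \<ge> 1" and a: "\<And>i. 1 \<le> i \<Longrightarrow> i < 2 * k \<Longrightarrow> a i = 0" "a (2 * k) \<noteq> 0"
    and r: "r * r = a (2 * k)" and i: "1 \<le> i"
  shows "((fps_const r * num_theta k a) * (fps_const r * num_theta k a)) $ (2 * i - 2) = a i"
proof -
  have "(fps_const r * num_theta k a) * (fps_const r * num_theta k a) =
      (fps_const r * fps_const r) * (num_theta k a * num_theta k a)"
    by (simp only: mult_ac)
  also have "\<dots> = fps_const (a (2 * k)) * (fps_X ^ (2 * (2 * k - 1)) * (1 + num_arg k a))"
    by (simp only: num_theta_square fps_const_mult r)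
  finally have eq: "((fps_const r * num_theta k a) * (fps_const r * num_theta k a)) $ (2 * i - 2) =
      a (2 * k) * (if 2 * i - 2 < 2 * (2 * k - 1) then 0 else (1 + num_arg k a) $ (2 * i - 2 - 2 * (2 * k - 1)))"
    by (simp only: fps_mult_left_const_nth fps_X_power_mult_nth)
  consider "i < 2 * k" | "i = 2 * k" | "i > 2 * k" by linarith
  then show ?thesis
  proof cases
    case 1
    then have "2 * i - 2 < 2 * (2 * k - 1)" using i by linarith
    then show ?thesis using eq a(1)[OF i 1] by simp
  next
    case 2
    then have "2 * i - 2 = 2 * (2 * k - 1)" by simp
    then show ?thesis unfolding eq by (simp add: num_arg_def 2)
  next
    case 3
    then obtain l where l: "i = 2 * k + l" "l > 0" by (metis less_imp_add_positive)
    then have "2 * i - 2 - 2 * (2 * k - 1) = 2 * l" "\<not> 2 * i - 2 < 2 * (2 * k - 1)" using k by auto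
    then show ?thesis unfolding eq using a(2) l by (simp add: num_arg_def)
  qed
qed

lemma xi_value_eq:
  assumes f: "f \<in> s_ring"
  shows "xi_value a (fps_deriv G) f = (\<Sum>i\<in>indets f. fps_deriv G $ (2 * i - 2) * peval a (pdiff i f))"
  unfolding xi_value_def
  by (rule sum.reindex_bij_witness[of _ "\<lambda>i. i - 1" Suc]) (use s_ring_indets[OF f] in \<open>auto simp: Suc_le_eq\<close>)

lemma theta_deriv_series:
  assumes f: "f \<in> s_ring" and a: "\<And>i. 1 \<le> i \<Longrightarrow> square_coords t i = a i"
  shows "theta_deriv t f = xi_value a (fps_deriv (odd_series t)) f"
  unfolding xi_value_eq[OF f] theta_deriv_def
proof (intro sum.cong refl)
  fix i assume "i \<in> indets f"
  then have i: "1 \<le> i" by (rule s_ring_indets[OF f])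
  have "peval (square_coords t) (pdiff i f) = peval a (pdiff i f)"
    by (rule peval_cong) (use indets_pdiff[of i f] s_ring_indets[OF f] a in blast)
  then show "deriv_coords t i * peval (square_coords t) (pdiff i f) =
      fps_deriv (odd_series t) $ (2 * i - 2) * peval a (pdiff i f)"
    by (simp only: odd_series_deriv[OF i])
qed

lemma xi_value_scale:
  "xi_value a (fps_const r * G) f = r * xi_value a G f"
  by (simp add: xi_value_def sum_distrib_left mult.assoc)

lemma peval_isCont:
  assumes "\<And>i. isCont (\<lambda>z. c z i) x"
  shows "isCont (\<lambda>z. peval (c z) p) (x :: complex)"
  by (induction p rule: cpoly_induct_UNIV) (use assms in auto)

text \<open>A point a of the k-th locus is the square of \<theta> = r \<open>num_theta k a\<close>
  with r^2 = a(2k), which gives one direction. Conversely a \<theta> with t_0 nonzero is, up to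
  sign, of this shape with k = 1, and the remaining \<theta> are limits of such.\<close>

lemma theta_deriv_eq_zero_iff:
  assumes f: "f \<in> s_ring"
  shows "(\<forall>t. theta_deriv t f = 0) \<longleftrightarrow>
    (\<forall>k\<ge>1. \<forall>a. (\<forall>i. 1 \<le> i \<and> i < 2 * k \<longrightarrow> a i = 0) \<and> a (2 * k) \<noteq> 0 \<longrightarrow>
      xi_value a (fps_deriv (num_theta k a)) f = 0)"
proof (intro iffI allI impI)
  fix k :: nat and a :: "nat \<Rightarrow> complex"
  assume zero: "\<forall>t. theta_deriv t f = 0" and k: "1 \<le> k"
    and a: "(\<forall>i. 1 \<le> i \<and> i < 2 * k \<longrightarrow> a i = 0) \<and> a (2 * k) \<noteq> 0"
  let ?r = "csqrt (a (2 * k))"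
  let ?F = "fps_const ?r * num_theta k a"
  let ?t = "\<lambda>j. ?F $ (2 * j + 1)"
  have r: "?r * ?r = a (2 * k)" "?r \<noteq> 0" using a by (simp_all add: power2_eq_square[symmetric])
  have F: "odd_series ?t = ?F" by (rule odd_series_eq) (simp add: num_theta_even[OF k])
  have "square_coords ?t i = a i" if "1 \<le> i" for i
    unfolding odd_series_square[OF that, symmetric] F
    by (rule num_theta_coords[where k = k and a = a and r = ?r and i = i]) (use a k r that in auto)
  from theta_deriv_series[OF f this] zero
  have "xi_value a (fps_deriv (odd_series ?t)) f = 0" by simp
  then show "xi_value a (fps_deriv (num_theta k a)) f = 0"
    using r(2) unfolding F by (simp add: xi_value_scale)
next
  fix t :: "nat \<Rightarrow> complex"
  assume zero: "\<forall>k\<ge>1. \<forall>a. (\<forall>i. 1 \<le> i \<and> i < 2 * k \<longrightarrow> a i = 0) \<and> a (2 * k) \<noteq> 0 \<longrightarrow>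
      xi_value a (fps_deriv (num_theta k a)) f = 0"
  have generic: "theta_deriv t f = 0" if t: "t 0 \<noteq> 0" for t :: "nat \<Rightarrow> complex"
  proof -
    let ?a = "square_coords t"
    let ?r = "csqrt (?a (2 * 1))"
    let ?F = "fps_const ?r * num_theta 1 ?a"
    have a: "?a (2 * 1) \<noteq> 0" "\<And>i. 1 \<le> i \<Longrightarrow> i < 2 * 1 \<Longrightarrow> ?a i = 0"
      using t by (simp_all add: square_coords_def)
    have r: "?r * ?r = ?a (2 * 1)" by (simp add: power2_eq_square[symmetric])
    have F: "odd_series (\<lambda>j. ?F $ (2 * j + 1)) = ?F"
      by (rule odd_series_eq) (simp add: num_theta_even)
    have "?F * ?F = odd_series t * odd_series t"
    proof (rule fps_ext)
      fix n
      show "(?F * ?F) $ n = (odd_series t * odd_series t) $ n"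
      proof (cases "even n")
        case True
        then obtain l where "n = 2 * l" by (elim evenE)
        then have n: "n = 2 * Suc l - 2" by simp
        show ?thesis unfolding n
          using num_theta_coords[where k = 1 and a = ?a and r = ?r and i = "Suc l", OF _ a(2,1) r] odd_series_square[of "Suc l" t] by simp
      next
        case False
        then show ?thesis using odd_series_square_odd F by metis
      qed
    qed
    \<comment> \<open>Power series over a field form an integral domain, so equal squares agree up
      to sign; the sign is harmless because \<open>xi_value\<close> is linear in the series.\<close>
    then have "odd_series t = ?F \<or> odd_series t = - ?F" by (metis square_eq_iff)
    moreover have "xi_value ?a (fps_deriv (num_theta 1 ?a)) f = 0" using zero a by auto
    then have scaled: "xi_value ?a (fps_deriv (fps_const c * num_theta 1 ?a)) f = 0" for c
      by (simp add: xi_value_scale)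
    have "- ?F = fps_const (- ?r) * num_theta 1 ?a" by (simp only: fps_const_neg[symmetric] minus_mult_left)
    then have "xi_value ?a (fps_deriv ?F) f = 0" "xi_value ?a (fps_deriv (- ?F)) f = 0"
      using scaled by (simp_all only:)
    ultimately show ?thesis using theta_deriv_series[OF f refl, of t] by auto
  qed
  \<comment> \<open>Only the leading coefficient is varied: \<open>theta_deriv\<close> is continuous
    in it and vanishes whenever it is nonzero, hence also at 0.\<close>
  let ?T = "\<lambda>z. t(0 := z)"
  have T: "isCont (\<lambda>z. ?T z j) (t 0)" for j by (cases "j = 0") auto
  have "isCont (\<lambda>z. theta_deriv (?T z) f) (t 0)"
    unfolding theta_deriv_def
  proof (intro continuous_sum continuous_mult)
    fix i
    show "isCont (\<lambda>z. deriv_coords (?T z) i) (t 0)"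
      unfolding deriv_coords_def by (intro continuous_mult continuous_const T)
    show "isCont (\<lambda>z. peval (square_coords (?T z)) (pdiff i f)) (t 0)"
    proof (rule peval_isCont)
      fix i
      show "isCont (\<lambda>z. square_coords (?T z) i) (t 0)"
        unfolding square_coords_def
        by (cases "i < 2") (simp_all del: fun_upd_apply add: continuous_sum continuous_mult T)
    qed
  qed
  then have "(\<lambda>z. theta_deriv (?T z) f) \<midarrow>t 0\<rightarrow> theta_deriv t f" by (simp add: isCont_def)
  moreover have "(\<lambda>z. theta_deriv (?T z) f) \<midarrow>t 0\<rightarrow> 0" if "t 0 = 0"
  proof (rule tendsto_eventually)
    show "eventually (\<lambda>z. theta_deriv (?T z) f = 0) (at (t 0))"
      unfolding that eventually_at_filter by (rule always_eventually) (simp add: generic)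
  qed
  ultimately show "theta_deriv t f = 0" using generic[of t] LIM_unique by blast
qed

text \<open>Fractions cannot be evaluated at a point in general, so evaluation on the localization
  is a relation: r has value z at a. It is single-valued when a(2k) is nonzero, and compatible with
  the ring and series operations used to build \<open>xi_series\<close>.\<close>

definition ev_rel :: "nat \<Rightarrow> (nat \<Rightarrow> complex) \<Rightarrow> srat \<Rightarrow> complex \<Rightarrow> bool" where
  "ev_rel k a r z \<longleftrightarrow> (\<exists>p N. r = to_fract p / s_var (2 * k) ^ N \<and> peval a p = z * a (2 * k) ^ N)"

lemma s_var_nonzero: "s_var i \<noteq> 0"
proof -
  have "peval (\<lambda>_. 1) (Var i) \<noteq> peval (\<lambda>_. 1) (0 :: spoly)" by simp
  then have "Var i \<noteq> (0 :: spoly)" by metis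
  then show ?thesis by (simp add: s_var_def)
qed

lemma to_fract_power: "to_fract (p ^ n) = to_fract p ^ n"
  by (induction n) (simp_all add: to_fract_mult)

lemma s_var_power: "s_var i ^ n = to_fract (Var i ^ n)"
  by (simp add: s_var_def to_fract_power)

context
  fixes k :: nat and a :: "nat \<Rightarrow> complex"
  assumes a: "a (2 * k) \<noteq> 0"
begin

abbreviation "ev \<equiv> ev_rel k a"

lemma ev_unique:
  assumes "ev r z" "ev r z'" shows "z = z'"
proof -
  let ?s = "s_var (2 * k)"
  obtain p N where p: "r = to_fract p / ?s ^ N" "peval a p = z * a (2 * k) ^ N"
    using assms(1) by (auto simp: ev_rel_def)
  obtain p' N' where p': "r = to_fract p' / ?s ^ N'" "peval a p' = z' * a (2 * k) ^ N'"
    using assms(2) by (auto simp: ev_rel_def)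
  have "to_fract p * ?s ^ N' = to_fract p' * ?s ^ N"
    using p(1) p'(1) s_var_nonzero[of "2 * k"] by (simp add: frac_eq_eq)
  then have "to_fract (p * Var (2 * k) ^ N') = to_fract (p' * Var (2 * k) ^ N)"
    by (simp only: to_fract_mult s_var_power)
  then have "p * Var (2 * k) ^ N' = p' * Var (2 * k) ^ N" by (simp only: to_fract_eq_iff)
  from arg_cong[OF this, of "peval a"]
  have "z * (a (2 * k) ^ N * a (2 * k) ^ N') = z' * (a (2 * k) ^ N * a (2 * k) ^ N')"
    by (simp only: peval_hom p p' mult_ac)
  then show ?thesis using a by simp
qed

lemma ev_to_fract: "ev (to_fract p) (peval a p)"
  unfolding ev_rel_def by (intro exI[of _ p] exI[of _ 0]) simp

lemma ev_of_peval: "ev (to_fract p / s_var (2 * k) ^ N) (peval a p / a (2 * k) ^ N)"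
  unfolding ev_rel_def by (intro exI[of _ p] exI[of _ N]) (use a in simp)

lemma ev_0: "ev 0 0" using ev_to_fract[of 0] by simp
lemma ev_1: "ev 1 1" using ev_to_fract[of 1] by simp
lemma ev_s_var: "ev (s_var i) (a i)" using ev_to_fract[of "Var i"] by (simp add: s_var_def)
lemma ev_inverse: "ev (1 / s_var (2 * k)) (1 / a (2 * k))" using ev_of_peval[of 1 1] by simp

lemma ev_add:
  assumes "ev r z" "ev r' z'" shows "ev (r + r') (z + z')"
proof -
  let ?s = "s_var (2 * k)"
  obtain p N where p: "r = to_fract p / ?s ^ N" "peval a p = z * a (2 * k) ^ N"
    using assms(1) by (auto simp: ev_rel_def)
  obtain p' N' where p': "r' = to_fract p' / ?s ^ N'" "peval a p' = z' * a (2 * k) ^ N'"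
    using assms(2) by (auto simp: ev_rel_def)
  show ?thesis unfolding ev_rel_def
  proof (intro exI conjI)
    show "r + r' = to_fract (p * Var (2 * k) ^ N' + p' * Var (2 * k) ^ N) / ?s ^ (N + N')"
      unfolding to_fract_add to_fract_mult s_var_power[symmetric] p(1) p'(1) power_add
      by (rule add_frac_eq) (simp_all add: s_var_nonzero)
    show "peval a (p * Var (2 * k) ^ N' + p' * Var (2 * k) ^ N) = (z + z') * a (2 * k) ^ (N + N')"
      by (simp add: p p' power_add algebra_simps)
  qed
qed

lemma ev_mult:
  assumes "ev r z" "ev r' z'" shows "ev (r * r') (z * z')"
proof -
  let ?s = "s_var (2 * k)"
  obtain p N where p: "r = to_fract p / ?s ^ N" "peval a p = z * a (2 * k) ^ N"
    using assms(1) by (auto simp: ev_rel_def)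
  obtain p' N' where p': "r' = to_fract p' / ?s ^ N'" "peval a p' = z' * a (2 * k) ^ N'"
    using assms(2) by (auto simp: ev_rel_def)
  show ?thesis unfolding ev_rel_def
  proof (intro exI conjI)
    show "r * r' = to_fract (p * p') / ?s ^ (N + N')"
      by (simp add: p p' to_fract_mult power_add)
    show "peval a (p * p') = (z * z') * a (2 * k) ^ (N + N')"
      by (simp add: p p' power_add algebra_simps)
  qed
qed

lemma ev_sum: "(\<And>i. i \<in> I \<Longrightarrow> ev (f i) (g i)) \<Longrightarrow> ev (\<Sum>i\<in>I. f i) (\<Sum>i\<in>I. g i)"
  by (induction I rule: infinite_finite_induct) (auto simp: ev_0 intro: ev_add)

lemma ev_of_nat: "ev (of_nat n) (of_nat n)"
  by (induction n) (auto simp: ev_0 ev_1 intro: ev_add)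

abbreviation "ev_fps F G \<equiv> \<forall>n. ev (F $ n) (G $ n)"

lemma ev_fps_mult: "ev_fps F G \<Longrightarrow> ev_fps F' G' \<Longrightarrow> ev_fps (F * F') (G * G')"
  unfolding fps_mult_nth by (auto intro!: ev_sum ev_mult)

lemma ev_fps_one: "ev_fps 1 1" by (simp add: fps_one_nth ev_0 ev_1)

lemma ev_fps_power: "ev_fps F G \<Longrightarrow> ev_fps (F ^ i) (G ^ i)"
proof (induction i)
  case (Suc i)
  then show ?case unfolding power_Suc by (intro ev_fps_mult)
qed (unfold power_0, rule ev_fps_one)

lemma ev_fps_compose: "ev_fps F G \<Longrightarrow> ev_fps F' G' \<Longrightarrow> ev_fps (fps_compose F F') (fps_compose G G')"
  unfolding fps_compose_nth using ev_fps_power[of F' G'] by (auto intro!: ev_sum ev_mult)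

lemma ev_fps_deriv: "ev_fps F G \<Longrightarrow> ev_fps (fps_deriv F) (fps_deriv G)"
  unfolding fps_deriv_nth by (intro allI ev_mult ev_of_nat) blast

lemma ev_xi_series: "ev_fps (xi_series k) (fps_deriv (num_theta k a))"
proof -
  have X: "ev_fps fps_X fps_X" by (simp add: fps_X_nth ev_0 ev_1)
  have "ev (to_fract (Const c)) c" for c using ev_to_fract[of "Const c"] by simp
  then have Q: "ev_fps Q_series (fps_binomial (1/2))" by (simp add: Q_series_def)
  have "ev_fps (Q_arg k) (num_arg k a)"
    unfolding Q_arg_def num_arg_def
    unfolding fps_mult_left_const_nth fps_nth_Abs_fps
    by (intro allI ev_mult[OF ev_inverse]) (simp add: ev_0 ev_s_var)
  from ev_fps_compose[OF Q this] show ?thesis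
    unfolding xi_series_def num_theta_def by (intro ev_fps_deriv ev_fps_mult ev_fps_power X)
qed

lemma ev_xi: "ev (xi k f) (xi_value a (fps_deriv (num_theta k a)) f)"
  unfolding xi_def V_field_def xi_value_def
  by (intro ev_sum ev_mult ev_to_fract) (use ev_xi_series in blast)

end

text \<open>The locus condition speaks of one representation p / s^N. As values do not depend on the
  representation, it amounts to the vanishing of the numbers \<open>xi_value\<close> at all points
  of the locus.\<close>

lemma vanishes_on_locus_xi:
  "vanishes_on_locus k (xi k f) \<longleftrightarrow>
    (\<forall>a. (\<forall>i. 1 \<le> i \<and> i < 2 * k \<longrightarrow> a i = 0) \<and> a (2 * k) \<noteq> 0 \<longrightarrow>
      xi_value a (fps_deriv (num_theta k a)) f = 0)"
proof
  assume "vanishes_on_locus k (xi k f)"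
  then obtain p N where p: "xi k f = to_fract p / s_var (2 * k) ^ N"
    "\<And>a. (\<forall>i. 1 \<le> i \<and> i < 2 * k \<longrightarrow> a i = 0) \<and> a (2 * k) \<noteq> 0 \<longrightarrow> peval a p = 0"
    unfolding vanishes_on_locus_def by blast
  show "\<forall>a. (\<forall>i. 1 \<le> i \<and> i < 2 * k \<longrightarrow> a i = 0) \<and> a (2 * k) \<noteq> 0 \<longrightarrow>
      xi_value a (fps_deriv (num_theta k a)) f = 0"
  proof (intro allI impI)
    fix a :: "nat \<Rightarrow> complex" assume a: "(\<forall>i. 1 \<le> i \<and> i < 2 * k \<longrightarrow> a i = 0) \<and> a (2 * k) \<noteq> 0"
    then have a2: "a (2 * k) \<noteq> 0" by blast
    have "ev_rel k a (xi k f) 0"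
      using ev_of_peval[where k = k and a = a, OF a2, of p N] p(2)[of a] a by (simp add: p(1))
    then show "xi_value a (fps_deriv (num_theta k a)) f = 0"
      using ev_unique[where k = k and a = a, OF a2 ev_xi[where k = k and a = a, OF a2]] by blast
  qed
next
  assume zero: "\<forall>a. (\<forall>i. 1 \<le> i \<and> i < 2 * k \<longrightarrow> a i = 0) \<and> a (2 * k) \<noteq> 0 \<longrightarrow>
      xi_value a (fps_deriv (num_theta k a)) f = 0"
  \<comment> \<open>The constant point 1 is a device for extracting a numerator and a power of
    s_(2k); the representation obtained does not refer to it and is then evaluated at other
    points.\<close>
  obtain p N where p: "xi k f = to_fract p / s_var (2 * k) ^ N"
    using ev_xi[of "\<lambda>_. 1" k f] by (auto simp: ev_rel_def)
  show "vanishes_on_locus k (xi k f)"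
    unfolding vanishes_on_locus_def
  proof (intro exI conjI allI impI)
    show "xi k f = to_fract p / s_var (2 * k) ^ N" by (rule p)
    fix a :: "nat \<Rightarrow> complex" assume a: "(\<forall>i. 1 \<le> i \<and> i < 2 * k \<longrightarrow> a i = 0) \<and> a (2 * k) \<noteq> 0"
    then have a2: "a (2 * k) \<noteq> 0" by blast
    have "xi_value a (fps_deriv (num_theta k a)) f = peval a p / a (2 * k) ^ N"
      using ev_unique[where k = k and a = a, OF a2 ev_xi[where k = k and a = a, OF a2]] ev_of_peval[where k = k and a = a, OF a2, of p N] p by metis
    then show "peval a p = 0" using zero a by simp
  qed
qed

lemma theta_deriv_xi:
  "f \<in> s_ring \<Longrightarrow> (\<forall>t. theta_deriv t f = 0) \<longleftrightarrow> (\<forall>k\<ge>1. vanishes_on_locus k (xi k f))"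
  by (simp only: theta_deriv_eq_zero_iff vanishes_on_locus_xi)

section \<open>The image of the restriction map\<close>

lemma odd_bracket_free_HP0: "odd_bracket_free n \<phi> \<Longrightarrow> \<phi> \<in> HP0_dual n (O_B n)"
  by (simp add: odd_bracket_free_def)

lemma odd_bracket_free_zero: "odd_bracket_free n (\<lambda>_. 0)"
  using odd_bracket_free_sum[of "{}" n] by simp

lemma odd_bracket_free_scale: "odd_bracket_free n \<phi> \<Longrightarrow> odd_bracket_free n (\<lambda>p. c * \<phi> p)"
  using odd_bracket_free_sum[of "{()}" n "\<lambda>_. \<phi>" "\<lambda>_. c"] by simp

lemma odd_bracket_free_add:
  assumes "odd_bracket_free n \<phi>" "odd_bracket_free n \<psi>"
  shows "odd_bracket_free n (\<lambda>p. \<phi> p + \<psi> p)"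
  using odd_bracket_free_sum[of UNIV n "\<lambda>b. if b then \<phi> else \<psi>" "\<lambda>_. 1"] assms
  by (simp add: UNIV_bool add.commute)

text \<open>The image of the restriction map described without reference to the functionals s; the
  algebra operations are checked on this description.\<close>

definition obf_families :: "gfunctional set" where
  "obf_families = direct_sum (\<lambda>n. {\<phi>. odd_bracket_free n \<phi>})"

lemma obf_families_iff:
  "\<Phi> \<in> obf_families \<longleftrightarrow> (\<forall>n. odd_bracket_free n (\<Phi> n)) \<and> finite {n. \<exists>p. \<Phi> n p \<noteq> 0}"
  by (simp add: obf_families_def direct_sum_def)

lemma obf_families_HP_B: "obf_families \<subseteq> HP_B"
  by (auto simp: obf_families_def HP_B_def direct_sum_def odd_bracket_free_HP0)

text \<open>Preimages are extensions by zero, degree by degree. They stay finitely supported because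
  the zero functional extends to zero.\<close>

lemma res_DB_image: "res_DB ` HP_D = obf_families"
proof (intro subset_antisym subsetI)
  fix \<Psi> assume "\<Psi> \<in> res_DB ` HP_D"
  then obtain \<Phi> where \<Phi>: "\<And>n. \<Phi> n \<in> HP0_dual n (O_D n)" "finite {n. \<exists>p. \<Phi> n p \<noteq> 0}" "\<Psi> = res_DB \<Phi>"
    by (auto simp: HP_D_def direct_sum_def)
  have "{n. \<exists>p. \<Psi> n p \<noteq> 0} \<subseteq> {n. \<exists>p. \<Phi> n p \<noteq> 0}"
    by (auto simp: \<Phi>(3) res_DB_def restrict_functional_def)
  then show "\<Psi> \<in> obf_families"
    unfolding obf_families_iff using odd_bracket_free_restrict[OF \<Phi>(1)] finite_subset[OF _ \<Phi>(2)]
    by (simp add: \<Phi>(3) res_DB_def)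
next
  fix \<Psi> assume "\<Psi> \<in> obf_families"
  then have \<Psi>: "\<And>n. odd_bracket_free n (\<Psi> n)" "finite {n. \<exists>p. \<Psi> n p \<noteq> 0}"
    by (auto simp: obf_families_iff)
  let ?\<Phi> = "\<lambda>n. extend_by_zero n (\<Psi> n)"
  have "{n. \<exists>p. ?\<Phi> n p \<noteq> 0} \<subseteq> {n. \<exists>p. \<Psi> n p \<noteq> 0}"
  proof
    fix n assume n: "n \<in> {n. \<exists>p. ?\<Phi> n p \<noteq> 0}"
    have "\<Psi> n \<noteq> (\<lambda>_. 0)"
    proof
      assume "\<Psi> n = (\<lambda>_. 0)"
      then show False using n by (simp add: extend_by_zero_zero)
    qed
    then show "n \<in> {n. \<exists>p. \<Psi> n p \<noteq> 0}" by (auto simp: fun_eq_iff)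
  qed
  then have "?\<Phi> \<in> HP_D"
    using extend_by_zero_HP0(1)[OF \<Psi>(1)] finite_subset[OF _ \<Psi>(2)] by (simp add: HP_D_def direct_sum_def)
  moreover have "\<Psi> = res_DB ?\<Phi>"
    by (simp add: res_DB_def extend_by_zero_HP0(2)[OF \<Psi>(1)])
  ultimately show "\<Psi> \<in> res_DB ` HP_D" by (intro image_eqI[where x = ?\<Phi>])
qed

lemma inj_on_res_DB: "inj_on res_DB HP_D"
proof (rule inj_onI)
  fix \<Phi> \<Psi> assume *: "\<Phi> \<in> HP_D" "\<Psi> \<in> HP_D" "res_DB \<Phi> = res_DB \<Psi>"
  show "\<Phi> = \<Psi>"
  proof
    fix n
    have HP0: "\<Phi> n \<in> HP0_dual n (O_D n)" "\<Psi> n \<in> HP0_dual n (O_D n)"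
      using *(1,2) by (simp_all add: HP_D_def direct_sum_def)
    have "restrict_functional (O_B n) (\<Phi> n) = restrict_functional (O_B n) (\<Psi> n)"
      using fun_cong[OF *(3), of n] by (simp add: res_DB_def)
    from HP0_D_determined[OF HP0 this] show "\<Phi> n = \<Psi> n" .
  qed
qed

lemma has_weight_restrict:
  "has_weight (O_D n) w \<phi> \<Longrightarrow> has_weight (O_B n) w (restrict_functional (O_B n) \<phi>)"
  using O_B_subset_O_D[of n] by (auto simp: has_weight_def restrict_functional_def)

lemma gone_obf: "gone \<in> obf_families"
proof -
  have "odd_bracket_free n (gone n)" for n
  proof (cases "n = 0")
    case True
    then have "gone n = unit_functional" by (simp add: gone_eq gin_def fun_eq_iff)
    then show ?thesis using unit_functional(1) True by simp
  next
    case False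
    then have "gone n = (\<lambda>_. 0)" by (simp add: gone_eq gin_def fun_eq_iff)
    then show ?thesis using odd_bracket_free_zero by simp
  qed
  moreover have "finite {n. \<exists>p. gone n p \<noteq> 0}"
    by (rule finite_subset[of _ "{0}"]) (auto simp: gone_eq gin_def split: if_splits)
  ultimately show ?thesis by (simp add: obf_families_iff)
qed

lemma gadd_obf: "\<Phi> \<in> obf_families \<Longrightarrow> \<Psi> \<in> obf_families \<Longrightarrow> gadd \<Phi> \<Psi> \<in> obf_families"
proof -
  assume *: "\<Phi> \<in> obf_families" "\<Psi> \<in> obf_families"
  have "{n. \<exists>p. gadd \<Phi> \<Psi> n p \<noteq> 0} \<subseteq> {n. \<exists>p. \<Phi> n p \<noteq> 0} \<union> {n. \<exists>p. \<Psi> n p \<noteq> 0}"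
    by (auto simp: gadd_def)
  then have "finite {n. \<exists>p. gadd \<Phi> \<Psi> n p \<noteq> 0}"
    by (rule finite_subset) (use * in \<open>simp add: obf_families_iff\<close>)
  then show ?thesis using * by (simp add: obf_families_iff gadd_def odd_bracket_free_add)
qed

lemma gscale_obf: "\<Phi> \<in> obf_families \<Longrightarrow> gscale c \<Phi> \<in> obf_families"
proof -
  assume *: "\<Phi> \<in> obf_families"
  have "{n. \<exists>p. gscale c \<Phi> n p \<noteq> 0} \<subseteq> {n. \<exists>p. \<Phi> n p \<noteq> 0}"
    by (auto simp: gscale_def)
  then have "finite {n. \<exists>p. gscale c \<Phi> n p \<noteq> 0}"
    by (rule finite_subset) (use * in \<open>simp add: obf_families_iff\<close>)
  then show ?thesis using * by (simp add: obf_families_iff gscale_def odd_bracket_free_scale)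
qed

lemma gmult_obf:
  assumes \<Phi>: "\<Phi> \<in> obf_families" and \<Psi>: "\<Psi> \<in> obf_families"
  shows "gmult \<Phi> \<Psi> \<in> obf_families"
proof -
  have free: "odd_bracket_free n (\<Phi> n)" "odd_bracket_free n (\<Psi> n)" for n
    using \<Phi> \<Psi> by (auto simp: obf_families_iff)
  note lin = free[THEN odd_bracket_free_HP0, THEN HP0_B_D(1)]
  have "odd_bracket_free N (gmult \<Phi> \<Psi> N)" for N
  proof -
    have "odd_bracket_free N (fun_mult m (N - m) (\<Phi> m) (\<Psi> (N - m)))" if "m \<in> {..N}" for m
      using fun_mult_odd_bracket_free[OF free(1)[of m] free(2)[of "N - m"]] that by simp
    from odd_bracket_free_sum[where I = "{..N}" and n = N and c = "\<lambda>_. 1"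
      and \<phi> = "\<lambda>m. fun_mult m (N - m) (\<Phi> m) (\<Psi> (N - m))", OF this] show ?thesis
      by (simp add: gmult_def)
  qed
  moreover obtain b where b: "\<And>n. b < n \<Longrightarrow> \<Phi> n = (\<lambda>_. 0)" "\<And>n. b < n \<Longrightarrow> \<Psi> n = (\<lambda>_. 0)"
  proof -
    have "finite ({n. \<exists>p. \<Phi> n p \<noteq> 0} \<union> {n. \<exists>p. \<Psi> n p \<noteq> 0})"
      using \<Phi> \<Psi> by (simp add: obf_families_iff)
    then obtain b where b: "\<forall>n\<in>{n. \<exists>p. \<Phi> n p \<noteq> 0} \<union> {n. \<exists>p. \<Psi> n p \<noteq> 0}. n \<le> b"
      by (meson finite_nat_set_iff_bounded_le)
    have "\<Phi> n = (\<lambda>_. 0)" if "b < n" for n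
    proof
      fix p show "\<Phi> n p = 0" using b that by force
    qed
    moreover have "\<Psi> n = (\<lambda>_. 0)" if "b < n" for n
    proof
      fix p show "\<Psi> n p = 0" using b that by force
    qed
    ultimately show thesis using that by blast
  qed
  have zero: "gmult \<Phi> \<Psi> N p = 0" if "2 * b < N" for N p
    unfolding gmult_def
  proof (intro sum.neutral ballI)
    fix m assume "m \<in> {..N}"
    have "b < m \<or> b < N - m" using that by linarith
    then have "\<Phi> m = (\<lambda>_. 0) \<or> \<Psi> (N - m) = (\<lambda>_. 0)" using b by blast
    then show "fun_mult m (N - m) (\<Phi> m) (\<Psi> (N - m)) p = 0"
      using fun_mult_zero[OF lin(1)[of m] lin(2)[of "N - m"]] by simp
  qed
  have "finite {N. \<exists>p. gmult \<Phi> \<Psi> N p \<noteq> 0}"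
  proof (rule finite_subset)
    show "{N. \<exists>p. gmult \<Phi> \<Psi> N p \<noteq> 0} \<subseteq> {..2 * b}"
    proof
      fix N assume "N \<in> {N. \<exists>p. gmult \<Phi> \<Psi> N p \<noteq> 0}"
      then obtain p where "gmult \<Phi> \<Psi> N p \<noteq> 0" by blast
      then have "\<not> 2 * b < N" using zero by blast
      then show "N \<in> {..2 * b}" by simp
    qed
  qed simp
  ultimately show ?thesis by (simp add: obf_families_iff)
qed

lemma identification_superset:
  assumes "finite K" "Poly_Mapping.keys f \<subseteq> K"
  shows "identification s f n p = (\<Sum>m\<in>K. Poly_Mapping.lookup f m * gmonomial s m n p)"
  unfolding identification_def
  by (rule sum.mono_neutral_left) (use assms in \<open>auto simp: in_keys_iff\<close>)

lemma graded_part_self: "mweight w ` Poly_Mapping.keys f \<subseteq> {d} \<Longrightarrow> graded_part w d f = f"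
proof (rule poly_mapping_eqI)
  fix m assume "mweight w ` Poly_Mapping.keys f \<subseteq> {d}"
  then have "mweight w m = d" if "m \<in> Poly_Mapping.keys f" using that by blast
  then show "Poly_Mapping.lookup (graded_part w d f) m = Poly_Mapping.lookup f m"
    by (cases "mweight w m = d") (auto simp: lookup_graded_part in_keys_iff)
qed

context
  fixes s :: "nat \<Rightarrow> functional"
  assumes s: "\<And>i. i \<ge> 1 \<Longrightarrow> is_s_functional i (s i)"
begin

lemma s_HP0: "i \<ge> 1 \<Longrightarrow> s i \<in> HP0_dual i (O_B i)"
  by (rule s_functional_HP0[OF s])

lemma identification_nform:
  assumes f: "f \<in> s_ring" and c: "\<forall>i>M. c i = 0"
  shows "identification s f n (pw n (nform M c)) = peval c (graded_part (\<lambda>i. i) n f)"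
proof -
  have "identification s f n (pw n (nform M c)) =
      peval (\<lambda>i. s i (pw i (nform M c))) (graded_part (\<lambda>i. i) n f)"
    by (rule identification_pw) (use s_HP0 f nform_parity in auto)
  also have "\<dots> = peval c (graded_part (\<lambda>i. i) n f)"
    by (rule peval_cong)
      (use s_ring_indets[OF graded_part_s_ring[OF f]] s_functional_nform[OF s c] in blast)
  finally show ?thesis .
qed

text \<open>For surjectivity, add up the polynomials that describe the components of a family on
  normal forms. The resulting element has the same values on normal forms, and these determine an
  invariant functional.\<close>

lemma HP_B_eq: "HP_B = identification s ` s_ring"
proof (intro subset_antisym subsetI)
  fix \<Phi> assume "\<Phi> \<in> HP_B"
  then have \<Phi>: "\<And>n. \<Phi> n \<in> HP0_dual n (O_B n)" and fin: "finite {n. \<exists>p. \<Phi> n p \<noteq> 0}"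
    by (auto simp: HP_B_def direct_sum_def)
  let ?S = "{n. \<exists>p. \<Phi> n p \<noteq> 0}"
  have "\<forall>n. \<exists>f. f \<in> s_ring \<and> (\<forall>m\<in>Poly_Mapping.keys f. wt m = n) \<and>
      (\<forall>M c. (\<forall>i>M. c i = 0) \<longrightarrow> \<Phi> n (pw n (nform M c)) = peval c f)"
    using HP0_B_polynomial[OF \<Phi>] by blast
  then obtain F where F: "\<And>n. F n \<in> s_ring" "\<And>n m. m \<in> Poly_Mapping.keys (F n) \<Longrightarrow> wt m = n"
    "\<And>n M c. \<forall>i>M. c i = 0 \<Longrightarrow> \<Phi> n (pw n (nform M c)) = peval c (F n)"
    by metis
  let ?f = "\<Sum>n\<in>?S. F n"
  have "indets ?f \<subseteq> (\<Union>n\<in>?S. indets (F n))" by (rule indets_sum)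
  then have f: "?f \<in> s_ring" using F(1) by (fastforce simp: s_ring_def)
  have part: "graded_part (\<lambda>i. i) n ?f = (if n \<in> ?S then F n else 0)" for n
  proof (rule poly_mapping_eqI)
    fix m
    have "Poly_Mapping.lookup (F j) m = (if j = wt m then Poly_Mapping.lookup (F j) m else 0)" for j
      using F(2)[of m j] by (auto simp: in_keys_iff)
    then have "(\<Sum>j\<in>?S. Poly_Mapping.lookup (F j) m) =
        (\<Sum>j\<in>?S. if j = wt m then Poly_Mapping.lookup (F j) m else 0)"
      by (intro sum.cong refl)
    also have "\<dots> = (if wt m \<in> ?S then Poly_Mapping.lookup (F (wt m)) m else 0)"
      using fin by (rule sum.delta)
    finally have "Poly_Mapping.lookup ?f m = (if wt m \<in> ?S then Poly_Mapping.lookup (F (wt m)) m else 0)"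
      by (simp only: lookup_sum)
    moreover have "Poly_Mapping.lookup (F n) m = 0" if "wt m \<noteq> n"
      using F(2)[of m n] that by (auto simp: in_keys_iff)
    ultimately show "Poly_Mapping.lookup (graded_part (\<lambda>i. i) n ?f) m = Poly_Mapping.lookup (if n \<in> ?S then F n else 0) m"
      by (auto simp: lookup_graded_part)
  qed
  have "\<Phi> n = identification s ?f n" for n
  proof (rule HP0_B_determined[OF \<Phi>])
    show "identification s ?f n \<in> HP0_dual n (O_B n)"
      by (rule identification_HP0) (use s_HP0 f in auto)
    fix \<nu> assume "\<nu> \<in> even_x"
    then obtain M c where c: "\<forall>i>M. c i = 0" "yv ^ 2 + \<nu> = nform M c" using even_x_nform by blast
    have "identification s ?f n (pw n (nform M c)) = peval c (if n \<in> ?S then F n else 0)"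
      by (simp only: identification_nform[OF f c(1)] part)
    also have "\<dots> = \<Phi> n (pw n (nform M c))"
    proof (cases "n \<in> ?S")
      case True
      then show ?thesis by (simp only: if_True F(3)[OF c(1)])
    next
      case False
      then have "\<Phi> n q = 0" for q by blast
      then show ?thesis using False by simp
    qed
    finally show "\<Phi> n (pw n (yv ^ 2 + \<nu>)) = identification s ?f n (pw n (yv ^ 2 + \<nu>))"
      by (simp only: c(2))
  qed
  then have "\<Phi> = identification s ?f" by (rule ext)
  then show "\<Phi> \<in> identification s ` s_ring" using f by (rule image_eqI)
next
  fix \<Phi> assume "\<Phi> \<in> identification s ` s_ring"
  then obtain f where f: "f \<in> s_ring" "\<Phi> = identification s f" by blast
  show "\<Phi> \<in> HP_B" unfolding f(2) by (rule identification_HP_B) (use s_HP0 f(1) in auto)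
qed

text \<open>The conditions hold degree by degree, whereas \<open>theta_deriv\<close> concerns the
  whole polynomial. Giving t_j degree j + 1 gives both coordinate vectors degree i at index i, so
  the condition on f splits into those on its graded parts.\<close>

lemma identification_obf:
  assumes f: "f \<in> s_ring"
  shows "identification s f \<in> obf_families \<longleftrightarrow> (\<forall>t. theta_deriv t f = 0)"
proof -
  have HP0: "identification s f n \<in> HP0_dual n (O_B n)" for n
    by (rule identification_HP0) (use s_HP0 f in auto)
  have "identification s f \<in> HP_B" using HP_B_eq f by blast
  then have fin: "finite {n. \<exists>p. identification s f n p \<noteq> 0}"
    by (simp add: HP_B_def direct_sum_def)
  have "odd_bracket_free n (identification s f n) \<longleftrightarrow> kappa_free n (identification s f n)" for n
    using odd_bracket_free_imp_kappa_free kappa_free_imp_odd_bracket_free[OF HP0] by blast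
  moreover have "kappa_free n (identification s f n) \<longleftrightarrow> (\<forall>t. theta_deriv t (graded_part (\<lambda>i. i) n f) = 0)" for n
    by (rule kappa_free_iff[OF HP0 graded_part_s_ring[OF f] identification_nform[OF f]])
  moreover have "(\<forall>n t. theta_deriv t (graded_part (\<lambda>i. i) n f) = 0) \<longleftrightarrow> (\<forall>t. theta_deriv t f = 0)"
  proof (intro iffI allI)
    fix t assume *: "\<forall>n t. theta_deriv t (graded_part (\<lambda>i. i) n f) = 0"
    let ?D = "wt ` Poly_Mapping.keys f"
    have "theta_deriv t (\<Sum>d\<in>?D. graded_part (\<lambda>i. i) d f) = 0"
      by (rule theta_deriv_sum_parts[where V = "indets f"]) (use * indets_graded_part in auto)
    then show "theta_deriv t f = 0" using sum_graded_parts[of ?D "\<lambda>i. i" f] by simp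
  next
    fix n t assume *: "\<forall>t. theta_deriv t f = 0"
    show "theta_deriv t (graded_part (\<lambda>i. i) n f) = 0"
      by (rule theta_deriv_graded[where e = "\<lambda>j. j + 1" and q = 0, OF f]) (use * in auto)
  qed
  ultimately show ?thesis using fin by (simp add: obf_families_iff)
qed

abbreviation s_weight :: "nat \<Rightarrow> nat" where "s_weight i \<equiv> 4 * (i - 1)"

lemma s_scales:
  assumes i: "i \<ge> 1" and f: "f \<in> parity_space True"
  shows "s i (pw i (dil f)) = 2 ^ s_weight i * s i (pw i f)"
proof -
  have "4 * (1 - int i) = - int (s_weight i)" using i by simp
  then have "has_weight (O_B i) (- int (s_weight i)) (s i)"
    using s[OF i] unfolding is_s_functional_def by metis
  from scales_of_has_weight[OF HP0_B_D(1)[OF s_HP0[OF i]] this] show ?thesis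
    using f by (simp add: scales_with_def)
qed

lemma identification_bihomogeneous:
  assumes f: "f \<in> s_ring" and n: "wt ` Poly_Mapping.keys f \<subseteq> {n}"
    and d: "mweight s_weight ` Poly_Mapping.keys f \<subseteq> {d}"
  shows "bihomogeneous n (- int d) (identification s f)"
  unfolding bihomogeneous_def
proof (intro conjI allI impI)
  fix m p assume "m \<noteq> n"
  then have "m \<notin> wt ` Poly_Mapping.keys f" using n by blast
  then have "identification s f m = (\<lambda>_. 0)"
    by (intro identification_zero) (use s_HP0 f in auto)
  then show "identification s f m p = 0" by simp
next
  have HP0: "identification s f n \<in> HP0_dual n (O_B n)"
    by (rule identification_HP0) (use s_HP0 f in auto)
  have val: "identification s f n (pw n g) = peval (\<lambda>i. s i (pw i g)) f" if "g \<in> parity_space True" for g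
  proof -
    have "identification s f n (pw n g) = peval (\<lambda>i. s i (pw i g)) (graded_part (\<lambda>i. i) n f)"
      by (rule identification_pw) (use s_HP0 f that in auto)
    then show ?thesis by (simp only: graded_part_self[OF n])
  qed
  have "scales_with n d (identification s f n)"
    unfolding scales_with_def
  proof
    fix g assume g: "g \<in> parity_space True"
    have "peval (\<lambda>i. s i (pw i (dil g))) f = peval (\<lambda>i. 2 ^ s_weight i * s i (pw i g)) f"
      by (rule peval_cong) (use s_scales g s_ring_indets[OF f] in blast)
    also have "\<dots> = 2 ^ d * peval (\<lambda>i. s i (pw i g)) f"
      using peval_scale_graded[of "{d}" s_weight f 2] d graded_part_self[OF d] by simp
    finally show "identification s f n (pw n (dil g)) = 2 ^ d * identification s f n (pw n g)"
      by (simp only: val[OF g] val[OF dil_parity[OF g]])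
  qed
  then show "has_weight (O_B n) (- int d) (identification s f n)"
    by (rule has_weight_of_scales[OF HP0_B_D(1)[OF HP0]])
qed

text \<open>The components are the parts of the representing polynomial for both gradings, and the
  condition \<open>theta_deriv\<close> = 0 passes to them because it is homogeneous for
  both.\<close>

lemma obf_families_decomposition:
  assumes "\<Phi> \<in> obf_families"
  shows "\<exists>J \<Psi>. finite J \<and> (\<forall>(n, w)\<in>J. \<Psi> (n, w) \<in> obf_families \<and> bihomogeneous n w (\<Psi> (n, w))) \<and>
    \<Phi> = (\<lambda>n p. \<Sum>j\<in>J. \<Psi> j n p)"
proof -
  obtain f where f: "f \<in> s_ring" "\<Phi> = identification s f" using assms obf_families_HP_B HP_B_eq by blast
  have zero: "\<And>t. theta_deriv t f = 0" using assms f identification_obf by blast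
  let ?part = "\<lambda>n d. graded_part s_weight d (graded_part (\<lambda>i. i) n f)"
  let ?K = "Poly_Mapping.keys f"
  let ?D = "wt ` ?K" and ?E = "mweight s_weight ` ?K"
  let ?h = "\<lambda>(n, d). (n, - int d)"
  let ?J = "?h ` (?D \<times> ?E)" and ?\<Psi> = "\<lambda>(n, w). identification s (?part n (nat (- w)))"
  have part: "?part n d \<in> s_ring" "\<And>t. theta_deriv t (?part n d) = 0" for n d
  proof -
    have g: "graded_part (\<lambda>i. i) n f \<in> s_ring" by (rule graded_part_s_ring[OF f(1)])
    then show "?part n d \<in> s_ring" by (rule graded_part_s_ring)
    have "theta_deriv t (graded_part (\<lambda>i. i) n f) = 0" for t
      by (rule theta_deriv_graded[where e = "\<lambda>j. j + 1" and q = 0, OF f(1)]) (use zero in auto)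
    \<comment> \<open>The weight is twice the exponent of x: t_j belongs to x^(2j+1), hence 4 j + 2,
      and q = 2 accounts for the exponent lost in differentiating.\<close>
    then show "theta_deriv t (?part n d) = 0" for t
      by (intro theta_deriv_graded[where e = "\<lambda>j. 4 * j + 2" and q = 2, OF g]) auto
  qed
  have homogeneous: "bihomogeneous n (- int d) (identification s (?part n d))" for n d
    by (rule identification_bihomogeneous[OF part(1)]) (auto simp: keys_graded_part)
  have "\<Phi> = (\<lambda>n p. \<Sum>j\<in>?J. ?\<Psi> j n p)"
  proof (intro ext)
    fix N p
    have inj: "inj_on ?h (?D \<times> ?E)" by (auto simp: inj_on_def)
    have lookup: "(\<Sum>(n, d)\<in>?D \<times> ?E. Poly_Mapping.lookup (?part n d) m) = Poly_Mapping.lookup f m" if "m \<in> ?K" for m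
    proof -
      have "(\<Sum>(n, d)\<in>?D \<times> ?E. Poly_Mapping.lookup (?part n d) m) =
          (\<Sum>j\<in>?D \<times> ?E. if j = (wt m, mweight s_weight m) then Poly_Mapping.lookup f m else 0)"
        by (intro sum.cong) (auto simp: lookup_graded_part split: if_splits)
      also have "\<dots> = Poly_Mapping.lookup f m" using that by (simp add: sum.delta')
      finally show ?thesis .
    qed
    have "(\<Sum>j\<in>?J. ?\<Psi> j N p) = (\<Sum>(n, d)\<in>?D \<times> ?E. identification s (?part n d) N p)"
      by (subst sum.reindex[OF inj]) (simp add: split_beta)
    also have "\<dots> = (\<Sum>(n, d)\<in>?D \<times> ?E. \<Sum>m\<in>?K. Poly_Mapping.lookup (?part n d) m * gmonomial s m N p)"
    proof (intro sum.cong refl)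
      fix j
      have "identification s (?part n d) N p = (\<Sum>m\<in>?K. Poly_Mapping.lookup (?part n d) m * gmonomial s m N p)" for n d
        by (rule identification_superset) (auto simp: keys_graded_part)
      then show "(case j of (n, d) \<Rightarrow> identification s (?part n d) N p) =
        (case j of (n, d) \<Rightarrow> \<Sum>m\<in>?K. Poly_Mapping.lookup (?part n d) m * gmonomial s m N p)"
        by (simp only: split_beta)
    qed
    also have "\<dots> = (\<Sum>m\<in>?K. (\<Sum>(n, d)\<in>?D \<times> ?E. Poly_Mapping.lookup (?part n d) m) * gmonomial s m N p)"
      by (simp only: case_prod_unfold sum_distrib_right) (rule sum.swap)
    also have "\<dots> = (\<Sum>m\<in>?K. Poly_Mapping.lookup f m * gmonomial s m N p)"
      by (intro sum.cong refl) (simp only: lookup)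
    also have "\<dots> = \<Phi> N p" by (simp add: f(2) identification_def)
    finally show "\<Phi> N p = (\<Sum>j\<in>?J. ?\<Psi> j N p)" by simp
  qed
  moreover have "\<forall>(n, w)\<in>?J. ?\<Psi> (n, w) \<in> obf_families \<and> bihomogeneous n w (?\<Psi> (n, w))"
    using part homogeneous identification_obf by auto
  moreover have "finite ?J" by simp
  ultimately show ?thesis by (intro exI[of _ ?J] exI[of _ ?\<Psi>]) (intro conjI)
qed

lemma bigraded_subalgebra_obf: "bigraded_subalgebra obf_families HP_B"
  unfolding bigraded_subalgebra_def
  using obf_families_HP_B gone_obf gadd_obf gscale_obf gmult_obf obf_families_decomposition
  by (intro conjI ballI allI) simp_all

end

theorem theoremA0p5:
  fixes s :: "nat \<Rightarrow> functional"
  assumes s: "\<And>i. i \<ge> 1 \<Longrightarrow> is_s_functional i (s i)"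
  shows "res_DB ` HP_D \<subseteq> HP_B \<and> inj_on res_DB HP_D
    \<and> (\<forall>n w. \<forall>\<phi>\<in>HP0_dual n (O_D n). has_weight (O_D n) w \<phi> \<longrightarrow>
          has_weight (O_B n) w (restrict_functional (O_B n) \<phi>))
    \<and> bigraded_subalgebra (res_DB ` HP_D) HP_B
    \<and> res_DB ` HP_D =
        identification s ` {f \<in> s_ring. \<forall>k\<ge>1. vanishes_on_locus k (xi k f)}
    \<and> (\<forall>f\<in>s_ring. identification s f \<in> res_DB ` HP_D \<longleftrightarrow>
          (\<forall>k\<ge>1. vanishes_on_locus k (xi k f)))"
proof -
  have iff: "identification s f \<in> obf_families \<longleftrightarrow> (\<forall>k\<ge>1. vanishes_on_locus k (xi k f))" if "f \<in> s_ring" for f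
  proof -
    have "identification s f \<in> obf_families \<longleftrightarrow> (\<forall>t. theta_deriv t f = 0)"
      by (rule identification_obf) (use s that in auto)
    then show ?thesis by (simp only: theta_deriv_xi[OF that])
  qed
  have "HP_B = identification s ` s_ring" by (rule HP_B_eq) (rule s)
  then have "obf_families \<subseteq> identification s ` s_ring" using obf_families_HP_B by simp
  then have "obf_families = identification s ` {f \<in> s_ring. \<forall>k\<ge>1. vanishes_on_locus k (xi k f)}"
    using iff by blast
  moreover have "bigraded_subalgebra obf_families HP_B"
    by (rule bigraded_subalgebra_obf[where s = s]) (rule s)
  ultimately show ?thesis
    unfolding res_DB_image using obf_families_HP_B inj_on_res_DB has_weight_restrict iff by simp
qed

end
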